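(* Let $S=\bigoplus_{n\in\mathbb Z}S_n$ be a densely graded algebra such that $S_0$ is noetherian and $S_i$ is finitely generated both as a left $S_0$-module and as a right $S_0$-module for every $i\in\mathbb Z$. Then the natural functor $(-)_0:\mathsf{GrMod}\,S\to\mathsf{Mod}\,S_0$, $M\mapsto M_0$, induces the following equivalences of abelian categories: $$(-)_0:\mathsf{QGr}_{\mathsf L}\,S\xrightarrow{\ \cong\ }\mathsf{QMod}\,S_0\quad\text{and}\quad (-)_0:\mathsf{qlgr}_{\mathsf l}\,S\xrightarrow{\ \cong\ }\mathsf{qmod}\,S_0.$$
   Context: Throughout, $k$ is an algebraically closed field of characteristic $0$; all algebras (associative, unital) are over $k$. Noetherian means right and left noetherian. $\mathsf{Mod}$, $\mathsf{mod}$ denote the categories of right modules and finitely generated right modules; $\mathsf{GrMod}\,S$ is the category of $\mathbb Z$-graded right $S$-modules with degree zero homomorphisms. A $\mathbb Z$-graded algebra $S=\bigoplus_n S_n$ is densely graded if $\dim_k(S_n/S_iS_{n-i})<\infty$ for all $n$ and $i$. A homogeneous element $x$ of $M\in\mathsf{GrMod}\,S$ is locally torsion if $\dim_k(xS)_n<\infty$ for all $n\in\mathbb Z$; $M$ is a locally torsion module if all its homogeneous elements are locally torsion. $\mathsf{LTors}\,S\subseteq\mathsf{GrMod}\,S$ is the full (Serre) subcategory of locally torsion modules, and $\mathsf{QGr}_{\mathsf L}\,S:=\mathsf{GrMod}\,S/\mathsf{LTors}\,S$. $\mathsf{lgrmod}\,S$ is the full subcategory of $\mathsf{GrMod}\,S$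 of graded modules $M$ with $M_i$ a finitely generated $S_0$-module for all $i$; $\mathsf{lltors}\,S$ is its full subcategory of locally torsion modules; $\mathsf{qlgr}_{\mathsf l}\,S:=\mathsf{lgrmod}\,S/\mathsf{lltors}\,S$. An element $y$ of a right $S_0$-module $N$ is a torsion element if $yS_0$ is finite dimensional; $N$ is a torsion module if all its elements are torsion. $\mathsf{Tors}\,S_0$ (resp. $\mathsf{tors}\,S_0$) is the full subcategory of $\mathsf{Mod}\,S_0$ (resp. $\mathsf{mod}\,S_0$) of torsion modules; $\mathsf{QMod}\,S_0:=\mathsf{Mod}\,S_0/\mathsf{Tors}\,S_0$ and $\mathsf{qmod}\,S_0:=\mathsf{mod}\,S_0/\mathsf{tors}\,S_0$. *)

theory Defs
  imports "HOL-Algebra.Ring" "HOL-Computational_Algebra.Polynomial"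
begin

section \<open>Abelian categories\<close>

text \<open>
  A category together with its hom-groups. Arrows need not determine their domain and codomain
  (below they are functions or equivalence classes), so hom-sets, composition and addition take the
  objects as arguments: for \<open>f : A \<rightarrow> B\<close> and \<open>g : B \<rightarrow> D\<close> the composite \<open>g \<circ> f\<close> is
  \<open>cmp C A B D g f\<close>. All axioms are relativised to \<open>Obj\<close> and \<open>Arr\<close>.
\<close>

record ('o, 'a) cat =
  Obj :: "'o set"
  Arr :: "'o \<Rightarrow> 'o \<Rightarrow> 'a set"
  cmp :: "'o \<Rightarrow> 'o \<Rightarrow> 'o \<Rightarrow> 'a \<Rightarrow> 'a \<Rightarrow> 'a"
  idn :: "'o \<Rightarrow> 'a"
  plus_arr :: "'o \<Rightarrow> 'o \<Rightarrow> 'a \<Rightarrow> 'a \<Rightarrow> 'a"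
  zero_arr :: "'o \<Rightarrow> 'o \<Rightarrow> 'a"

locale category =
  fixes C :: "('o, 'a) cat"
  assumes idn_in: "A \<in> Obj C \<Longrightarrow> idn C A \<in> Arr C A A"
    and cmp_in: "\<lbrakk>A \<in> Obj C; B \<in> Obj C; D \<in> Obj C; f \<in> Arr C A B; g \<in> Arr C B D\<rbrakk>
      \<Longrightarrow> cmp C A B D g f \<in> Arr C A D"
    and cmp_idn_right: "\<lbrakk>A \<in> Obj C; B \<in> Obj C; f \<in> Arr C A B\<rbrakk> \<Longrightarrow> cmp C A A B f (idn C A) = f"
    and cmp_idn_left: "\<lbrakk>A \<in> Obj C; B \<in> Obj C; f \<in> Arr C A B\<rbrakk> \<Longrightarrow> cmp C A B B (idn C B) f = f"
    and cmp_assoc: "\<lbrakk>A \<in> Obj C; B \<in> Obj C; D \<in> Obj C; E \<in> Obj C;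
        f \<in> Arr C A B; g \<in> Arr C B D; h \<in> Arr C D E\<rbrakk>
      \<Longrightarrow> cmp C A D E h (cmp C A B D g f) = cmp C A B E (cmp C B D E h g) f"

definition hom_group :: "('o, 'a) cat \<Rightarrow> 'o \<Rightarrow> 'o \<Rightarrow> 'a monoid" where
  "hom_group C A B =
    \<lparr>carrier = Arr C A B, monoid.mult = plus_arr C A B, one = zero_arr C A B\<rparr>"

locale preadditive_category = category +
  assumes hom_group: "\<lbrakk>A \<in> Obj C; B \<in> Obj C\<rbrakk> \<Longrightarrow> comm_group (hom_group C A B)"
    and cmp_plus_right: "\<lbrakk>A \<in> Obj C; B \<in> Obj C; D \<in> Obj C;
        f \<in> Arr C A B; f' \<in> Arr C A B; g \<in> Arr C B D\<rbrakk>
      \<Longrightarrow> cmp C A B D g (plus_arr C A B f f') =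
          plus_arr C A D (cmp C A B D g f) (cmp C A B D g f')"
    and cmp_plus_left: "\<lbrakk>A \<in> Obj C; B \<in> Obj C; D \<in> Obj C;
        f \<in> Arr C A B; g \<in> Arr C B D; g' \<in> Arr C B D\<rbrakk>
      \<Longrightarrow> cmp C A B D (plus_arr C B D g g') f =
          plus_arr C A D (cmp C A B D g f) (cmp C A B D g' f)"

definition is_iso :: "('o, 'a) cat \<Rightarrow> 'o \<Rightarrow> 'o \<Rightarrow> 'a \<Rightarrow> bool" where
  "is_iso C A B f \<longleftrightarrow> f \<in> Arr C A B \<and>
    (\<exists>g\<in>Arr C B A. cmp C A B A g f = idn C A \<and> cmp C B A B f g = idn C B)"

definition is_mono :: "('o, 'a) cat \<Rightarrow> 'o \<Rightarrow> 'o \<Rightarrow> 'a \<Rightarrow> bool" where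
  "is_mono C A B f \<longleftrightarrow> f \<in> Arr C A B \<and>
    (\<forall>X\<in>Obj C. \<forall>g\<in>Arr C X A. \<forall>h\<in>Arr C X A. cmp C X A B f g = cmp C X A B f h \<longrightarrow> g = h)"

definition is_epi :: "('o, 'a) cat \<Rightarrow> 'o \<Rightarrow> 'o \<Rightarrow> 'a \<Rightarrow> bool" where
  "is_epi C A B f \<longleftrightarrow> f \<in> Arr C A B \<and>
    (\<forall>X\<in>Obj C. \<forall>g\<in>Arr C B X. \<forall>h\<in>Arr C B X. cmp C A B X g f = cmp C A B X h f \<longrightarrow> g = h)"

definition is_zero_object :: "('o, 'a) cat \<Rightarrow> 'o \<Rightarrow> bool" where
  "is_zero_object C Z \<longleftrightarrow> Z \<in> Obj C \<and>
    (\<forall>X\<in>Obj C. (\<exists>!f. f \<in> Arr C X Z) \<and> (\<exists>!f. f \<in> Arr C Z X))"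

text \<open>\<open>is_kernel C A B f K i\<close>: the arrow \<open>i : K \<rightarrow> A\<close> is a kernel of \<open>f : A \<rightarrow> B\<close>.\<close>

definition is_kernel :: "('o, 'a) cat \<Rightarrow> 'o \<Rightarrow> 'o \<Rightarrow> 'a \<Rightarrow> 'o \<Rightarrow> 'a \<Rightarrow> bool" where
  "is_kernel C A B f K i \<longleftrightarrow> K \<in> Obj C \<and> i \<in> Arr C K A \<and>
    cmp C K A B f i = zero_arr C K B \<and>
    (\<forall>X\<in>Obj C. \<forall>g\<in>Arr C X A. cmp C X A B f g = zero_arr C X B \<longrightarrow>
      (\<exists>!h. h \<in> Arr C X K \<and> cmp C X K A i h = g))"

text \<open>\<open>is_cokernel C A B f Q p\<close>: the arrow \<open>p : B \<rightarrow> Q\<close> is a cokernel of \<open>f : A \<rightarrow> B\<close>.\<close>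

definition is_cokernel :: "('o, 'a) cat \<Rightarrow> 'o \<Rightarrow> 'o \<Rightarrow> 'a \<Rightarrow> 'o \<Rightarrow> 'a \<Rightarrow> bool" where
  "is_cokernel C A B f Q p \<longleftrightarrow> Q \<in> Obj C \<and> p \<in> Arr C B Q \<and>
    cmp C A B Q p f = zero_arr C A Q \<and>
    (\<forall>X\<in>Obj C. \<forall>g\<in>Arr C B X. cmp C A B X g f = zero_arr C A X \<longrightarrow>
      (\<exists>!h. h \<in> Arr C Q X \<and> cmp C B Q X h p = g))"

definition is_product ::
    "('o, 'a) cat \<Rightarrow> 'o \<Rightarrow> 'o \<Rightarrow> 'o \<Rightarrow> 'a \<Rightarrow> 'a \<Rightarrow> bool" where
  "is_product C A B P p q \<longleftrightarrow> P \<in> Obj C \<and> p \<in> Arr C P A \<and> q \<in> Arr C P B \<and>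
    (\<forall>X\<in>Obj C. \<forall>f\<in>Arr C X A. \<forall>g\<in>Arr C X B.
      \<exists>!h. h \<in> Arr C X P \<and> cmp C X P A p h = f \<and> cmp C X P B q h = g)"

text \<open>In a preadditive category finite products are biproducts.\<close>

locale abelian_category = preadditive_category +
  assumes zero_object: "\<exists>Z. is_zero_object C Z"
    and products: "\<lbrakk>A \<in> Obj C; B \<in> Obj C\<rbrakk> \<Longrightarrow> \<exists>P p q. is_product C A B P p q"
    and kernels: "\<lbrakk>A \<in> Obj C; B \<in> Obj C; f \<in> Arr C A B\<rbrakk> \<Longrightarrow> \<exists>K i. is_kernel C A B f K i"
    and cokernels: "\<lbrakk>A \<in> Obj C; B \<in> Obj C; f \<in> Arr C A B\<rbrakk> \<Longrightarrow> \<exists>Q p. is_cokernel C A B f Q p"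
    and monos_normal: "\<lbrakk>A \<in> Obj C; B \<in> Obj C; is_mono C A B f\<rbrakk>
      \<Longrightarrow> \<exists>D\<in>Obj C. \<exists>g\<in>Arr C B D. is_kernel C B D g A f"
    and epis_normal: "\<lbrakk>A \<in> Obj C; B \<in> Obj C; is_epi C A B f\<rbrakk>
      \<Longrightarrow> \<exists>D\<in>Obj C. \<exists>g\<in>Arr C D A. is_cokernel C D A g B f"

definition full_subcategory :: "('o, 'a) cat \<Rightarrow> 'o set \<Rightarrow> ('o, 'a) cat" where
  "full_subcategory C P = C\<lparr>Obj := Obj C \<inter> P\<rparr>"


section \<open>Functors and equivalences\<close>

record ('o, 'a, 'p, 'b) cat_map =
  omap :: "'o \<Rightarrow> 'p"
  amap :: "'o \<Rightarrow> 'o \<Rightarrow> 'a \<Rightarrow> 'b"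

definition is_functor ::
    "('o, 'a) cat \<Rightarrow> ('p, 'b) cat \<Rightarrow> ('o, 'a, 'p, 'b) cat_map \<Rightarrow> bool" where
  "is_functor C D F \<longleftrightarrow>
    (\<forall>A\<in>Obj C. omap F A \<in> Obj D) \<and>
    (\<forall>A\<in>Obj C. \<forall>B\<in>Obj C. \<forall>f\<in>Arr C A B. amap F A B f \<in> Arr D (omap F A) (omap F B)) \<and>
    (\<forall>A\<in>Obj C. amap F A A (idn C A) = idn D (omap F A)) \<and>
    (\<forall>A\<in>Obj C. \<forall>B\<in>Obj C. \<forall>E\<in>Obj C. \<forall>f\<in>Arr C A B. \<forall>g\<in>Arr C B E.
      amap F A E (cmp C A B E g f) =
        cmp D (omap F A) (omap F B) (omap F E) (amap F B E g) (amap F A B f))"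

definition is_additive_functor ::
    "('o, 'a) cat \<Rightarrow> ('p, 'b) cat \<Rightarrow> ('o, 'a, 'p, 'b) cat_map \<Rightarrow> bool" where
  "is_additive_functor C D F \<longleftrightarrow> is_functor C D F \<and>
    (\<forall>A\<in>Obj C. \<forall>B\<in>Obj C. \<forall>f\<in>Arr C A B. \<forall>g\<in>Arr C A B.
      amap F A B (plus_arr C A B f g) =
        plus_arr D (omap F A) (omap F B) (amap F A B f) (amap F A B g))"

definition id_map :: "('o, 'a, 'o, 'a) cat_map" where
  "id_map = \<lparr>omap = (\<lambda>A. A), amap = (\<lambda>A B f. f)\<rparr>"

definition comp_map ::
    "('p, 'b, 'q, 'c) cat_map \<Rightarrow> ('o, 'a, 'p, 'b) cat_map \<Rightarrow> ('o, 'a, 'q, 'c) cat_map" where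
  "comp_map G F =
    \<lparr>omap = (\<lambda>A. omap G (omap F A)),
     amap = (\<lambda>A B f. amap G (omap F A) (omap F B) (amap F A B f))\<rparr>"

definition is_natural_iso :: "('o, 'a) cat \<Rightarrow> ('p, 'b) cat \<Rightarrow>
    ('o, 'a, 'p, 'b) cat_map \<Rightarrow> ('o, 'a, 'p, 'b) cat_map \<Rightarrow> ('o \<Rightarrow> 'b) \<Rightarrow> bool" where
  "is_natural_iso C D F G \<eta> \<longleftrightarrow>
    (\<forall>A\<in>Obj C. is_iso D (omap F A) (omap G A) (\<eta> A)) \<and>
    (\<forall>A\<in>Obj C. \<forall>B\<in>Obj C. \<forall>f\<in>Arr C A B.
      cmp D (omap F A) (omap F B) (omap G B) (\<eta> B) (amap F A B f) =
      cmp D (omap F A) (omap G A) (omap G B) (amap G A B f) (\<eta> A))"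

definition is_equivalence ::
    "('o, 'a) cat \<Rightarrow> ('p, 'b) cat \<Rightarrow> ('o, 'a, 'p, 'b) cat_map \<Rightarrow> bool" where
  "is_equivalence C D F \<longleftrightarrow> is_functor C D F \<and>
    (\<exists>G. is_functor D C G \<and>
      (\<exists>\<eta>. is_natural_iso C C id_map (comp_map G F) \<eta>) \<and>
      (\<exists>\<epsilon>. is_natural_iso D D (comp_map F G) id_map \<epsilon>))"

definition is_abelian_equivalence ::
    "('o, 'a) cat \<Rightarrow> ('p, 'b) cat \<Rightarrow> ('o, 'a, 'p, 'b) cat_map \<Rightarrow> bool" where
  "is_abelian_equivalence C D F \<longleftrightarrow>
    abelian_category C \<and> abelian_category D \<and> is_additive_functor C D F \<and> is_equivalence C D F"


section \<open>Serre quotients\<close>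

text \<open>
  The quotient \<open>C/T\<close> of an abelian category by a Serre subcategory, given by its set \<open>T\<close> of objects,
  is the localisation of \<open>C\<close> at the arrows whose kernel and cokernel lie in \<open>T\<close>. As these arrows
  admit a calculus of right fractions, an arrow \<open>M \<rightarrow> N\<close> of \<open>C/T\<close> is a class of roofs
  \<open>M \<leftarrow> X \<rightarrow> N\<close>, written \<open>(X, s, f)\<close> with \<open>s : X \<rightarrow> M\<close> inverted; it stands for \<open>f \<circ> s\<inverse>\<close>.
\<close>

definition serre_weq :: "('o, 'a) cat \<Rightarrow> 'o set \<Rightarrow> 'o \<Rightarrow> 'o \<Rightarrow> 'a set" where
  "serre_weq C T X M = {s \<in> Arr C X M.
    (\<exists>K\<in>T. \<exists>i. is_kernel C X M s K i) \<and> (\<exists>Q\<in>T. \<exists>p. is_cokernel C X M s Q p)}"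

definition roofs :: "('o, 'a) cat \<Rightarrow> 'o set \<Rightarrow> 'o \<Rightarrow> 'o \<Rightarrow> ('o \<times> 'a \<times> 'a) set" where
  "roofs C T M N = {(X, s, f). X \<in> Obj C \<and> s \<in> serre_weq C T X M \<and> f \<in> Arr C X N}"

definition roof_rel :: "('o, 'a) cat \<Rightarrow> 'o set \<Rightarrow> 'o \<Rightarrow> 'o \<Rightarrow> ('o \<times> 'a \<times> 'a) rel" where
  "roof_rel C T M N = {((X, s, f), (Y, t, g)).
    (X, s, f) \<in> roofs C T M N \<and> (Y, t, g) \<in> roofs C T M N \<and>
    (\<exists>Z\<in>Obj C. \<exists>u\<in>Arr C Z X. \<exists>v\<in>Arr C Z Y.
      cmp C Z X M s u = cmp C Z Y M t v \<and> cmp C Z X M s u \<in> serre_weq C T Z M \<and>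
      cmp C Z X N f u = cmp C Z Y N g v)}"

text \<open>
  Operations on classes are taken as the saturation of all results obtained from representatives:
  \<open>[Y, t, g] \<circ> [X, s, f] = [Z, s \<circ> u, g \<circ> v]\<close> whenever \<open>f \<circ> u = t \<circ> v\<close> and \<open>u\<close> is inverted, and
  \<open>[X, s, f] + [X, s, g] = [X, s, f + g]\<close>.
\<close>

definition serre_quotient :: "('o, 'a) cat \<Rightarrow> 'o set \<Rightarrow> ('o, ('o \<times> 'a \<times> 'a) set) cat" where
  "serre_quotient C T =
    \<lparr>Obj = Obj C,
     Arr = (\<lambda>M N. roofs C T M N // roof_rel C T M N),
     cmp = (\<lambda>M N P d c. roof_rel C T M P ``
       {(Z, cmp C Z X M s u, cmp C Z Y P g v) | Z X Y s f t g u v.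
         (X, s, f) \<in> c \<and> (Y, t, g) \<in> d \<and> Z \<in> Obj C \<and> u \<in> serre_weq C T Z X \<and>
         v \<in> Arr C Z Y \<and> cmp C Z X N f u = cmp C Z Y N t v}),
     idn = (\<lambda>M. roof_rel C T M M `` {(M, idn C M, idn C M)}),
     plus_arr = (\<lambda>M N c d. roof_rel C T M N ``
       {(X, s, plus_arr C X N f g) | X s f g. (X, s, f) \<in> c \<and> (X, s, g) \<in> d}),
     zero_arr = (\<lambda>M N. roof_rel C T M N `` {(M, idn C M, zero_arr C M N)})\<rparr>"

definition serre_projection ::
    "('o, 'a) cat \<Rightarrow> 'o set \<Rightarrow> ('o, 'a, 'o, ('o \<times> 'a \<times> 'a) set) cat_map" where
  "serre_projection C T =
    \<lparr>omap = (\<lambda>M. M), amap = (\<lambda>M N f. roof_rel C T M N `` {(M, idn C M, f)})\<rparr>"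

text \<open>The functor \<open>[X, s, f] \<mapsto> [F X, F s, F f]\<close> into \<open>D/U\<close> induced by a functor \<open>F\<close> into \<open>D\<close>.\<close>

definition induced_map :: "('p, 'b) cat \<Rightarrow> 'p set \<Rightarrow> ('o, 'a, 'p, 'b) cat_map \<Rightarrow>
    ('o, ('o \<times> 'a \<times> 'a) set, 'p, ('p \<times> 'b \<times> 'b) set) cat_map" where
  "induced_map D U F =
    \<lparr>omap = omap F,
     amap = (\<lambda>M N c. roof_rel D U (omap F M) (omap F N) ``
       {(omap F X, amap F X M s, amap F X N f) | X s f. (X, s, f) \<in> c})\<rparr>"

text \<open>
  \<open>F : C \<rightarrow> D\<close> induces an equivalence of abelian categories \<open>C/T \<rightarrow> D/U\<close>; the second conjunct says
  that the induced functor, precomposed with \<open>C \<rightarrow> C/T\<close>, is \<open>F\<close> followed by \<open>D \<rightarrow> D/U\<close>.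
\<close>

definition induces_abelian_equivalence :: "('o, 'a) cat \<Rightarrow> 'o set \<Rightarrow> ('p, 'b) cat \<Rightarrow> 'p set \<Rightarrow>
    ('o, 'a, 'p, 'b) cat_map \<Rightarrow> bool" where
  "induces_abelian_equivalence C T D U F \<longleftrightarrow>
    is_additive_functor C D F \<and>
    (\<forall>M\<in>Obj C. \<forall>N\<in>Obj C. \<forall>f\<in>Arr C M N.
      amap (comp_map (induced_map D U F) (serre_projection C T)) M N f =
      amap (comp_map (serre_projection D U) F) M N f) \<and>
    is_abelian_equivalence (serre_quotient C T) (serre_quotient D U) (induced_map D U F)"


section \<open>Densely graded algebras\<close>

text \<open>
  The sort \<open>{ring, monoid_mult}\<close> is that of associative unital rings; unlike \<open>ring_1\<close> it does not
  exclude the zero ring.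
\<close>

locale k_algebra = vector_space scale
  for scale :: "'k::field \<Rightarrow> 's::{ring,monoid_mult} \<Rightarrow> 's" +
  assumes scale_mult_left: "scale c x * y = scale c (x * y)"
    and scale_mult_right: "x * scale c y = scale c (x * y)"

locale graded_algebra = k_algebra scale
  for scale :: "'k::field \<Rightarrow> 's::{ring,monoid_mult} \<Rightarrow> 's" +
  fixes S :: "int \<Rightarrow> 's set"
  assumes subspace_S: "subspace (S n)"
    and one_S: "1 \<in> S 0"
    and mult_S: "\<lbrakk>x \<in> S i; y \<in> S j\<rbrakk> \<Longrightarrow> x * y \<in> S (i + j)"
    and direct_sum_S: "\<exists>!f. (\<forall>n. f n \<in> S n) \<and> finite {n. f n \<noteq> 0} \<and> x = (\<Sum>n | f n \<noteq> 0. f n)"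

text \<open>\<open>finite_codim W V\<close> says \<open>dim (V/W) < \<infinity>\<close>: the classes of finitely many elements of \<open>V\<close> span \<open>V/W\<close>.\<close>

definition (in vector_space) finite_codim :: "'b set \<Rightarrow> 'b set \<Rightarrow> bool" where
  "finite_codim W V \<longleftrightarrow> W \<subseteq> V \<and> (\<exists>B. finite B \<and> B \<subseteq> V \<and> V \<subseteq> span (W \<union> B))"

locale densely_graded_algebra = graded_algebra scale S
  for scale :: "'k::field \<Rightarrow> 's::{ring,monoid_mult} \<Rightarrow> 's" and S :: "int \<Rightarrow> 's set" +
  assumes dense_grading: "finite_codim (span {x * y | x y. x \<in> S i \<and> y \<in> S (n - i)}) (S n)"

definition fg_left :: "'s::{ring,monoid_mult} set \<Rightarrow> 's set \<Rightarrow> bool" where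
  "fg_left R X \<longleftrightarrow> (\<exists>B. finite B \<and> B \<subseteq> X \<and> X = {\<Sum>b\<in>B. r b * b | r. r \<in> B \<rightarrow> R})"

definition fg_right :: "'s::{ring,monoid_mult} set \<Rightarrow> 's set \<Rightarrow> bool" where
  "fg_right R X \<longleftrightarrow> (\<exists>B. finite B \<and> B \<subseteq> X \<and> X = {\<Sum>b\<in>B. b * r b | r. r \<in> B \<rightarrow> R})"

definition left_ideal :: "'s::{ring,monoid_mult} set \<Rightarrow> 's set \<Rightarrow> bool" where
  "left_ideal R I \<longleftrightarrow> I \<subseteq> R \<and> 0 \<in> I \<and> (\<forall>x\<in>I. \<forall>y\<in>I. x - y \<in> I) \<and> (\<forall>r\<in>R. \<forall>x\<in>I. r * x \<in> I)"

definition right_ideal :: "'s::{ring,monoid_mult} set \<Rightarrow> 's set \<Rightarrow> bool" where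
  "right_ideal R I \<longleftrightarrow> I \<subseteq> R \<and> 0 \<in> I \<and> (\<forall>x\<in>I. \<forall>y\<in>I. x - y \<in> I) \<and> (\<forall>r\<in>R. \<forall>x\<in>I. x * r \<in> I)"

definition noetherian_subring :: "'s::{ring,monoid_mult} set \<Rightarrow> bool" where
  "noetherian_subring R \<longleftrightarrow>
    (\<forall>I. left_ideal R I \<longrightarrow> fg_left R I) \<and> (\<forall>I. right_ideal R I \<longrightarrow> fg_right R I)"


section \<open>Right modules over a subring\<close>

text \<open>
  The fields \<open>mult\<close> and \<open>one\<close> of the underlying ring record are not used, as for \<open>module\<close> in
  HOL-Algebra. A type \<open>'m\<close> serves as universe: the categories consist of all modules with
  underlying set (respectively with homogeneous components) contained in \<open>'m\<close>.
\<close>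

record ('m, 's) rmodule = "'m ring" +
  ract :: "'m \<Rightarrow> 's \<Rightarrow> 'm"

locale right_module = abelian_group M
  for R :: "'s::{ring,monoid_mult} set" and M :: "('m, 's) rmodule" (structure) +
  assumes ract_closed: "\<lbrakk>x \<in> carrier M; r \<in> R\<rbrakk> \<Longrightarrow> ract M x r \<in> carrier M"
    and ract_add_left: "\<lbrakk>x \<in> carrier M; y \<in> carrier M; r \<in> R\<rbrakk>
      \<Longrightarrow> ract M (x \<oplus> y) r = ract M x r \<oplus> ract M y r"
    and ract_add_right: "\<lbrakk>x \<in> carrier M; r \<in> R; s \<in> R\<rbrakk>
      \<Longrightarrow> ract M x (r + s) = ract M x r \<oplus> ract M x s"
    and ract_mult: "\<lbrakk>x \<in> carrier M; r \<in> R; s \<in> R\<rbrakk> \<Longrightarrow> ract M x (r * s) = ract M (ract M x r) s"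
    and ract_one: "x \<in> carrier M \<Longrightarrow> ract M x 1 = x"

definition Mod :: "'s::{ring,monoid_mult} set \<Rightarrow> (('m, 's) rmodule, 'm \<Rightarrow> 'm) cat" where
  "Mod R =
    \<lparr>Obj = {M. right_module R M},
     Arr = (\<lambda>M N. {f \<in> carrier M \<rightarrow>\<^sub>E carrier N.
       (\<forall>x\<in>carrier M. \<forall>y\<in>carrier M. f (x \<oplus>\<^bsub>M\<^esub> y) = f x \<oplus>\<^bsub>N\<^esub> f y) \<and>
       (\<forall>x\<in>carrier M. \<forall>r\<in>R. f (ract M x r) = ract N (f x) r)}),
     cmp = (\<lambda>M N P g f. compose (carrier M) g f),
     idn = (\<lambda>M. \<lambda>x\<in>carrier M. x),
     plus_arr = (\<lambda>M N f g. \<lambda>x\<in>carrier M. f x \<oplus>\<^bsub>N\<^esub> g x),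
     zero_arr = (\<lambda>M N. \<lambda>x\<in>carrier M. \<zero>\<^bsub>N\<^esub>)\<rparr>"

definition fg_module :: "'s set \<Rightarrow> ('m, 's) rmodule \<Rightarrow> bool" where
  "fg_module R M \<longleftrightarrow> (\<exists>B. finite B \<and> B \<subseteq> carrier M \<and>
    (\<forall>x\<in>carrier M. \<exists>r\<in>B \<rightarrow> R. x = (\<Oplus>\<^bsub>M\<^esub>b\<in>B. ract M b (r b))))"

definition mod_fg :: "'s::{ring,monoid_mult} set \<Rightarrow> (('m, 's) rmodule, 'm \<Rightarrow> 'm) cat" where
  "mod_fg R = full_subcategory (Mod R) {M. fg_module R M}"

text \<open>
  For a \<open>k\<close>-subspace \<open>V\<close> of a module over a \<open>k\<close>-algebra; the scalar \<open>c\<close> acts as \<open>c \<cdot> 1\<close>.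
\<close>

definition finite_dim_in ::
    "('k \<Rightarrow> 's \<Rightarrow> 's) \<Rightarrow> ('m, 's::{ring,monoid_mult}) rmodule \<Rightarrow> 'm set \<Rightarrow> bool" where
  "finite_dim_in scale M V \<longleftrightarrow> (\<exists>B. finite B \<and> B \<subseteq> V \<and>
    (\<forall>v\<in>V. \<exists>c :: 'm \<Rightarrow> 'k. v = (\<Oplus>\<^bsub>M\<^esub>b\<in>B. ract M b (scale (c b) 1))))"

definition torsion_element ::
    "('k \<Rightarrow> 's \<Rightarrow> 's) \<Rightarrow> 's set \<Rightarrow> ('m, 's::{ring,monoid_mult}) rmodule \<Rightarrow> 'm \<Rightarrow> bool" where
  "torsion_element scale R N y \<longleftrightarrow> finite_dim_in scale N {ract N y r | r. r \<in> R}"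

definition Tors ::
    "('k \<Rightarrow> 's \<Rightarrow> 's) \<Rightarrow> 's::{ring,monoid_mult} set \<Rightarrow> ('m, 's) rmodule set" where
  "Tors scale R = {N \<in> Obj (Mod R). \<forall>y\<in>carrier N. torsion_element scale R N y}"

definition tors_fg ::
    "('k \<Rightarrow> 's \<Rightarrow> 's) \<Rightarrow> 's::{ring,monoid_mult} set \<Rightarrow> ('m, 's) rmodule set" where
  "tors_fg scale R = Obj (mod_fg R) \<inter> Tors scale R"


section \<open>Graded right modules\<close>

text \<open>
  A graded module is given by its homogeneous components \<open>M\<^sub>i\<close>, which are separate abelian groups, and
  the actions \<open>M\<^sub>i \<times> S\<^sub>j \<rightarrow> M\<^sub>i\<^sub>+\<^sub>j\<close>, written \<open>gact M i j\<close>. A homomorphism of degree zero is the family of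
  its restrictions to the components.
\<close>

record ('m, 's) grmodule =
  gcomp :: "int \<Rightarrow> 'm ring"
  gact :: "int \<Rightarrow> int \<Rightarrow> 'm \<Rightarrow> 's \<Rightarrow> 'm"

abbreviation gcar :: "('m, 's) grmodule \<Rightarrow> int \<Rightarrow> 'm set" where
  "gcar M i \<equiv> carrier (gcomp M i)"

locale graded_right_module =
  fixes S :: "int \<Rightarrow> 's::{ring,monoid_mult} set" and M :: "('m, 's) grmodule"
  assumes gcomp_group: "abelian_group (gcomp M i)"
    and gact_closed: "\<lbrakk>x \<in> gcar M i; s \<in> S j\<rbrakk> \<Longrightarrow> gact M i j x s \<in> gcar M (i + j)"
    and gact_add_left: "\<lbrakk>x \<in> gcar M i; y \<in> gcar M i; s \<in> S j\<rbrakk>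
      \<Longrightarrow> gact M i j (x \<oplus>\<^bsub>gcomp M i\<^esub> y) s = gact M i j x s \<oplus>\<^bsub>gcomp M (i + j)\<^esub> gact M i j y s"
    and gact_add_right: "\<lbrakk>x \<in> gcar M i; s \<in> S j; t \<in> S j\<rbrakk>
      \<Longrightarrow> gact M i j x (s + t) = gact M i j x s \<oplus>\<^bsub>gcomp M (i + j)\<^esub> gact M i j x t"
    and gact_mult: "\<lbrakk>x \<in> gcar M i; s \<in> S j; t \<in> S l\<rbrakk>
      \<Longrightarrow> gact M i (j + l) x (s * t) = gact M (i + j) l (gact M i j x s) t"
    and gact_one: "x \<in> gcar M i \<Longrightarrow> gact M i 0 x 1 = x"

definition GrMod ::
    "(int \<Rightarrow> 's::{ring,monoid_mult} set) \<Rightarrow> (('m, 's) grmodule, int \<Rightarrow> 'm \<Rightarrow> 'm) cat" where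
  "GrMod S =
    \<lparr>Obj = {M. graded_right_module S M},
     Arr = (\<lambda>M N. {f.
       (\<forall>i. f i \<in> gcar M i \<rightarrow>\<^sub>E gcar N i) \<and>
       (\<forall>i. \<forall>x\<in>gcar M i. \<forall>y\<in>gcar M i. f i (x \<oplus>\<^bsub>gcomp M i\<^esub> y) = f i x \<oplus>\<^bsub>gcomp N i\<^esub> f i y) \<and>
       (\<forall>i j. \<forall>x\<in>gcar M i. \<forall>s\<in>S j. f (i + j) (gact M i j x s) = gact N i j (f i x) s)}),
     cmp = (\<lambda>M N P g f i. compose (gcar M i) (g i) (f i)),
     idn = (\<lambda>M i. \<lambda>x\<in>gcar M i. x),
     plus_arr = (\<lambda>M N f g i. \<lambda>x\<in>gcar M i. f i x \<oplus>\<^bsub>gcomp N i\<^esub> g i x),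
     zero_arr = (\<lambda>M N i. \<lambda>x\<in>gcar M i. \<zero>\<^bsub>gcomp N i\<^esub>)\<rparr>"

text \<open>The component \<open>M\<^sub>i\<close> as a right \<open>S\<^sub>0\<close>-module.\<close>

definition degree_part :: "('m, 's) grmodule \<Rightarrow> int \<Rightarrow> ('m, 's) rmodule" where
  "degree_part M i =
    \<lparr>carrier = gcar M i, monoid.mult = monoid.mult (gcomp M i), one = one (gcomp M i),
     zero = zero (gcomp M i), add = add (gcomp M i), ract = gact M i 0\<rparr>"

text \<open>For \<open>x\<close> of degree \<open>i\<close> the component \<open>(xS)\<^sub>n\<close> is \<open>x S\<^bsub>n-i\<^esub>\<close>.\<close>

definition locally_torsion_element :: "('k \<Rightarrow> 's \<Rightarrow> 's) \<Rightarrow> (int \<Rightarrow> 's::{ring,monoid_mult} set) \<Rightarrow>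
    ('m, 's) grmodule \<Rightarrow> int \<Rightarrow> 'm \<Rightarrow> bool" where
  "locally_torsion_element scale S M i x \<longleftrightarrow>
    (\<forall>n. finite_dim_in scale (degree_part M n) {gact M i (n - i) x s | s. s \<in> S (n - i)})"

definition LTors :: "('k \<Rightarrow> 's \<Rightarrow> 's) \<Rightarrow> (int \<Rightarrow> 's::{ring,monoid_mult} set) \<Rightarrow>
    ('m, 's) grmodule set" where
  "LTors scale S =
    {M \<in> Obj (GrMod S). \<forall>i. \<forall>x\<in>gcar M i. locally_torsion_element scale S M i x}"

definition lgrmod ::
    "(int \<Rightarrow> 's::{ring,monoid_mult} set) \<Rightarrow> (('m, 's) grmodule, int \<Rightarrow> 'm \<Rightarrow> 'm) cat" where
  "lgrmod S = full_subcategory (GrMod S) {M. \<forall>i. fg_module (S 0) (degree_part M i)}"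

definition lltors :: "('k \<Rightarrow> 's \<Rightarrow> 's) \<Rightarrow> (int \<Rightarrow> 's::{ring,monoid_mult} set) \<Rightarrow>
    ('m, 's) grmodule set" where
  "lltors scale S = Obj (lgrmod S) \<inter> LTors scale S"

text \<open>The functor \<open>M \<mapsto> M\<^sub>0\<close>; its argument only names the universe \<open>'m\<close> of the modules.\<close>

definition degree_zero ::
    "'m itself \<Rightarrow> (('m, 's) grmodule, int \<Rightarrow> 'm \<Rightarrow> 'm, ('m, 's) rmodule, 'm \<Rightarrow> 'm) cat_map" where
  "degree_zero U = \<lparr>omap = (\<lambda>M. degree_part M 0), amap = (\<lambda>M N f. f 0)\<rparr>"

end

theory Submission
  imports Defs
begin

text \<open>
  The theorem rests on two facts about a graded module \<open>M\<close> over a densely graded algebra \<open>S\<close>.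
  
  \<^item> Torsion is visible in degree zero: \<open>x \<in> M\<^sub>i\<close> is locally torsion as soon as all elements of
    \<open>x S\<^bsub>-i\<^esub> \<subseteq> M\<^sub>0\<close> are torsion over \<open>S\<^sub>0\<close>. Indeed \<open>x S\<^bsub>-i\<^esub>\<close> is then finite dimensional, being a
    finitely generated torsion module; since \<open>S\<^sub>n\<close> is finitely generated on the left, \<open>x S\<^bsub>-i\<^esub> S\<^sub>n\<close> is
    finite dimensional; and by density it has finite codimension in \<open>x S\<^bsub>n-i\<^esub>\<close>. Hence an arrow of
    graded modules is inverted by the quotient if and only if its component of degree zero is.
  \<^item> Every right \<open>S\<^sub>0\<close>-module \<open>N\<close> is \<open>M\<^sub>0\<close> for some graded module \<open>M\<close>, namely for the submodule
    generated by \<open>N\<close> in the coinduced module with components \<open>Hom(S\<^bsub>-i\<^esub>, N)\<close>; it is locally finitely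
    generated if \<open>N\<close> is finitely generated.
  
  Given the first fact, fullness and faithfulness of the induced functor follow from a construction:
  a pair of arrows \<open>X \<rightarrow> M\<^sub>0\<close>, \<open>X \<rightarrow> P\<^sub>0\<close> of \<open>S\<^sub>0\<close>-modules, in particular a roof, is a surjection onto
  \<open>Z\<^sub>0\<close> followed by the degree-zero parts of two arrows \<open>Z \<rightarrow> M\<close>, \<open>Z \<rightarrow> P\<close>, where \<open>Z\<close> is the graded
  submodule of \<open>M \<times> P\<close> generated by the image of \<open>X\<close>. Being generated in degree zero, \<open>Z\<close> has the
  further property that an arrow out of it is determined by its component of degree zero. This is
  axiomatised in \<open>element_equivalence\<close> and turned into an equivalence by \<open>induces_equivalence\<close>.
  
  That the four quotient categories are abelian has to be proved along the way. Modules and graded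
  modules are treated uniformly as categories whose objects have elements and in which every element
  is torsion or not (locale \<open>element_category\<close>). The arrows with torsion kernel and cokernel are
  described by elements, they admit a calculus of right fractions, and kernels and cokernels of a
  fraction are computed from those of its numerator (theorem \<open>abelian_quot\<close>).
  
  The modules are required to have their elements in a fixed type \<open>'m\<close>. Quotients are formed by
  choosing representatives of cosets, and products and the modules of the second fact are carried
  into \<open>'m\<close> by counting: a nonzero module is infinite because the base field is, an infinite type
  contains a copy of its square, and \<open>N S\<^sub>i\<close> is the image of a finite power of \<open>N\<close>.
\<close>

section \<open>Categories of right fractions\<close>

context preadditive_category begin

text \<open>
  Rewriting with a commuting square inside a longer composite.
\<close>

lemma cmp_prolong:
  assumes "cmp C A B N u w = cmp C A B' N u' w'" "A \<in> Obj C" "B \<in> Obj C" "B' \<in> Obj C" "N \<in> Obj C" "P \<in> Obj C"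
    "u \<in> Arr C B N" "w \<in> Arr C A B" "u' \<in> Arr C B' N" "w' \<in> Arr C A B'" "s \<in> Arr C N P"
  shows "cmp C A B P (cmp C B N P s u) w = cmp C A B' P (cmp C B' N P s u') w'"
  using assms(2-) assms(1)[symmetric] by (simp flip: cmp_assoc)

lemma plus_in: "\<lbrakk>A \<in> Obj C; B \<in> Obj C; f \<in> Arr C A B; g \<in> Arr C A B\<rbrakk> \<Longrightarrow> plus_arr C A B f g \<in> Arr C A B"
  using comm_group.axioms(1)[OF hom_group, THEN comm_monoid.axioms(1), THEN monoid.m_closed, of A B f g]
  by (simp add: hom_group_def)

lemma zero_in: "\<lbrakk>A \<in> Obj C; B \<in> Obj C\<rbrakk> \<Longrightarrow> zero_arr C A B \<in> Arr C A B"
  using comm_group.axioms(1)[OF hom_group, THEN comm_monoid.axioms(1), THEN monoid.one_closed, of A B]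
  by (simp add: hom_group_def)

lemma plus_assoc: "\<lbrakk>A \<in> Obj C; B \<in> Obj C; f \<in> Arr C A B; g \<in> Arr C A B; h \<in> Arr C A B\<rbrakk>
    \<Longrightarrow> plus_arr C A B (plus_arr C A B f g) h = plus_arr C A B f (plus_arr C A B g h)"
  using comm_group.axioms(1)[OF hom_group, THEN comm_monoid.axioms(1), THEN monoid.m_assoc, of A B f g h]
  by (simp add: hom_group_def)

lemma plus_comm: "\<lbrakk>A \<in> Obj C; B \<in> Obj C; f \<in> Arr C A B; g \<in> Arr C A B\<rbrakk>
    \<Longrightarrow> plus_arr C A B f g = plus_arr C A B g f"
  using comm_group.axioms(1)[OF hom_group, THEN comm_monoid.m_comm, of A B f g]
  by (simp add: hom_group_def)

lemma plus_zero: "\<lbrakk>A \<in> Obj C; B \<in> Obj C; f \<in> Arr C A B\<rbrakk> \<Longrightarrow> plus_arr C A B (zero_arr C A B) f = f"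
  using comm_group.axioms(1)[OF hom_group, THEN comm_monoid.axioms(1), THEN monoid.l_one, of A B f]
  by (simp add: hom_group_def)

lemma neg_ex:
  assumes "A \<in> Obj C" "B \<in> Obj C" "f \<in> Arr C A B"
  obtains g where "g \<in> Arr C A B" "plus_arr C A B g f = zero_arr C A B"
proof -
  interpret G: comm_group "hom_group C A B" using assms hom_group by simp
  show thesis using that[of "inv\<^bsub>hom_group C A B\<^esub> f"] G.inv_closed[of f] G.l_inv[of f] assms
    by (simp add: hom_group_def)
qed

lemma cmp_zero_right:
  assumes "A \<in> Obj C" "B \<in> Obj C" "D \<in> Obj C" "g \<in> Arr C B D"
  shows "cmp C A B D g (zero_arr C A B) = zero_arr C A D"
proof -
  interpret G: comm_group "hom_group C A D" using assms hom_group by simp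
  have "cmp C A B D g (plus_arr C A B (zero_arr C A B) (zero_arr C A B)) =
    plus_arr C A D (cmp C A B D g (zero_arr C A B)) (cmp C A B D g (zero_arr C A B))"
    using assms by (simp add: cmp_plus_right zero_in)
  moreover have "cmp C A B D g (zero_arr C A B) \<in> Arr C A D" using assms by (simp add: cmp_in zero_in)
  ultimately show ?thesis
    using G.r_cancel_one'[of "cmp C A B D g (zero_arr C A B)" "cmp C A B D g (zero_arr C A B)"] assms
    by (simp add: hom_group_def plus_zero zero_in)
qed

lemma cmp_zero_left:
  assumes "A \<in> Obj C" "B \<in> Obj C" "D \<in> Obj C" "f \<in> Arr C A B"
  shows "cmp C A B D (zero_arr C B D) f = zero_arr C A D"
proof -
  interpret G: comm_group "hom_group C A D" using assms hom_group by simp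
  have "cmp C A B D (plus_arr C B D (zero_arr C B D) (zero_arr C B D)) f =
    plus_arr C A D (cmp C A B D (zero_arr C B D) f) (cmp C A B D (zero_arr C B D) f)"
    using assms by (simp add: cmp_plus_left zero_in)
  moreover have "cmp C A B D (zero_arr C B D) f \<in> Arr C A D" using assms by (simp add: cmp_in zero_in)
  ultimately show ?thesis
    using G.r_cancel_one'[of "cmp C A B D (zero_arr C B D) f" "cmp C A B D (zero_arr C B D) f"] assms
    by (simp add: hom_group_def plus_zero zero_in)
qed

end

text \<open>
  The calculus of right fractions for the class of arrows inverted by \<open>serre_quotient\<close>. Besides the
  usual identity, composition and Ore conditions it asks for a left cancellation law and, in place of
  equalising parallel arrows, for annihilating a single one; by additivity this amounts to the same.
\<close>

locale right_fractions = preadditive_category C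
  for C :: "('o, 'a) cat" and T :: "'o set" +
  assumes weq_idn: "M \<in> Obj C \<Longrightarrow> idn C M \<in> serre_weq C T M M"
    and weq_cmp: "\<lbrakk>X \<in> Obj C; Y \<in> Obj C; Z \<in> Obj C; u \<in> serre_weq C T X Y; v \<in> serre_weq C T Y Z\<rbrakk>
      \<Longrightarrow> cmp C X Y Z v u \<in> serre_weq C T X Z"
    and weq_cancel: "\<lbrakk>X \<in> Obj C; Y \<in> Obj C; Z \<in> Obj C; u \<in> Arr C X Y; v \<in> serre_weq C T Y Z;
        cmp C X Y Z v u \<in> serre_weq C T X Z\<rbrakk> \<Longrightarrow> u \<in> serre_weq C T X Y"
    and weq_ore: "\<lbrakk>X \<in> Obj C; Y \<in> Obj C; N \<in> Obj C; f \<in> Arr C X N; t \<in> serre_weq C T Y N\<rbrakk>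
      \<Longrightarrow> \<exists>Z\<in>Obj C. \<exists>u\<in>serre_weq C T Z X. \<exists>v\<in>Arr C Z Y. cmp C Z X N f u = cmp C Z Y N t v"
    and weq_annihilate: "\<lbrakk>X \<in> Obj C; Y \<in> Obj C; N \<in> Obj C; f \<in> Arr C X Y; t \<in> serre_weq C T Y N;
        cmp C X Y N t f = zero_arr C X N\<rbrakk>
      \<Longrightarrow> \<exists>Z\<in>Obj C. \<exists>u\<in>serre_weq C T Z X. cmp C Z X Y f u = zero_arr C Z Y"
begin

abbreviation "W \<equiv> serre_weq C T"
abbreviation "quot \<equiv> serre_quotient C T"

definition frac :: "'o \<Rightarrow> 'o \<Rightarrow> 'o \<Rightarrow> 'a \<Rightarrow> 'a \<Rightarrow> ('o \<times> 'a \<times> 'a) set" where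
  "frac M N X s f = roof_rel C T M N `` {(X, s, f)}"

lemma weq_arr: "s \<in> W X M \<Longrightarrow> s \<in> Arr C X M"
  by (simp add: serre_weq_def)

lemmas arr_rules = cmp_in weq_arr idn_in weq_idn weq_cmp

lemma roofs_iff: "(X, s, f) \<in> roofs C T M N \<longleftrightarrow> X \<in> Obj C \<and> s \<in> W X M \<and> f \<in> Arr C X N"
  by (simp add: roofs_def)

lemma roof_relI:
  assumes "X \<in> Obj C" "s \<in> W X M" "f \<in> Arr C X N" "Y \<in> Obj C" "t \<in> W Y M" "g \<in> Arr C Y N"
    "Z \<in> Obj C" "u \<in> Arr C Z X" "v \<in> Arr C Z Y" "cmp C Z X M s u = cmp C Z Y M t v"
    "cmp C Z X M s u \<in> W Z M" "cmp C Z X N f u = cmp C Z Y N g v"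
  shows "((X, s, f), (Y, t, g)) \<in> roof_rel C T M N"
proof -
  have "\<exists>Z\<in>Obj C. \<exists>u\<in>Arr C Z X. \<exists>v\<in>Arr C Z Y.
      cmp C Z X M s u = cmp C Z Y M t v \<and> cmp C Z X M s u \<in> serre_weq C T Z M \<and>
      cmp C Z X N f u = cmp C Z Y N g v"
    using assms(7-) by blast
  with assms(1-6) show ?thesis by (simp add: roof_rel_def roofs_iff)
qed

text \<open>
  The roof relation only puts the common composite \<open>s \<circ> u = t \<circ> v\<close> into the inverted class; by
  cancellation \<open>u\<close> and \<open>v\<close> are then inverted themselves.
\<close>

lemma roof_relE:
  assumes "((X, s, f), (Y, t, g)) \<in> roof_rel C T M N" and "M \<in> Obj C"
  obtains Z u v where "X \<in> Obj C" "s \<in> W X M" "f \<in> Arr C X N"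
    "Y \<in> Obj C" "t \<in> W Y M" "g \<in> Arr C Y N" "Z \<in> Obj C" "u \<in> W Z X" "v \<in> W Z Y"
    "cmp C Z X M s u = cmp C Z Y M t v" "cmp C Z X N f u = cmp C Z Y N g v"
proof -
  obtain Z u v where *: "X \<in> Obj C" "s \<in> W X M" "f \<in> Arr C X N"
    "Y \<in> Obj C" "t \<in> W Y M" "g \<in> Arr C Y N" "Z \<in> Obj C" "u \<in> Arr C Z X" "v \<in> Arr C Z Y"
    "cmp C Z X M s u = cmp C Z Y M t v" "cmp C Z X M s u \<in> W Z M" "cmp C Z X N f u = cmp C Z Y N g v"
    using assms(1) by (auto simp: roof_rel_def roofs_iff)
  have "u \<in> W Z X" "v \<in> W Z Y"
    using * assms(2) weq_cancel[of Z X M u s] weq_cancel[of Z Y M v t] by auto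
  with * show ?thesis using that by blast
qed

lemma equiv_roof_rel:
  assumes "M \<in> Obj C" "N \<in> Obj C"
  shows "equiv (roofs C T M N) (roof_rel C T M N)"
proof (rule equivI)
  show "refl_on (roofs C T M N) (roof_rel C T M N)"
  proof (rule refl_onI, clarify)
    fix X s f assume "(X, s, f) \<in> roofs C T M N"
    then have *: "X \<in> Obj C" "s \<in> W X M" "f \<in> Arr C X N" by (auto simp: roofs_iff)
    have "cmp C X X M s (idn C X) = s"
      using * assms by (simp add: cmp_idn_right weq_arr)
    then show "((X, s, f), (X, s, f)) \<in> roof_rel C T M N"
      using * by (intro roof_relI[of _ _ _ _ _ _ _ _ X "idn C X" "idn C X"]) (auto intro: idn_in)
  qed
  show "sym_on UNIV (roof_rel C T M N)"
  proof (rule symI, clarify)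
    fix X s f Y t g assume "((X, s, f), (Y, t, g)) \<in> roof_rel C T M N"
    from this assms(1) obtain Z u v where 1: "X \<in> Obj C" "s \<in> W X M" "f \<in> Arr C X N"
      "Y \<in> Obj C" "t \<in> W Y M" "g \<in> Arr C Y N" "Z \<in> Obj C" "u \<in> W Z X" "v \<in> W Z Y"
      "cmp C Z X M s u = cmp C Z Y M t v" "cmp C Z X N f u = cmp C Z Y N g v"
      by (rule roof_relE)
    have "cmp C Z Y M t v \<in> W Z M" using 1 assms by (intro weq_cmp)
    then show "((Y, t, g), (X, s, f)) \<in> roof_rel C T M N"
      by (intro roof_relI[OF 1(4-6,1-3,7) _ _ 1(10)[symmetric] _ 1(11)[symmetric]] weq_arr 1)
  qed
  show "roof_rel C T M N \<subseteq> roofs C T M N \<times> roofs C T M N"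
    by (auto simp: roof_rel_def)
  show "trans (roof_rel C T M N)"
  proof (rule transI, clarify)
    fix X s f Y t g V r h
    assume a: "((X, s, f), (Y, t, g)) \<in> roof_rel C T M N"
      and b: "((Y, t, g), (V, r, h)) \<in> roof_rel C T M N"
    from a assms(1) obtain Z u v where 1: "X \<in> Obj C" "s \<in> W X M" "f \<in> Arr C X N"
      "Y \<in> Obj C" "t \<in> W Y M" "g \<in> Arr C Y N" "Z \<in> Obj C" "u \<in> W Z X" "v \<in> W Z Y"
      "cmp C Z X M s u = cmp C Z Y M t v" "cmp C Z X N f u = cmp C Z Y N g v"
      by (rule roof_relE)
    from b assms(1) obtain Z' u' v' where 2: 
      "V \<in> Obj C" "r \<in> W V M" "h \<in> Arr C V N" "Z' \<in> Obj C" "u' \<in> W Z' Y" "v' \<in> W Z' V"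
      "cmp C Z' Y M t u' = cmp C Z' V M r v'" "cmp C Z' Y N g u' = cmp C Z' V N h v'"
      by (rule roof_relE)
    obtain B a b where 3: "B \<in> Obj C" "a \<in> W B Z" "b \<in> Arr C B Z'" "cmp C B Z Y v a = cmp C B Z' Y u' b"
      using weq_ore[of Z Z' Y v u'] 1 2 by (metis weq_arr)
    note ar = weq_arr[OF 1(2)] weq_arr[OF 1(5)] weq_arr[OF 1(8)] weq_arr[OF 1(9)]
      weq_arr[OF 2(2)] weq_arr[OF 2(5)] weq_arr[OF 2(6)] weq_arr[OF 3(2)]
    note [simp] = 1(1,3,4,6,7) 2(1,3,4) 3(1,3) assms ar
    have "cmp C B X M s (cmp C B Z X u a) = cmp C B Z M (cmp C Z Y M t v) a"
      by (simp add: cmp_assoc 1(10))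
    also have "\<dots> = cmp C B Y M t (cmp C B Z' Y u' b)" by (simp add: cmp_assoc flip: 3(4))
    also have "\<dots> = cmp C B V M r (cmp C B Z' V v' b)" by (simp add: cmp_assoc 2(7))
    finally have e1: "cmp C B X M s (cmp C B Z X u a) = cmp C B V M r (cmp C B Z' V v' b)" .
    have "cmp C B X N f (cmp C B Z X u a) = cmp C B Z N (cmp C Z Y N g v) a"
      by (simp add: cmp_assoc 1(11))
    also have "\<dots> = cmp C B Y N g (cmp C B Z' Y u' b)" by (simp add: cmp_assoc flip: 3(4))
    also have "\<dots> = cmp C B V N h (cmp C B Z' V v' b)" by (simp add: cmp_assoc 2(8))
    finally have e2: "cmp C B X N f (cmp C B Z X u a) = cmp C B V N h (cmp C B Z' V v' b)" .
    show "((X, s, f), (V, r, h)) \<in> roof_rel C T M N"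
      by (rule roof_relI[OF _ 1(2) _ _ 2(2) _ _ _ _ e1 _ e2])
        (use 1 2 3 assms in \<open>simp_all add: arr_rules\<close>)
  qed
qed

lemma frac_in: "\<lbrakk>M \<in> Obj C; N \<in> Obj C; X \<in> Obj C; s \<in> W X M; f \<in> Arr C X N\<rbrakk> \<Longrightarrow> frac M N X s f \<in> Arr quot M N"
  unfolding frac_def serre_quotient_def by (simp add: quotientI roofs_iff)

lemma Obj_quot [simp]: "Obj quot = Obj C"
  by (simp add: serre_quotient_def)

lemma fracE:
  assumes "\<phi> \<in> Arr quot M N"
  obtains X s f where "X \<in> Obj C" "s \<in> W X M" "f \<in> Arr C X N" "\<phi> = frac M N X s f"
  using assms unfolding frac_def serre_quotient_def
  by (auto elim!: quotientE simp: roofs_iff)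

lemma frac_eq_iff:
  assumes "M \<in> Obj C" "N \<in> Obj C" "X \<in> Obj C" "s \<in> W X M" "f \<in> Arr C X N"
    "Y \<in> Obj C" "t \<in> W Y M" "g \<in> Arr C Y N"
  shows "frac M N X s f = frac M N Y t g \<longleftrightarrow> ((X, s, f), (Y, t, g)) \<in> roof_rel C T M N"
  unfolding frac_def
  by (rule eq_equiv_class_iff[OF equiv_roof_rel]) (use assms in \<open>auto simp: roofs_iff\<close>)

lemma frac_eqE:
  assumes "frac M N X s f = frac M N Y t g" "M \<in> Obj C" "N \<in> Obj C" "X \<in> Obj C" "s \<in> W X M" "f \<in> Arr C X N"
    "Y \<in> Obj C" "t \<in> W Y M" "g \<in> Arr C Y N"
  obtains Z u v where "Z \<in> Obj C" "u \<in> W Z X" "v \<in> W Z Y"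
    "cmp C Z X M s u = cmp C Z Y M t v" "cmp C Z X N f u = cmp C Z Y N g v"
proof -
  have "((X, s, f), (Y, t, g)) \<in> roof_rel C T M N" using assms frac_eq_iff[of M N X s f Y t g] by simp
  then show ?thesis using that assms(2) by (elim roof_relE) blast+
qed

lemma in_frac_iff:
  assumes "M \<in> Obj C" "N \<in> Obj C" "X \<in> Obj C" "s \<in> W X M" "f \<in> Arr C X N"
  shows "(Y, t, g) \<in> frac M N X s f \<longleftrightarrow>
    Y \<in> Obj C \<and> t \<in> W Y M \<and> g \<in> Arr C Y N \<and> frac M N Y t g = frac M N X s f"
proof -
  have "(Y, t, g) \<in> frac M N X s f \<longleftrightarrow> ((X, s, f), (Y, t, g)) \<in> roof_rel C T M N"
    by (simp add: frac_def)
  also have "\<dots> \<longleftrightarrow> Y \<in> Obj C \<and> t \<in> W Y M \<and> g \<in> Arr C Y N \<and> ((X, s, f), (Y, t, g)) \<in> roof_rel C T M N"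
    by (auto simp: roof_rel_def roofs_iff)
  also have "\<dots> \<longleftrightarrow> Y \<in> Obj C \<and> t \<in> W Y M \<and> g \<in> Arr C Y N \<and> frac M N Y t g = frac M N X s f"
    using frac_eq_iff[OF assms] by metis
  finally show ?thesis .
qed

text \<open>
  A fraction may be expanded by any inverted arrow: this is how fractions are brought to a common form below.
\<close>

lemma frac_expand:
  assumes "M \<in> Obj C" "N \<in> Obj C" "X \<in> Obj C" "s \<in> W X M" "f \<in> Arr C X N" "Z \<in> Obj C" "u \<in> W Z X"
  shows "frac M N Z (cmp C Z X M s u) (cmp C Z X N f u) = frac M N X s f"
proof -
  have *: "cmp C Z X M s u \<in> W Z M" "cmp C Z X N f u \<in> Arr C Z N"
    using assms by (simp_all add: arr_rules)
  then have "((Z, cmp C Z X M s u, cmp C Z X N f u), (X, s, f)) \<in> roof_rel C T M N"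
    using assms
    by (intro roof_relI[of _ _ _ _ _ _ _ _ Z "idn C Z" u]) (simp_all add: arr_rules cmp_idn_right)
  then show ?thesis using frac_eq_iff * assms by simp
qed

lemma frac_eqI:
  assumes "M \<in> Obj C" "N \<in> Obj C" "X \<in> Obj C" "s \<in> W X M" "f \<in> Arr C X N" "Y \<in> Obj C" "t \<in> W Y M" "g \<in> Arr C Y N"
    "Z \<in> Obj C" "u \<in> W Z X" "v \<in> W Z Y"
    "cmp C Z X M s u = cmp C Z Y M t v" "cmp C Z X N f u = cmp C Z Y N g v"
  shows "frac M N X s f = frac M N Y t g"
  using frac_expand[of M N X s f Z u] frac_expand[of M N Y t g Z v] assms by simp

text \<open>
  The Ore condition for the two denominators, followed by expansion of both fractions.
\<close>

lemma common_denominator2: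
  assumes "\<phi> \<in> Arr quot M N" "\<psi> \<in> Arr quot M P" "M \<in> Obj C" "N \<in> Obj C" "P \<in> Obj C"
  obtains X s f g where "X \<in> Obj C" "s \<in> W X M" "f \<in> Arr C X N" "g \<in> Arr C X P"
    "\<phi> = frac M N X s f" "\<psi> = frac M P X s g"
proof -
  obtain X s f where 1: "X \<in> Obj C" "s \<in> W X M" "f \<in> Arr C X N" "\<phi> = frac M N X s f"
    using assms(1) by (rule fracE)
  obtain Y t g where 2: "Y \<in> Obj C" "t \<in> W Y M" "g \<in> Arr C Y P" "\<psi> = frac M P Y t g"
    using assms(2) by (rule fracE)
  obtain Z u v where 3: "Z \<in> Obj C" "u \<in> W Z X" "v \<in> Arr C Z Y" "cmp C Z X M s u = cmp C Z Y M t v"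
    using weq_ore[of X Y M s t] 1 2 assms by (metis weq_arr)
  have v: "v \<in> W Z Y"
    using weq_cancel[of Z Y M v t] weq_cmp[of Z X M u s] 1 2 3 assms by simp
  show ?thesis
  proof (rule that[of Z "cmp C Z X M s u" "cmp C Z X N f u" "cmp C Z Y P g v"])
    show "\<phi> = frac M N Z (cmp C Z X M s u) (cmp C Z X N f u)"
      using frac_expand[OF _ _ 1(1-3) 3(1,2)] 1 assms by simp
    show "\<psi> = frac M P Z (cmp C Z X M s u) (cmp C Z Y P g v)"
      unfolding 3(4) using frac_expand[of M P Y t g Z v] 2 3 assms v by simp
  qed (use 1 2 3 assms v in \<open>simp_all add: arr_rules\<close>)
qed

lemma common_denominator3:
  assumes "\<phi> \<in> Arr quot M N" "\<psi> \<in> Arr quot M P" "\<chi> \<in> Arr quot M R" "M \<in> Obj C" "N \<in> Obj C" "P \<in> Obj C" "R \<in> Obj C"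
  obtains X s f g h where "X \<in> Obj C" "s \<in> W X M" "f \<in> Arr C X N" "g \<in> Arr C X P" "h \<in> Arr C X R"
    "\<phi> = frac M N X s f" "\<psi> = frac M P X s g" "\<chi> = frac M R X s h"
proof -
  obtain X s f g where 1: "X \<in> Obj C" "s \<in> W X M" "f \<in> Arr C X N" "g \<in> Arr C X P"
    "\<phi> = frac M N X s f" "\<psi> = frac M P X s g"
    using common_denominator2[OF assms(1,2,4,5,6)] by metis
  obtain Y t h where 2: "Y \<in> Obj C" "t \<in> W Y M" "h \<in> Arr C Y R" "\<chi> = frac M R Y t h"
    using assms(3) by (rule fracE)
  obtain Z u v where 3: "Z \<in> Obj C" "u \<in> W Z X" "v \<in> Arr C Z Y" "cmp C Z X M s u = cmp C Z Y M t v"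
    using weq_ore[of X Y M s t] 1 2 assms by (metis weq_arr)
  have v: "v \<in> W Z Y"
    using weq_cancel[of Z Y M v t] weq_cmp[of Z X M u s] 1 2 3 assms by simp
  show ?thesis
  proof (rule that[of Z "cmp C Z X M s u" "cmp C Z X N f u" "cmp C Z X P g u" "cmp C Z Y R h v"])
    show "\<phi> = frac M N Z (cmp C Z X M s u) (cmp C Z X N f u)"
      using frac_expand[OF _ _ 1(1-3) 3(1,2)] 1 assms by simp
    show "\<psi> = frac M P Z (cmp C Z X M s u) (cmp C Z X P g u)"
      using frac_expand[OF _ _ 1(1,2,4) 3(1,2)] 1 assms by simp
    show "\<chi> = frac M R Z (cmp C Z X M s u) (cmp C Z Y R h v)"
      unfolding 3(4) using frac_expand[of M R Y t h Z v] 2 3 assms v by simp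
  qed (use 1 2 3 assms v in \<open>simp_all add: arr_rules\<close>)
qed

text \<open>
  The difference of the two arrows is annihilated by an inverted arrow.
\<close>

lemma weq_equalize:
  assumes "X \<in> Obj C" "Y \<in> Obj C" "N \<in> Obj C" "f \<in> Arr C X Y" "g \<in> Arr C X Y" "t \<in> W Y N"
    "cmp C X Y N t f = cmp C X Y N t g"
  obtains Z u where "Z \<in> Obj C" "u \<in> W Z X" "cmp C Z X Y f u = cmp C Z X Y g u"
proof -
  obtain g' where g': "g' \<in> Arr C X Y" "plus_arr C X Y g' g = zero_arr C X Y"
    using assms neg_ex by metis
  have "cmp C X Y N t (plus_arr C X Y g' f) = cmp C X Y N t (plus_arr C X Y g' g)"
    using assms g'(1) by (simp add: cmp_plus_right weq_arr)
  then have "cmp C X Y N t (plus_arr C X Y g' f) = zero_arr C X N"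
    using g' assms by (simp add: cmp_zero_right weq_arr)
  then obtain Z u where u: "Z \<in> Obj C" "u \<in> W Z X" "cmp C Z X Y (plus_arr C X Y g' f) u = zero_arr C Z Y"
    using weq_annihilate[of X Y N "plus_arr C X Y g' f" t] assms g' by (auto simp: plus_in)
  let ?a = "cmp C Z X Y g' u" and ?b = "cmp C Z X Y f u" and ?c = "cmp C Z X Y g u"
  have *: "?a \<in> Arr C Z Y" "?b \<in> Arr C Z Y" "?c \<in> Arr C Z Y"
    using assms u g' by (simp_all add: arr_rules)
  interpret G: comm_group "hom_group C Z Y" using assms u hom_group by simp
  have "plus_arr C Z Y ?a ?b = zero_arr C Z Y"
    using u assms g' by (simp add: cmp_plus_left weq_arr)
  moreover have "plus_arr C Z Y ?a ?c = cmp C Z X Y (plus_arr C X Y g' g) u"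
    using u(1,2) assms g'(1) by (simp add: cmp_plus_left weq_arr)
  ultimately have "plus_arr C Z Y ?a ?b = plus_arr C Z Y ?a ?c"
    using g'(2) u assms by (simp add: cmp_zero_left weq_arr)
  then have "?b = ?c"
    using G.Units_l_cancel[of ?a ?b ?c] G.Units_eq * by (simp add: hom_group_def)
  then show ?thesis using that u by blast
qed

lemma frac_eq_sameE:
  assumes "frac M N X s f = frac M N X s g" "M \<in> Obj C" "N \<in> Obj C" "X \<in> Obj C" "s \<in> W X M"
    "f \<in> Arr C X N" "g \<in> Arr C X N"
  obtains Z u where "Z \<in> Obj C" "u \<in> W Z X" "cmp C Z X N f u = cmp C Z X N g u"
proof -
  obtain Z u v where 1: "Z \<in> Obj C" "u \<in> W Z X" "v \<in> W Z X"
    "cmp C Z X M s u = cmp C Z X M s v" "cmp C Z X N f u = cmp C Z X N g v"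
    using frac_eqE[OF assms(1-6,4,5,7)] by metis
  obtain V w where 2: "V \<in> Obj C" "w \<in> W V Z" "cmp C V Z X u w = cmp C V Z X v w"
    using weq_equalize[of Z X M u v s] 1 assms by (metis weq_arr)
  note [simp] = assms(2-) 1(1-3) 2(1,2)
  have "cmp C V X N f (cmp C V Z X u w) = cmp C V Z N (cmp C Z X N g v) w"
    by (simp add: cmp_assoc arr_rules 1(5))
  also have "\<dots> = cmp C V X N g (cmp C V Z X u w)"
    by (simp add: 2(3) arr_rules flip: cmp_assoc)
  finally show ?thesis using that[of V "cmp C V Z X u w"] by (simp add: arr_rules)
qed

text \<open>
  Composition in the quotient is defined through an arbitrary choice of an Ore square. Two squares are
  compared over a common refinement of \<open>Z\<close> and \<open>Z'\<close>, on which \<open>t \<circ> v\<close> and \<open>t \<circ> v'\<close> agree; a further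
  refinement makes \<open>v\<close> and \<open>v'\<close> agree.
\<close>

lemma cmp_frac_unique:
  assumes obj: "M \<in> Obj C" "N \<in> Obj C" "P \<in> Obj C" "X \<in> Obj C" "Y \<in> Obj C" "Z \<in> Obj C" "Z' \<in> Obj C"
    and s: "s \<in> W X M" "f \<in> Arr C X N" and t: "t \<in> W Y N" "g \<in> Arr C Y P"
    and u: "u \<in> W Z X" "v \<in> Arr C Z Y" "cmp C Z X N f u = cmp C Z Y N t v"
    and u': "u' \<in> W Z' X" "v' \<in> Arr C Z' Y" "cmp C Z' X N f u' = cmp C Z' Y N t v'"
  shows "frac M P Z (cmp C Z X M s u) (cmp C Z Y P g v) = frac M P Z' (cmp C Z' X M s u') (cmp C Z' Y P g v')"
proof -
  obtain E w w' where w: "E \<in> Obj C" "w \<in> W E Z" "w' \<in> Arr C E Z'" "cmp C E Z X u w = cmp C E Z' X u' w'"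
    using weq_ore[of Z Z' X u u'] obj u u' by (metis weq_arr)
  have w'W: "w' \<in> W E Z'"
    using weq_cancel[of E Z' X w' u'] weq_cmp[of E Z X w u] obj u u' w by simp
  note [simp] = obj s t u(1,2) u'(1,2) w(1,2,3) w'W
  have "cmp C E Z N (cmp C Z Y N t v) w = cmp C E Z' N (cmp C Z' Y N t v') w'"
    using cmp_prolong[OF w(4), of N f] u(3) u'(3) by (simp add: arr_rules)
  then have "cmp C E Y N t (cmp C E Z Y v w) = cmp C E Y N t (cmp C E Z' Y v' w')"
    by (simp add: arr_rules cmp_assoc)
  then obtain D e where e: "D \<in> Obj C" "e \<in> W D E"
    "cmp C D E Y (cmp C E Z Y v w) e = cmp C D E Y (cmp C E Z' Y v' w') e"
    using weq_equalize[of E Y N "cmp C E Z Y v w" "cmp C E Z' Y v' w'" t] by (auto simp: arr_rules)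
  note [simp] = e(1,2)
  have e1: "cmp C E Z M (cmp C Z X M s u) w = cmp C E Z' M (cmp C Z' X M s u') w'"
    using cmp_prolong[OF w(4), of M s] by (simp add: arr_rules)
  have e2: "cmp C D E P (cmp C E Z P (cmp C Z Y P g v) w) e = cmp C D E P (cmp C E Z' P (cmp C Z' Y P g v') w') e"
    using cmp_prolong[OF e(3), of P g] by (simp add: arr_rules cmp_assoc)
  show ?thesis
    by (rule frac_eqI[of M P _ _ _ _ _ _ D "cmp C D E Z w e" "cmp C D E Z' w' e"])
      (simp_all add: arr_rules cmp_assoc e1 e2)
qed

lemma cmp_frac:
  assumes obj: "M \<in> Obj C" "N \<in> Obj C" "P \<in> Obj C" "X \<in> Obj C" "Y \<in> Obj C" "Z \<in> Obj C"
    and s: "s \<in> W X M" "f \<in> Arr C X N" and t: "t \<in> W Y N" "g \<in> Arr C Y P"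
    and u: "u \<in> W Z X" "v \<in> Arr C Z Y" "cmp C Z X N f u = cmp C Z Y N t v"
  shows "cmp quot M N P (frac N P Y t g) (frac M N X s f) = frac M P Z (cmp C Z X M s u) (cmp C Z Y P g v)"
proof -
  let ?S = "{(Z, cmp C Z X M s u, cmp C Z Y P g v) | Z X Y s f t g u v.
         (X, s, f) \<in> frac M N X s f \<and> (Y, t, g) \<in> frac N P Y t g \<and> Z \<in> Obj C \<and> u \<in> serre_weq C T Z X \<and>
         v \<in> Arr C Z Y \<and> cmp C Z X N f u = cmp C Z Y N t v}"
  define S where "S = {(Z, cmp C Z X' M s' u, cmp C Z Y' P g' v) | Z X' Y' s' f' t' g' u v.
         (X', s', f') \<in> frac M N X s f \<and> (Y', t', g') \<in> frac N P Y t g \<and> Z \<in> Obj C \<and> u \<in> serre_weq C T Z X' \<and>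
         v \<in> Arr C Z Y' \<and> cmp C Z X' N f' u = cmp C Z Y' N t' v}"
  have "(X, s, f) \<in> frac M N X s f" "(Y, t, g) \<in> frac N P Y t g"
    using obj s t by (simp_all add: in_frac_iff)
  then have "(Z, cmp C Z X M s u, cmp C Z Y P g v) \<in> S"
    using obj s t u unfolding S_def by blast
  moreover have "roof_rel C T M P `` {\<rho>} = frac M P Z (cmp C Z X M s u) (cmp C Z Y P g v)" if "\<rho> \<in> S" for \<rho>
  proof -
    from that obtain Z' X' Y' s' f' t' g' u' v' where \<rho>: "\<rho> = (Z', cmp C Z' X' M s' u', cmp C Z' Y' P g' v')"
      and in1: "(X', s', f') \<in> frac M N X s f" and in2: "(Y', t', g') \<in> frac N P Y t g"
      and u': "Z' \<in> Obj C" "u' \<in> W Z' X'" "v' \<in> Arr C Z' Y'" "cmp C Z' X' N f' u' = cmp C Z' Y' N t' v'"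
      unfolding S_def by blast
    have 1: "X' \<in> Obj C" "s' \<in> W X' M" "f' \<in> Arr C X' N" "frac M N X s f = frac M N X' s' f'"
      using in1 obj s by (simp_all add: in_frac_iff)
    have 2: "Y' \<in> Obj C" "t' \<in> W Y' N" "g' \<in> Arr C Y' P" "frac N P Y t g = frac N P Y' t' g'"
      using in2 obj t by (simp_all add: in_frac_iff)
    obtain A a a' where a: "A \<in> Obj C" "a \<in> W A X" "a' \<in> W A X'"
      "cmp C A X M s a = cmp C A X' M s' a'" "cmp C A X N f a = cmp C A X' N f' a'"
      using frac_eqE[OF 1(4)] obj s 1 by metis
    obtain B b b' where b: "B \<in> Obj C" "b \<in> W B Y" "b' \<in> W B Y'"
      "cmp C B Y N t b = cmp C B Y' N t' b'" "cmp C B Y P g b = cmp C B Y' P g' b'"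
      using frac_eqE[OF 2(4)] obj t 2 by metis
    note [simp] = obj s t u(1,2) u'(1-3) 1(1-3) 2(1-3) a(1-3) b(1-3)
    have tb: "cmp C B Y N t b \<in> W B N" "cmp C A X N f a \<in> Arr C A N" by (simp_all add: arr_rules)
    obtain E u1 v1 where e: "E \<in> Obj C" "u1 \<in> W E A" "v1 \<in> Arr C E B"
      "cmp C E A N (cmp C A X N f a) u1 = cmp C E B N (cmp C B Y N t b) v1"
      using weq_ore[of A B N, OF _ _ _ tb(2,1)] by auto
    note [simp] = e(1-3)
    have c1: "cmp C E X N f (cmp C E A X a u1) = cmp C E Y N t (cmp C E B Y b v1)"
      using e(4) by (simp add: arr_rules cmp_assoc)
    have c2: "cmp C E X' N f' (cmp C E A X' a' u1) = cmp C E Y' N t' (cmp C E B Y' b' v1)"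
      using e(4) a(5) b(4) by (simp add: arr_rules cmp_assoc)
    have "frac M P Z (cmp C Z X M s u) (cmp C Z Y P g v) =
      frac M P E (cmp C E X M s (cmp C E A X a u1)) (cmp C E Y P g (cmp C E B Y b v1))"
      by (rule cmp_frac_unique[OF _ _ _ _ _ _ _ s t u _ _ c1]) (simp_all add: arr_rules)
    also have "\<dots> = frac M P E (cmp C E X' M s' (cmp C E A X' a' u1)) (cmp C E Y' P g' (cmp C E B Y' b' v1))"
      using a(4) b(5) by (simp add: arr_rules cmp_assoc)
    also have "\<dots> = frac M P Z' (cmp C Z' X' M s' u') (cmp C Z' Y' P g' v')"
      by (rule cmp_frac_unique[OF _ _ _ _ _ _ _ 1(2,3) 2(2,3) _ _ c2 u'(2-)]) (simp_all add: arr_rules)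
    finally show ?thesis by (simp add: \<rho> frac_def)
  qed
  ultimately have "roof_rel C T M P `` S = frac M P Z (cmp C Z X M s u) (cmp C Z Y P g v)"
    by blast
  then show ?thesis by (simp add: S_def serre_quotient_def)
qed

lemma plus_frac:
  assumes obj: "M \<in> Obj C" "N \<in> Obj C" "X \<in> Obj C" and s: "s \<in> W X M" "f \<in> Arr C X N" "g \<in> Arr C X N"
  shows "plus_arr quot M N (frac M N X s f) (frac M N X s g) = frac M N X s (plus_arr C X N f g)"
proof -
  define S where "S = {(X', s', plus_arr C X' N f' g') | X' s' f' g'.
    (X', s', f') \<in> frac M N X s f \<and> (X', s', g') \<in> frac M N X s g}"
  have "(X, s, f) \<in> frac M N X s f" "(X, s, g) \<in> frac M N X s g"
    using obj s by (simp_all add: in_frac_iff)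
  then have "(X, s, plus_arr C X N f g) \<in> S"
    unfolding S_def by blast
  moreover have "roof_rel C T M N `` {\<rho>} = frac M N X s (plus_arr C X N f g)" if "\<rho> \<in> S" for \<rho>
  proof -
    from that obtain X' s' f' g' where \<rho>: "\<rho> = (X', s', plus_arr C X' N f' g')"
      and in1: "(X', s', f') \<in> frac M N X s f" and in2: "(X', s', g') \<in> frac M N X s g"
      unfolding S_def by blast
    have 1: "X' \<in> Obj C" "s' \<in> W X' M" "f' \<in> Arr C X' N" "frac M N X s f = frac M N X' s' f'"
      "g' \<in> Arr C X' N" "frac M N X s g = frac M N X' s' g'"
      using in1 in2 obj s by (simp_all add: in_frac_iff)
    obtain A a a' where a: "A \<in> Obj C" "a \<in> W A X" "a' \<in> W A X'"
      "cmp C A X M s a = cmp C A X' M s' a'" "cmp C A X N f a = cmp C A X' N f' a'"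
      using frac_eqE[OF 1(4)] obj s 1 by metis
    obtain B b b' where b: "B \<in> Obj C" "b \<in> W B X" "b' \<in> W B X'"
      "cmp C B X M s b = cmp C B X' M s' b'" "cmp C B X N g b = cmp C B X' N g' b'"
      using frac_eqE[OF 1(6)] obj s 1 by metis
    note [simp] = obj s 1(1-3,5) a(1-3) b(1-3)
    obtain E w w' where w: "E \<in> Obj C" "w \<in> W E A" "w' \<in> Arr C E B" "cmp C E A X a w = cmp C E B X b w'"
      using weq_ore[of A B X a b] by (auto simp: arr_rules)
    note [simp] = w(1-3)
    have "cmp C E A M (cmp C A X M s a) w = cmp C E B M (cmp C B X M s b) w'"
      using cmp_prolong[OF w(4), of M s] by (simp add: arr_rules)
    then have "cmp C E X' M s' (cmp C E A X' a' w) = cmp C E X' M s' (cmp C E B X' b' w')"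
      using a(4) b(4) by (simp add: arr_rules cmp_assoc)
    then obtain D e where e: "D \<in> Obj C" "e \<in> W D E"
      "cmp C D E X' (cmp C E A X' a' w) e = cmp C D E X' (cmp C E B X' b' w') e"
      using weq_equalize[of E X' M "cmp C E A X' a' w" "cmp C E B X' b' w'" s'] by (auto simp: arr_rules)
    note [simp] = e(1,2)
    let ?p = "cmp C D A X a (cmp C D E A w e)" and ?p' = "cmp C D A X' a' (cmp C D E A w e)"
    have p: "?p \<in> W D X" "?p' \<in> W D X'" by (simp_all add: arr_rules)
    have s1: "cmp C D X M s ?p = cmp C D X' M s' ?p'"
      using a(4) by (simp add: arr_rules cmp_assoc)
    have f1: "cmp C D X N f ?p = cmp C D X' N f' ?p'"
      using a(5) by (simp add: arr_rules cmp_assoc)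
    have pb: "?p = cmp C D B X b (cmp C D E B w' e)" "?p' = cmp C D B X' b' (cmp C D E B w' e)"
      using w(4) e(3) by (simp_all add: arr_rules cmp_assoc)
    have g1: "cmp C D X N g ?p = cmp C D X' N g' ?p'"
      unfolding pb using b(5) by (simp add: arr_rules cmp_assoc)
    have "cmp C D X N (plus_arr C X N f g) ?p = cmp C D X' N (plus_arr C X' N f' g') ?p'"
      using p f1 g1 by (simp add: cmp_plus_left weq_arr)
    then have "frac M N X s (plus_arr C X N f g) = frac M N X' s' (plus_arr C X' N f' g')"
      by (intro frac_eqI[OF _ _ _ _ _ _ _ _ _ p s1]) (simp_all add: plus_in)
    then show ?thesis by (simp add: \<rho> frac_def)
  qed
  ultimately have "roof_rel C T M N `` S = frac M N X s (plus_arr C X N f g)"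
    by blast
  then show ?thesis by (simp add: S_def serre_quotient_def)
qed

lemma idn_frac: "idn quot M = frac M M M (idn C M) (idn C M)"
  by (simp add: serre_quotient_def frac_def)

lemma zero_frac_idn: "zero_arr quot M N = frac M N M (idn C M) (zero_arr C M N)"
  by (simp add: serre_quotient_def frac_def)

lemma zero_frac:
  assumes "M \<in> Obj C" "N \<in> Obj C" "X \<in> Obj C" "s \<in> W X M"
  shows "zero_arr quot M N = frac M N X s (zero_arr C X N)"
  using frac_expand[of M N M "idn C M" "zero_arr C M N" X s] assms
  by (simp add: zero_frac_idn zero_in cmp_idn_left cmp_zero_left arr_rules)

lemma frac_eq_zeroE:
  assumes "frac M N X s f = zero_arr quot M N" "M \<in> Obj C" "N \<in> Obj C" "X \<in> Obj C" "s \<in> W X M" "f \<in> Arr C X N"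
  obtains Z u where "Z \<in> Obj C" "u \<in> W Z X" "cmp C Z X N f u = zero_arr C Z N"
proof -
  have "frac M N X s f = frac M N X s (zero_arr C X N)" using assms zero_frac by simp
  then obtain Z u v where 1: "Z \<in> Obj C" "u \<in> W Z X" "v \<in> W Z X"
    "cmp C Z X N f u = cmp C Z X N (zero_arr C X N) v"
    using frac_eqE[of M N X s f X s "zero_arr C X N"] assms by (metis zero_in)
  then show ?thesis using that assms by (simp add: cmp_zero_left weq_arr)
qed

end

context right_fractions begin

lemma cmp_frac_common:
  assumes "M \<in> Obj C" "N \<in> Obj C" "P \<in> Obj C" "X \<in> Obj C" "Y \<in> Obj C"
    "s \<in> W X M" "t \<in> W Y N" "g \<in> Arr C Y P" "v \<in> Arr C X Y"
  shows "cmp quot M N P (frac N P Y t g) (frac M N X s (cmp C X Y N t v)) = frac M P X s (cmp C X Y P g v)"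
  using cmp_frac[of M N P X Y X s "cmp C X Y N t v" t g "idn C X" v] assms
  by (simp add: arr_rules cmp_idn_right)

text \<open>
  By the Ore condition the numerator of the first arrow can be made to run through the denominator of
  the second; composing them then needs no further choice.
\<close>

lemma composable_fracE:
  assumes "\<phi> \<in> Arr quot M N" "\<psi> \<in> Arr quot N P" "M \<in> Obj C" "N \<in> Obj C" "P \<in> Obj C"
  obtains X Y s t v g where "X \<in> Obj C" "Y \<in> Obj C" "s \<in> W X M" "t \<in> W Y N" "v \<in> Arr C X Y" "g \<in> Arr C Y P"
    "\<phi> = frac M N X s (cmp C X Y N t v)" "\<psi> = frac N P Y t g"
proof -
  obtain X s f where 1: "X \<in> Obj C" "s \<in> W X M" "f \<in> Arr C X N" "\<phi> = frac M N X s f"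
    using assms(1) by (rule fracE)
  obtain Y t g where 2: "Y \<in> Obj C" "t \<in> W Y N" "g \<in> Arr C Y P" "\<psi> = frac N P Y t g"
    using assms(2) by (rule fracE)
  obtain Z u v where 3: "Z \<in> Obj C" "u \<in> W Z X" "v \<in> Arr C Z Y" "cmp C Z X N f u = cmp C Z Y N t v"
    using weq_ore[of X Y N f t] 1 2 assms by metis
  have "\<phi> = frac M N Z (cmp C Z X M s u) (cmp C Z Y N t v)"
    using frac_expand[OF assms(3,4) 1(1-3) 3(1,2)] 1(4) 3(4) by simp
  moreover have "cmp C Z X M s u \<in> W Z M" using 1 3 assms by (simp add: arr_rules)
  ultimately show ?thesis using that 2 3 by blast
qed

lemma cmp_quot_in:
  assumes "\<phi> \<in> Arr quot M N" "\<psi> \<in> Arr quot N P" "M \<in> Obj C" "N \<in> Obj C" "P \<in> Obj C"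
  shows "cmp quot M N P \<psi> \<phi> \<in> Arr quot M P"
  using composable_fracE[OF assms] assms(3-) by (metis cmp_frac_common frac_in cmp_in)

lemma category_quot: "category quot"
proof
  fix A assume "A \<in> Obj quot"
  then show "idn quot A \<in> Arr quot A A"
    by (simp add: idn_frac frac_in arr_rules)
next
  fix A B D f g assume "A \<in> Obj quot" "B \<in> Obj quot" "D \<in> Obj quot" "f \<in> Arr quot A B" "g \<in> Arr quot B D"
  then show "cmp quot A B D g f \<in> Arr quot A D" by (simp add: cmp_quot_in)
next
  fix A B \<phi> assume o: "A \<in> Obj quot" "B \<in> Obj quot" and \<phi>: "\<phi> \<in> Arr quot A B"
  from \<phi> obtain X s f where 1: "X \<in> Obj C" "s \<in> W X A" "f \<in> Arr C X B" "\<phi> = frac A B X s f"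
    by (rule fracE)
  have "idn quot A = frac A A X s s"
    using frac_expand[of A A A "idn C A" "idn C A" X s] 1 o by (simp add: idn_frac cmp_idn_left arr_rules)
  then show "cmp quot A A B \<phi> (idn quot A) = \<phi>"
    using cmp_frac_common[of A A B X X s s f "idn C X"] 1 o by (simp add: cmp_idn_right arr_rules)
  show "cmp quot A B B (idn quot B) \<phi> = \<phi>"
    using cmp_frac_common[of A B B X B s "idn C B" "idn C B" f] 1 o by (simp add: cmp_idn_left arr_rules idn_frac)
next
  fix A B D E \<phi> \<psi> \<chi> assume o: "A \<in> Obj quot" "B \<in> Obj quot" "D \<in> Obj quot" "E \<in> Obj quot"
    and \<phi>: "\<phi> \<in> Arr quot A B" and \<psi>: "\<psi> \<in> Arr quot B D" and \<chi>: "\<chi> \<in> Arr quot D E"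
  note [simp] = o[simplified]
  obtain Y Z t r v h where 1: "Y \<in> Obj C" "Z \<in> Obj C" "t \<in> W Y B" "r \<in> W Z D" "v \<in> Arr C Y Z" "h \<in> Arr C Z E"
    "\<psi> = frac B D Y t (cmp C Y Z D r v)" "\<chi> = frac D E Z r h"
    using composable_fracE[OF \<psi> \<chi>] o by (metis Obj_quot)
  obtain X s f where 2: "X \<in> Obj C" "s \<in> W X A" "f \<in> Arr C X B" "\<phi> = frac A B X s f"
    using \<phi> by (rule fracE)
  obtain V e k where 3: "V \<in> Obj C" "e \<in> W V X" "k \<in> Arr C V Y" "cmp C V X B f e = cmp C V Y B t k"
    using weq_ore[of X Y B f t] 1 2 by auto
  note [simp] = 1(1-6) 2(1-3) 3(1-3)
  have \<phi>': "\<phi> = frac A B V (cmp C V X A s e) (cmp C V Y B t k)"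
    using frac_expand[of A B X s f V e] 2 3 by simp
  have "cmp quot B D E \<chi> \<psi> = frac B E Y t (cmp C Y Z E h v)"
    unfolding 1(7,8) by (rule cmp_frac_common) simp_all
  then have l: "cmp quot A B E (cmp quot B D E \<chi> \<psi>) \<phi> = frac A E V (cmp C V X A s e) (cmp C V Y E (cmp C Y Z E h v) k)"
    unfolding \<phi>' using cmp_frac_common[of A B E V Y "cmp C V X A s e" t "cmp C Y Z E h v" k] by (simp add: arr_rules)
  have "cmp quot A B D \<psi> \<phi> = frac A D V (cmp C V X A s e) (cmp C V Y D (cmp C Y Z D r v) k)"
    unfolding \<phi>' 1(7) by (rule cmp_frac_common) (simp_all add: arr_rules)
  also have "\<dots> = frac A D V (cmp C V X A s e) (cmp C V Z D r (cmp C V Y Z v k))"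
    by (simp add: arr_rules cmp_assoc)
  finally show "cmp quot A D E \<chi> (cmp quot A B D \<psi> \<phi>) = cmp quot A B E (cmp quot B D E \<chi> \<psi>) \<phi>"
    unfolding l unfolding 1(8) using cmp_frac_common[of A D E V Z "cmp C V X A s e" r h "cmp C V Y Z v k"]
    by (simp add: arr_rules cmp_assoc)
qed

lemma plus_quot_in:
  assumes "\<phi> \<in> Arr quot M N" "\<psi> \<in> Arr quot M N" "M \<in> Obj C" "N \<in> Obj C"
  shows "plus_arr quot M N \<phi> \<psi> \<in> Arr quot M N"
  using common_denominator2[OF assms(1,2,3,4,4)] assms(3-) by (metis plus_frac frac_in plus_in)

lemma hom_group_quot:
  assumes o: "M \<in> Obj C" "N \<in> Obj C"
  shows "comm_group (hom_group quot M N)"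
proof (rule comm_groupI; simp add: hom_group_def)
  show "\<And>x y. x \<in> Arr quot M N \<Longrightarrow> y \<in> Arr quot M N \<Longrightarrow> plus_arr quot M N x y \<in> Arr quot M N"
    using plus_quot_in o by simp
  show "zero_arr quot M N \<in> Arr quot M N"
    using o by (simp add: zero_frac_idn frac_in arr_rules zero_in)
  show "plus_arr quot M N (plus_arr quot M N x y) z = plus_arr quot M N x (plus_arr quot M N y z)"
    if *: "x \<in> Arr quot M N" "y \<in> Arr quot M N" "z \<in> Arr quot M N" for x y z
  proof -
    obtain X s f g h where "X \<in> Obj C" "s \<in> W X M" "f \<in> Arr C X N" "g \<in> Arr C X N" "h \<in> Arr C X N"
      "x = frac M N X s f" "y = frac M N X s g" "z = frac M N X s h"
      using common_denominator3[OF * o(1) o(2) o(2) o(2)] by metis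
    then show ?thesis using o by (simp add: plus_frac plus_in plus_assoc)
  qed
  show "plus_arr quot M N x y = plus_arr quot M N y x" if *: "x \<in> Arr quot M N" "y \<in> Arr quot M N" for x y
  proof -
    obtain X s f g where "X \<in> Obj C" "s \<in> W X M" "f \<in> Arr C X N" "g \<in> Arr C X N"
      "x = frac M N X s f" "y = frac M N X s g"
      using common_denominator2[OF * o(1) o(2) o(2)] by metis
    then show ?thesis using o plus_comm[of X N f g] by (simp add: plus_frac)
  qed
  show "plus_arr quot M N (zero_arr quot M N) x = x" if *: "x \<in> Arr quot M N" for x
  proof -
    obtain X s f where "X \<in> Obj C" "s \<in> W X M" "f \<in> Arr C X N" "x = frac M N X s f"
      using * by (rule fracE)
    then show ?thesis using o by (simp add: plus_frac plus_zero zero_frac[of M N X s] zero_in)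
  qed
  show "\<exists>y\<in>Arr quot M N. plus_arr quot M N y x = zero_arr quot M N" if *: "x \<in> Arr quot M N" for x
  proof -
    obtain X s f where 1: "X \<in> Obj C" "s \<in> W X M" "f \<in> Arr C X N" "x = frac M N X s f"
      using * by (rule fracE)
    obtain g where "g \<in> Arr C X N" "plus_arr C X N g f = zero_arr C X N"
      using 1 o neg_ex by metis
    then show ?thesis using 1 o by (intro bexI[of _ "frac M N X s g"]) (simp_all add: plus_frac frac_in zero_frac[of M N X s])
  qed
qed

lemma preadditive_quot: "preadditive_category quot"
proof (intro preadditive_category.intro[OF category_quot] preadditive_category_axioms.intro)
  fix A B assume "A \<in> Obj quot" "B \<in> Obj quot" then show "comm_group (hom_group quot A B)"
    by (simp add: hom_group_quot)
next
  fix A B D \<phi> \<phi>' \<psi> assume o: "A \<in> Obj quot" "B \<in> Obj quot" "D \<in> Obj quot"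
    and a: "\<phi> \<in> Arr quot A B" "\<phi>' \<in> Arr quot A B" "\<psi> \<in> Arr quot B D"
  note [simp] = o[simplified]
  obtain X s f f' where 1: "X \<in> Obj C" "s \<in> W X A" "f \<in> Arr C X B" "f' \<in> Arr C X B"
    "\<phi> = frac A B X s f" "\<phi>' = frac A B X s f'"
    using common_denominator2[OF a(1,2)] o by (metis Obj_quot)
  obtain Y t g where 2: "Y \<in> Obj C" "t \<in> W Y B" "g \<in> Arr C Y D" "\<psi> = frac B D Y t g"
    using a(3) by (rule fracE)
  note [simp] = 1(1-4) 2(1-3)
  obtain Z u v where 3: "Z \<in> Obj C" "u \<in> W Z X" "v \<in> Arr C Z Y" "cmp C Z X B f u = cmp C Z Y B t v"
    using weq_ore[of X Y B f t] by auto
  note [simp] = 3(1-3)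
  have *: "cmp C Z X B f' u \<in> Arr C Z B" by (simp add: arr_rules)
  obtain Z' u' v' where 4: "Z' \<in> Obj C" "u' \<in> W Z' Z" "v' \<in> Arr C Z' Y"
    "cmp C Z' Z B (cmp C Z X B f' u) u' = cmp C Z' Y B t v'"
    using weq_ore[OF _ _ _ *, of Y t] by auto
  note [simp] = 4(1-3)
  let ?w = "cmp C Z' Z X u u'" let ?v = "cmp C Z' Z Y v u'"
  have f: "cmp C Z' X B f ?w = cmp C Z' Y B t ?v"
    using 3(4) by (simp add: cmp_assoc arr_rules)
  have f': "cmp C Z' X B f' ?w = cmp C Z' Y B t v'"
    using 4(4) by (simp add: cmp_assoc arr_rules)
  have p: "cmp C Z' X B (plus_arr C X B f f') ?w = cmp C Z' Y B t (plus_arr C Z' Y ?v v')"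
    using f f' by (simp add: cmp_plus_left cmp_plus_right arr_rules)
  have [simp]: "?w \<in> W Z' X" "?v \<in> Arr C Z' Y" by (simp_all add: arr_rules)
  have "cmp quot A B D \<psi> \<phi> = frac A D Z' (cmp C Z' X A s ?w) (cmp C Z' Y D g ?v)"
    unfolding 1 2 by (rule cmp_frac[OF _ _ _ _ _ _ _ _ _ _ _ _ f]) simp_all
  moreover have "cmp quot A B D \<psi> \<phi>' = frac A D Z' (cmp C Z' X A s ?w) (cmp C Z' Y D g v')"
    unfolding 1 2 by (rule cmp_frac[OF _ _ _ _ _ _ _ _ _ _ _ _ f']) simp_all
  moreover have "cmp quot A B D \<psi> (plus_arr quot A B \<phi> \<phi>') =
      frac A D Z' (cmp C Z' X A s ?w) (cmp C Z' Y D g (plus_arr C Z' Y ?v v'))"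
    unfolding 1 2 using cmp_frac[OF _ _ _ _ _ _ _ _ _ _ _ _ p, of A D s g] by (simp add: plus_frac plus_in)
  ultimately show "cmp quot A B D \<psi> (plus_arr quot A B \<phi> \<phi>') = 
      plus_arr quot A D (cmp quot A B D \<psi> \<phi>) (cmp quot A B D \<psi> \<phi>')"
    by (simp add: plus_frac arr_rules cmp_plus_right)
next
  fix A B D \<phi> \<psi> \<psi>' assume o: "A \<in> Obj quot" "B \<in> Obj quot" "D \<in> Obj quot"
    and a: "\<phi> \<in> Arr quot A B" "\<psi> \<in> Arr quot B D" "\<psi>' \<in> Arr quot B D"
  note [simp] = o[simplified]
  obtain Y t g g' where 1: "Y \<in> Obj C" "t \<in> W Y B" "g \<in> Arr C Y D" "g' \<in> Arr C Y D"
    "\<psi> = frac B D Y t g" "\<psi>' = frac B D Y t g'"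
    using common_denominator2[OF a(2,3)] o by (metis Obj_quot)
  obtain X s f where 2: "X \<in> Obj C" "s \<in> W X A" "f \<in> Arr C X B" "\<phi> = frac A B X s f"
    using a(1) by (rule fracE)
  note [simp] = 1(1-4) 2(1-3)
  obtain Z u v where 3: "Z \<in> Obj C" "u \<in> W Z X" "v \<in> Arr C Z Y" "cmp C Z X B f u = cmp C Z Y B t v"
    using weq_ore[of X Y B f t] by auto
  note [simp] = 3(1-3)
  show "cmp quot A B D (plus_arr quot B D \<psi> \<psi>') \<phi> = 
      plus_arr quot A D (cmp quot A B D \<psi> \<phi>) (cmp quot A B D \<psi>' \<phi>)"
    unfolding 1 2 using cmp_frac[OF _ _ _ _ _ _ _ _ _ _ _ _ 3(4), of A D s]
    by (simp add: plus_frac arr_rules plus_in cmp_plus_left)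
qed

lemma zero_object_quot:
  assumes "is_zero_object C Z"
  shows "is_zero_object quot Z"
proof -
  have Z: "Z \<in> Obj C" using assms by (simp add: is_zero_object_def)
  have 1: "\<phi> = zero_arr quot X Z" if X: "X \<in> Obj C" "\<phi> \<in> Arr quot X Z" for X \<phi>
  proof -
    obtain Y s f where 1: "Y \<in> Obj C" "s \<in> W Y X" "f \<in> Arr C Y Z" "\<phi> = frac X Z Y s f"
      using X(2) by (rule fracE)
    then have "f = zero_arr C Y Z" using assms zero_in[of Y Z] Z unfolding is_zero_object_def by blast
    then show ?thesis using zero_frac[of X Z Y s] 1 Z X by simp
  qed
  have idz: "idn C Z = zero_arr C Z Z" using assms zero_in[of Z Z] Z idn_in[of Z] unfolding is_zero_object_def by blast
  have 2: "\<phi> = zero_arr quot Z X" if X: "X \<in> Obj C" "\<phi> \<in> Arr quot Z X" for X \<phi>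
  proof -
    interpret q: preadditive_category quot by (rule preadditive_quot)
    have "idn quot Z = zero_arr quot Z Z" by (simp add: idn_frac zero_frac_idn idz)
    then have "\<phi> = cmp quot Z Z X \<phi> (zero_arr quot Z Z)"
      using q.cmp_idn_right[of Z X \<phi>] X Z by simp
    also have "\<dots> = zero_arr quot Z X"
    proof -
      obtain Y s f where 1: "Y \<in> Obj C" "s \<in> W Y Z" "f \<in> Arr C Y X" "\<phi> = frac Z X Y s f"
        using X(2) by (rule fracE)
      have "zero_arr quot Z Z = frac Z Z Y s (cmp C Y Y Z s (zero_arr C Y Y))"
        using 1 Z by (simp add: zero_frac[of Z Z Y s] cmp_zero_right weq_arr)
      then show ?thesis using cmp_frac_common[of Z Z X Y Y s s f "zero_arr C Y Y"] 1 X Z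
        by (simp add: zero_in cmp_zero_right zero_frac[of Z X Y s])
    qed
    finally show ?thesis .
  qed
  have z: "zero_arr quot X Y \<in> Arr quot X Y" if "X \<in> Obj C" "Y \<in> Obj C" for X Y
    using that by (simp add: zero_frac_idn frac_in arr_rules zero_in)
  show ?thesis unfolding is_zero_object_def using 1 2 z Z by (metis Obj_quot)
qed

lemma product_quot:
  assumes o: "A \<in> Obj C" "B \<in> Obj C" and p: "is_product C A B P p q"
  shows "is_product quot A B P (frac P A P (idn C P) p) (frac P B P (idn C P) q)"
proof -
  have P: "P \<in> Obj C" "p \<in> Arr C P A" "q \<in> Arr C P B"
    and univ: "\<And>X f g. X \<in> Obj C \<Longrightarrow> f \<in> Arr C X A \<Longrightarrow> g \<in> Arr C X B \<Longrightarrow>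
      \<exists>!h. h \<in> Arr C X P \<and> cmp C X P A p h = f \<and> cmp C X P B q h = g"
    using p unfolding is_product_def by blast+
  note [simp] = P o
  have pr: "cmp quot X P A (frac P A P (idn C P) p) (frac X P Y s h) = frac X A Y s (cmp C Y P A p h)"
    "cmp quot X P B (frac P B P (idn C P) q) (frac X P Y s h) = frac X B Y s (cmp C Y P B q h)"
    if "X \<in> Obj C" "Y \<in> Obj C" "s \<in> W Y X" "h \<in> Arr C Y P" for X Y s h
    using that cmp_frac_common[of X P A Y P s "idn C P" p h] cmp_frac_common[of X P B Y P s "idn C P" q h]
    by (simp_all add: arr_rules cmp_idn_left)
  have ex: "\<exists>\<theta>. \<theta> \<in> Arr quot X P \<and> cmp quot X P A (frac P A P (idn C P) p) \<theta> = \<phi> \<and>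
     cmp quot X P B (frac P B P (idn C P) q) \<theta> = \<psi>"
    if X[simp]: "X \<in> Obj C" and a: "\<phi> \<in> Arr quot X A" "\<psi> \<in> Arr quot X B" for X \<phi> \<psi>
  proof -
    obtain Y s f g where 1: "Y \<in> Obj C" "s \<in> W Y X" "f \<in> Arr C Y A" "g \<in> Arr C Y B"
      "\<phi> = frac X A Y s f" "\<psi> = frac X B Y s g"
      using common_denominator2[OF a] o X by metis
    obtain h where "h \<in> Arr C Y P" "cmp C Y P A p h = f" "cmp C Y P B q h = g"
      using univ[of Y f g] 1 by blast
    then show ?thesis using 1 pr[of X Y s h] frac_in[of X P Y s h] by auto
  qed
  have un: "\<theta> = \<theta>'" if X[simp]: "X \<in> Obj C" and a: "\<theta> \<in> Arr quot X P" "\<theta>' \<in> Arr quot X P"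
     and e: "cmp quot X P A (frac P A P (idn C P) p) \<theta> = cmp quot X P A (frac P A P (idn C P) p) \<theta>'"
     "cmp quot X P B (frac P B P (idn C P) q) \<theta> = cmp quot X P B (frac P B P (idn C P) q) \<theta>'" for X \<theta> \<theta>'
  proof -
    obtain Y s h h' where 1: "Y \<in> Obj C" "s \<in> W Y X" "h \<in> Arr C Y P" "h' \<in> Arr C Y P"
      "\<theta> = frac X P Y s h" "\<theta>' = frac X P Y s h'"
      using common_denominator2[OF a] P(1) X by metis
    note [simp] = 1(1-4)
    have e1: "frac X A Y s (cmp C Y P A p h) = frac X A Y s (cmp C Y P A p h')"
      "frac X B Y s (cmp C Y P B q h) = frac X B Y s (cmp C Y P B q h')"
      using e by (simp_all add: 1(5,6) pr)
    obtain Z u where u: "Z \<in> Obj C" "u \<in> W Z Y" "cmp C Z Y A (cmp C Y P A p h) u = cmp C Z Y A (cmp C Y P A p h') u"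
      by (rule frac_eq_sameE[OF e1(1)]) (auto simp: arr_rules)
    note [simp] = u(1,2)
    have e2: "frac X B Z (cmp C Z Y X s u) (cmp C Z Y B (cmp C Y P B q h) u) =
       frac X B Z (cmp C Z Y X s u) (cmp C Z Y B (cmp C Y P B q h') u)"
      using e1(2) by (simp add: frac_expand arr_rules)
    obtain V w where w: "V \<in> Obj C" "w \<in> W V Z" "cmp C V Z B (cmp C Z Y B (cmp C Y P B q h) u) w = 
        cmp C V Z B (cmp C Z Y B (cmp C Y P B q h') u) w"
      by (rule frac_eq_sameE[OF e2]) (auto simp: arr_rules)
    note [simp] = w(1,2)
    let ?w = "cmp C V Z Y u w"
    have w'[simp]: "?w \<in> W V Y" by (simp add: arr_rules)
    have "cmp C V P A p (cmp C V Y P h ?w) = cmp C V P A p (cmp C V Y P h' ?w)"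
      using u(3) by (simp add: arr_rules cmp_assoc)
    moreover have "cmp C V P B q (cmp C V Y P h ?w) = cmp C V P B q (cmp C V Y P h' ?w)"
      using w(3) by (simp add: arr_rules cmp_assoc)
    moreover have "cmp C V Y P h ?w \<in> Arr C V P" "cmp C V Y P h' ?w \<in> Arr C V P"
      by (simp_all add: arr_rules)
    ultimately have "cmp C V Y P h ?w = cmp C V Y P h' ?w"
      using univ[of V "cmp C V P A p (cmp C V Y P h ?w)" "cmp C V P B q (cmp C V Y P h ?w)"]
      by (metis P(1-3) cmp_in o w(1))
    then show ?thesis using frac_expand[of X P Y s h V ?w] frac_expand[of X P Y s h' V ?w] 1 by simp
  qed
  show ?thesis unfolding is_product_def
    using ex un frac_in[of P A P "idn C P" p] frac_in[of P B P "idn C P" q]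
    by (simp add: arr_rules) metis
qed

text \<open>
  The kernel of \<open>f \<circ> s\<inverse>\<close> is \<open>s \<circ> ker f\<close>: an arrow killed by the fraction can be written with a numerator
  through \<open>X\<close> that is killed by \<open>f\<close> after refinement.
\<close>

lemma kernel_quot:
  assumes o: "M \<in> Obj C" "N \<in> Obj C" "X \<in> Obj C" "s \<in> W X M" "f \<in> Arr C X N" and k: "is_kernel C X N f K i"
  shows "is_kernel quot M N (frac M N X s f) K (frac K M K (idn C K) (cmp C K X M s i))"
proof -
  have K: "K \<in> Obj C" "i \<in> Arr C K X" "cmp C K X N f i = zero_arr C K N"
    and univ: "\<And>L g. L \<in> Obj C \<Longrightarrow> g \<in> Arr C L X \<Longrightarrow> cmp C L X N f g = zero_arr C L N \<Longrightarrow>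
      \<exists>!h. h \<in> Arr C L K \<and> cmp C L K X i h = g"
    using k unfolding is_kernel_def by blast+
  note [simp] = K(1,2) o
  let ?k = "frac K M K (idn C K) (cmp C K X M s i)"
  have k: "?k \<in> Arr quot K M" by (simp add: frac_in arr_rules)
  have z: "cmp quot K M N (frac M N X s f) ?k = zero_arr quot K N"
    by (simp add: cmp_frac_common arr_rules K(3) zero_frac_idn)
  have kc: "cmp quot L K M ?k (frac L K Y t h) = frac L M Y t (cmp C Y X M s (cmp C Y K X i h))"
    if "L \<in> Obj C" "Y \<in> Obj C" "t \<in> W Y L" "h \<in> Arr C Y K" for L Y t h
    using cmp_frac_common[of L K M Y K t "idn C K" "cmp C K X M s i" h] that
    by (simp add: arr_rules cmp_idn_left cmp_assoc)
  have ex: "\<exists>\<theta>. \<theta> \<in> Arr quot L K \<and> cmp quot L K M ?k \<theta> = \<psi>"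
    if L[simp]: "L \<in> Obj C" and a: "\<psi> \<in> Arr quot L M" "cmp quot L M N (frac M N X s f) \<psi> = zero_arr quot L N" for L \<psi>
  proof -
    have f: "frac M N X s f \<in> Arr quot M N" by (simp add: frac_in)
    obtain Y t g where 1: "Y \<in> Obj C" "t \<in> W Y L" "g \<in> Arr C Y M" "\<psi> = frac L M Y t g"
      using a(1) by (rule fracE)
    obtain Z u v where 2: "Z \<in> Obj C" "u \<in> W Z Y" "v \<in> Arr C Z X" "cmp C Z Y M g u = cmp C Z X M s v"
      using weq_ore[of Y X M g s] 1 by auto
    note [simp] = 1(1-3) 2(1-3)
    have "\<psi> = frac L M Z (cmp C Z Y L t u) (cmp C Z X M s v)"
      using frac_expand[of L M Y t g Z u] 1(4) 2(4) by simp
    moreover from this have "frac L N Z (cmp C Z Y L t u) (cmp C Z X N f v) = zero_arr quot L N"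
      using a(2) by (simp add: cmp_frac_common arr_rules)
    then obtain V w where 3: "V \<in> Obj C" "w \<in> W V Z" "cmp C V Z N (cmp C Z X N f v) w = zero_arr C V N"
      by (rule frac_eq_zeroE) (auto simp: arr_rules)
    note [simp] = 3(1,2)
    have "cmp C V X N f (cmp C V Z X v w) = zero_arr C V N"
      using 3(3) by (simp add: cmp_assoc arr_rules)
    then obtain h where h: "h \<in> Arr C V K" "cmp C V K X i h = cmp C V Z X v w"
      using univ[of V "cmp C V Z X v w"] by (auto simp: arr_rules)
    note [simp] = h(1)
    ultimately have "\<psi> = frac L M V (cmp C V Z L (cmp C Z Y L t u) w) (cmp C V X M s (cmp C V K X i h))"
      using frac_expand[of L M Z "cmp C Z Y L t u" "cmp C Z X M s v" V w] 
      by (simp add: h(2) cmp_assoc arr_rules)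
    then have "cmp quot L K M ?k (frac L K V (cmp C V Z L (cmp C Z Y L t u) w) h) = \<psi>"
      by (simp add: kc arr_rules)
    moreover have "frac L K V (cmp C V Z L (cmp C Z Y L t u) w) h \<in> Arr quot L K"
      by (simp add: frac_in arr_rules)
    ultimately show ?thesis by blast
  qed
  have un: "\<theta> = \<theta>'" if L[simp]: "L \<in> Obj C" and a: "\<theta> \<in> Arr quot L K" "\<theta>' \<in> Arr quot L K"
    and e: "cmp quot L K M ?k \<theta> = cmp quot L K M ?k \<theta>'" for L \<theta> \<theta>'
  proof -
    obtain Y t h h' where 1: "Y \<in> Obj C" "t \<in> W Y L" "h \<in> Arr C Y K" "h' \<in> Arr C Y K"
      "\<theta> = frac L K Y t h" "\<theta>' = frac L K Y t h'"
      using common_denominator2[OF a] K(1) L by metis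
    note [simp] = 1(1-4)
    have "frac L M Y t (cmp C Y X M s (cmp C Y K X i h)) = frac L M Y t (cmp C Y X M s (cmp C Y K X i h'))"
      using e by (simp add: 1(5,6) kc)
    then obtain Z u where 2: "Z \<in> Obj C" "u \<in> W Z Y"
      "cmp C Z Y M (cmp C Y X M s (cmp C Y K X i h)) u = cmp C Z Y M (cmp C Y X M s (cmp C Y K X i h')) u"
      by (rule frac_eq_sameE) (auto simp: arr_rules)
    note [simp] = 2(1,2)
    have "cmp C Z X M s (cmp C Z Y X (cmp C Y K X i h) u) = cmp C Z X M s (cmp C Z Y X (cmp C Y K X i h') u)"
      using 2(3) by (simp add: cmp_assoc arr_rules)
    then obtain V w where 3: "V \<in> Obj C" "w \<in> W V Z" 
      "cmp C V Z X (cmp C Z Y X (cmp C Y K X i h) u) w = cmp C V Z X (cmp C Z Y X (cmp C Y K X i h') u) w"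
      using weq_equalize[of Z X M "cmp C Z Y X (cmp C Y K X i h) u" "cmp C Z Y X (cmp C Y K X i h') u" s] by (auto simp: arr_rules)
    note [simp] = 3(1,2)
    let ?w = "cmp C V Z Y u w"
    have w'[simp]: "?w \<in> W V Y" by (simp add: arr_rules)
    have e1: "cmp C V K X i (cmp C V Y K h ?w) = cmp C V K X i (cmp C V Y K h' ?w)"
      using 3(3) by (simp add: cmp_assoc arr_rules)
    have "cmp C V X N f (cmp C V K X i (cmp C V Y K h ?w)) = zero_arr C V N"
      using K(3) by (simp add: cmp_assoc arr_rules cmp_zero_left)
    then have "cmp C V Y K h ?w = cmp C V Y K h' ?w"
      using univ[of V "cmp C V K X i (cmp C V Y K h ?w)"] e1 
      by (metis "1"(1,3,4) "3"(1) K(1,2) cmp_in o(3) w' weq_arr)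
    then show ?thesis using frac_expand[of L K Y t h V ?w] frac_expand[of L K Y t h' V ?w] 1 by simp
  qed
  show ?thesis unfolding is_kernel_def
    using k z ex un by simp metis
qed

end

section \<open>Categories with elements and their torsion\<close>

text \<open>
  An additive category whose objects \<open>M\<close> are families \<open>grp M i\<close> of abelian groups and whose arrows act
  on elements through \<open>app\<close>, together with a notion of torsion element. The index \<open>i\<close> is the degree of a
  graded module and ranges over \<open>unit\<close> for ungraded modules. Kernels, cokernels and products are given
  by their elements; \<open>lift\<close> and \<open>descend\<close> supply the factorisations of arrows from which their universal
  properties follow. The last four axioms say that torsion elements are closed under addition, arrows
  and extensions; in \<open>tor_extension\<close> the whole kernel is required to be torsion, which is
  the form in which torsion over a noetherian ring passes from a quotient to the module.
\<close>

locale element_category =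
  fixes C :: "('o, 'a) cat" and grp :: "'o \<Rightarrow> 'i \<Rightarrow> ('m, 'e) ring_scheme"
    and app :: "'a \<Rightarrow> 'i \<Rightarrow> 'm \<Rightarrow> 'm" and tor :: "'o \<Rightarrow> 'i \<Rightarrow> 'm \<Rightarrow> bool"
  assumes grp: "M \<in> Obj C \<Longrightarrow> abelian_group (grp M i)"
    and app_in: "\<lbrakk>M \<in> Obj C; N \<in> Obj C; f \<in> Arr C M N; x \<in> carrier (grp M i)\<rbrakk> \<Longrightarrow> app f i x \<in> carrier (grp N i)"
    and app_add: "\<lbrakk>M \<in> Obj C; N \<in> Obj C; f \<in> Arr C M N; x \<in> carrier (grp M i); y \<in> carrier (grp M i)\<rbrakk>
      \<Longrightarrow> app f i (x \<oplus>\<^bsub>grp M i\<^esub> y) = app f i x \<oplus>\<^bsub>grp N i\<^esub> app f i y"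
    and arr_eqI: "\<lbrakk>M \<in> Obj C; N \<in> Obj C; f \<in> Arr C M N; g \<in> Arr C M N;
        \<And>i x. x \<in> carrier (grp M i) \<Longrightarrow> app f i x = app g i x\<rbrakk> \<Longrightarrow> f = g"
    and idn_arr: "M \<in> Obj C \<Longrightarrow> idn C M \<in> Arr C M M"
    and app_idn: "\<lbrakk>M \<in> Obj C; x \<in> carrier (grp M i)\<rbrakk> \<Longrightarrow> app (idn C M) i x = x"
    and cmp_arr: "\<lbrakk>M \<in> Obj C; N \<in> Obj C; P \<in> Obj C; f \<in> Arr C M N; g \<in> Arr C N P\<rbrakk>
      \<Longrightarrow> cmp C M N P g f \<in> Arr C M P"
    and app_cmp: "\<lbrakk>M \<in> Obj C; N \<in> Obj C; P \<in> Obj C; f \<in> Arr C M N; g \<in> Arr C N P; x \<in> carrier (grp M i)\<rbrakk>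
      \<Longrightarrow> app (cmp C M N P g f) i x = app g i (app f i x)"
    and plus_arr: "\<lbrakk>M \<in> Obj C; N \<in> Obj C; f \<in> Arr C M N; g \<in> Arr C M N\<rbrakk>
      \<Longrightarrow> plus_arr C M N f g \<in> Arr C M N"
    and app_plus: "\<lbrakk>M \<in> Obj C; N \<in> Obj C; f \<in> Arr C M N; g \<in> Arr C M N; x \<in> carrier (grp M i)\<rbrakk>
      \<Longrightarrow> app (plus_arr C M N f g) i x = app f i x \<oplus>\<^bsub>grp N i\<^esub> app g i x"
    and zero_arr: "\<lbrakk>M \<in> Obj C; N \<in> Obj C\<rbrakk> \<Longrightarrow> zero_arr C M N \<in> Arr C M N"
    and app_zero: "\<lbrakk>M \<in> Obj C; N \<in> Obj C; x \<in> carrier (grp M i)\<rbrakk> \<Longrightarrow> app (zero_arr C M N) i x = \<zero>\<^bsub>grp N i\<^esub>"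
    and neg_arr: "\<lbrakk>M \<in> Obj C; N \<in> Obj C; f \<in> Arr C M N\<rbrakk>
      \<Longrightarrow> \<exists>g\<in>Arr C M N. \<forall>i. \<forall>x\<in>carrier (grp M i). app g i x = \<ominus>\<^bsub>grp N i\<^esub> app f i x"
    and zero_obj: "\<exists>Z\<in>Obj C. \<forall>i. carrier (grp Z i) = {\<zero>\<^bsub>grp Z i\<^esub>}"
    and product: "\<lbrakk>A \<in> Obj C; B \<in> Obj C\<rbrakk> \<Longrightarrow> \<exists>P\<in>Obj C. \<exists>p\<in>Arr C P A. \<exists>q\<in>Arr C P B.
      (\<forall>i. \<forall>x\<in>carrier (grp A i). \<forall>y\<in>carrier (grp B i).
        \<exists>!z. z \<in> carrier (grp P i) \<and> app p i z = x \<and> app q i z = y) \<and>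
      (\<forall>X\<in>Obj C. \<forall>f\<in>Arr C X A. \<forall>g\<in>Arr C X B. \<exists>h\<in>Arr C X P. cmp C X P A p h = f \<and> cmp C X P B q h = g)"
    and kernel: "\<lbrakk>M \<in> Obj C; N \<in> Obj C; f \<in> Arr C M N\<rbrakk> \<Longrightarrow> \<exists>K\<in>Obj C. \<exists>j\<in>Arr C K M.
      (\<forall>i. inj_on (app j i) (carrier (grp K i)) \<and>
        app j i ` carrier (grp K i) = {x \<in> carrier (grp M i). app f i x = \<zero>\<^bsub>grp N i\<^esub>})"
    and cokernel: "\<lbrakk>M \<in> Obj C; N \<in> Obj C; f \<in> Arr C M N\<rbrakk> \<Longrightarrow> \<exists>Q\<in>Obj C. \<exists>p\<in>Arr C N Q.
      (\<forall>i. app p i ` carrier (grp N i) = carrier (grp Q i) \<and>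
        {x \<in> carrier (grp N i). app p i x = \<zero>\<^bsub>grp Q i\<^esub>} = app f i ` carrier (grp M i))"
    and lift: "\<lbrakk>X \<in> Obj C; K \<in> Obj C; M \<in> Obj C; f \<in> Arr C X M; j \<in> Arr C K M;
        \<And>i. inj_on (app j i) (carrier (grp K i));
        \<And>i. app f i ` carrier (grp X i) \<subseteq> app j i ` carrier (grp K i)\<rbrakk> \<Longrightarrow> \<exists>h\<in>Arr C X K. cmp C X K M j h = f"
    and descend: "\<lbrakk>M \<in> Obj C; Q \<in> Obj C; X \<in> Obj C; f \<in> Arr C M X; p \<in> Arr C M Q;
        \<And>i. app p i ` carrier (grp M i) = carrier (grp Q i);
        \<And>i x. \<lbrakk>x \<in> carrier (grp M i); app p i x = \<zero>\<^bsub>grp Q i\<^esub>\<rbrakk> \<Longrightarrow> app f i x = \<zero>\<^bsub>grp X i\<^esub>\<rbrakk>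
      \<Longrightarrow> \<exists>h\<in>Arr C Q X. cmp C M Q X h p = f"
    and tor_zero: "M \<in> Obj C \<Longrightarrow> tor M i \<zero>\<^bsub>grp M i\<^esub>"
    and tor_add: "\<lbrakk>M \<in> Obj C; x \<in> carrier (grp M i); y \<in> carrier (grp M i); tor M i x; tor M i y\<rbrakk>
      \<Longrightarrow> tor M i (x \<oplus>\<^bsub>grp M i\<^esub> y)"
    and tor_image: "\<lbrakk>M \<in> Obj C; N \<in> Obj C; f \<in> Arr C M N; x \<in> carrier (grp M i); tor M i x\<rbrakk> \<Longrightarrow> tor N i (app f i x)"
    and tor_extension: "\<lbrakk>M \<in> Obj C; N \<in> Obj C; f \<in> Arr C M N; x \<in> carrier (grp M i); tor N i (app f i x);
        \<And>j y. \<lbrakk>y \<in> carrier (grp M j); app f j y = \<zero>\<^bsub>grp N j\<^esub>\<rbrakk> \<Longrightarrow> tor M j y\<rbrakk> \<Longrightarrow> tor M i x"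
begin

abbreviation E where "E M i \<equiv> carrier (grp M i)"
abbreviation nul where "nul M i \<equiv> \<zero>\<^bsub>grp M i\<^esub>"

definition torsion_objects :: "'o set" where
  "torsion_objects = {M \<in> Obj C. \<forall>i. \<forall>x\<in>E M i. tor M i x}"

text \<open>
  Monomorphisms and epimorphisms modulo torsion. For the latter, testing on all arrows that vanish on
  the image avoids choosing a cokernel, so that these arrows compose and cancel like epimorphisms.
\<close>

definition tor_mono :: "'o \<Rightarrow> 'o \<Rightarrow> 'a \<Rightarrow> bool" where
  "tor_mono M N f \<longleftrightarrow> (\<forall>i. \<forall>x\<in>E M i. app f i x = nul N i \<longrightarrow> tor M i x)"

definition tor_epi :: "'o \<Rightarrow> 'o \<Rightarrow> 'a \<Rightarrow> bool" where
  "tor_epi M N f \<longleftrightarrow> (\<forall>Q\<in>Obj C. \<forall>r\<in>Arr C N Q. cmp C M N Q r f = zero_arr C M Q \<longrightarrow>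
    (\<forall>i. \<forall>y\<in>E N i. tor Q i (app r i y)))"

lemma nul_in: "M \<in> Obj C \<Longrightarrow> nul M i \<in> E M i"
  by (rule abelian_group.axioms(1)[OF grp, THEN abelian_monoid.zero_closed])

lemma app_nul:
  assumes "M \<in> Obj C" "N \<in> Obj C" "f \<in> Arr C M N"
  shows "app f i (nul M i) = nul N i"
proof -
  interpret M: abelian_group "grp M i" using assms grp by simp
  interpret N: abelian_group "grp N i" using assms grp by simp
  have "app f i (nul M i) = app f i (nul M i) \<oplus>\<^bsub>grp N i\<^esub> app f i (nul M i)"
    using app_add[OF assms M.zero_closed M.zero_closed] by simp
  then show ?thesis using N.add.r_cancel_one' app_in[OF assms M.zero_closed] by simp
qed

lemma app_neg:
  assumes "M \<in> Obj C" "N \<in> Obj C" "f \<in> Arr C M N" "x \<in> E M i"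
  shows "app f i (\<ominus>\<^bsub>grp M i\<^esub> x) = \<ominus>\<^bsub>grp N i\<^esub> app f i x"
proof -
  interpret M: abelian_group "grp M i" using assms grp by simp
  interpret N: abelian_group "grp N i" using assms grp by simp
  have "app f i x \<oplus>\<^bsub>grp N i\<^esub> app f i (\<ominus>\<^bsub>grp M i\<^esub> x) = nul N i"
    using app_add[OF assms(1-3), of x i "\<ominus>\<^bsub>grp M i\<^esub> x"] assms app_nul[OF assms(1-3)] by (simp add: M.r_neg)
  then show ?thesis
    using N.minus_equality[of "app f i (\<ominus>\<^bsub>grp M i\<^esub> x)" "app f i x"] app_in[OF assms(1-3)] assms(4)
      N.a_comm[of "app f i x" "app f i (\<ominus>\<^bsub>grp M i\<^esub> x)"] by simp
qed

lemma app_minus: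
  assumes "M \<in> Obj C" "N \<in> Obj C" "f \<in> Arr C M N" "x \<in> E M i" "y \<in> E M i"
  shows "app f i (x \<ominus>\<^bsub>grp M i\<^esub> y) = app f i x \<ominus>\<^bsub>grp N i\<^esub> app f i y"
proof -
  interpret M: abelian_group "grp M i" using assms grp by simp
  show ?thesis using assms app_add[of M N f x i "\<ominus>\<^bsub>grp M i\<^esub> y"] app_neg[of M N f y i] by (simp add: a_minus_def)
qed

lemma minus_in: "M \<in> Obj C \<Longrightarrow> x \<in> E M i \<Longrightarrow> y \<in> E M i \<Longrightarrow> x \<ominus>\<^bsub>grp M i\<^esub> y \<in> E M i"
  using grp abelian_group.minus_closed by metis

lemma minus_eq_nul_iff: "M \<in> Obj C \<Longrightarrow> x \<in> E M i \<Longrightarrow> y \<in> E M i \<Longrightarrow> x \<ominus>\<^bsub>grp M i\<^esub> y = nul M i \<longleftrightarrow> x = y"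
proof -
  assume a: "M \<in> Obj C" "x \<in> E M i" "y \<in> E M i"
  interpret M: abelian_group "grp M i" using a grp by simp
  show ?thesis
  proof
    assume "x \<ominus>\<^bsub>grp M i\<^esub> y = nul M i"
    then have "x \<oplus>\<^bsub>grp M i\<^esub> \<ominus>\<^bsub>grp M i\<^esub> y = nul M i" by (simp add: a_minus_def)
    then show "x = y" using M.minus_equality[of x "\<ominus>\<^bsub>grp M i\<^esub> y"] a M.minus_minus by simp
  next
    assume "x = y" then show "x \<ominus>\<^bsub>grp M i\<^esub> y = nul M i" using a by (simp add: a_minus_def M.r_neg)
  qed
qed

lemma cmp_eq_zero_iff:
  assumes "M \<in> Obj C" "N \<in> Obj C" "P \<in> Obj C" "f \<in> Arr C M N" "g \<in> Arr C N P"
  shows "cmp C M N P g f = zero_arr C M P \<longleftrightarrow> (\<forall>i. \<forall>x\<in>E M i. app g i (app f i x) = nul P i)"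
proof
  assume "cmp C M N P g f = zero_arr C M P"
  then show "\<forall>i. \<forall>x\<in>E M i. app g i (app f i x) = nul P i" using assms by (metis app_cmp app_zero)
next
  assume "\<forall>i. \<forall>x\<in>E M i. app g i (app f i x) = nul P i"
  then show "cmp C M N P g f = zero_arr C M P"
    using assms by (intro arr_eqI[of M P]) (simp_all add: cmp_arr zero_arr app_cmp app_zero)
qed

lemma minus_arr:
  assumes "M \<in> Obj C" "N \<in> Obj C" "f \<in> Arr C M N" "g \<in> Arr C M N"
  obtains h where "h \<in> Arr C M N" "\<And>i x. x \<in> E M i \<Longrightarrow> app h i x = app f i x \<ominus>\<^bsub>grp N i\<^esub> app g i x"
proof -
  obtain g' where "g' \<in> Arr C M N" "\<forall>i. \<forall>x\<in>E M i. app g' i x = \<ominus>\<^bsub>grp N i\<^esub> app g i x"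
    using neg_arr assms by blast
  then show ?thesis using that[of "plus_arr C M N f g'"] assms by (simp add: plus_arr app_plus a_minus_def)
qed

lemma category: "category C"
proof
  fix A assume "A \<in> Obj C" then show "idn C A \<in> Arr C A A" by (rule idn_arr)
next
  fix A B D f g assume "A \<in> Obj C" "B \<in> Obj C" "D \<in> Obj C" "f \<in> Arr C A B" "g \<in> Arr C B D"
  then show "cmp C A B D g f \<in> Arr C A D" by (rule cmp_arr)
next
  fix A B f assume "A \<in> Obj C" "B \<in> Obj C" "f \<in> Arr C A B"
  then show "cmp C A A B f (idn C A) = f" "cmp C A B B (idn C B) f = f"
    by (auto intro!: arr_eqI[of A B] simp: cmp_arr idn_arr app_cmp app_idn app_in)
next
  fix A B D E f g h assume "A \<in> Obj C" "B \<in> Obj C" "D \<in> Obj C" "E \<in> Obj C"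
    "f \<in> Arr C A B" "g \<in> Arr C B D" "h \<in> Arr C D E"
  then show "cmp C A D E h (cmp C A B D g f) = cmp C A B E (cmp C B D E h g) f"
    by (intro arr_eqI[of A E]) (simp_all add: cmp_arr app_cmp app_in)
qed

lemma preadditive: "preadditive_category C"
proof (intro preadditive_category.intro[OF category] preadditive_category_axioms.intro)
  fix A B assume o: "A \<in> Obj C" "B \<in> Obj C"
  show "comm_group (hom_group C A B)"
  proof (rule comm_groupI; simp add: hom_group_def)
    show "\<And>x y. x \<in> Arr C A B \<Longrightarrow> y \<in> Arr C A B \<Longrightarrow> plus_arr C A B x y \<in> Arr C A B"
      using plus_arr o by simp
    show "zero_arr C A B \<in> Arr C A B" using zero_arr o by simp
    show "plus_arr C A B (plus_arr C A B x y) z = plus_arr C A B x (plus_arr C A B y z)"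
      if "x \<in> Arr C A B" "y \<in> Arr C A B" "z \<in> Arr C A B" for x y z
      using that o abelian_monoid.a_assoc[OF abelian_group.axioms(1)[OF grp]]
      by (intro arr_eqI[of A B]) (simp_all add: plus_arr app_plus app_in)
    show "plus_arr C A B x y = plus_arr C A B y x"
      if "x \<in> Arr C A B" "y \<in> Arr C A B" for x y
      using that o abelian_monoid.a_comm[OF abelian_group.axioms(1)[OF grp]]
      by (intro arr_eqI[of A B]) (simp_all add: plus_arr app_plus app_in)
    show "plus_arr C A B (zero_arr C A B) x = x"
      if "x \<in> Arr C A B" for x
      using that o abelian_monoid.l_zero[OF abelian_group.axioms(1)[OF grp]]
      by (intro arr_eqI[of A B]) (simp_all add: plus_arr app_plus app_in zero_arr app_zero)
    show "\<exists>y\<in>Arr C A B. plus_arr C A B y x = zero_arr C A B"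
      if x: "x \<in> Arr C A B" for x
    proof -
      obtain y where y: "y \<in> Arr C A B" "\<forall>i. \<forall>z\<in>E A i. app y i z = \<ominus>\<^bsub>grp B i\<^esub> app x i z"
        using neg_arr o x by blast
      have "plus_arr C A B y x = zero_arr C A B"
        using x y o abelian_group.l_neg[OF grp]
        by (intro arr_eqI[of A B]) (simp_all add: plus_arr app_plus app_in zero_arr app_zero)
      then show ?thesis using y by blast
    qed
  qed
next
  fix A B D f f' g assume o: "A \<in> Obj C" "B \<in> Obj C" "D \<in> Obj C" "f \<in> Arr C A B" "f' \<in> Arr C A B" "g \<in> Arr C B D"
  show "cmp C A B D g (plus_arr C A B f f') = plus_arr C A D (cmp C A B D g f) (cmp C A B D g f')"
    using o by (intro arr_eqI[of A D]) (simp_all add: plus_arr cmp_arr app_plus app_cmp app_in app_add)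
next
  fix A B D f g g' assume o: "A \<in> Obj C" "B \<in> Obj C" "D \<in> Obj C" "f \<in> Arr C A B" "g \<in> Arr C B D" "g' \<in> Arr C B D"
  show "cmp C A B D (plus_arr C B D g g') f = plus_arr C A D (cmp C A B D g f) (cmp C A B D g' f)"
    using o by (intro arr_eqI[of A D]) (simp_all add: plus_arr cmp_arr app_plus app_cmp app_in app_add)
qed

lemma inj_on_iff_kernel:
  assumes "M \<in> Obj C" "N \<in> Obj C" "f \<in> Arr C M N"
  shows "inj_on (app f i) (E M i) \<longleftrightarrow> (\<forall>x\<in>E M i. app f i x = nul N i \<longrightarrow> x = nul M i)"
proof
  assume "inj_on (app f i) (E M i)"
  then show "\<forall>x\<in>E M i. app f i x = nul N i \<longrightarrow> x = nul M i"
    using app_nul[OF assms] nul_in[OF assms(1)] by (metis inj_onD)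
next
  assume *: "\<forall>x\<in>E M i. app f i x = nul N i \<longrightarrow> x = nul M i"
  show "inj_on (app f i) (E M i)"
  proof (rule inj_onI)
    fix x y assume xy: "x \<in> E M i" "y \<in> E M i" "app f i x = app f i y"
    then have "app f i (x \<ominus>\<^bsub>grp M i\<^esub> y) = nul N i"
      using app_minus[OF assms] minus_eq_nul_iff[OF assms(2)] app_in[OF assms] by metis
    then show "x = y" using * xy minus_eq_nul_iff[OF assms(1)] minus_in[OF assms(1)] by metis
  qed
qed

text \<open>
  Injectivity gives uniqueness of factorisations, \<open>lift\<close> their existence.
\<close>

lemma is_kernelI:
  assumes o: "M \<in> Obj C" "N \<in> Obj C" "f \<in> Arr C M N" "K \<in> Obj C" "j \<in> Arr C K M"
    and inj: "\<And>i. inj_on (app j i) (E K i)"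
    and im: "\<And>i. app j i ` E K i = {x \<in> E M i. app f i x = nul N i}"
  shows "is_kernel C M N f K j"
proof -
  have "\<exists>!h. h \<in> Arr C X K \<and> cmp C X K M j h = g"
    if X: "X \<in> Obj C" "g \<in> Arr C X M" "cmp C X M N f g = zero_arr C X N" for X g
  proof -
    have "app f i (app g i x) = nul N i" if "x \<in> E X i" for i x
      using cmp_eq_zero_iff[OF X(1) o(1,2) X(2) o(3)] X(3) that by simp
    then have "app g i ` E X i \<subseteq> app j i ` E K i" for i
      unfolding im using app_in[OF X(1) o(1) X(2)] by blast
    from lift[OF X(1) o(4,1) X(2) o(5) inj this]
    obtain h where h: "h \<in> Arr C X K" "cmp C X K M j h = g" by (rule bexE)
    have "h' = h" if "h' \<in> Arr C X K" "cmp C X K M j h' = g" for h'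
    proof (rule arr_eqI[OF X(1) o(4) that(1) h(1)])
      fix i x assume x: "x \<in> E X i"
      have "app j i (app h' i x) = app j i (app h i x)"
        using app_cmp[OF X(1) o(4,1) that(1) o(5) x] app_cmp[OF X(1) o(4,1) h(1) o(5) x] that h by simp
      then show "app h' i x = app h i x"
        using inj_onD[OF inj[of i], of "app h' i x" "app h i x"]
          app_in[OF X(1) o(4) that(1) x] app_in[OF X(1) o(4) h(1) x] by simp
    qed
    then show ?thesis using h by blast
  qed
  moreover have "cmp C K M N f j = zero_arr C K N"
  proof -
    have "app f i (app j i x) = nul N i" if "x \<in> E K i" for i x
      using im[of i] that by blast
    then show ?thesis using cmp_eq_zero_iff[OF o(4,1,2,5,3)] by simp
  qed
  ultimately show ?thesis using o unfolding is_kernel_def by blast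
qed

text \<open>
  Surjectivity gives uniqueness of factorisations, \<open>descend\<close> their existence.
\<close>

lemma is_cokernelI:
  assumes o: "M \<in> Obj C" "N \<in> Obj C" "f \<in> Arr C M N" "Q \<in> Obj C" "p \<in> Arr C N Q"
    and sur: "\<And>i. app p i ` E N i = E Q i"
    and ker: "\<And>i. {x \<in> E N i. app p i x = nul Q i} = app f i ` E M i"
  shows "is_cokernel C M N f Q p"
proof -
  have "\<exists>!h. h \<in> Arr C Q X \<and> cmp C N Q X h p = g"
    if X: "X \<in> Obj C" "g \<in> Arr C N X" "cmp C M N X g f = zero_arr C M X" for X g
  proof -
    have "app g i x = nul X i" if "x \<in> E N i" "app p i x = nul Q i" for i x
    proof -
      have "x \<in> app f i ` E M i" unfolding ker[symmetric] using that by simp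
      then obtain y where "y \<in> E M i" "x = app f i y" by (rule imageE)
      then show ?thesis using cmp_eq_zero_iff[OF o(1,2) X(1) o(3) X(2)] X(3) by simp
    qed
    from descend[OF o(2,4) X(1,2) o(5) sur this]
    obtain h where h: "h \<in> Arr C Q X" "cmp C N Q X h p = g" by (rule bexE)
    have "h' = h" if h': "h' \<in> Arr C Q X" "cmp C N Q X h' p = g" for h'
    proof (rule arr_eqI[OF o(4) X(1) h'(1) h(1)])
      fix i x assume "x \<in> E Q i"
      then obtain y where y: "y \<in> E N i" "x = app p i y" using sur by blast
      show "app h' i x = app h i x"
        using app_cmp[OF o(2,4) X(1) o(5) h'(1) y(1)] app_cmp[OF o(2,4) X(1) o(5) h(1) y(1)] h' h y by simp
    qed
    then show ?thesis using h by blast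
  qed
  moreover have "cmp C M N Q p f = zero_arr C M Q"
  proof -
    have "app p i (app f i x) = nul Q i" if "x \<in> E M i" for i x
      using ker[of i] that by blast
    then show ?thesis using cmp_eq_zero_iff[OF o(1,2,4,3,5)] by simp
  qed
  ultimately show ?thesis using o unfolding is_cokernel_def by blast
qed

lemma concrete_kernel:
  assumes "M \<in> Obj C" "N \<in> Obj C" "f \<in> Arr C M N"
  obtains K j where "K \<in> Obj C" "j \<in> Arr C K M" "is_kernel C M N f K j"
    "\<And>i. inj_on (app j i) (E K i)" "\<And>i. app j i ` E K i = {x \<in> E M i. app f i x = nul N i}"
proof -
  obtain K j where K: "K \<in> Obj C" "j \<in> Arr C K M"
    and *: "\<forall>i. inj_on (app j i) (E K i) \<and> app j i ` E K i = {x \<in> E M i. app f i x = nul N i}"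
    using kernel[OF assms] by (elim bexE)
  have inj: "inj_on (app j i) (E K i)" and im: "app j i ` E K i = {x \<in> E M i. app f i x = nul N i}" for i
    using * by simp_all
  show thesis by (rule that[OF K is_kernelI[OF assms K inj im] inj im])
qed

lemma concrete_cokernel:
  assumes "M \<in> Obj C" "N \<in> Obj C" "f \<in> Arr C M N"
  obtains Q p where "Q \<in> Obj C" "p \<in> Arr C N Q" "is_cokernel C M N f Q p"
    "\<And>i. app p i ` E N i = E Q i" "\<And>i. {x \<in> E N i. app p i x = nul Q i} = app f i ` E M i"
proof -
  obtain Q p where Q: "Q \<in> Obj C" "p \<in> Arr C N Q"
    and *: "\<forall>i. app p i ` E N i = E Q i \<and> {x \<in> E N i. app p i x = nul Q i} = app f i ` E M i"
    using cokernel[OF assms] by (elim bexE)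
  have sur: "app p i ` E N i = E Q i" and ker: "{x \<in> E N i. app p i x = nul Q i} = app f i ` E M i" for i
    using * by simp_all
  show thesis by (rule that[OF Q is_cokernelI[OF assms Q sur ker] sur ker])
qed

lemma concrete_product:
  assumes "A \<in> Obj C" "B \<in> Obj C"
  obtains P p q where "P \<in> Obj C" "p \<in> Arr C P A" "q \<in> Arr C P B" "is_product C A B P p q"
    "\<And>i x y. x \<in> E A i \<Longrightarrow> y \<in> E B i \<Longrightarrow> \<exists>z\<in>E P i. app p i z = x \<and> app q i z = y"
    "\<And>i z z'. z \<in> E P i \<Longrightarrow> z' \<in> E P i \<Longrightarrow> app p i z = app p i z' \<Longrightarrow> app q i z = app q i z' \<Longrightarrow> z = z'"
proof -
  obtain P p q where P: "P \<in> Obj C" "p \<in> Arr C P A" "q \<in> Arr C P B"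
    and *: "(\<forall>i. \<forall>x\<in>E A i. \<forall>y\<in>E B i. \<exists>!z. z \<in> E P i \<and> app p i z = x \<and> app q i z = y) \<and>
      (\<forall>X\<in>Obj C. \<forall>f\<in>Arr C X A. \<forall>g\<in>Arr C X B. \<exists>h\<in>Arr C X P. cmp C X P A p h = f \<and> cmp C X P B q h = g)"
    using product[OF assms] by (elim bexE)
  have ex1: "\<exists>!z. z \<in> E P i \<and> app p i z = x \<and> app q i z = y" if "x \<in> E A i" "y \<in> E B i" for i x y
    using * that by simp
  have ex: "\<exists>z\<in>E P i. app p i z = x \<and> app q i z = y" if "x \<in> E A i" "y \<in> E B i" for i x y
    using ex1[OF that] by (elim ex1E) auto
  have pair: "\<exists>h\<in>Arr C X P. cmp C X P A p h = f \<and> cmp C X P B q h = g"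
    if "X \<in> Obj C" "f \<in> Arr C X A" "g \<in> Arr C X B" for X f g
    using * that by simp
  have inj: "z = z'" if "z \<in> E P i" "z' \<in> E P i" "app p i z = app p i z'" "app q i z = app q i z'" for i z z'
    using ex1[OF app_in[OF P(1) assms(1) P(2) that(1)] app_in[OF P(1) assms(2) P(3) that(1)]] that by metis
  have "is_product C A B P p q"
    unfolding is_product_def
  proof (intro conjI ballI P ex_ex1I)
    fix X f g assume X: "X \<in> Obj C" and fg: "f \<in> Arr C X A" "g \<in> Arr C X B"
    show "\<exists>h. h \<in> Arr C X P \<and> cmp C X P A p h = f \<and> cmp C X P B q h = g" using pair[OF X fg] by blast
    fix h h' assume *: "h \<in> Arr C X P \<and> cmp C X P A p h = f \<and> cmp C X P B q h = g"
      "h' \<in> Arr C X P \<and> cmp C X P A p h' = f \<and> cmp C X P B q h' = g"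
    show "h = h'"
    proof (rule arr_eqI[OF X P(1)])
      fix i x assume x: "x \<in> E X i"
      have "app p i (app h i x) = app p i (app h' i x)" "app q i (app h i x) = app q i (app h' i x)"
        using * x X P assms app_cmp[of X P A h p x i] app_cmp[of X P B h q x i]
          app_cmp[of X P A h' p x i] app_cmp[of X P B h' q x i] by simp_all
      then show "app h i x = app h' i x"
        using inj[of "app h i x" i "app h' i x"] app_in[OF X P(1) _ x] * by simp
    qed (use * in auto)
  qed
  show ?thesis by (rule that[OF P \<open>is_product C A B P p q\<close> ex inj])
qed

lemma tor_monoD: "\<lbrakk>tor_mono M N f; x \<in> E M i; app f i x = nul N i\<rbrakk> \<Longrightarrow> tor M i x"
  by (simp add: tor_mono_def)

lemma tor_epiD:
  assumes "tor_epi M N f" "M \<in> Obj C" "N \<in> Obj C" "f \<in> Arr C M N" "Q \<in> Obj C" "r \<in> Arr C N Q"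
    "\<And>j x. x \<in> E M j \<Longrightarrow> app r j (app f j x) = nul Q j" "y \<in> E N i"
  shows "tor Q i (app r i y)"
proof -
  have "cmp C M N Q r f = zero_arr C M Q"
    using assms(7) cmp_eq_zero_iff[OF assms(2,3,5,4,6)] by simp
  then show ?thesis using assms(1,5,6,8) by (simp add: tor_epi_def)
qed

lemma tor_epiI:
  assumes "M \<in> Obj C" "N \<in> Obj C" "f \<in> Arr C M N"
    "\<And>Q r i y. \<lbrakk>Q \<in> Obj C; r \<in> Arr C N Q; \<And>j x. x \<in> E M j \<Longrightarrow> app r j (app f j x) = nul Q j; y \<in> E N i\<rbrakk>
      \<Longrightarrow> tor Q i (app r i y)"
  shows "tor_epi M N f"
  unfolding tor_epi_def
proof (intro ballI impI allI)
  fix Q r i y assume "Q \<in> Obj C" "r \<in> Arr C N Q" "cmp C M N Q r f = zero_arr C M Q" "y \<in> E N i"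
  then show "tor Q i (app r i y)"
    using cmp_eq_zero_iff[OF assms(1,2) _ assms(3), of Q r] by (intro assms(4)) simp_all
qed

text \<open>
  Membership in the inverted class, defined through some kernel and some cokernel, becomes a condition
  on elements. Any kernel is isomorphic to the concrete one, whose elements are those of \<open>X\<close> killed by
  \<open>s\<close>; conversely \<open>tor_extension\<close> along the inclusion makes the concrete kernel a torsion object.
\<close>

lemma serre_weq_iff:
  assumes "X \<in> Obj C" "M \<in> Obj C"
  shows "s \<in> serre_weq C torsion_objects X M \<longleftrightarrow> s \<in> Arr C X M \<and> tor_mono X M s \<and> tor_epi X M s"
proof
  assume "s \<in> serre_weq C torsion_objects X M"
  then obtain K i Q p where s: "s \<in> Arr C X M" and K: "K \<in> torsion_objects" "is_kernel C X M s K i"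
    and Q: "Q \<in> torsion_objects" "is_cokernel C X M s Q p"
    unfolding serre_weq_def by blast
  have Ki: "K \<in> Obj C" "i \<in> Arr C K X" and Qp: "Q \<in> Obj C" "p \<in> Arr C M Q"
    using K Q by (auto simp: is_kernel_def is_cokernel_def)
  have "tor_mono X M s" unfolding tor_mono_def
  proof (intro allI ballI impI)
    fix l x assume x: "x \<in> E X l" "app s l x = nul M l"
    obtain K' j where K': "K' \<in> Obj C" "j \<in> Arr C K' X" "is_kernel C X M s K' j"
      "\<And>i. inj_on (app j i) (E K' i)" "\<And>i. app j i ` E K' i = {x \<in> E X i. app s i x = nul M i}"
      by (rule concrete_kernel[OF assms s]) (rule that)
    obtain h where h: "h \<in> Arr C K' K" "cmp C K' K X i h = j"
      using K(2) K'(1-3) unfolding is_kernel_def by blast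
    obtain y where y: "y \<in> E K' l" "x = app j l y" using x K'(5)[of l] by blast
    have "tor K l (app h l y)" using K(1) app_in[OF K'(1) Ki(1) h(1) y(1)] by (simp add: torsion_objects_def)
    then have "tor X l (app i l (app h l y))" using tor_image[OF Ki(1) assms(1) Ki(2)] app_in[OF K'(1) Ki(1) h(1) y(1)] by simp
    then show "tor X l x" using app_cmp[OF K'(1) Ki(1) assms(1) h(1) Ki(2) y(1)] h y by simp
  qed
  moreover have "tor_epi X M s" unfolding tor_epi_def
  proof (intro allI ballI impI)
    fix R r l y assume R: "R \<in> Obj C" "r \<in> Arr C M R" "cmp C X M R r s = zero_arr C X R" and y: "y \<in> E M l"
    obtain h where h: "h \<in> Arr C Q R" "cmp C M Q R h p = r"
      using Q(2) R unfolding is_cokernel_def by blast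
    have *: "app p l y \<in> E Q l" using app_in assms Qp y by blast
    then have "tor Q l (app p l y)" using Q(1) by (simp add: torsion_objects_def)
    then have "tor R l (app h l (app p l y))" using tor_image[OF Qp(1) R(1) h(1) *] by simp
    then show "tor R l (app r l y)" using app_cmp[OF assms(2) Qp(1) R(1) Qp(2) h(1) y] h by simp
  qed
  ultimately show "s \<in> Arr C X M \<and> tor_mono X M s \<and> tor_epi X M s" using s by blast
next
  assume *: "s \<in> Arr C X M \<and> tor_mono X M s \<and> tor_epi X M s"
  then have s: "s \<in> Arr C X M" by blast
  obtain K j where K: "K \<in> Obj C" "j \<in> Arr C K X" "is_kernel C X M s K j"
      "\<And>i. inj_on (app j i) (E K i)" "\<And>i. app j i ` E K i = {x \<in> E X i. app s i x = nul M i}"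
    by (rule concrete_kernel[OF assms s]) (rule that)
  have "tor K i x" if x: "x \<in> E K i" for i x
  proof (rule tor_extension[OF K(1) assms(1) K(2) x])
    show "tor X i (app j i x)" using * K(5)[of i] x unfolding tor_mono_def by blast
    show "tor K l y" if "y \<in> E K l" "app j l y = nul X l" for l y
      using K(4) inj_on_iff_kernel[OF K(1) assms(1) K(2)] that tor_zero[OF K(1)] by metis
  qed
  then have KT: "K \<in> torsion_objects" using K(1) by (simp add: torsion_objects_def)
  obtain Q p where Q: "Q \<in> Obj C" "p \<in> Arr C M Q" "is_cokernel C X M s Q p"
      "\<And>i. app p i ` E M i = E Q i" "\<And>i. {x \<in> E M i. app p i x = nul Q i} = app s i ` E X i"
    by (rule concrete_cokernel[OF assms s]) (rule that)
  have "tor Q i z" if z: "z \<in> E Q i" for i z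
  proof -
    obtain y where y: "y \<in> E M i" "z = app p i y" using z Q(4)[of i] by blast
    have "app p j (app s j x) = nul Q j" if "x \<in> E X j" for j x
      using Q(5)[of j] that by blast
    then show ?thesis using * y tor_epiD[OF _ assms s Q(1,2)] by simp
  qed
  then have "Q \<in> torsion_objects" using Q(1) by (simp add: torsion_objects_def)
  then show "s \<in> serre_weq C torsion_objects X M"
    using s K(3) KT Q(3) unfolding serre_weq_def by blast
qed

lemma product_pairing:
  assumes "is_product C A B P p q" "X \<in> Obj C" "f \<in> Arr C X A" "g \<in> Arr C X B"
  shows "\<exists>h\<in>Arr C X P. cmp C X P A p h = f \<and> cmp C X P B q h = g"
proof -
  have "\<exists>!h. h \<in> Arr C X P \<and> cmp C X P A p h = f \<and> cmp C X P B q h = g"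
    using assms(1) assms(2-) unfolding is_product_def by simp
  then show ?thesis by blast
qed

text \<open>
  Map \<open>Z\<close> into the product of \<open>A\<close> and \<open>B\<close>. The image of \<open>z\<close> is the sum of its two torsion
  coordinates, and the kernel of the map is zero, so \<open>tor_extension\<close> applies.
\<close>

lemma tor_jointly:
  assumes o: "Z \<in> Obj C" "A \<in> Obj C" "B \<in> Obj C" "p \<in> Arr C Z A" "q \<in> Arr C Z B"
    and inj: "\<And>i z. z \<in> E Z i \<Longrightarrow> app p i z = nul A i \<Longrightarrow> app q i z = nul B i \<Longrightarrow> z = nul Z i"
    and z: "z \<in> E Z i" "tor A i (app p i z)" "tor B i (app q i z)"
  shows "tor Z i z"
proof -
  obtain P a b where P: "P \<in> Obj C" "a \<in> Arr C P A" "b \<in> Arr C P B" and prod: "is_product C A B P a b"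
    and ex: "\<And>i x y. x \<in> E A i \<Longrightarrow> y \<in> E B i \<Longrightarrow> \<exists>z\<in>E P i. app a i z = x \<and> app b i z = y"
    and un: "\<And>i z z'. z \<in> E P i \<Longrightarrow> z' \<in> E P i \<Longrightarrow> app a i z = app a i z' \<Longrightarrow> app b i z = app b i z' \<Longrightarrow> z = z'"
    by (rule concrete_product[OF o(2,3)]) (rule that)
  obtain h where h: "h \<in> Arr C Z P" "cmp C Z P A a h = p" "cmp C Z P B b h = q"
    using product_pairing[OF prod o(1,4,5)] by metis
  obtain k where k: "k \<in> Arr C A P" "cmp C A P A a k = idn C A" "cmp C A P B b k = zero_arr C A B"
    using product_pairing[OF prod o(2) idn_arr[OF o(2)] zero_arr[OF o(2,3)]] by metis
  obtain l where l: "l \<in> Arr C B P" "cmp C B P A a l = zero_arr C B A" "cmp C B P B b l = idn C B"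
    using product_pairing[OF prod o(3) zero_arr[OF o(3,2)] idn_arr[OF o(3)]] by metis
  note [simp] = o P h(1) k(1) l(1)
  have ah: "app a i (app h i z) = app p i z" "app b i (app h i z) = app q i z" if "z \<in> E Z i" for i z
    using that h app_cmp[of Z P A h a z i] app_cmp[of Z P B h b z i] by simp_all
  have ak: "app a i (app k i x) = x" "app b i (app k i x) = nul B i" if "x \<in> E A i" for i x
    using that k app_cmp[of A P A k a x i] app_cmp[of A P B k b x i] by (simp_all add: app_idn app_zero)
  have al: "app a i (app l i x) = nul A i" "app b i (app l i x) = x" if "x \<in> E B i" for i x
    using that l app_cmp[of B P A l a x i] app_cmp[of B P B l b x i] by (simp_all add: app_idn app_zero)
  interpret A: abelian_group "grp A i" by (simp add: grp)
  interpret B: abelian_group "grp B i" by (simp add: grp)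
  interpret P: abelian_group "grp P i" by (simp add: grp)
  have pz: "app p i z \<in> E A i" "app q i z \<in> E B i" using app_in z o by blast+
  then have in1: "app k i (app p i z) \<in> E P i" "app l i (app q i z) \<in> E P i" by (simp_all add: app_in[of A P k] app_in[of B P l])
  have "app h i z = app k i (app p i z) \<oplus>\<^bsub>grp P i\<^esub> app l i (app q i z)"
    by (rule un[where i = i]) (use z(1) pz in1 in \<open>simp_all add: ah ak al app_in[of Z P h] app_add[of P A a] app_add[of P B b] P.a_closed\<close>)
  then have "tor P i (app h i z)"
    using tor_add[OF P(1) in1] tor_image[of A P k] tor_image[of B P l] pz z by simp
  then show ?thesis
  proof (rule tor_extension[OF o(1) P(1) h(1) z(1)])
    fix j y assume y: "y \<in> E Z j" "app h j y = nul P j"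
    then have "y = nul Z j" using inj[OF y(1)] ah[OF y(1)] by (simp add: app_nul[of P A a] app_nul[of P B b])
    then show "tor Z j y" by (simp add: tor_zero)
  qed
qed

lemma image_of_pair:
  assumes o: "M \<in> Obj C" "P \<in> Obj C" "R \<in> Obj C" "p \<in> Arr C M P" "r \<in> Arr C M R"
  obtains I e p' r' where "I \<in> Obj C" "e \<in> Arr C M I" "p' \<in> Arr C I P" "r' \<in> Arr C I R"
    "cmp C M I P p' e = p" "cmp C M I R r' e = r" "\<And>i. app e i ` E M i = E I i"
    "\<And>i z. z \<in> E I i \<Longrightarrow> app p' i z = nul P i \<Longrightarrow> app r' i z = nul R i \<Longrightarrow> z = nul I i"
proof -
  obtain B a b where B: "B \<in> Obj C" "a \<in> Arr C B P" "b \<in> Arr C B R" and prod: "is_product C P R B a b"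
    and ex: "\<And>i x y. x \<in> E P i \<Longrightarrow> y \<in> E R i \<Longrightarrow> \<exists>z\<in>E B i. app a i z = x \<and> app b i z = y"
    and un: "\<And>i z z'. z \<in> E B i \<Longrightarrow> z' \<in> E B i \<Longrightarrow> app a i z = app a i z' \<Longrightarrow> app b i z = app b i z' \<Longrightarrow> z = z'"
    by (rule concrete_product[OF o(2,3)]) (rule that)
  obtain h where h: "h \<in> Arr C M B" "cmp C M B P a h = p" "cmp C M B R b h = r"
    using product_pairing[OF prod o(1,4,5)] by metis
  note [simp] = o B h(1)
  have ah: "app a i (app h i z) = app p i z" "app b i (app h i z) = app r i z" if "z \<in> E M i" for i z
    using that h app_cmp[of M B P h a z i] app_cmp[of M B R h b z i] by simp_all
  obtain K j where K: "K \<in> Obj C" "j \<in> Arr C K M" "is_kernel C M B h K j"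
      "\<And>i. inj_on (app j i) (E K i)" "\<And>i. app j i ` E K i = {x \<in> E M i. app h i x = nul B i}"
    by (rule concrete_kernel[OF o(1) B(1) h(1)]) (rule that)
  obtain I e where I: "I \<in> Obj C" "e \<in> Arr C M I" "is_cokernel C K M j I e"
      "\<And>i. app e i ` E M i = E I i" "\<And>i. {x \<in> E M i. app e i x = nul I i} = app j i ` E K i"
    by (rule concrete_cokernel[OF K(1) o(1) K(2)]) (rule that)
  have ke: "app e i x = nul I i \<longleftrightarrow> app h i x = nul B i" if "x \<in> E M i" for i x
    using I(5)[of i] K(5)[of i] that by blast
  have "app p i x = nul P i" "app r i x = nul R i" if "x \<in> E M i" "app e i x = nul I i" for i x
    using that ke ah[OF that(1)] by (simp_all add: app_nul[of B P a] app_nul[of B R b])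
  then have "\<exists>h\<in>Arr C I P. cmp C M I P h e = p" "\<exists>h\<in>Arr C I R. cmp C M I R h e = r"
    by (auto intro!: descend[OF o(1) I(1) o(2,4) I(2,4)] descend[OF o(1) I(1) o(3,5) I(2,4)])
  then obtain p' r' where p': "p' \<in> Arr C I P" "cmp C M I P p' e = p" and r': "r' \<in> Arr C I R" "cmp C M I R r' e = r"
    by blast
  have "z = nul I i" if z: "z \<in> E I i" "app p' i z = nul P i" "app r' i z = nul R i" for i z
  proof -
    obtain x where x: "x \<in> E M i" "z = app e i x" using z I(4)[of i] by blast
    then have "app p i x = nul P i" "app r i x = nul R i"
      using p' r' z I app_cmp[of M I P e p' x i] app_cmp[of M I R e r' x i] by simp_all
    then have "app h i x = nul B i"
      by - (rule un[where i = i], use x in \<open>simp_all add: app_nul[of B P a] app_nul[of B R b] nul_in ah app_in[of M B h]\<close>)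
    then show ?thesis using x ke by simp
  qed
  then show ?thesis by (rule that[OF I(1,2) p'(1) r'(1) p'(2) r'(2) I(4)])
qed

text \<open>
  An element that is torsion for \<open>p\<close> is torsion for \<open>r\<close> as soon as this holds for the elements killed by
  \<open>p\<close>. This is immediate from \<open>tor_extension\<close> when \<open>p\<close> and \<open>r\<close> come from a subobject of \<open>P \<times> R\<close>: there
  an element with vanishing first coordinate is torsion because its second coordinate is. The general
  case is reduced to this one by passing to the image of \<open>M\<close> in \<open>P \<times> R\<close>.
\<close>

lemma tor_transfer:
  assumes o: "M \<in> Obj C" "P \<in> Obj C" "R \<in> Obj C" "p \<in> Arr C M P" "r \<in> Arr C M R"
    and ker: "\<And>i y. y \<in> E M i \<Longrightarrow> app p i y = nul P i \<Longrightarrow> tor R i (app r i y)"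
    and x: "x \<in> E M i" "tor P i (app p i x)"
  shows "tor R i (app r i x)"
proof -
  obtain I e p' r' where I: "I \<in> Obj C" "e \<in> Arr C M I" "p' \<in> Arr C I P" "r' \<in> Arr C I R"
    "cmp C M I P p' e = p" "cmp C M I R r' e = r" "\<And>i. app e i ` E M i = E I i"
    "\<And>i z. z \<in> E I i \<Longrightarrow> app p' i z = nul P i \<Longrightarrow> app r' i z = nul R i \<Longrightarrow> z = nul I i"
    by (rule image_of_pair[OF o]) (rule that)
  note [simp] = o I(1-4)
  have pe: "app p' i (app e i y) = app p i y" "app r' i (app e i y) = app r i y" if "y \<in> E M i" for i y
    using that I(5,6) app_cmp[of M I P e p' y i] app_cmp[of M I R e r' y i] by simp_all
  have e: "app e i x \<in> E I i" using x by (simp add: app_in[of M I e])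
  have "tor I i (app e i x)"
  proof (rule tor_extension[OF I(1) o(2) I(3) e])
    show "tor P i (app p' i (app e i x))" using x pe by simp
    fix j z assume z: "z \<in> E I j" "app p' j z = nul P j"
    then obtain y where y: "y \<in> E M j" "z = app e j y" using I(7)[of j] by blast
    then have "tor R j (app r' j z)" using ker[of y j] z pe[OF y(1)] by simp
    then show "tor I j z" using tor_jointly[OF I(1) o(2,3) I(3,4) I(8) z(1)] z tor_zero[OF o(2)] by metis
  qed
  then show ?thesis using tor_image[OF I(1) o(3) I(4) e] x pe by simp
qed

end

section \<open>The inverted arrows admit right fractions\<close>

context element_category begin

lemma tor_epi_cmp:
  assumes o: "X \<in> Obj C" "Y \<in> Obj C" "Z \<in> Obj C" "u \<in> Arr C X Y" "v \<in> Arr C Y Z"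
    and e: "tor_epi X Y u" "tor_epi Y Z v"
  shows "tor_epi X Z (cmp C X Y Z v u)"
proof (rule tor_epiI[OF o(1,3) cmp_arr[OF o]])
  fix R r i z assume R: "R \<in> Obj C" "r \<in> Arr C Z R"
    and 0: "\<And>j x. x \<in> E X j \<Longrightarrow> app r j (app (cmp C X Y Z v u) j x) = nul R j" and z: "z \<in> E Z i"
  have rv: "cmp C Y Z R r v \<in> Arr C Y R" using o R by (simp add: cmp_arr)
  have 1: "tor R j (app (cmp C Y Z R r v) j y)" if "y \<in> E Y j" for j y
    by (rule tor_epiD[OF e(1) o(1,2,4) R(1) rv _ that])
      (use o R 0 app_in[OF o(1,2,4)] in \<open>simp add: app_cmp\<close>)
  obtain Q q where Q: "Q \<in> Obj C" "q \<in> Arr C R Q" "is_cokernel C Y R (cmp C Y Z R r v) Q q"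
    "\<And>i. app q i ` E R i = E Q i" "\<And>i. {x \<in> E R i. app q i x = nul Q i} = app (cmp C Y Z R r v) i ` E Y i"
    by (rule concrete_cokernel[OF o(2) R(1) rv]) (rule that)
  have qr: "cmp C Z R Q q r \<in> Arr C Z Q" using o R Q by (simp add: cmp_arr)
  have "app (cmp C Z R Q q r) j (app v j y) = nul Q j" if "y \<in> E Y j" for j y
  proof -
    have "app (cmp C Y Z R r v) j y \<in> {x \<in> E R j. app q j x = nul Q j}"
      unfolding Q(5) using that by blast
    then show ?thesis using that o R Q(1,2) app_in[OF o(2,3,5)] by (simp add: app_cmp)
  qed
  then have "tor Q i (app (cmp C Z R Q q r) i z)"
    by (rule tor_epiD[OF e(2) o(2,3,5) Q(1) qr _ z])
  then have qz: "tor Q i (app q i (app r i z))" using z o R Q(1,2) by (simp add: app_cmp)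
  show "tor R i (app r i z)"
  proof (rule tor_extension[OF R(1) Q(1,2) app_in[OF o(3) R z] qz])
    fix j y assume "y \<in> E R j" "app q j y = nul Q j"
    then have "y \<in> app (cmp C Y Z R r v) j ` E Y j" unfolding Q(5)[symmetric] by simp
    then show "tor R j y" using 1 by blast
  qed
qed

lemma tor_mono_cmp:
  assumes o: "X \<in> Obj C" "Y \<in> Obj C" "Z \<in> Obj C" "u \<in> Arr C X Y" "v \<in> Arr C Y Z"
    and e: "tor_mono X Y u" "tor_mono Y Z v"
  shows "tor_mono X Z (cmp C X Y Z v u)"
  unfolding tor_mono_def
proof (intro allI ballI impI)
  fix i x assume x: "x \<in> E X i" "app (cmp C X Y Z v u) i x = nul Z i"
  then have *: "tor Y i (app u i x)"
    using o by (intro tor_monoD[OF e(2)]) (simp_all add: app_cmp app_in[of X Y u])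
  show "tor X i x"
    by (rule tor_extension[OF o(1,2,4) x(1) *]) (rule tor_monoD[OF e(1)])
qed

lemma tor_mono_right:
  assumes o: "X \<in> Obj C" "Y \<in> Obj C" "Z \<in> Obj C" "u \<in> Arr C X Y" "v \<in> Arr C Y Z"
    and e: "tor_mono X Z (cmp C X Y Z v u)"
  shows "tor_mono X Y u"
  unfolding tor_mono_def
  using o by (auto intro!: tor_monoD[OF e] simp: app_cmp app_nul[of Y Z v])

lemma tor_epi_left:
  assumes o: "X \<in> Obj C" "Y \<in> Obj C" "Z \<in> Obj C" "u \<in> Arr C X Y" "v \<in> Arr C Y Z"
    and e: "tor_epi X Z (cmp C X Y Z v u)"
  shows "tor_epi Y Z v"
proof (rule tor_epiI[OF o(2,3,5)])
  fix R r i z assume R: "R \<in> Obj C" "r \<in> Arr C Z R"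
    and 0: "\<And>j y. y \<in> E Y j \<Longrightarrow> app r j (app v j y) = nul R j" and z: "z \<in> E Z i"
  show "tor R i (app r i z)"
    by (rule tor_epiD[OF e o(1,3) cmp_arr[OF o] R _ z]) (simp add: app_cmp[OF o] 0 app_in[OF o(1,2,4)])
qed

lemma tor_epi_surj:
  assumes o: "X \<in> Obj C" "Y \<in> Obj C" "f \<in> Arr C X Y" and "\<And>i. app f i ` E X i = E Y i"
  shows "tor_epi X Y f"
proof (rule tor_epiI[OF o])
  fix R r i y assume R: "R \<in> Obj C" "r \<in> Arr C Y R"
    and 0: "\<And>j x. x \<in> E X j \<Longrightarrow> app r j (app f j x) = nul R j" and y: "y \<in> E Y i"
  obtain x where "x \<in> E X i" "y = app f i x" using y assms(4)[of i] by blast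
  then show "tor R i (app r i y)" using 0 R tor_zero by simp
qed

lemma tor_mono_inj:
  assumes o: "X \<in> Obj C" "Y \<in> Obj C" "f \<in> Arr C X Y" and "\<And>i. inj_on (app f i) (E X i)"
  shows "tor_mono X Y f"
  unfolding tor_mono_def using assms inj_on_iff_kernel[OF o] tor_zero[OF o(1)] by metis

text \<open>
  The left cancellation law of the calculus, on the epimorphic side. Let \<open>r\<close> vanish on the image of \<open>u\<close>,
  and let \<open>q\<close> be the cokernel of \<open>s\<close> restricted to the kernel of \<open>r\<close>. Then \<open>q\<close> vanishes on the image of
  \<open>s \<circ> u\<close>, so \<open>q \<circ> s\<close> has torsion values. An element killed by \<open>q \<circ> s\<close> differs from one of the kernel of
  \<open>r\<close> by an element killed by \<open>s\<close>, which is torsion; so \<open>tor_transfer\<close> carries torsion from \<open>q \<circ> s\<close> to \<open>r\<close>.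
\<close>

lemma tor_epi_cancel:
  assumes o: "Z \<in> Obj C" "X \<in> Obj C" "M \<in> Obj C" "u \<in> Arr C Z X" "s \<in> Arr C X M"
    and e: "tor_mono X M s" "tor_epi Z M (cmp C Z X M s u)"
  shows "tor_epi Z X u"
proof (rule tor_epiI[OF o(1,2,4)])
  fix R r i x assume R: "R \<in> Obj C" "r \<in> Arr C X R"
    and 0: "\<And>j z. z \<in> E Z j \<Longrightarrow> app r j (app u j z) = nul R j" and x: "x \<in> E X i"
  obtain K k where K: "K \<in> Obj C" "k \<in> Arr C K X" "is_kernel C X R r K k"
      "\<And>i. inj_on (app k i) (E K i)" "\<And>i. app k i ` E K i = {x \<in> E X i. app r i x = nul R i}"
    by (rule concrete_kernel[OF o(2) R]) (rule that)
  have sk: "cmp C K X M s k \<in> Arr C K M" using o K(1,2) by (simp add: cmp_arr)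
  obtain Q q where Q: "Q \<in> Obj C" "q \<in> Arr C M Q" "is_cokernel C K M (cmp C K X M s k) Q q"
    "\<And>i. app q i ` E M i = E Q i" "\<And>i. {x \<in> E M i. app q i x = nul Q i} = app (cmp C K X M s k) i ` E K i"
    by (rule concrete_cokernel[OF K(1) o(3) sk]) (rule that)
  have qs: "cmp C X M Q q s \<in> Arr C X Q" using o Q(1,2) by (simp add: cmp_arr)
  have "tor Q i (app q i (app s i x))"
  proof (rule tor_epiD[OF e(2) o(1,3) cmp_arr[OF o] Q(1,2)])
    show "app s i x \<in> E M i" by (rule app_in[OF o(2,3,5) x])
    fix j z assume z: "z \<in> E Z j"
    have "app u j z \<in> {x \<in> E X j. app r j x = nul R j}" using 0[OF z] app_in[OF o(1,2,4) z] by simp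
    then obtain w where w: "w \<in> E K j" "app u j z = app k j w" unfolding K(5)[symmetric] by blast
    have "app (cmp C K X M s k) j w \<in> {x \<in> E M j. app q j x = nul Q j}"
      unfolding Q(5) using w(1) by blast
    then show "app q j (app (cmp C Z X M s u) j z) = nul Q j"
      using z w o K(1,2) by (simp add: app_cmp)
  qed
  then have px: "tor Q i (app (cmp C X M Q q s) i x)" using x o Q(1,2) by (simp add: app_cmp)
  show "tor R i (app r i x)"
  proof (rule tor_transfer[OF o(2) Q(1) R(1) qs R(2) _ x px])
    fix j y assume y: "y \<in> E X j" "app (cmp C X M Q q s) j y = nul Q j"
    then have "app s j y \<in> {x \<in> E M j. app q j x = nul Q j}"
      using o Q(1,2) app_in[OF o(2,3,5)] by (simp add: app_cmp)
    then obtain w where w: "w \<in> E K j" "app s j y = app (cmp C K X M s k) j w" unfolding Q(5) by blast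
    have kw: "app k j w \<in> E X j" "app r j (app k j w) = nul R j" using K(5)[of j] w(1) by blast+
    have "app s j (y \<ominus>\<^bsub>grp X j\<^esub> app k j w) = nul M j"
      using app_minus[OF o(2,3,5) y(1) kw(1)] w o K(1,2) minus_eq_nul_iff[OF o(3)] app_in[OF o(2,3,5)] kw(1)
      by (simp add: app_cmp)
    then have "tor X j (y \<ominus>\<^bsub>grp X j\<^esub> app k j w)"
      using tor_monoD[OF e(1) minus_in[OF o(2) y(1) kw(1)]] by simp
    then have "tor R j (app r j (y \<ominus>\<^bsub>grp X j\<^esub> app k j w))"
      using tor_image[OF o(2) R minus_in[OF o(2) y(1) kw(1)]] by simp
    moreover have "app r j (y \<ominus>\<^bsub>grp X j\<^esub> app k j w) = app r j y"
    proof -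
      interpret R: abelian_group "grp R j" using R grp by simp
      show ?thesis using app_minus[OF o(2) R y(1) kw(1)] kw(2) app_in[OF o(2) R y(1)]
        by (simp add: a_minus_def R.add.inv_one)
    qed
    ultimately show "tor R j (app r j y)" by simp
  qed
qed

text \<open>
  The kernel of the difference of the two composites on the product.
\<close>

lemma concrete_pullback:
  assumes o: "X \<in> Obj C" "Y \<in> Obj C" "N \<in> Obj C" "f \<in> Arr C X N" "t \<in> Arr C Y N"
  obtains Z a b where "Z \<in> Obj C" "a \<in> Arr C Z X" "b \<in> Arr C Z Y" "cmp C Z X N f a = cmp C Z Y N t b"
    "\<And>i x y. x \<in> E X i \<Longrightarrow> y \<in> E Y i \<Longrightarrow> app f i x = app t i y \<Longrightarrow> \<exists>z\<in>E Z i. app a i z = x \<and> app b i z = y"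
    "\<And>i z. z \<in> E Z i \<Longrightarrow> app a i z = nul X i \<Longrightarrow> app b i z = nul Y i \<Longrightarrow> z = nul Z i"
proof -
  obtain P p q where P: "P \<in> Obj C" "p \<in> Arr C P X" "q \<in> Arr C P Y" and prod: "is_product C X Y P p q"
    and ex: "\<And>i x y. x \<in> E X i \<Longrightarrow> y \<in> E Y i \<Longrightarrow> \<exists>z\<in>E P i. app p i z = x \<and> app q i z = y"
    and un: "\<And>i z z'. z \<in> E P i \<Longrightarrow> z' \<in> E P i \<Longrightarrow> app p i z = app p i z' \<Longrightarrow> app q i z = app q i z' \<Longrightarrow> z = z'"
    by (rule concrete_product[OF o(1,2)]) (rule that)
  have fp: "cmp C P X N f p \<in> Arr C P N" "cmp C P Y N t q \<in> Arr C P N" using o P by (simp_all add: cmp_arr)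
  obtain h where h: "h \<in> Arr C P N"
    "\<And>i x. x \<in> E P i \<Longrightarrow> app h i x = app (cmp C P X N f p) i x \<ominus>\<^bsub>grp N i\<^esub> app (cmp C P Y N t q) i x"
    by (rule minus_arr[OF P(1) o(3) fp]) (rule that)
  have h0: "app h i z = nul N i \<longleftrightarrow> app f i (app p i z) = app t i (app q i z)" if "z \<in> E P i" for i z
    using h(2)[OF that] minus_eq_nul_iff[OF o(3)] app_in[OF P(1) o(3) fp(1) that] app_in[OF P(1) o(3) fp(2) that]
      that o P by (simp add: app_cmp)
  obtain Z j where Z: "Z \<in> Obj C" "j \<in> Arr C Z P" "is_kernel C P N h Z j"
      "\<And>i. inj_on (app j i) (E Z i)" "\<And>i. app j i ` E Z i = {x \<in> E P i. app h i x = nul N i}"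
    by (rule concrete_kernel[OF P(1) o(3) h(1)]) (rule that)
  have hj: "app j i z \<in> E P i" "app h i (app j i z) = nul N i" if "z \<in> E Z i" for i z
    using Z(5)[of i] that by blast+
  show thesis
  proof (rule that[of Z "cmp C Z P X p j" "cmp C Z P Y q j"])
    show "cmp C Z X N f (cmp C Z P X p j) = cmp C Z Y N t (cmp C Z P Y q j)"
    proof (rule arr_eqI[OF Z(1) o(3)])
      fix i z assume z: "z \<in> E Z i"
      have "app f i (app p i (app j i z)) = app t i (app q i (app j i z))"
        using h0[OF hj(1)[OF z]] hj(2)[OF z] by simp
      then show "app (cmp C Z X N f (cmp C Z P X p j)) i z = app (cmp C Z Y N t (cmp C Z P Y q j)) i z"
        using o P Z(1,2) z by (simp add: cmp_arr app_cmp)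
    qed (use o P Z(1,2) in \<open>simp_all add: cmp_arr\<close>)
  next
    fix i x y assume xy: "x \<in> E X i" "y \<in> E Y i" "app f i x = app t i y"
    obtain w where w: "w \<in> E P i" "app p i w = x" "app q i w = y" using ex[OF xy(1,2)] by blast
    then have "w \<in> {x \<in> E P i. app h i x = nul N i}" using h0 xy by simp
    then obtain z where "z \<in> E Z i" "w = app j i z" unfolding Z(5)[symmetric] by blast
    then show "\<exists>z\<in>E Z i. app (cmp C Z P X p j) i z = x \<and> app (cmp C Z P Y q j) i z = y"
      using w app_cmp[OF Z(1) P(1) o(1) Z(2) P(2), of z i] app_cmp[OF Z(1) P(1) o(2) Z(2) P(3), of z i]
      by (intro bexI[of _ z]) simp_all
  next
    fix i z assume z: "z \<in> E Z i" "app (cmp C Z P X p j) i z = nul X i" "app (cmp C Z P Y q j) i z = nul Y i"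
    have "app j i z = nul P i"
      by (rule un[where i = i])
        (use z o P Z(1,2) hj(1)[OF z(1)] in \<open>simp_all add: app_cmp nul_in app_nul[of P X p] app_nul[of P Y q]\<close>)
    then show "z = nul Z i" using inj_on_iff_kernel[OF Z(1) P(1) Z(2)] Z(4) z(1) by blast
  qed (use o P Z(1,2) in \<open>simp_all add: cmp_arr\<close>)
qed

lemma pullback_tor_mono:
  assumes o: "X \<in> Obj C" "Y \<in> Obj C" "N \<in> Obj C" "f \<in> Arr C X N" "t \<in> Arr C Y N"
    and Z: "Z \<in> Obj C" "a \<in> Arr C Z X" "b \<in> Arr C Z Y" "cmp C Z X N f a = cmp C Z Y N t b"
    and inj: "\<And>i z. z \<in> E Z i \<Longrightarrow> app a i z = nul X i \<Longrightarrow> app b i z = nul Y i \<Longrightarrow> z = nul Z i"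
    and t: "tor_mono Y N t"
  shows "tor_mono Z X a"
  unfolding tor_mono_def
proof (intro allI ballI impI)
  fix i z assume z: "z \<in> E Z i" "app a i z = nul X i"
  have "app t i (app b i z) = app (cmp C Z X N f a) i z" using z(1) o Z(1-3) by (simp add: Z(4) app_cmp)
  also have "\<dots> = nul N i" using z app_cmp[OF Z(1) o(1,3) Z(2) o(4) z(1)] app_nul[OF o(1,3,4)] by simp
  finally have tb: "tor Y i (app b i z)" by (rule tor_monoD[OF t app_in[OF Z(1) o(2) Z(3) z(1)]])
  have "tor X i (app a i z)" using z(2) tor_zero[OF o(1)] by simp
  from tor_jointly[OF Z(1) o(1,2) Z(2,3) inj z(1) this tb] show "tor Z i z" .
qed

text \<open>
  Epimorphisms modulo torsion are stable under pullback. The condition on \<open>t\<close> is only asked along \<open>f\<close>: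
  in the proof that monomorphisms of the quotient are kernels, \<open>t\<close> is the numerator of a monomorphism,
  and all that is known is that \<open>f\<close> takes values in its image modulo torsion.
\<close>

lemma pullback_tor_epi:
  assumes o: "X \<in> Obj C" "Y \<in> Obj C" "N \<in> Obj C" "f \<in> Arr C X N" "t \<in> Arr C Y N"
    and Z: "Z \<in> Obj C" "a \<in> Arr C Z X"
    and ex: "\<And>i x y. x \<in> E X i \<Longrightarrow> y \<in> E Y i \<Longrightarrow> app f i x = app t i y \<Longrightarrow> \<exists>z\<in>E Z i. app a i z = x"
    and t: "\<And>Q q i x. \<lbrakk>Q \<in> Obj C; q \<in> Arr C N Q; x \<in> E X i; \<And>j y. y \<in> E Y j \<Longrightarrow> app q j (app t j y) = nul Q j\<rbrakk>
      \<Longrightarrow> tor Q i (app q i (app f i x))"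
  shows "tor_epi Z X a"
proof (rule tor_epiI[OF Z(1) o(1) Z(2)])
  fix R r i x assume R: "R \<in> Obj C" "r \<in> Arr C X R"
    and 0: "\<And>j z. z \<in> E Z j \<Longrightarrow> app r j (app a j z) = nul R j" and x: "x \<in> E X i"
  obtain Q q where Q: "Q \<in> Obj C" "q \<in> Arr C N Q" "is_cokernel C Y N t Q q"
    "\<And>i. app q i ` E N i = E Q i" "\<And>i. {x \<in> E N i. app q i x = nul Q i} = app t i ` E Y i"
    by (rule concrete_cokernel[OF o(2,3,5)]) (rule that)
  have qf: "cmp C X N Q q f \<in> Arr C X Q" using o Q(1,2) by (simp add: cmp_arr)
  have "tor Q i (app q i (app f i x))"
  proof (rule t[OF Q(1,2) x])
    fix j y assume "y \<in> E Y j" 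
    then have "app t j y \<in> {x \<in> E N j. app q j x = nul Q j}" unfolding Q(5) by blast
    then show "app q j (app t j y) = nul Q j" by blast
  qed
  then have px: "tor Q i (app (cmp C X N Q q f) i x)" using x o Q(1,2) by (simp add: app_cmp)
  show "tor R i (app r i x)"
  proof (rule tor_transfer[OF o(1) Q(1) R(1) qf R(2) _ x px])
    fix j y assume y: "y \<in> E X j" "app (cmp C X N Q q f) j y = nul Q j"
    then have "app f j y \<in> {x \<in> E N j. app q j x = nul Q j}"
      using o Q(1,2) app_in[OF o(1,3,4)] by (simp add: app_cmp)
    then obtain w where "w \<in> E Y j" "app f j y = app t j w" unfolding Q(5) by blast
    then obtain z where "z \<in> E Z j" "app a j z = y" using ex[OF y(1)] by blast
    then show "tor R j (app r j y)" using 0 tor_zero[OF R(1)] by metis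
  qed
qed

text \<open>
  If \<open>f\<close> has torsion values, its kernel is all of \<open>X\<close> modulo torsion. So an arrow that vanishes modulo
  torsion vanishes after composition with an inverted arrow, which is the annihilation axiom.
\<close>

lemma kernel_inclusion_weq:
  assumes o: "X \<in> Obj C" "Y \<in> Obj C" "f \<in> Arr C X Y"
    and f: "\<And>i x. x \<in> E X i \<Longrightarrow> tor Y i (app f i x)"
    and K: "K \<in> Obj C" "k \<in> Arr C K X" "\<And>i. inj_on (app k i) (E K i)"
      "\<And>i. app k i ` E K i = {x \<in> E X i. app f i x = nul Y i}"
  shows "k \<in> serre_weq C torsion_objects K X"
proof -
  have "tor_epi K X k"
  proof (rule tor_epiI[OF K(1) o(1) K(2)])
    fix R r i x assume R: "R \<in> Obj C" "r \<in> Arr C X R"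
      and 0: "\<And>j z. z \<in> E K j \<Longrightarrow> app r j (app k j z) = nul R j" and x: "x \<in> E X i"
    show "tor R i (app r i x)"
    proof (rule tor_transfer[OF o(1,2) R(1) o(3) R(2) _ x f[OF x]])
      fix j y assume y: "y \<in> E X j" "app f j y = nul Y j"
      then have "y \<in> app k j ` E K j" unfolding K(4) by simp
      then obtain z where "z \<in> E K j" "y = app k j z" by blast
      then show "tor R j (app r j y)" using 0 tor_zero[OF R(1)] by metis
    qed
  qed
  then show ?thesis using serre_weq_iff[OF K(1) o(1)] K tor_mono_inj[OF K(1) o(1) K(2,3)] by simp
qed

text \<open>
  The Ore condition is satisfied by pullbacks.
\<close>

lemma right_fractions: "right_fractions C torsion_objects"
proof (intro right_fractions.intro[OF preadditive] right_fractions_axioms.intro)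
  fix M assume M: "M \<in> Obj C"
  have "app (idn C M) i ` E M i = E M i" "inj_on (app (idn C M) i) (E M i)" for i
    using M by (simp_all add: app_idn inj_on_def)
  then show "idn C M \<in> serre_weq C torsion_objects M M"
    using M idn_arr[OF M] tor_mono_inj[OF M M idn_arr[OF M]] tor_epi_surj[OF M M idn_arr[OF M]]
    by (simp add: serre_weq_iff)
next
  fix X Y Z u v assume "X \<in> Obj C" "Y \<in> Obj C" "Z \<in> Obj C" "u \<in> serre_weq C torsion_objects X Y"
    "v \<in> serre_weq C torsion_objects Y Z"
  then show "cmp C X Y Z v u \<in> serre_weq C torsion_objects X Z"
    by (simp add: serre_weq_iff cmp_arr tor_mono_cmp tor_epi_cmp)
next
  fix X Y Z u v assume "X \<in> Obj C" "Y \<in> Obj C" "Z \<in> Obj C" "u \<in> Arr C X Y"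
    "v \<in> serre_weq C torsion_objects Y Z" "cmp C X Y Z v u \<in> serre_weq C torsion_objects X Z"
  then show "u \<in> serre_weq C torsion_objects X Y"
    using tor_mono_right[of X Y Z u v] tor_epi_cancel[of X Y Z u v] by (simp add: serre_weq_iff)
next
  fix X Y N f t assume o: "X \<in> Obj C" "Y \<in> Obj C" "N \<in> Obj C" "f \<in> Arr C X N" 
    and t: "t \<in> serre_weq C torsion_objects Y N"
  have t': "t \<in> Arr C Y N" "tor_mono Y N t" "tor_epi Y N t" using t o by (simp_all add: serre_weq_iff)
  obtain Z a b where Z: "Z \<in> Obj C" "a \<in> Arr C Z X" "b \<in> Arr C Z Y" "cmp C Z X N f a = cmp C Z Y N t b"
    "\<And>i x y. x \<in> E X i \<Longrightarrow> y \<in> E Y i \<Longrightarrow> app f i x = app t i y \<Longrightarrow> \<exists>z\<in>E Z i. app a i z = x \<and> app b i z = y"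
    "\<And>i z. z \<in> E Z i \<Longrightarrow> app a i z = nul X i \<Longrightarrow> app b i z = nul Y i \<Longrightarrow> z = nul Z i"
    by (rule concrete_pullback[OF o t'(1)]) (rule that)
  have "tor_epi Z X a"
  proof (rule pullback_tor_epi[OF o t'(1) Z(1,2)])
    show "\<exists>z\<in>E Z i. app a i z = x" if "x \<in> E X i" "y \<in> E Y i" "app f i x = app t i y" for i x y
      using Z(5)[OF that] by blast
    show "tor Q i (app q i (app f i x))"
      if "Q \<in> Obj C" "q \<in> Arr C N Q" "x \<in> E X i" "\<And>j y. y \<in> E Y j \<Longrightarrow> app q j (app t j y) = nul Q j" for Q q i x
      by (rule tor_epiD[OF t'(3) o(2,3) t'(1) that(1,2,4) app_in[OF o(1,3,4) that(3)]])
  qed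
  moreover have "tor_mono Z X a" by (rule pullback_tor_mono[OF o t'(1) Z(1-4) Z(6) t'(2)])
  ultimately have "a \<in> serre_weq C torsion_objects Z X" using Z(1,2) o by (simp add: serre_weq_iff)
  then show "\<exists>Z\<in>Obj C. \<exists>u\<in>serre_weq C torsion_objects Z X. \<exists>v\<in>Arr C Z Y. cmp C Z X N f u = cmp C Z Y N t v"
    using Z(1,3,4) by blast
next
  fix X Y N f t assume o: "X \<in> Obj C" "Y \<in> Obj C" "N \<in> Obj C" "f \<in> Arr C X Y" 
    and t: "t \<in> serre_weq C torsion_objects Y N" and 0: "cmp C X Y N t f = zero_arr C X N"
  have t': "t \<in> Arr C Y N" "tor_mono Y N t" using t o by (simp_all add: serre_weq_iff)
  have f: "tor Y i (app f i x)" if "x \<in> E X i" for i x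
    using 0 cmp_eq_zero_iff[OF o t'(1)] that app_in[OF o(1,2,4) that] by (intro tor_monoD[OF t'(2)]) simp_all
  obtain K k where K: "K \<in> Obj C" "k \<in> Arr C K X" "is_kernel C X Y f K k"
      "\<And>i. inj_on (app k i) (E K i)" "\<And>i. app k i ` E K i = {x \<in> E X i. app f i x = nul Y i}"
    by (rule concrete_kernel[OF o(1,2,4)]) (rule that)
  have "k \<in> serre_weq C torsion_objects K X"
    by (rule kernel_inclusion_weq[OF o(1,2,4) f K(1,2,4,5)])
  moreover have "cmp C K X Y f k = zero_arr C K Y" using K(3) by (simp add: is_kernel_def)
  ultimately show "\<exists>Z\<in>Obj C. \<exists>u\<in>serre_weq C torsion_objects Z X. cmp C Z X Y f u = zero_arr C Z Y"
    using K(1) by blast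
qed

end

section \<open>The quotient category is abelian\<close>

context element_category begin

sublocale fr: right_fractions C torsion_objects
  by (rule right_fractions)

abbreviation WE where "WE \<equiv> serre_weq C torsion_objects"
abbreviation quo where "quo \<equiv> serre_quotient C torsion_objects"

lemma weqD:
  assumes "s \<in> WE X M" "X \<in> Obj C" "M \<in> Obj C"
  shows "s \<in> Arr C X M" "tor_mono X M s" "tor_epi X M s"
  using assms serre_weq_iff by simp_all

text \<open>
  If \<open>f\<close> and \<open>g\<close> agree after an inverted refinement, their difference vanishes on its image and
  therefore has torsion values; conversely the kernel of a difference with torsion values is such a
  refinement. From here on equations in the quotient are checked on elements.
\<close>

lemma frac_eq_iff_tor:
  assumes o: "M \<in> Obj C" "N \<in> Obj C" "X \<in> Obj C" and s: "s \<in> WE X M" and f: "f \<in> Arr C X N" and g: "g \<in> Arr C X N"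
  shows "fr.frac M N X s f = fr.frac M N X s g \<longleftrightarrow> (\<forall>i. \<forall>x\<in>E X i. tor N i (app f i x \<ominus>\<^bsub>grp N i\<^esub> app g i x))"
proof -
  obtain d where d: "d \<in> Arr C X N" "\<And>i x. x \<in> E X i \<Longrightarrow> app d i x = app f i x \<ominus>\<^bsub>grp N i\<^esub> app g i x"
    by (rule minus_arr[OF o(3,2) f g]) (rule that)
  have d0: "app d i x = nul N i \<longleftrightarrow> app f i x = app g i x" if "x \<in> E X i" for i x
    using d(2)[OF that] minus_eq_nul_iff[OF o(2) app_in[OF o(3,2) f that] app_in[OF o(3,2) g that]] by simp
  show ?thesis
  proof
    assume "fr.frac M N X s f = fr.frac M N X s g"
    then obtain Z u where u: "Z \<in> Obj C" "u \<in> WE Z X" "cmp C Z X N f u = cmp C Z X N g u"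
      by (rule fr.frac_eq_sameE[OF _ o s f g]) (rule that)
    note u' = weqD[OF u(2,1) o(3)]
    have du: "app d j (app u j z) = nul N j" if z: "z \<in> E Z j" for j z
      using d0[OF app_in[OF u(1) o(3) u'(1) z]] app_cmp[OF u(1) o(3,2) u'(1) f z] app_cmp[OF u(1) o(3,2) u'(1) g z] u(3) by simp
    show "\<forall>i. \<forall>x\<in>E X i. tor N i (app f i x \<ominus>\<^bsub>grp N i\<^esub> app g i x)"
    proof (intro allI ballI)
      fix i x assume x: "x \<in> E X i"
      show "tor N i (app f i x \<ominus>\<^bsub>grp N i\<^esub> app g i x)"
        using tor_epiD[OF u'(3) u(1) o(3) u'(1) o(2) d(1) du x] d(2)[OF x] by simp
    qed
  next
    assume *: "\<forall>i. \<forall>x\<in>E X i. tor N i (app f i x \<ominus>\<^bsub>grp N i\<^esub> app g i x)"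
    then have dt: "tor N i (app d i x)" if "x \<in> E X i" for i x using d(2)[OF that] that by simp
    obtain K k where K: "K \<in> Obj C" "k \<in> Arr C K X" "is_kernel C X N d K k"
      "\<And>i. inj_on (app k i) (E K i)" "\<And>i. app k i ` E K i = {x \<in> E X i. app d i x = nul N i}"
      by (rule concrete_kernel[OF o(3,2) d(1)]) (rule that)
    have k: "k \<in> WE K X"
      by (rule kernel_inclusion_weq[OF o(3,2) d(1) dt K(1,2,4,5)])
    have "cmp C K X N f k = cmp C K X N g k"
    proof (rule arr_eqI[OF K(1) o(2)])
      fix i z assume z: "z \<in> E K i"
      have "app k i z \<in> {x \<in> E X i. app d i x = nul N i}" unfolding K(5)[symmetric] using z by blast
      then have "app f i (app k i z) = app g i (app k i z)" using d0[of "app k i z" i] by simp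
      then show "app (cmp C K X N f k) i z = app (cmp C K X N g k) i z"
        using app_cmp[OF K(1) o(3,2) K(2) f z] app_cmp[OF K(1) o(3,2) K(2) g z] by simp
    qed (use cmp_arr[OF K(1) o(3,2) K(2)] f g in simp_all)
    then show "fr.frac M N X s f = fr.frac M N X s g"
      by (intro fr.frac_eqI[OF o s f o(3) s g K(1) k k]) simp_all
  qed
qed

lemma frac_zero_iff_tor:
  assumes o: "M \<in> Obj C" "N \<in> Obj C" "X \<in> Obj C" and s: "s \<in> WE X M" and f: "f \<in> Arr C X N"
  shows "fr.frac M N X s f = zero_arr quo M N \<longleftrightarrow> (\<forall>i. \<forall>x\<in>E X i. tor N i (app f i x))"
proof -
  have "app f i x \<ominus>\<^bsub>grp N i\<^esub> app (zero_arr C X N) i x = app f i x" if x: "x \<in> E X i" for i x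
  proof -
    interpret N: abelian_group "grp N i" using o grp by simp
    show ?thesis using app_zero[OF o(3,2) x] app_in[OF o(3,2) f x] by (simp add: a_minus_def N.add.inv_one)
  qed
  then show ?thesis
    using frac_eq_iff_tor[OF o s f zero_arr[OF o(3,2)]] fr.zero_frac[OF o s] by simp
qed

text \<open>
  The image of \<open>f\<close> under the localisation functor \<open>C \<rightarrow> C/T\<close>.
\<close>

definition loc :: "'o \<Rightarrow> 'o \<Rightarrow> 'a \<Rightarrow> ('o \<times> 'a \<times> 'a) set" where
  "loc M N f = fr.frac M N M (idn C M) f"

lemma loc_in: "\<lbrakk>M \<in> Obj C; N \<in> Obj C; f \<in> Arr C M N\<rbrakk> \<Longrightarrow> loc M N f \<in> Arr quo M N"
  by (simp add: loc_def fr.frac_in fr.weq_idn)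

lemma cmp_loc_frac:
  assumes "M \<in> Obj C" "N \<in> Obj C" "Q \<in> Obj C" "X \<in> Obj C" "s \<in> WE X M" "f \<in> Arr C X N" "p \<in> Arr C N Q"
  shows "cmp quo M N Q (loc N Q p) (fr.frac M N X s f) = fr.frac M Q X s (cmp C X N Q p f)"
  using fr.cmp_frac_common[of M N Q X N s "idn C N" p f] assms
  by (simp add: loc_def fr.weq_idn fr.cmp_idn_left)

lemma cmp_frac_loc:
  assumes "M \<in> Obj C" "N \<in> Obj C" "L \<in> Obj C" "Y \<in> Obj C" "t \<in> WE Y N" "g \<in> Arr C Y L" "p \<in> Arr C M N"
    "Z \<in> Obj C" "u \<in> WE Z M" "v \<in> Arr C Z Y" "cmp C Z M N p u = cmp C Z Y N t v"
  shows "cmp quo M N L (fr.frac N L Y t g) (loc M N p) = fr.frac M L Z u (cmp C Z Y L g v)"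
  using fr.cmp_frac[of M N L M Y Z "idn C M" p t g u v] assms fr.weq_arr[OF assms(9)]
  by (simp add: loc_def fr.weq_idn fr.cmp_idn_left)

text \<open>
  A surjection stays epimorphic in the quotient. Pulling the common denominator \<open>t\<close> of the two arrows
  back along \<open>p\<close> gives an arrow \<open>v\<close> that is epimorphic modulo torsion, and the difference \<open>d\<close> of the
  numerators has torsion values on its image; dividing out \<open>d \<circ> v\<close> shows that \<open>d\<close> has torsion values
  everywhere.
\<close>

lemma loc_epi:
  assumes o: "N \<in> Obj C" "Q \<in> Obj C" "L \<in> Obj C" "p \<in> Arr C N Q" and sur: "\<And>i. app p i ` E N i = E Q i"
    and \<chi>: "\<chi> \<in> Arr quo Q L" "\<chi>' \<in> Arr quo Q L"
    and eq: "cmp quo N Q L \<chi> (loc N Q p) = cmp quo N Q L \<chi>' (loc N Q p)"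
  shows "\<chi> = \<chi>'"
proof -
  obtain Y t g g' where Y: "Y \<in> Obj C" "t \<in> WE Y Q" "g \<in> Arr C Y L" "g' \<in> Arr C Y L"
    "\<chi> = fr.frac Q L Y t g" "\<chi>' = fr.frac Q L Y t g'"
    by (rule fr.common_denominator2[OF \<chi> o(2,3,3)]) (rule that)
  note t = weqD[OF Y(2,1) o(2)]
  obtain Z u v where Z: "Z \<in> Obj C" "u \<in> WE Z N" "v \<in> Arr C Z Y" "cmp C Z N Q p u = cmp C Z Y Q t v"
    using fr.weq_ore[OF o(1) Y(1) o(2,4) Y(2)] by blast
  note u = weqD[OF Z(2,1) o(1)]
  have tv: "tor_epi Z Q (cmp C Z Y Q t v)"
    unfolding Z(4)[symmetric] by (rule tor_epi_cmp[OF Z(1) o(1,2) u(1) o(4) u(3) tor_epi_surj[OF o(1,2,4) sur]])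
  have v: "tor_epi Z Y v" by (rule tor_epi_cancel[OF Z(1) Y(1) o(2) Z(3) t(1,2) tv])
  have gv: "cmp C Z Y L g v \<in> Arr C Z L" "cmp C Z Y L g' v \<in> Arr C Z L" using cmp_arr Z Y o by simp_all
  have "fr.frac N L Z u (cmp C Z Y L g v) = fr.frac N L Z u (cmp C Z Y L g' v)"
    using eq unfolding Y(5,6)
    using cmp_frac_loc[OF o(1-3) Y(1,2,3) o(4) Z(1-4)] cmp_frac_loc[OF o(1-3) Y(1,2,4) o(4) Z(1-4)] by simp
  then have *: "\<forall>i. \<forall>x\<in>E Z i. tor L i (app (cmp C Z Y L g v) i x \<ominus>\<^bsub>grp L i\<^esub> app (cmp C Z Y L g' v) i x)"
    using frac_eq_iff_tor[OF o(1,3) Z(1,2) gv] by simp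
  have dv: "tor L i (app g i (app v i z) \<ominus>\<^bsub>grp L i\<^esub> app g' i (app v i z))" if z: "z \<in> E Z i" for i z
    using bspec[OF spec[OF *, of i] z] app_cmp[OF Z(1) Y(1) o(3) Z(3) Y(3) z] app_cmp[OF Z(1) Y(1) o(3) Z(3) Y(4) z]
    by simp
  obtain d where d: "d \<in> Arr C Y L" "\<And>i x. x \<in> E Y i \<Longrightarrow> app d i x = app g i x \<ominus>\<^bsub>grp L i\<^esub> app g' i x"
    by (rule minus_arr[OF Y(1) o(3) Y(3,4)]) (rule that)
  have dv': "cmp C Z Y L d v \<in> Arr C Z L" using cmp_arr[OF Z(1) Y(1) o(3) Z(3) d(1)] .
  obtain R q where R: "R \<in> Obj C" "q \<in> Arr C L R" "is_cokernel C Z L (cmp C Z Y L d v) R q"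
    "\<And>i. app q i ` E L i = E R i" "\<And>i. {x \<in> E L i. app q i x = nul R i} = app (cmp C Z Y L d v) i ` E Z i"
    by (rule concrete_cokernel[OF Z(1) o(3) dv']) (rule that)
  have dvz: "app (cmp C Z Y L d v) i z = app d i (app v i z)" if "z \<in> E Z i" for i z
    by (rule app_cmp[OF Z(1) Y(1) o(3) Z(3) d(1) that])
  have qd: "cmp C Y L R q d \<in> Arr C Y R" using cmp_arr[OF Y(1) o(3) R(1) d(1) R(2)] .
  have qd0: "app (cmp C Y L R q d) i (app v i z) = nul R i" if z: "z \<in> E Z i" for i z
  proof -
    have "app (cmp C Z Y L d v) i z \<in> {x \<in> E L i. app q i x = nul R i}" unfolding R(5) using z by blast
    then show ?thesis
      using dvz[OF z] app_cmp[OF Y(1) o(3) R(1) d(1) R(2) app_in[OF Z(1) Y(1) Z(3) z]] by simp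
  qed
  have dt: "tor L i (app d i y)" if y: "y \<in> E Y i" for i y
  proof (rule tor_extension[OF o(3) R(1,2) app_in[OF Y(1) o(3) d(1) y]])
    show "tor R i (app q i (app d i y))"
      using tor_epiD[OF v Z(1) Y(1) Z(3) R(1) qd qd0 y] app_cmp[OF Y(1) o(3) R(1) d(1) R(2) y] by simp
    fix j l assume "l \<in> E L j" "app q j l = nul R j"
    then have "l \<in> app (cmp C Z Y L d v) j ` E Z j" unfolding R(5)[symmetric] by simp
    then obtain z where "z \<in> E Z j" "l = app d j (app v j z)" using dvz by auto
    then show "tor L j l" using dv d(2)[OF app_in[OF Z(1) Y(1) Z(3)]] by simp
  qed
  have "tor L i (app g i y \<ominus>\<^bsub>grp L i\<^esub> app g' i y)" if "y \<in> E Y i" for i y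
    using dt[OF that] d(2)[OF that] by simp
  then show ?thesis unfolding Y(5,6) using frac_eq_iff_tor[OF o(2,3) Y(1-4)] by simp
qed

text \<open>
  The cokernel \<open>p : N \<rightarrow> Q\<close> of the numerator remains a cokernel of the fraction. The difficulty is that
  an arrow \<open>g \<circ> t\<inverse>\<close> killed by the fraction need not vanish on the image of \<open>f\<close>, only on that of a
  refinement \<open>V\<close> of \<open>X\<close>. So \<open>Y\<close> is divided by the image of \<open>V\<close>, through which both \<open>g\<close> and \<open>p \<circ> t\<close>
  descend; it remains to see that the arrow \<open>t1\<close> to \<open>Q\<close> obtained in this way is inverted.
\<close>

lemma cokernel_quot:
  assumes o: "M \<in> Obj C" "N \<in> Obj C" "X \<in> Obj C" and s: "s \<in> WE X M" and f: "f \<in> Arr C X N"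
    and Q: "Q \<in> Obj C" "p \<in> Arr C N Q" "\<And>i. app p i ` E N i = E Q i"
      "\<And>i. {x \<in> E N i. app p i x = nul Q i} = app f i ` E X i"
  shows "is_cokernel quo M N (fr.frac M N X s f) Q (loc N Q p)"
proof -
  have pf: "app p i (app f i x) = nul Q i" if "x \<in> E X i" for i x
  proof -
    have "app f i x \<in> {x \<in> E N i. app p i x = nul Q i}" unfolding Q(4) using that by blast
    then show ?thesis by simp
  qed
  then have "cmp C X N Q p f = zero_arr C X Q" using cmp_eq_zero_iff[OF o(3,2) Q(1) f Q(2)] by simp
  then have z: "cmp quo M N Q (loc N Q p) (fr.frac M N X s f) = zero_arr quo M Q"
    using cmp_loc_frac[OF o(1,2) Q(1) o(3) s f Q(2)] fr.zero_frac[OF o(1) Q(1) o(3) s] by simp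
  have ex: "\<exists>\<chi>. \<chi> \<in> Arr quo Q L \<and> cmp quo N Q L \<chi> (loc N Q p) = \<psi>"
    if L: "L \<in> Obj C" and \<psi>: "\<psi> \<in> Arr quo N L" and 0: "cmp quo M N L \<psi> (fr.frac M N X s f) = zero_arr quo M L" for L \<psi>
  proof -
    obtain Y t g where Y: "Y \<in> Obj C" "t \<in> WE Y N" "g \<in> Arr C Y L" "\<psi> = fr.frac N L Y t g"
      by (rule fr.fracE[OF \<psi>]) (rule that)
    note t = weqD[OF Y(2,1) o(2)]
    obtain Z u v where Z: "Z \<in> Obj C" "u \<in> WE Z X" "v \<in> Arr C Z Y" "cmp C Z X N f u = cmp C Z Y N t v"
      using fr.weq_ore[OF o(3) Y(1) o(2) f Y(2)] by blast
    note u = weqD[OF Z(2,1) o(3)]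
    have su: "cmp C Z X M s u \<in> WE Z M" using fr.weq_cmp[OF Z(1) o(3,1) Z(2) s] .
    have gv: "cmp C Z Y L g v \<in> Arr C Z L" using cmp_arr[OF Z(1) Y(1) L Z(3) Y(3)] .
    have "fr.frac M L Z (cmp C Z X M s u) (cmp C Z Y L g v) = zero_arr quo M L"
      using 0 fr.cmp_frac[OF o(1,2) L o(3) Y(1) Z(1) s f Y(2,3) Z(2,3,4)] unfolding Y(4) by simp
    then obtain V a where V: "V \<in> Obj C" "a \<in> WE V Z" "cmp C V Z L (cmp C Z Y L g v) a = zero_arr C V L"
      by (rule fr.frac_eq_zeroE[OF _ o(1) L Z(1) su gv]) (rule that)
    note a = weqD[OF V(2,1) Z(1)]
    define w where "w = cmp C V Z Y v a"
    define e where "e = cmp C V Z X u a"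
    have w: "w \<in> Arr C V Y" unfolding w_def by (rule cmp_arr[OF V(1) Z(1) Y(1) a(1) Z(3)])
    have eW: "e \<in> WE V X" unfolding e_def by (rule fr.weq_cmp[OF V(1) Z(1) o(3) V(2) Z(2)])
    note e = weqD[OF eW V(1) o(3)]
    have fe: "app f i (app e i z) = app t i (app w i z)" if z: "z \<in> E V i" for i z
    proof -
      have "app f i (app e i z) = app (cmp C Z X N f u) i (app a i z)"
        using z o f V(1) Z(1) a(1) u(1) app_in[OF V(1) Z(1) a(1) z] by (simp add: e_def app_cmp)
      also have "\<dots> = app t i (app w i z)"
        unfolding Z(4) using z o t(1) V(1) Z(1,3) Y(1) a(1) app_in[OF V(1) Z(1) a(1) z] by (simp add: w_def app_cmp)
      finally show ?thesis .
    qed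
    have gw: "app g i (app w i z) = nul L i" if z: "z \<in> E V i" for i z
    proof -
      have "app (cmp C Z Y L g v) i (app a i z) = nul L i"
        using V(3) cmp_eq_zero_iff[OF V(1) Z(1) L a(1) gv] z by simp
      then show ?thesis using z L V(1) Z(1,3) Y(1,3) a(1) app_in[OF V(1) Z(1) a(1) z] by (simp add: w_def app_cmp)
    qed
    \<comment> \<open>\<open>Q1\<close> is \<open>Y\<close> modulo the image of \<open>V\<close>.\<close>
    obtain Q1 p1 where Q1: "Q1 \<in> Obj C" "p1 \<in> Arr C Y Q1" "is_cokernel C V Y w Q1 p1"
      "\<And>i. app p1 i ` E Y i = E Q1 i" "\<And>i. {x \<in> E Y i. app p1 i x = nul Q1 i} = app w i ` E V i"
      by (rule concrete_cokernel[OF V(1) Y(1) w]) (rule that)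
    have ker1: "\<exists>z\<in>E V i. y = app w i z" if "y \<in> E Y i" "app p1 i y = nul Q1 i" for i y
    proof -
      have "y \<in> app w i ` E V i" unfolding Q1(5)[symmetric] using that by simp
      then show ?thesis by blast
    qed
    have p1w: "app p1 i (app w i z) = nul Q1 i" if "z \<in> E V i" for i z
    proof -
      have "app w i z \<in> {x \<in> E Y i. app p1 i x = nul Q1 i}" unfolding Q1(5) using that by blast
      then show ?thesis by simp
    qed
    have "app g i y = nul L i" if "y \<in> E Y i" "app p1 i y = nul Q1 i" for i y
      using ker1[OF that] gw by auto
    from descend[OF Y(1) Q1(1) L Y(3) Q1(2,4) this]
    obtain g1 where g1: "g1 \<in> Arr C Q1 L" "cmp C Y Q1 L g1 p1 = g" by (rule bexE)
    have pt: "cmp C Y N Q p t \<in> Arr C Y Q" by (rule cmp_arr[OF Y(1) o(2) Q(1) t(1) Q(2)])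
    have "app (cmp C Y N Q p t) i y = nul Q i" if y: "y \<in> E Y i" "app p1 i y = nul Q1 i" for i y
    proof -
      obtain z where z: "z \<in> E V i" "y = app w i z" using ker1[OF y] by blast
      then show ?thesis using app_cmp[OF Y(1) o(2) Q(1) t(1) Q(2) y(1)] fe[OF z(1)] pf[OF app_in[OF V(1) o(3) e(1) z(1)]] by simp
    qed
    from descend[OF Y(1) Q1(1) Q(1) pt Q1(2,4) this]
    obtain t1 where t1: "t1 \<in> Arr C Q1 Q" "cmp C Y Q1 Q t1 p1 = cmp C Y N Q p t" by (rule bexE)
    have "tor_epi Q1 Q t1"
    proof (rule tor_epi_left[OF Y(1) Q1(1) Q(1) Q1(2) t1(1)])
      show "tor_epi Y Q (cmp C Y Q1 Q t1 p1)"
        unfolding t1(2) by (rule tor_epi_cmp[OF Y(1) o(2) Q(1) t(1) Q(2) t(3) tor_epi_surj[OF o(2) Q(1-3)]])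
    qed
    moreover have "tor_mono Q1 Q t1"
      unfolding tor_mono_def
    proof (intro allI ballI impI)
      fix i q assume q: "q \<in> E Q1 i" "app t1 i q = nul Q i"
      obtain y where y: "y \<in> E Y i" "q = app p1 i y" using q(1) Q1(4)[of i] by blast
      have "app p i (app t i y) = nul Q i"
        using q(2) app_cmp[OF Y(1) Q1(1) Q(1) Q1(2) t1(1) y(1)] app_cmp[OF Y(1) o(2) Q(1) t(1) Q(2) y(1)] y(2) t1(2) by simp
      then have "app t i y \<in> {x \<in> E N i. app p i x = nul Q i}" using app_in[OF Y(1) o(2) t(1) y(1)] by simp
      then obtain x where x: "x \<in> E X i" "app t i y = app f i x" unfolding Q(4) by blast
      \<comment> \<open>If \<open>p \<circ> t\<close> kills \<open>y\<close>, then \<open>t y = f x\<close>, and \<open>(x, y)\<close> is an element of the pullback \<open>B\<close>. As \<open>V \<rightarrow> X\<close>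
        is inverted, the class of \<open>x\<close> modulo \<open>V\<close> is torsion, and this transfers to the class of \<open>y\<close>.\<close>
      obtain B b c where B: "B \<in> Obj C" "b \<in> Arr C B X" "c \<in> Arr C B Y" "cmp C B X N f b = cmp C B Y N t c"
        "\<And>i x y. x \<in> E X i \<Longrightarrow> y \<in> E Y i \<Longrightarrow> app f i x = app t i y \<Longrightarrow> \<exists>z\<in>E B i. app b i z = x \<and> app c i z = y"
        "\<And>i z. z \<in> E B i \<Longrightarrow> app b i z = nul X i \<Longrightarrow> app c i z = nul Y i \<Longrightarrow> z = nul B i"
        by (rule concrete_pullback[OF o(3) Y(1) o(2) f t(1)]) (rule that)
      obtain z where z: "z \<in> E B i" "app b i z = x" "app c i z = y" using B(5)[OF x(1) y(1) x(2)[symmetric]] by blast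
      obtain R r where R: "R \<in> Obj C" "r \<in> Arr C X R" "is_cokernel C V X e R r"
        "\<And>i. app r i ` E X i = E R i" "\<And>i. {x \<in> E X i. app r i x = nul R i} = app e i ` E V i"
        by (rule concrete_cokernel[OF V(1) o(3) e(1)]) (rule that)
      have re: "app r i (app e i z) = nul R i" if "z \<in> E V i" for i z
      proof -
        have "app e i z \<in> {x \<in> E X i. app r i x = nul R i}" unfolding R(5) using that by blast
        then show ?thesis by simp
      qed
      have rb: "cmp C B X R r b \<in> Arr C B R" by (rule cmp_arr[OF B(1) o(3) R(1) B(2) R(2)])
      have pc: "cmp C B Y Q1 p1 c \<in> Arr C B Q1" by (rule cmp_arr[OF B(1) Y(1) Q1(1) B(3) Q1(2)])
      have trb: "tor R i (app (cmp C B X R r b) i z)"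
        using tor_epiD[OF e(3) V(1) o(3) e(1) R(1,2) re x(1)] app_cmp[OF B(1) o(3) R(1) B(2) R(2) z(1)] z(2) by simp
      have "tor Q1 i (app (cmp C B Y Q1 p1 c) i z)"
      proof (rule tor_transfer[OF B(1) R(1) Q1(1) rb pc _ z(1) trb])
        fix j h assume h: "h \<in> E B j" "app (cmp C B X R r b) j h = nul R j"
        have bh: "app b j h \<in> E X j" and ch: "app c j h \<in> E Y j" using app_in[OF B(1) _ _ h(1)] o(3) Y(1) B(2,3) by simp_all
        have "app b j h \<in> {x \<in> E X j. app r j x = nul R j}"
          using h bh app_cmp[OF B(1) o(3) R(1) B(2) R(2) h(1)] by simp
        then obtain z' where z': "z' \<in> E V j" "app b j h = app e j z'" unfolding R(5) by blast
        have wz: "app w j z' \<in> E Y j" by (rule app_in[OF V(1) Y(1) w z'(1)])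
        have "app t j (app c j h) = app f j (app b j h)"
          using app_cmp[OF B(1) o(3,2) B(2) f h(1)] app_cmp[OF B(1) Y(1) o(2) B(3) t(1) h(1)] B(4) by simp
        then have "app t j (app c j h) = app t j (app w j z')" using z'(2) fe[OF z'(1)] by simp
        then have "app t j (app c j h \<ominus>\<^bsub>grp Y j\<^esub> app w j z') = nul N j"
          using app_minus[OF Y(1) o(2) t(1) ch wz] minus_eq_nul_iff[OF o(2)] app_in[OF Y(1) o(2) t(1) wz] by simp
        then have ty: "tor Y j (app c j h \<ominus>\<^bsub>grp Y j\<^esub> app w j z')"
          by (rule tor_monoD[OF t(2) minus_in[OF Y(1) ch wz]])
        interpret Q1: abelian_group "grp Q1 j" using Q1(1) grp by simp
        have "app p1 j (app c j h \<ominus>\<^bsub>grp Y j\<^esub> app w j z') = app p1 j (app c j h)"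
          using app_minus[OF Y(1) Q1(1,2) ch wz] p1w[OF z'(1)] app_in[OF Y(1) Q1(1,2) ch]
          by (simp add: a_minus_def Q1.add.inv_one)
        then show "tor Q1 j (app (cmp C B Y Q1 p1 c) j h)"
          using tor_image[OF Y(1) Q1(1,2) minus_in[OF Y(1) ch wz] ty] app_cmp[OF B(1) Y(1) Q1(1) B(3) Q1(2) h(1)] by simp
      qed
      then show "tor Q1 i q" using app_cmp[OF B(1) Y(1) Q1(1) B(3) Q1(2) z(1)] z(3) y(2) by simp
    qed
    ultimately have t1W: "t1 \<in> WE Q1 Q" using serre_weq_iff[OF Q1(1) Q(1)] t1(1) by simp
    have "cmp quo N Q L (fr.frac Q L Q1 t1 g1) (loc N Q p) = fr.frac N L Y t (cmp C Y Q1 L g1 p1)"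
      by (rule cmp_frac_loc[OF o(2) Q(1) L Q1(1) t1W g1(1) Q(2) Y(1,2) Q1(2) t1(2)[symmetric]])
    then have "cmp quo N Q L (fr.frac Q L Q1 t1 g1) (loc N Q p) = \<psi>" using g1(2) Y(4) by simp
    moreover have "fr.frac Q L Q1 t1 g1 \<in> Arr quo Q L" by (rule fr.frac_in[OF Q(1) L Q1(1) t1W g1(1)])
    ultimately show ?thesis by blast
  qed
  show ?thesis unfolding is_cokernel_def
  proof (intro conjI ballI impI ex_ex1I)
    show "Q \<in> Obj quo" using Q(1) fr.Obj_quot by blast
    show "loc N Q p \<in> Arr quo N Q" by (rule loc_in[OF o(2) Q(1,2)])
    show "cmp quo M N Q (loc N Q p) (fr.frac M N X s f) = zero_arr quo M Q" by (rule z)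
    fix L \<psi> assume L: "L \<in> Obj quo" and \<psi>: "\<psi> \<in> Arr quo N L" and 0: "cmp quo M N L \<psi> (fr.frac M N X s f) = zero_arr quo M L"
    have L': "L \<in> Obj C" using L by simp
    show "\<exists>h. h \<in> Arr quo Q L \<and> cmp quo N Q L h (loc N Q p) = \<psi>" by (rule ex[OF L' \<psi> 0])
    fix h h' assume hh: "h \<in> Arr quo Q L \<and> cmp quo N Q L h (loc N Q p) = \<psi>" "h' \<in> Arr quo Q L \<and> cmp quo N Q L h' (loc N Q p) = \<psi>"
    show "h = h'" by (rule loc_epi[OF o(2) Q(1) L' Q(2,3)]) (use hh in simp_all)
  qed
qed

end

context element_category begin

lemma zero_arr_quot_in: "\<lbrakk>M \<in> Obj C; N \<in> Obj C\<rbrakk> \<Longrightarrow> zero_arr quo M N \<in> Arr quo M N"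
  by (simp add: fr.zero_frac_idn fr.frac_in fr.weq_idn zero_arr)

text \<open>
  The kernel of the fraction, computed from that of \<open>f\<close>, is zero in the quotient and hence torsion.
\<close>

lemma tor_mono_of_mono:
  assumes o: "M \<in> Obj C" "N \<in> Obj C" "X \<in> Obj C" and s: "s \<in> WE X M" and f: "f \<in> Arr C X N"
    and mono: "is_mono quo M N (fr.frac M N X s f)"
  shows "tor_mono X N f"
proof -
  interpret q: preadditive_category quo by (rule fr.preadditive_quot)
  note s' = weqD[OF s o(3,1)]
  obtain K k where K: "K \<in> Obj C" "k \<in> Arr C K X" "is_kernel C X N f K k"
      "\<And>i. inj_on (app k i) (E K i)" "\<And>i. app k i ` E K i = {x \<in> E X i. app f i x = nul N i}"
    by (rule concrete_kernel[OF o(3,2) f]) (rule that)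
  let ?k = "fr.frac K M K (idn C K) (cmp C K X M s k)"
  have ker: "is_kernel quo M N (fr.frac M N X s f) K ?k"
    by (rule fr.kernel_quot[OF o s f K(3)])
  then have k: "?k \<in> Arr quo K M" "cmp quo K M N (fr.frac M N X s f) ?k = zero_arr quo K N"
    by (simp_all add: is_kernel_def)
  have "cmp quo K M N (fr.frac M N X s f) (zero_arr quo K M) = zero_arr quo K N"
    using q.cmp_zero_right[of K M N] K(1) o fr.frac_in[OF o s f] by simp
  then have "?k = zero_arr quo K M"
    using mono k zero_arr_quot_in[OF K(1) o(1)] K(1) unfolding is_mono_def by simp
  then have *: "\<forall>i. \<forall>x\<in>E K i. tor M i (app (cmp C K X M s k) i x)"
    using frac_zero_iff_tor[OF K(1) o(1) K(1) fr.weq_idn[OF K(1)] cmp_arr[OF K(1) o(3,1) K(2) s'(1)]] by simp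
  show ?thesis unfolding tor_mono_def
  proof (intro allI ballI impI)
    fix i x assume x: "x \<in> E X i" "app f i x = nul N i"
    then have "x \<in> app k i ` E K i" unfolding K(5) by simp
    then obtain z where z: "z \<in> E K i" "x = app k i z" by blast
    have "tor M i (app s i x)" using bspec[OF spec[OF *, of i] z(1)] app_cmp[OF K(1) o(3,1) K(2) s'(1) z(1)] z(2) by simp
    then show "tor X i x" by (rule tor_extension[OF o(3,1) s'(1) x(1)]) (rule tor_monoD[OF s'(2)])
  qed
qed

text \<open>
  An arrow vanishing on the image of \<open>f\<close> is zero in the quotient, hence has torsion values.
\<close>

lemma tor_epi_of_epi:
  assumes o: "M \<in> Obj C" "N \<in> Obj C" "X \<in> Obj C" and s: "s \<in> WE X M" and f: "f \<in> Arr C X N"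
    and epi: "is_epi quo M N (fr.frac M N X s f)"
  shows "tor_epi X N f"
proof (rule tor_epiI[OF o(3,2) f])
  fix Q r i y assume r: "Q \<in> Obj C" "r \<in> Arr C N Q" and 0: "\<And>j x. x \<in> E X j \<Longrightarrow> app r j (app f j x) = nul Q j"
    and y: "y \<in> E N i"
  interpret q: preadditive_category quo by (rule fr.preadditive_quot)
  have "cmp C X N Q r f = zero_arr C X Q" using 0 cmp_eq_zero_iff[OF o(3,2) r(1) f r(2)] by simp
  then have "cmp quo M N Q (loc N Q r) (fr.frac M N X s f) = zero_arr quo M Q"
    using cmp_loc_frac[OF o(1,2) r(1) o(3) s f r(2)] fr.zero_frac[OF o(1) r(1) o(3) s] by simp
  moreover have "cmp quo M N Q (zero_arr quo N Q) (fr.frac M N X s f) = zero_arr quo M Q"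
    using q.cmp_zero_left[of M N Q] o r(1) fr.frac_in[OF o s f] by simp
  ultimately have "loc N Q r = zero_arr quo N Q"
    using epi loc_in[OF o(2) r] zero_arr_quot_in[OF o(2) r(1)] r(1) unfolding is_epi_def by simp
  then have "\<forall>i. \<forall>x\<in>E N i. tor Q i (app r i x)"
    using frac_zero_iff_tor[OF o(2) r(1) o(2) fr.weq_idn[OF o(2)] r(2)] by (simp add: loc_def)
  then show "tor Q i (app r i y)" using y by blast
qed

text \<open>
  A monomorphism \<open>f \<circ> s\<inverse>\<close> is a kernel of its cokernel \<open>p\<close>. If \<open>p\<close> kills \<open>g \<circ> t\<inverse>\<close>, then \<open>g\<close> takes values
  in the image of \<open>f\<close> modulo torsion, so the pullback of \<open>f\<close> along \<open>g\<close> is inverted, and its other leg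
  is the numerator of the factorisation.
\<close>

lemma mono_quot_normal:
  assumes o: "M \<in> Obj C" "N \<in> Obj C" and mono: "is_mono quo M N \<phi>"
  shows "\<exists>D\<in>Obj quo. \<exists>g\<in>Arr quo N D. is_kernel quo N D g M \<phi>"
proof -
  interpret q: preadditive_category quo by (rule fr.preadditive_quot)
  have \<phi>: "\<phi> \<in> Arr quo M N" using mono by (simp add: is_mono_def)
  obtain X s f where X: "X \<in> Obj C" "s \<in> WE X M" "f \<in> Arr C X N" "\<phi> = fr.frac M N X s f"
    by (rule fr.fracE[OF \<phi>]) (rule that)
  note s = weqD[OF X(2,1) o(1)]
  have tf: "tor_mono X N f" by (rule tor_mono_of_mono[OF o X(1-3)]) (use mono X(4) in simp)
  obtain Q p where Q: "Q \<in> Obj C" "p \<in> Arr C N Q" "is_cokernel C X N f Q p"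
    "\<And>i. app p i ` E N i = E Q i" "\<And>i. {x \<in> E N i. app p i x = nul Q i} = app f i ` E X i"
    by (rule concrete_cokernel[OF X(1) o(2) X(3)]) (rule that)
  have "is_cokernel quo M N \<phi> Q (loc N Q p)"
    unfolding X(4) by (rule cokernel_quot[OF o X(1-3) Q(1,2,4,5)])
  then have z: "cmp quo M N Q (loc N Q p) \<phi> = zero_arr quo M Q" by (simp add: is_cokernel_def)
  have "is_kernel quo N Q (loc N Q p) M \<phi>"
    unfolding is_kernel_def
  proof (intro conjI ballI impI ex_ex1I)
    show "M \<in> Obj quo" "\<phi> \<in> Arr quo M N" "cmp quo M N Q (loc N Q p) \<phi> = zero_arr quo M Q"
      using o(1) \<phi> z by simp_all
    fix L \<psi> assume L': "L \<in> Obj quo" and \<psi>: "\<psi> \<in> Arr quo L N" and 0: "cmp quo L N Q (loc N Q p) \<psi> = zero_arr quo L Q"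
    have L: "L \<in> Obj C" using L' by simp
    obtain Y t g where Y: "Y \<in> Obj C" "t \<in> WE Y L" "g \<in> Arr C Y N" "\<psi> = fr.frac L N Y t g"
      by (rule fr.fracE[OF \<psi>]) (rule that)
    have pg: "cmp C Y N Q p g \<in> Arr C Y Q" by (rule cmp_arr[OF Y(1) o(2) Q(1) Y(3) Q(2)])
    have "fr.frac L Q Y t (cmp C Y N Q p g) = zero_arr quo L Q"
      using 0 cmp_loc_frac[OF L o(2) Q(1) Y(1-3) Q(2)] Y(4) by simp
    then have *: "\<forall>i. \<forall>y\<in>E Y i. tor Q i (app (cmp C Y N Q p g) i y)"
      using frac_zero_iff_tor[OF L Q(1) Y(1,2) pg] by simp
    obtain Z a b where Z: "Z \<in> Obj C" "a \<in> Arr C Z Y" "b \<in> Arr C Z X" "cmp C Z Y N g a = cmp C Z X N f b"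
      "\<And>i x y. x \<in> E Y i \<Longrightarrow> y \<in> E X i \<Longrightarrow> app g i x = app f i y \<Longrightarrow> \<exists>z\<in>E Z i. app a i z = x \<and> app b i z = y"
      "\<And>i z. z \<in> E Z i \<Longrightarrow> app a i z = nul Y i \<Longrightarrow> app b i z = nul X i \<Longrightarrow> z = nul Z i"
      by (rule concrete_pullback[OF Y(1) X(1) o(2) Y(3) X(3)]) (rule that)
    have "tor_mono Z Y a" by (rule pullback_tor_mono[OF Y(1) X(1) o(2) Y(3) X(3) Z(1-4) Z(6) tf])
    moreover have "tor_epi Z Y a"
    proof (rule pullback_tor_epi[OF Y(1) X(1) o(2) Y(3) X(3) Z(1,2)])
      show "\<exists>z\<in>E Z i. app a i z = x" if "x \<in> E Y i" "y \<in> E X i" "app g i x = app f i y" for i x y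
        using Z(5)[OF that] by blast
      show "tor R i (app r i (app g i x))"
        if R: "R \<in> Obj C" "r \<in> Arr C N R" and x: "x \<in> E Y i" and rf: "\<And>j y. y \<in> E X j \<Longrightarrow> app r j (app f j y) = nul R j" for R r i x
      proof -
        have "app r i y = nul R i" if "y \<in> E N i" "app p i y = nul Q i" for i y
        proof -
          have "y \<in> app f i ` E X i" unfolding Q(5)[symmetric] using that by simp
          then show ?thesis using rf by auto
        qed
        from descend[OF o(2) Q(1) R(1) R(2) Q(2,4) this]
        obtain h where h: "h \<in> Arr C Q R" "cmp C N Q R h p = r" by (rule bexE)
        have gx: "app g i x \<in> E N i" by (rule app_in[OF Y(1) o(2) Y(3) x])
        have "tor Q i (app p i (app g i x))"
          using bspec[OF spec[OF *, of i] x] app_cmp[OF Y(1) o(2) Q(1) Y(3) Q(2) x] by simp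
        then show ?thesis
          using tor_image[OF Q(1) R(1) h(1) app_in[OF o(2) Q(1,2) gx]] app_cmp[OF o(2) Q(1) R(1) Q(2) h(1) gx] h(2) by simp
      qed
    qed
    ultimately have a: "a \<in> WE Z Y" using serre_weq_iff[OF Z(1) Y(1)] Z(2) by simp
    have ta: "cmp C Z Y L t a \<in> WE Z L" by (rule fr.weq_cmp[OF Z(1) Y(1) L a Y(2)])
    have sb: "cmp C Z X M s b \<in> Arr C Z M" by (rule cmp_arr[OF Z(1) X(1) o(1) Z(3) s(1)])
    have "cmp quo L M N \<phi> (fr.frac L M Z (cmp C Z Y L t a) (cmp C Z X M s b)) =
        fr.frac L N Z (cmp C Z Y L t a) (cmp C Z X N f b)"
      unfolding X(4) by (rule fr.cmp_frac_common[OF L o Z(1) X(1) ta X(2,3) Z(3)])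
    also have "\<dots> = \<psi>"
      unfolding Z(4)[symmetric] Y(4) by (rule fr.frac_expand[OF L o(2) Y(1-3) Z(1) a])
    finally have "cmp quo L M N \<phi> (fr.frac L M Z (cmp C Z Y L t a) (cmp C Z X M s b)) = \<psi>" .
    then show "\<exists>h. h \<in> Arr quo L M \<and> cmp quo L M N \<phi> h = \<psi>"
      using fr.frac_in[OF L o(1) Z(1) ta sb] by blast
    fix h h' assume "h \<in> Arr quo L M \<and> cmp quo L M N \<phi> h = \<psi>" "h' \<in> Arr quo L M \<and> cmp quo L M N \<phi> h' = \<psi>"
    then show "h = h'" using mono L unfolding is_mono_def by simp
  qed
  then show ?thesis using Q(1) loc_in[OF o(2) Q(1,2)] by auto
qed

text \<open>
  An epimorphism \<open>\<phi>\<close> is a cokernel of its kernel. Let \<open>\<psi>\<close> vanish on the kernel and write \<open>\<phi>\<close>, \<open>\<psi>\<close> with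
  a common denominator and numerators \<open>f\<close>, \<open>g\<close>. Then \<open>g\<close> is torsion on the kernel of \<open>f\<close>, so the image
  \<open>I\<close> of \<open>(f, g)\<close> in \<open>N \<times> L\<close> is the graph of an arrow modulo torsion: its projection to \<open>N\<close> is inverted,
  and the other projection yields the factorisation.
\<close>

lemma epi_quot_normal:
  assumes o: "M \<in> Obj C" "N \<in> Obj C" and epi: "is_epi quo M N \<phi>"
  shows "\<exists>D\<in>Obj quo. \<exists>g\<in>Arr quo D M. is_cokernel quo D M g N \<phi>"
proof -
  interpret q: preadditive_category quo by (rule fr.preadditive_quot)
  have \<phi>: "\<phi> \<in> Arr quo M N" using epi by (simp add: is_epi_def)
  obtain X0 s0 f0 where X0: "X0 \<in> Obj C" "s0 \<in> WE X0 M" "f0 \<in> Arr C X0 N" "\<phi> = fr.frac M N X0 s0 f0"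
    by (rule fr.fracE[OF \<phi>]) (rule that)
  obtain K0 k0 where K0: "K0 \<in> Obj C" "k0 \<in> Arr C K0 X0" "is_kernel C X0 N f0 K0 k0"
      "\<And>i. inj_on (app k0 i) (E K0 i)" "\<And>i. app k0 i ` E K0 i = {x \<in> E X0 i. app f0 i x = nul N i}"
    by (rule concrete_kernel[OF X0(1) o(2) X0(3)]) (rule that)
  define \<kappa> where "\<kappa> = fr.frac K0 M K0 (idn C K0) (cmp C K0 X0 M s0 k0)"
  have ker0: "is_kernel quo M N \<phi> K0 \<kappa>"
    unfolding X0(4) \<kappa>_def by (rule fr.kernel_quot[OF o X0(1-3) K0(3)])
  have \<kappa>: "\<kappa> \<in> Arr quo K0 M" "cmp quo K0 M N \<phi> \<kappa> = zero_arr quo K0 N"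
    using ker0 by (simp_all add: is_kernel_def)
  have "is_cokernel quo K0 M \<kappa> N \<phi>"
    unfolding is_cokernel_def
  proof (intro conjI ballI impI ex_ex1I)
    show "N \<in> Obj quo" "\<phi> \<in> Arr quo M N" "cmp quo K0 M N \<phi> \<kappa> = zero_arr quo K0 N"
      using o(2) \<phi> \<kappa>(2) by simp_all
    fix L \<psi> assume L': "L \<in> Obj quo" and \<psi>: "\<psi> \<in> Arr quo M L" and 0: "cmp quo K0 M L \<psi> \<kappa> = zero_arr quo K0 L"
    have L: "L \<in> Obj C" using L' by simp
    \<comment> \<open>The common denominator may change \<open>f\<close>; the kernel computed from the new \<open>f\<close> factors through \<open>K0\<close>.\<close>
    obtain X s f g where X: "X \<in> Obj C" "s \<in> WE X M" "f \<in> Arr C X N" "g \<in> Arr C X L"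
      "\<phi> = fr.frac M N X s f" "\<psi> = fr.frac M L X s g"
      by (rule fr.common_denominator2[OF \<phi> \<psi> o L]) (rule that)
    note s = weqD[OF X(2,1) o(1)]
    have tf: "tor_epi X N f" by (rule tor_epi_of_epi[OF o X(1-3)]) (use epi X(5) in simp)
    obtain K k where K: "K \<in> Obj C" "k \<in> Arr C K X" "is_kernel C X N f K k"
        "\<And>i. inj_on (app k i) (E K i)" "\<And>i. app k i ` E K i = {x \<in> E X i. app f i x = nul N i}"
      by (rule concrete_kernel[OF X(1) o(2) X(3)]) (rule that)
    let ?k = "fr.frac K M K (idn C K) (cmp C K X M s k)"
    have "is_kernel quo M N \<phi> K ?k" unfolding X(5) by (rule fr.kernel_quot[OF o X(1-3) K(3)])
    then have k: "?k \<in> Arr quo K M" "cmp quo K M N \<phi> ?k = zero_arr quo K N" by (simp_all add: is_kernel_def)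
    then obtain \<theta> where \<theta>: "\<theta> \<in> Arr quo K K0" "cmp quo K K0 M \<kappa> \<theta> = ?k"
      using ker0 K(1) unfolding is_kernel_def by (metis fr.Obj_quot)
    have "cmp quo K M L \<psi> ?k = cmp quo K K0 L (cmp quo K0 M L \<psi> \<kappa>) \<theta>"
      using q.cmp_assoc[of K K0 M L \<theta> \<kappa> \<psi>] \<theta> \<kappa>(1) \<psi> K(1) K0(1) o L by simp
    also have "\<dots> = zero_arr quo K L"
      unfolding 0 using q.cmp_zero_left[of K K0 L \<theta>] \<theta>(1) K(1) K0(1) L by simp
    finally have "cmp quo K M L \<psi> ?k = zero_arr quo K L" .
    then have *: "fr.frac K L K (idn C K) (cmp C K X L g k) = zero_arr quo K L"
      unfolding X(6) using fr.cmp_frac_common[OF K(1) o(1) L K(1) X(1) fr.weq_idn[OF K(1)] X(2,4) K(2)] by simp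
    have **: "\<forall>i. \<forall>x\<in>E K i. tor L i (app (cmp C K X L g k) i x)"
      using * frac_zero_iff_tor[OF K(1) L K(1) fr.weq_idn[OF K(1)] cmp_arr[OF K(1) X(1) L K(2) X(4)]] by simp
    have gk: "tor L i (app g i x)" if x: "x \<in> E X i" "app f i x = nul N i" for i x
    proof -
      have "x \<in> app k i ` E K i" unfolding K(5) using x by simp
      then obtain z where z: "z \<in> E K i" "x = app k i z" by blast
      then show ?thesis using bspec[OF spec[OF **, of i] z(1)] app_cmp[OF K(1) X(1) L K(2) X(4) z(1)] by simp
    qed
    obtain I e f' g' where I: "I \<in> Obj C" "e \<in> Arr C X I" "f' \<in> Arr C I N" "g' \<in> Arr C I L"
      "cmp C X I N f' e = f" "cmp C X I L g' e = g" "\<And>i. app e i ` E X i = E I i"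
      "\<And>i z. z \<in> E I i \<Longrightarrow> app f' i z = nul N i \<Longrightarrow> app g' i z = nul L i \<Longrightarrow> z = nul I i"
      by (rule image_of_pair[OF X(1) o(2) L X(3,4)]) (rule that)
    have "tor_mono I N f'"
      unfolding tor_mono_def
    proof (intro allI ballI impI)
      fix i z assume z: "z \<in> E I i" "app f' i z = nul N i"
      obtain x where x: "x \<in> E X i" "z = app e i x" using z(1) I(7)[of i] by blast
      have "app f i x = nul N i" using app_cmp[OF X(1) I(1) o(2) I(2,3) x(1)] I(5) x(2) z(2) by simp
      then have "tor L i (app g i x)" by (rule gk[OF x(1)])
      then have tg: "tor L i (app g' i z)" using app_cmp[OF X(1) I(1) L I(2,4) x(1)] I(6) x(2) by simp
      have "tor N i (app f' i z)" using z(2) tor_zero[OF o(2)] by simp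
      from tor_jointly[OF I(1) o(2) L I(3,4,8) z(1) this tg] show "tor I i z" .
    qed
    moreover have "tor_epi I N f'"
      by (rule tor_epi_left[OF X(1) I(1) o(2) I(2,3)]) (simp add: I(5) tf)
    ultimately have f': "f' \<in> WE I N" using serre_weq_iff[OF I(1) o(2)] I(3) by simp
    have "cmp quo M N L (fr.frac N L I f' g') \<phi> = fr.frac M L X s (cmp C X I L g' e)"
      using fr.cmp_frac_common[OF o L X(1) I(1) X(2) f' I(4,2)] I(5) X(5) by simp
    then have "cmp quo M N L (fr.frac N L I f' g') \<phi> = \<psi>" using I(6) X(6) by simp
    then show "\<exists>h. h \<in> Arr quo N L \<and> cmp quo M N L h \<phi> = \<psi>"
      using fr.frac_in[OF o(2) L I(1) f' I(4)] by blast
    fix h h' assume "h \<in> Arr quo N L \<and> cmp quo M N L h \<phi> = \<psi>" "h' \<in> Arr quo N L \<and> cmp quo M N L h' \<phi> = \<psi>"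
    then show "h = h'" using epi L unfolding is_epi_def by simp
  qed
  then show ?thesis using K0(1) \<kappa>(1) by auto
qed

lemma zero_object_concrete: "\<exists>Z. is_zero_object C Z"
proof -
  obtain Z where Z: "Z \<in> Obj C" "\<forall>i. E Z i = {nul Z i}" using zero_obj by (elim bexE)
  have 1: "f = g" if "X \<in> Obj C" "f \<in> Arr C X Z" "g \<in> Arr C X Z" for X f g
  proof (rule arr_eqI[OF that(1) Z(1) that(2,3)])
    fix i x assume "x \<in> E X i"
    then have "app f i x \<in> E Z i" "app g i x \<in> E Z i" using app_in that Z(1) by simp_all
    then show "app f i x = app g i x" using Z(2) by simp
  qed
  have 2: "f = g" if "X \<in> Obj C" "f \<in> Arr C Z X" "g \<in> Arr C Z X" for X f g
  proof (rule arr_eqI[OF Z(1) that])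
    fix i x assume "x \<in> E Z i"
    then have "x = nul Z i" using Z(2) by simp
    then show "app f i x = app g i x" using app_nul[OF Z(1) that(1,2)] app_nul[OF Z(1) that(1,3)] by simp
  qed
  have "is_zero_object C Z"
    unfolding is_zero_object_def
  proof (intro conjI ballI Z(1))
    fix X assume X: "X \<in> Obj C"
    show "\<exists>!f. f \<in> Arr C X Z" using zero_arr[OF X Z(1)] 1[OF X] by (intro ex1I)
    show "\<exists>!f. f \<in> Arr C Z X" using zero_arr[OF Z(1) X] 2[OF X] by (intro ex1I)
  qed
  then show ?thesis by blast
qed

theorem abelian_quot: "abelian_category quo"
proof (intro abelian_category.intro[OF fr.preadditive_quot] abelian_category_axioms.intro)
  show "\<exists>Z. is_zero_object quo Z" using zero_object_concrete fr.zero_object_quot by blast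
next
  fix A B assume "A \<in> Obj quo" "B \<in> Obj quo"
  then have o: "A \<in> Obj C" "B \<in> Obj C" by simp_all
  obtain P p q where "is_product C A B P p q"
    by (rule concrete_product[OF o]) (rule that)
  then show "\<exists>P p q. is_product quo A B P p q" using fr.product_quot[OF o] by blast
next
  fix A B \<phi> assume "A \<in> Obj quo" "B \<in> Obj quo" and \<phi>: "\<phi> \<in> Arr quo A B"
  then have o: "A \<in> Obj C" "B \<in> Obj C" by simp_all
  obtain X s f where X: "X \<in> Obj C" "s \<in> WE X A" "f \<in> Arr C X B" "\<phi> = fr.frac A B X s f"
    by (rule fr.fracE[OF \<phi>]) (rule that)
  obtain K k where K: "is_kernel C X B f K k"
    by (rule concrete_kernel[OF X(1) o(2) X(3)]) (rule that)
  have "is_kernel quo A B \<phi> K (fr.frac K A K (idn C K) (cmp C K X A s k))"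
    unfolding X(4) by (rule fr.kernel_quot[OF o X(1-3) K])
  then show "\<exists>K i. is_kernel quo A B \<phi> K i" by (intro exI)
  obtain Q p where Q: "Q \<in> Obj C" "p \<in> Arr C B Q" "is_cokernel C X B f Q p"
    "\<And>i. app p i ` E B i = E Q i" "\<And>i. {x \<in> E B i. app p i x = nul Q i} = app f i ` E X i"
    by (rule concrete_cokernel[OF X(1) o(2) X(3)]) (rule that)
  have "is_cokernel quo A B \<phi> Q (loc B Q p)"
    unfolding X(4) by (rule cokernel_quot[OF o X(1-3) Q(1,2,4,5)])
  then show "\<exists>Q p. is_cokernel quo A B \<phi> Q p" by (intro exI)
next
  fix A B \<phi> assume "A \<in> Obj quo" "B \<in> Obj quo" 
  then have o: "A \<in> Obj C" "B \<in> Obj C" by simp_all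
  show "\<exists>D\<in>Obj quo. \<exists>g\<in>Arr quo B D. is_kernel quo B D g A \<phi>" if "is_mono quo A B \<phi>"
    using mono_quot_normal[OF o that] .
  show "\<exists>D\<in>Obj quo. \<exists>g\<in>Arr quo D A. is_cokernel quo D A g B \<phi>" if "is_epi quo A B \<phi>"
    using epi_quot_normal[OF o that] .
qed

end

section \<open>A criterion for induced equivalences\<close>

text \<open>
  A quasi-inverse is obtained by choosing preimages of objects and, by fullness, of the conjugated
  arrows; faithfulness makes it a functor and the chosen isomorphisms natural.
\<close>

lemma equivalence_of_fully_faithful:
  assumes C: "category C" and D: "category D" and F: "is_functor C D F"
    and faithful: "\<And>A B f g. \<lbrakk>A \<in> Obj C; B \<in> Obj C; f \<in> Arr C A B; g \<in> Arr C A B; amap F A B f = amap F A B g\<rbrakk> \<Longrightarrow> f = g"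
    and full: "\<And>A B h. \<lbrakk>A \<in> Obj C; B \<in> Obj C; h \<in> Arr D (omap F A) (omap F B)\<rbrakk> \<Longrightarrow> \<exists>f\<in>Arr C A B. amap F A B f = h"
    and ess: "\<And>N. N \<in> Obj D \<Longrightarrow> \<exists>M\<in>Obj C. \<exists>e. is_iso D N (omap F M) e"
  shows "is_equivalence C D F"
proof -
  interpret C: category C by (rule C)
  interpret D: category D by (rule D)
  have Fo: "omap F A \<in> Obj D" if "A \<in> Obj C" for A using F that by (simp add: is_functor_def)
  have Fa: "amap F A B f \<in> Arr D (omap F A) (omap F B)" if "A \<in> Obj C" "B \<in> Obj C" "f \<in> Arr C A B" for A B f
    using F that by (simp add: is_functor_def)
  have Fi: "amap F A A (idn C A) = idn D (omap F A)" if "A \<in> Obj C" for A using F that by (simp add: is_functor_def)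
  have Fc: "amap F A E (cmp C A B E g f) = cmp D (omap F A) (omap F B) (omap F E) (amap F B E g) (amap F A B f)"
    if "A \<in> Obj C" "B \<in> Obj C" "E \<in> Obj C" "f \<in> Arr C A B" "g \<in> Arr C B E" for A B E f g
    using F that by (simp add: is_functor_def)
  have "\<exists>M e e'. M \<in> Obj C \<and> e \<in> Arr D N (omap F M) \<and> e' \<in> Arr D (omap F M) N \<and>
      cmp D N (omap F M) N e' e = idn D N \<and> cmp D (omap F M) N (omap F M) e e' = idn D (omap F M)"
    if "N \<in> Obj D" for N using ess[OF that] unfolding is_iso_def by blast
  then obtain g e e' where g: "\<And>N. N \<in> Obj D \<Longrightarrow> g N \<in> Obj C"
    and e: "\<And>N. N \<in> Obj D \<Longrightarrow> e N \<in> Arr D N (omap F (g N))"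
    and e': "\<And>N. N \<in> Obj D \<Longrightarrow> e' N \<in> Arr D (omap F (g N)) N"
    and ee1: "\<And>N. N \<in> Obj D \<Longrightarrow> cmp D N (omap F (g N)) N (e' N) (e N) = idn D N"
    and ee2: "\<And>N. N \<in> Obj D \<Longrightarrow> cmp D (omap F (g N)) N (omap F (g N)) (e N) (e' N) = idn D (omap F (g N))"
    by metis
  define conj where "conj A B h = cmp D (omap F (g A)) B (omap F (g B)) (e B) (cmp D (omap F (g A)) A B h (e' A))" for A B h
  have conj_in: "conj A B h \<in> Arr D (omap F (g A)) (omap F (g B))"
    if "A \<in> Obj D" "B \<in> Obj D" "h \<in> Arr D A B" for A B h
    using that by (simp add: conj_def D.cmp_in Fo g e e')
  define ga where "ga A B h = (SOME f. f \<in> Arr C (g A) (g B) \<and> amap F (g A) (g B) f = conj A B h)" for A B h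
  have ga: "ga A B h \<in> Arr C (g A) (g B)" "amap F (g A) (g B) (ga A B h) = conj A B h"
    if "A \<in> Obj D" "B \<in> Obj D" "h \<in> Arr D A B" for A B h
  proof -
    have "\<exists>f. f \<in> Arr C (g A) (g B) \<and> amap F (g A) (g B) f = conj A B h"
      using full[OF g[OF that(1)] g[OF that(2)] conj_in[OF that]] by blast
    from someI_ex[OF this] show "ga A B h \<in> Arr C (g A) (g B)" "amap F (g A) (g B) (ga A B h) = conj A B h"
      by (simp_all add: ga_def)
  qed
  let ?G = "\<lparr>omap = g, amap = ga\<rparr>"
  have G: "is_functor D C ?G"
    unfolding is_functor_def
  proof (intro conjI ballI; simp)
    show "\<And>A. A \<in> Obj D \<Longrightarrow> g A \<in> Obj C" by (rule g)
    show "\<And>A B h. A \<in> Obj D \<Longrightarrow> B \<in> Obj D \<Longrightarrow> h \<in> Arr D A B \<Longrightarrow> ga A B h \<in> Arr C (g A) (g B)" by (rule ga)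
    show "ga A A (idn D A) = idn C (g A)" if A: "A \<in> Obj D" for A
    proof (rule faithful[OF g[OF A] g[OF A] ga(1)[OF A A D.idn_in[OF A]] C.idn_in[OF g[OF A]]])
      show "amap F (g A) (g A) (ga A A (idn D A)) = amap F (g A) (g A) (idn C (g A))"
        using A by (simp add: ga(2) D.idn_in Fi g conj_def D.cmp_idn_left Fo e e' ee2)
    qed
    show "ga A E (cmp D A B E k h) = cmp C (g A) (g B) (g E) (ga B E k) (ga A B h)"
      if o: "A \<in> Obj D" "B \<in> Obj D" "E \<in> Obj D" "h \<in> Arr D A B" "k \<in> Arr D B E" for A B E h k
    proof (rule faithful[OF g[OF o(1)] g[OF o(3)] ga(1)[OF o(1,3) D.cmp_in[OF o]]])
      show "cmp C (g A) (g B) (g E) (ga B E k) (ga A B h) \<in> Arr C (g A) (g E)"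
        using o by (simp add: C.cmp_in g ga)
      let ?A = "omap F (g A)" and ?B = "omap F (g B)" and ?E = "omap F (g E)"
      note [simp] = o Fo g e e' D.cmp_in
      have m: "cmp D ?A ?B ?E (conj B E k) (conj A B h) = conj A E (cmp D A B E k h)"
      proof -
        have "cmp D ?A ?B ?E (conj B E k) (conj A B h) =
          cmp D ?A B ?E (cmp D B E ?E (e E) k) (cmp D ?A B B (cmp D B ?B B (e' B) (e B)) (cmp D ?A A B h (e' A)))"
          by (simp add: conj_def D.cmp_assoc)
        also have "\<dots> = conj A E (cmp D A B E k h)"
          by (simp add: ee1 D.cmp_idn_left conj_def D.cmp_assoc)
        finally show ?thesis .
      qed
      show "amap F (g A) (g E) (ga A E (cmp D A B E k h)) = amap F (g A) (g E) (cmp C (g A) (g B) (g E) (ga B E k) (ga A B h))"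
        by (simp add: ga Fc m)
    qed
  qed
  define \<theta> where "\<theta> A = (SOME f. f \<in> Arr C A (g (omap F A)) \<and> amap F A (g (omap F A)) f = e (omap F A))" for A
  have \<theta>: "\<theta> A \<in> Arr C A (g (omap F A))" "amap F A (g (omap F A)) (\<theta> A) = e (omap F A)" if A: "A \<in> Obj C" for A
  proof -
    have "\<exists>f. f \<in> Arr C A (g (omap F A)) \<and> amap F A (g (omap F A)) f = e (omap F A)"
      using full[OF A g[OF Fo[OF A]] e[OF Fo[OF A]]] by blast
    from someI_ex[OF this] show "\<theta> A \<in> Arr C A (g (omap F A))" "amap F A (g (omap F A)) (\<theta> A) = e (omap F A)"
      by (simp_all add: \<theta>_def)
  qed
  have "is_natural_iso C C id_map (comp_map ?G F) \<theta>"
    unfolding is_natural_iso_def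
  proof (intro conjI ballI; simp add: id_map_def comp_map_def)
    fix A assume A: "A \<in> Obj C"
    note [simp] = A Fo g e e' C.cmp_in D.cmp_in \<theta>
    obtain k where k: "k \<in> Arr C (g (omap F A)) A" "amap F (g (omap F A)) A k = e' (omap F A)"
      using full[of "g (omap F A)" A "e' (omap F A)"] by auto
    have 1: "cmp C A (g (omap F A)) A k (\<theta> A) = idn C A"
      by (rule faithful[OF A A]) (simp_all add: k C.idn_in Fc Fi ee1)
    have 2: "cmp C (g (omap F A)) A (g (omap F A)) (\<theta> A) k = idn C (g (omap F A))"
      by (rule faithful[of "g (omap F A)" "g (omap F A)"]) (simp_all add: k C.idn_in Fc Fi ee2)
    show "is_iso C A (g (omap F A)) (\<theta> A)"
      unfolding is_iso_def using k 1 2 \<theta>(1)[OF A] by blast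
  next
    fix A B f assume o: "A \<in> Obj C" "B \<in> Obj C" "f \<in> Arr C A B"
    note [simp] = o Fo g e e' C.cmp_in D.cmp_in \<theta> Fa ga
    have "cmp D (omap F A) (omap F (g (omap F A))) (omap F (g (omap F B))) (conj (omap F A) (omap F B) (amap F A B f)) (e (omap F A))
      = cmp D (omap F A) (omap F B) (omap F (g (omap F B))) (e (omap F B))
          (cmp D (omap F A) (omap F A) (omap F B) (amap F A B f)
             (cmp D (omap F A) (omap F (g (omap F A))) (omap F A) (e' (omap F A)) (e (omap F A))))"
      by (simp add: conj_def D.cmp_assoc)
    also have "\<dots> = cmp D (omap F A) (omap F B) (omap F (g (omap F B))) (e (omap F B)) (amap F A B f)"
      by (simp add: ee1 D.cmp_idn_right)
    finally have *: "cmp D (omap F A) (omap F (g (omap F A))) (omap F (g (omap F B))) (conj (omap F A) (omap F B) (amap F A B f)) (e (omap F A))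
      = cmp D (omap F A) (omap F B) (omap F (g (omap F B))) (e (omap F B)) (amap F A B f)" .
    show "cmp C A B (g (omap F B)) (\<theta> B) f =
       cmp C A (g (omap F A)) (g (omap F B)) (ga (omap F A) (omap F B) (amap F A B f)) (\<theta> A)"
      by (rule faithful[of A "g (omap F B)"]) (simp_all add: Fc *)
  qed
  moreover have "is_natural_iso D D (comp_map F ?G) id_map e'"
    unfolding is_natural_iso_def
  proof (intro conjI ballI; simp add: id_map_def comp_map_def)
    fix A assume A: "A \<in> Obj D"
    show "is_iso D (omap F (g A)) A (e' A)"
      unfolding is_iso_def using e[OF A] e'[OF A] ee1[OF A] ee2[OF A] by blast
  next
    fix A B h assume o: "A \<in> Obj D" "B \<in> Obj D" "h \<in> Arr D A B"
    note [simp] = o Fo g e e' D.cmp_in ga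
    have "cmp D (omap F (g A)) (omap F (g B)) B (e' B) (conj A B h) =
      cmp D (omap F (g A)) B B (cmp D B (omap F (g B)) B (e' B) (e B)) (cmp D (omap F (g A)) A B h (e' A))"
      by (simp add: conj_def D.cmp_assoc)
    then show "cmp D (omap F (g A)) (omap F (g B)) B (e' B) (amap F (g A) (g B) (ga A B h)) =
       cmp D (omap F (g A)) A B h (e' A)"
      by (simp add: ee1 D.cmp_idn_left)
  qed
  ultimately show ?thesis unfolding is_equivalence_def using F G by blast
qed

text \<open>
  Conditions under which a functor induces an equivalence of the quotients. By \<open>reflects\<close> it preserves
  and detects inverted arrows. By \<open>generate\<close> a pair of arrows from \<open>X\<close> into objects \<open>F M\<close>, \<open>F P\<close> comes,
  up to a surjection \<open>e\<close>, from a pair of arrows in \<open>C\<close>; this lifts roofs. Arrows out of the object \<open>Z\<close>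
  so obtained are determined by their images, which gives faithfulness.
\<close>

locale element_equivalence =
  C: element_category C grpC appC torC + D: element_category D grpD appD torD
  for C :: "('o, 'a) cat" and grpC :: "'o \<Rightarrow> 'i \<Rightarrow> ('m, 'e) ring_scheme" and appC torC
    and D :: "('p, 'b) cat" and grpD :: "'p \<Rightarrow> 'j \<Rightarrow> ('n, 'f) ring_scheme" and appD torD +
  fixes F :: "('o, 'a, 'p, 'b) cat_map"
  assumes additive: "is_additive_functor C D F"
    and reflects: "\<lbrakk>L \<in> Obj C; M \<in> Obj C; r \<in> Arr C L M\<rbrakk> \<Longrightarrow>
      r \<in> serre_weq C C.torsion_objects L M \<longleftrightarrow> amap F L M r \<in> serre_weq D D.torsion_objects (omap F L) (omap F M)"
    and generate: "\<lbrakk>M \<in> Obj C; P \<in> Obj C; X \<in> Obj D; s \<in> Arr D X (omap F M); f \<in> Arr D X (omap F P)\<rbrakk> \<Longrightarrow>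
      \<exists>Z\<in>Obj C. \<exists>p\<in>Arr C Z M. \<exists>q\<in>Arr C Z P. \<exists>e\<in>Arr D X (omap F Z).
        (\<forall>i. appD e i ` carrier (grpD X i) = carrier (grpD (omap F Z) i)) \<and>
        cmp D X (omap F Z) (omap F M) (amap F Z M p) e = s \<and> cmp D X (omap F Z) (omap F P) (amap F Z P q) e = f \<and>
        (\<forall>A\<in>Obj C. \<forall>a\<in>Arr C Z A. \<forall>b\<in>Arr C Z A. amap F Z A a = amap F Z A b \<longrightarrow> a = b)"
    and essential: "N \<in> Obj D \<Longrightarrow> \<exists>M\<in>Obj C. \<exists>e\<in>Arr D N (omap F M).
        \<forall>i. bij_betw (appD e i) (carrier (grpD N i)) (carrier (grpD (omap F M) i))"
begin

abbreviation ind where "ind \<equiv> induced_map D D.torsion_objects F"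

lemma F_obj: "A \<in> Obj C \<Longrightarrow> omap F A \<in> Obj D"
  using additive by (simp add: is_additive_functor_def is_functor_def)

lemma F_arr: "\<lbrakk>A \<in> Obj C; B \<in> Obj C; f \<in> Arr C A B\<rbrakk> \<Longrightarrow> amap F A B f \<in> Arr D (omap F A) (omap F B)"
  using additive by (simp add: is_additive_functor_def is_functor_def)

lemma F_idn: "A \<in> Obj C \<Longrightarrow> amap F A A (idn C A) = idn D (omap F A)"
  using additive by (simp add: is_additive_functor_def is_functor_def)

lemma F_cmp: "\<lbrakk>A \<in> Obj C; B \<in> Obj C; E \<in> Obj C; f \<in> Arr C A B; g \<in> Arr C B E\<rbrakk> \<Longrightarrow>
    amap F A E (cmp C A B E g f) = cmp D (omap F A) (omap F B) (omap F E) (amap F B E g) (amap F A B f)"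
  using additive by (simp add: is_additive_functor_def is_functor_def)

lemma F_plus: "\<lbrakk>A \<in> Obj C; B \<in> Obj C; f \<in> Arr C A B; g \<in> Arr C A B\<rbrakk> \<Longrightarrow>
    amap F A B (plus_arr C A B f g) = plus_arr D (omap F A) (omap F B) (amap F A B f) (amap F A B g)"
  using additive by (simp add: is_additive_functor_def)

lemma F_weq: "\<lbrakk>X \<in> Obj C; M \<in> Obj C; s \<in> C.WE X M\<rbrakk> \<Longrightarrow> amap F X M s \<in> D.WE (omap F X) (omap F M)"
  using reflects C.fr.weq_arr by blast

text \<open>
  The induced functor is defined through all representatives of a class at once; a common refinement
  of two of them is mapped to a common refinement, so one representative suffices.
\<close>

lemma induced_frac:
  assumes o: "M \<in> Obj C" "N \<in> Obj C" "X \<in> Obj C" and s: "s \<in> C.WE X M" and f: "f \<in> Arr C X N"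
  shows "amap ind M N (C.fr.frac M N X s f) =
    D.fr.frac (omap F M) (omap F N) (omap F X) (amap F X M s) (amap F X N f)"
proof -
  define S where "S = {(omap F X', amap F X' M s', amap F X' N f') | X' s' f'. (X', s', f') \<in> C.fr.frac M N X s f}"
  have "(X, s, f) \<in> C.fr.frac M N X s f" using o s f by (simp add: C.fr.in_frac_iff)
  then have in_S: "(omap F X, amap F X M s, amap F X N f) \<in> S" unfolding S_def by blast
  have "roof_rel D D.torsion_objects (omap F M) (omap F N) `` {\<rho>} =
     D.fr.frac (omap F M) (omap F N) (omap F X) (amap F X M s) (amap F X N f)" if "\<rho> \<in> S" for \<rho>
  proof -
    from that obtain Y t g where \<rho>: "\<rho> = (omap F Y, amap F Y M t, amap F Y N g)" and in1: "(Y, t, g) \<in> C.fr.frac M N X s f"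
      unfolding S_def by blast
    have 1: "Y \<in> Obj C" "t \<in> C.WE Y M" "g \<in> Arr C Y N" "C.fr.frac M N X s f = C.fr.frac M N Y t g"
      using in1 o s f by (simp_all add: C.fr.in_frac_iff)
    obtain Z u v where Z: "Z \<in> Obj C" "u \<in> C.WE Z X" "v \<in> C.WE Z Y"
      "cmp C Z X M s u = cmp C Z Y M t v" "cmp C Z X N f u = cmp C Z Y N g v"
      by (rule C.fr.frac_eqE[OF 1(4) o s f 1(1-3)]) (rule that)
    have e1: "cmp D (omap F Z) (omap F X) (omap F M) (amap F X M s) (amap F Z X u) =
       cmp D (omap F Z) (omap F Y) (omap F M) (amap F Y M t) (amap F Z Y v)"
      using F_cmp[of Z X M u s] F_cmp[of Z Y M v t] Z o 1 s by (simp add: C.fr.weq_arr)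
    have e2: "cmp D (omap F Z) (omap F X) (omap F N) (amap F X N f) (amap F Z X u) =
       cmp D (omap F Z) (omap F Y) (omap F N) (amap F Y N g) (amap F Z Y v)"
      using F_cmp[of Z X N u f] F_cmp[of Z Y N v g] Z o 1 f by (simp add: C.fr.weq_arr)
    have "D.fr.frac (omap F M) (omap F N) (omap F X) (amap F X M s) (amap F X N f) =
      D.fr.frac (omap F M) (omap F N) (omap F Y) (amap F Y M t) (amap F Y N g)"
      by (rule D.fr.frac_eqI[OF _ _ _ _ _ _ _ _ _ _ _ e1 e2])
        (use o s f 1 Z in \<open>simp_all add: F_obj F_arr F_weq\<close>)
    then show ?thesis by (simp add: \<rho> D.fr.frac_def)
  qed
  then have "roof_rel D D.torsion_objects (omap F M) (omap F N) `` S =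
     D.fr.frac (omap F M) (omap F N) (omap F X) (amap F X M s) (amap F X N f)"
    using in_S by blast
  then show ?thesis by (simp add: induced_map_def S_def)
qed

lemma omap_ind [simp]: "omap ind = omap F"
  by (simp add: induced_map_def)

lemma induced_functor: "is_functor C.quo D.quo ind"
  unfolding is_functor_def
proof (intro conjI ballI)
  fix A assume "A \<in> Obj C.quo"
  then have A: "A \<in> Obj C" by simp
  show "omap ind A \<in> Obj D.quo" using A by (simp add: F_obj)
  show "amap ind A A (idn C.quo A) = idn D.quo (omap ind A)"
    using A by (simp add: C.fr.idn_frac D.fr.idn_frac induced_frac C.fr.weq_idn C.idn_arr F_idn)
next
  fix A B \<phi> assume o: "A \<in> Obj C.quo" "B \<in> Obj C.quo" and \<phi>: "\<phi> \<in> Arr C.quo A B"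
  obtain X s f where "X \<in> Obj C" "s \<in> C.WE X A" "f \<in> Arr C X B" "\<phi> = C.fr.frac A B X s f"
    by (rule C.fr.fracE[OF \<phi>]) (rule that)
  then show "amap ind A B \<phi> \<in> Arr D.quo (omap ind A) (omap ind B)"
    using o by (simp add: induced_frac D.fr.frac_in F_obj F_arr F_weq)
next
  fix A B E \<phi> \<psi> assume "A \<in> Obj C.quo" "B \<in> Obj C.quo" "E \<in> Obj C.quo"
    and a: "\<phi> \<in> Arr C.quo A B" "\<psi> \<in> Arr C.quo B E"
  then have o: "A \<in> Obj C" "B \<in> Obj C" "E \<in> Obj C" by simp_all
  obtain X Y s t v g where 1: "X \<in> Obj C" "Y \<in> Obj C" "s \<in> C.WE X A" "t \<in> C.WE Y B" "v \<in> Arr C X Y" "g \<in> Arr C Y E"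
    "\<phi> = C.fr.frac A B X s (cmp C X Y B t v)" "\<psi> = C.fr.frac B E Y t g"
    by (rule C.fr.composable_fracE[OF a o]) (rule that)
  show "amap ind A E (cmp C.quo A B E \<psi> \<phi>) = cmp D.quo (omap ind A) (omap ind B) (omap ind E) (amap ind B E \<psi>) (amap ind A B \<phi>)"
    unfolding 1(7,8) using o 1(1-6)
    by (simp add: C.fr.cmp_frac_common induced_frac C.cmp_arr C.fr.weq_arr F_cmp D.fr.cmp_frac_common F_obj F_arr F_weq)
qed

lemma induced_additive: "is_additive_functor C.quo D.quo ind"
  unfolding is_additive_functor_def
proof (intro conjI ballI induced_functor)
  fix A B \<phi> \<psi> assume "A \<in> Obj C.quo" "B \<in> Obj C.quo" and a: "\<phi> \<in> Arr C.quo A B" "\<psi> \<in> Arr C.quo A B"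
  then have o: "A \<in> Obj C" "B \<in> Obj C" by simp_all
  obtain X s f g where 1: "X \<in> Obj C" "s \<in> C.WE X A" "f \<in> Arr C X B" "g \<in> Arr C X B"
    "\<phi> = C.fr.frac A B X s f" "\<psi> = C.fr.frac A B X s g"
    by (rule C.fr.common_denominator2[OF a o o(2)]) (rule that)
  then show "amap ind A B (plus_arr C.quo A B \<phi> \<psi>) = plus_arr D.quo (omap ind A) (omap ind B) (amap ind A B \<phi>) (amap ind A B \<psi>)"
    using o by (simp add: C.fr.plus_frac induced_frac C.plus_arr F_plus D.fr.plus_frac F_obj F_arr F_weq)
qed

text \<open>
  Let a surjection followed by \<open>p\<close> be inverted. An element killed by \<open>p\<close> is the image of one killed by
  the composite, so \<open>p\<close> is inverted as well, and by cancellation so is the surjection.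
\<close>

lemma surj_factor_weq:
  assumes o: "X \<in> Obj D" "Y \<in> Obj D" "M \<in> Obj D" "e \<in> Arr D X Y" "p \<in> Arr D Y M"
    and e: "\<And>i. appD e i ` carrier (grpD X i) = carrier (grpD Y i)"
    and w: "cmp D X Y M p e \<in> D.WE X M"
  shows "p \<in> D.WE Y M" "e \<in> D.WE X Y"
proof -
  note w' = D.weqD[OF w o(1,3)]
  have "D.tor_mono Y M p" unfolding D.tor_mono_def
  proof (intro allI ballI impI)
    fix i y assume y: "y \<in> carrier (grpD Y i)" "appD p i y = \<zero>\<^bsub>grpD M i\<^esub>"
    obtain x where x: "x \<in> carrier (grpD X i)" "y = appD e i x" using y(1) e[of i] by blast
    have "torD X i x" by (rule D.tor_monoD[OF w'(2) x(1)]) (use D.app_cmp[OF o x(1)] x y in simp)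
    then show "torD Y i y" using D.tor_image[OF o(1,2,4) x(1)] x(2) by simp
  qed
  then show p: "p \<in> D.WE Y M"
    using D.tor_epi_left[OF o w'(3)] o by (simp add: D.serre_weq_iff)
  show "e \<in> D.WE X Y" by (rule D.fr.weq_cancel[OF o(1-4) p w])
qed

text \<open>
  Lift the two legs \<open>s\<close>, \<open>f\<close> of a roof to \<open>p\<close>, \<open>q\<close>. As \<open>s\<close> is inverted, so are \<open>F p\<close> and \<open>e\<close>; hence
  \<open>p\<close> is inverted, and the roof of \<open>F p\<close> and \<open>F q\<close> represents the given arrow.
\<close>

lemma induced_full:
  assumes o: "M \<in> Obj C" "P \<in> Obj C" and \<chi>: "\<chi> \<in> Arr D.quo (omap F M) (omap F P)"
  shows "\<exists>\<phi>\<in>Arr C.quo M P. amap ind M P \<phi> = \<chi>"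
proof -
  obtain X s f where X: "X \<in> Obj D" "s \<in> D.WE X (omap F M)" "f \<in> Arr D X (omap F P)"
    "\<chi> = D.fr.frac (omap F M) (omap F P) X s f"
    by (rule D.fr.fracE[OF \<chi>]) (rule that)
  obtain Z p q e where Z: "Z \<in> Obj C" "p \<in> Arr C Z M" "q \<in> Arr C Z P" "e \<in> Arr D X (omap F Z)"
    "\<forall>i. appD e i ` carrier (grpD X i) = carrier (grpD (omap F Z) i)"
    "cmp D X (omap F Z) (omap F M) (amap F Z M p) e = s" "cmp D X (omap F Z) (omap F P) (amap F Z P q) e = f"
    using generate[OF o X(1) D.fr.weq_arr[OF X(2)] X(3)] by (elim bexE conjE)
  note Fo = F_obj[OF o(1)] F_obj[OF o(2)] F_obj[OF Z(1)]
  have sur: "\<And>i. appD e i ` carrier (grpD X i) = carrier (grpD (omap F Z) i)" using Z(5) by simp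
  have sW: "cmp D X (omap F Z) (omap F M) (amap F Z M p) e \<in> D.WE X (omap F M)" using Z(6) X(2) by simp
  note w = surj_factor_weq[OF X(1) Fo(3,1) Z(4) F_arr[OF Z(1) o(1) Z(2)] sur sW]
  have p: "p \<in> C.WE Z M" using w(1) reflects[OF Z(1) o(1) Z(2)] by simp
  have "amap ind M P (C.fr.frac M P Z p q) = \<chi>"
    using D.fr.frac_expand[OF Fo(1,2,3) w(1) F_arr[OF Z(1) o(2) Z(3)] X(1) w(2)]
    by (simp add: induced_frac[OF o Z(1) p Z(3)] Z(6,7) X(4))
  then show ?thesis using C.fr.frac_in[OF o Z(1) p Z(3)] by blast
qed

text \<open>
  If two numerators agree after composition with an inverted \<open>u\<close> in \<open>D\<close>, lift \<open>u\<close>, by \<open>generate\<close> for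
  the pair \<open>(u, u)\<close>, to an inverted arrow of \<open>C\<close> out of a \<open>Z\<close> on which arrows are determined by their images; there the numerators agree.
\<close>

lemma induced_faithful:
  assumes o: "M \<in> Obj C" "P \<in> Obj C" and a: "\<phi> \<in> Arr C.quo M P" "\<psi> \<in> Arr C.quo M P"
    and eq: "amap ind M P \<phi> = amap ind M P \<psi>"
  shows "\<phi> = \<psi>"
proof -
  obtain X s f g where X: "X \<in> Obj C" "s \<in> C.WE X M" "f \<in> Arr C X P" "g \<in> Arr C X P"
    "\<phi> = C.fr.frac M P X s f" "\<psi> = C.fr.frac M P X s g"
    by (rule C.fr.common_denominator2[OF a o o(2)]) (rule that)
  note Fo = F_obj[OF o(1)] F_obj[OF o(2)] F_obj[OF X(1)]
  have "D.fr.frac (omap F M) (omap F P) (omap F X) (amap F X M s) (amap F X P f) =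
    D.fr.frac (omap F M) (omap F P) (omap F X) (amap F X M s) (amap F X P g)"
    using eq X o by (simp add: induced_frac)
  then obtain Y u where Y: "Y \<in> Obj D" "u \<in> D.WE Y (omap F X)"
    "cmp D Y (omap F X) (omap F P) (amap F X P f) u = cmp D Y (omap F X) (omap F P) (amap F X P g) u"
    by (rule D.fr.frac_eq_sameE[OF _ Fo F_weq[OF X(1) o(1) X(2)] F_arr[OF X(1) o(2) X(3)] F_arr[OF X(1) o(2) X(4)]]) (rule that)
  obtain Z p q e where Z: "Z \<in> Obj C" "p \<in> Arr C Z X" "q \<in> Arr C Z X" "e \<in> Arr D Y (omap F Z)"
    "\<forall>i. appD e i ` carrier (grpD Y i) = carrier (grpD (omap F Z) i)"
    "cmp D Y (omap F Z) (omap F X) (amap F Z X p) e = u"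
    "\<forall>A\<in>Obj C. \<forall>a\<in>Arr C Z A. \<forall>b\<in>Arr C Z A. amap F Z A a = amap F Z A b \<longrightarrow> a = b"
    using generate[OF X(1) X(1) Y(1) D.fr.weq_arr[OF Y(2)] D.fr.weq_arr[OF Y(2)]] by (elim bexE conjE)
  note FZ = F_obj[OF Z(1)] and Fp = F_arr[OF Z(1) X(1) Z(2)]
  have sur: "\<And>i. appD e i ` carrier (grpD Y i) = carrier (grpD (omap F Z) i)" using Z(5) by simp
  have uW: "cmp D Y (omap F Z) (omap F X) (amap F Z X p) e \<in> D.WE Y (omap F X)" using Z(6) Y(2) by simp
  have p: "p \<in> C.WE Z X"
    using surj_factor_weq(1)[OF Y(1) FZ Fo(3) Z(4) Fp sur uW] reflects[OF Z(1) X(1) Z(2)] by simp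
  have "amap F Z P (cmp C Z X P f p) = amap F Z P (cmp C Z X P g p)"
  proof (rule D.arr_eqI[OF FZ Fo(2)])
    fix i z assume "z \<in> carrier (grpD (omap F Z) i)"
    then obtain y where y: "y \<in> carrier (grpD Y i)" "z = appD e i y" using sur[of i] by blast
    have pe: "appD (amap F Z X p) i z = appD u i y"
      using D.app_cmp[OF Y(1) FZ Fo(3) Z(4) Fp y(1)] Z(6) y(2) by simp
    have z: "z \<in> carrier (grpD (omap F Z) i)" using sur[of i] y by blast
    have "appD (amap F X P f) i (appD u i y) = appD (amap F X P g) i (appD u i y)"
      using D.app_cmp[OF Y(1) Fo(3,2) D.fr.weq_arr[OF Y(2)] F_arr[OF X(1) o(2) X(3)] y(1)]
        D.app_cmp[OF Y(1) Fo(3,2) D.fr.weq_arr[OF Y(2)] F_arr[OF X(1) o(2) X(4)] y(1)] Y(3) by simp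
    then show "appD (amap F Z P (cmp C Z X P f p)) i z = appD (amap F Z P (cmp C Z X P g p)) i z"
      using D.app_cmp[OF FZ Fo(3,2) Fp F_arr[OF X(1) o(2) X(3)] z] D.app_cmp[OF FZ Fo(3,2) Fp F_arr[OF X(1) o(2) X(4)] z] pe
      by (simp add: F_cmp[OF Z(1) X(1) o(2) Z(2)] X(3,4))
  qed (simp_all add: F_arr C.cmp_arr Z X o)
  then have "cmp C Z X P f p = cmp C Z X P g p"
    using Z(7) o(2) C.cmp_arr[OF Z(1) X(1) o(2) Z(2)] X(3,4) by blast
  then show ?thesis
    unfolding X(5,6) by (intro C.fr.frac_eqI[OF o X(1,2,3,1,2,4) Z(1) p p]) simp_all
qed

lemma loc_bij_iso:
  assumes o: "N \<in> Obj D" "M \<in> Obj D" "e \<in> Arr D N M"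
    and bij: "\<And>i. bij_betw (appD e i) (carrier (grpD N i)) (carrier (grpD M i))"
  shows "is_iso D.quo N M (D.loc N M e)"
proof -
  have inj: "inj_on (appD e i) (carrier (grpD N i))" and sur: "appD e i ` carrier (grpD N i) = carrier (grpD M i)" for i
    using bij[of i] by (simp_all add: bij_betw_def)
  have e: "e \<in> D.WE N M" using D.tor_mono_inj[OF o inj] D.tor_epi_surj[OF o sur] o by (simp add: D.serre_weq_iff)
  let ?g = "D.fr.frac M N N e (idn D N)"
  have "cmp D.quo N M N ?g (D.loc N M e) = D.fr.frac N N N (idn D N) (cmp D N N N (idn D N) (idn D N))"
    by (rule D.cmp_frac_loc[OF o(1,2,1) o(1) e D.idn_arr[OF o(1)] o(3) o(1) D.fr.weq_idn[OF o(1)] D.idn_arr[OF o(1)]]) simp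
  then have 1: "cmp D.quo N M N ?g (D.loc N M e) = idn D.quo N"
    using D.idn_arr[OF o(1)] o(1) by (simp add: D.fr.idn_frac D.fr.cmp_idn_left)
  have "cmp D.quo M N M (D.loc N M e) ?g = D.fr.frac M M N e (cmp D N N M e (idn D N))"
    by (rule D.cmp_loc_frac[OF o(2,1,2,1) e D.idn_arr[OF o(1)] o(3)])
  also have "\<dots> = D.fr.frac M M N e e" using o by (simp add: D.fr.cmp_idn_right)
  also have "\<dots> = idn D.quo M"
    using D.fr.frac_expand[OF o(2,2,2) D.fr.weq_idn[OF o(2)] D.idn_arr[OF o(2)] o(1) e] o
    by (simp add: D.fr.idn_frac D.fr.cmp_idn_left)
  finally have 2: "cmp D.quo M N M (D.loc N M e) ?g = idn D.quo M" .
  show ?thesis unfolding is_iso_def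
    using 1 2 D.loc_in[OF o] D.fr.frac_in[OF o(2,1,1) e D.idn_arr[OF o(1)]] by blast
qed

theorem induces_equivalence:
  "induces_abelian_equivalence C C.torsion_objects D D.torsion_objects F"
  unfolding induces_abelian_equivalence_def
proof (intro conjI ballI additive)
  fix M N f assume "M \<in> Obj C" "N \<in> Obj C" "f \<in> Arr C M N"
  then show "amap (comp_map (induced_map D D.torsion_objects F) (serre_projection C C.torsion_objects)) M N f =
      amap (comp_map (serre_projection D D.torsion_objects) F) M N f"
    using induced_frac[of M N M "idn C M" f] F_idn[of M]
    by (simp add: comp_map_def serre_projection_def C.fr.weq_idn C.fr.frac_def D.fr.frac_def)
next
  have "is_equivalence C.quo D.quo ind"
  proof (rule equivalence_of_fully_faithful[OF C.fr.category_quot D.fr.category_quot induced_functor])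
    show "f = g" if "A \<in> Obj C.quo" "B \<in> Obj C.quo" "f \<in> Arr C.quo A B" "g \<in> Arr C.quo A B"
      "amap ind A B f = amap ind A B g" for A B f g
      using that by (intro induced_faithful) simp_all
    show "\<exists>f\<in>Arr C.quo A B. amap ind A B f = h" if "A \<in> Obj C.quo" "B \<in> Obj C.quo" "h \<in> Arr D.quo (omap ind A) (omap ind B)" for A B h
      using that by (intro induced_full) simp_all
    show "\<exists>M\<in>Obj C.quo. \<exists>e. is_iso D.quo N (omap ind M) e" if "N \<in> Obj D.quo" for N
    proof -
      have N: "N \<in> Obj D" using that by simp
      obtain M e where M: "M \<in> Obj C" "e \<in> Arr D N (omap F M)"
        "\<forall>i. bij_betw (appD e i) (carrier (grpD N i)) (carrier (grpD (omap F M) i))"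
        using essential[OF N] by (elim bexE)
      have "is_iso D.quo N (omap F M) (D.loc N (omap F M) e)"
        by (rule loc_bij_iso[OF N F_obj[OF M(1)] M(2)]) (use M(3) in simp)
      then show ?thesis using M(1) by auto
    qed
  qed
  then show "is_abelian_equivalence C.quo D.quo ind"
    unfolding is_abelian_equivalence_def using C.abelian_quot D.abelian_quot induced_additive by blast
qed

end

section \<open>Finite spans over noetherian subrings\<close>

locale unital_module = right_module R M for R :: "'s::{ring,monoid_mult} set" and M :: "('m, 's) rmodule" (structure) +
  assumes one_R: "1 \<in> R" and diff_R: "\<lbrakk>r \<in> R; s \<in> R\<rbrakk> \<Longrightarrow> r - s \<in> R" and mult_R: "\<lbrakk>r \<in> R; s \<in> R\<rbrakk> \<Longrightarrow> r * s \<in> R"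
begin

lemma zero_R: "0 \<in> R" using diff_R[OF one_R one_R] by simp

lemma neg_R: "r \<in> R \<Longrightarrow> - r \<in> R" using diff_R[OF zero_R] by simp

lemma add_R: "\<lbrakk>r \<in> R; s \<in> R\<rbrakk> \<Longrightarrow> r + s \<in> R" using diff_R[OF _ neg_R, of r s] by simp

lemma ract_zero_right: "x \<in> carrier M \<Longrightarrow> ract M x 0 = \<zero>"
  using ract_add_right[of x 0 0] ract_closed[of x 0] zero_R by simp

lemma ract_zero_left: "r \<in> R \<Longrightarrow> ract M \<zero> r = \<zero>"
  using ract_add_left[of \<zero> \<zero> r] ract_closed[of \<zero> r] by simp

lemma ract_minus_right: "\<lbrakk>x \<in> carrier M; r \<in> R\<rbrakk> \<Longrightarrow> ract M x (- r) = \<ominus> ract M x r"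
  using ract_add_right[of x "- r" r] ract_closed[of x r] ract_closed[of x "- r"] neg_R[of r] ract_zero_right[of x]
    minus_equality[of "ract M x (- r)" "ract M x r"] by simp

lemma neg_zero: "\<ominus> \<zero> = \<zero>"
  using minus_equality[of \<zero> \<zero>] by simp

lemma neg_eq_ract: "x \<in> carrier M \<Longrightarrow> \<ominus> x = ract M x (- 1)"
  using ract_minus_right[of x 1] one_R ract_one by simp

lemma ract_neg: "\<lbrakk>x \<in> carrier M; r \<in> R\<rbrakk> \<Longrightarrow> ract M (\<ominus> x) r = \<ominus> ract M x r"
  using ract_mult[of x "-1" r] neg_R[OF one_R] ract_minus_right[of x r] neg_eq_ract[of x] by simp

definition submod :: "'m set \<Rightarrow> bool" where
  "submod V \<longleftrightarrow> V \<subseteq> carrier M \<and> \<zero> \<in> V \<and> (\<forall>x\<in>V. \<forall>y\<in>V. x \<oplus> y \<in> V) \<and> (\<forall>x\<in>V. \<forall>r\<in>R. ract M x r \<in> V)"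

lemma submodD:
  assumes "submod V"
  shows "V \<subseteq> carrier M" "\<zero> \<in> V" "\<And>x y. x \<in> V \<Longrightarrow> y \<in> V \<Longrightarrow> x \<oplus> y \<in> V" "\<And>x r. x \<in> V \<Longrightarrow> r \<in> R \<Longrightarrow> ract M x r \<in> V"
  using assms by (auto simp: submod_def)

lemma submod_neg: "submod V \<Longrightarrow> x \<in> V \<Longrightarrow> \<ominus> x \<in> V"
  using submodD(1,4)[of V] neg_eq_ract[of x] neg_R[OF one_R] by auto

lemma submod_minus: "submod V \<Longrightarrow> x \<in> V \<Longrightarrow> y \<in> V \<Longrightarrow> x \<ominus> y \<in> V"
  using submodD(3)[of V x "\<ominus> y"] submod_neg[of V y] by (simp add: a_minus_def)

lemma submod_zero: "submod {\<zero>}"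
  by (simp add: submod_def ract_zero_left)

lemma submod_carrier: "submod (carrier M)"
  by (simp add: submod_def ract_closed)

lemma submod_Int: "submod V \<Longrightarrow> submod W \<Longrightarrow> submod (V \<inter> W)"
  by (auto simp: submod_def)

text \<open>
  The sum \<open>U + b\<^sub>1 R + \<dots> + b\<^sub>n R\<close>. Lists of generators allow induction on their number, and the base \<open>U\<close>
  is what the exchange argument below varies.
\<close>

fun span_over :: "'m set \<Rightarrow> 'm list \<Rightarrow> 'm set" where
  "span_over U [] = U"
| "span_over U (b # bs) = {x \<oplus> ract M b r | x r. x \<in> span_over U bs \<and> r \<in> R}"

abbreviation spn where "spn \<equiv> span_over {\<zero>}"

lemma span_over_submod:
  assumes "submod U" "set bs \<subseteq> carrier M"
  shows "submod (span_over U bs)"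
  using assms(2)
proof (induction bs)
  case Nil then show ?case using assms(1) by simp
next
  case (Cons b bs)
  then have IH: "submod (span_over U bs)" and b: "b \<in> carrier M" by simp_all
  note IH' = submodD[OF IH]
  show ?case unfolding submod_def
  proof (intro conjI ballI)
    show "span_over U (b # bs) \<subseteq> carrier M" using IH'(1) b ract_closed by auto
    show "\<zero> \<in> span_over U (b # bs)"
      using IH'(2) zero_R ract_zero_right[OF b] by (auto intro!: exI[of _ \<zero>] exI[of _ 0])
    fix x assume "x \<in> span_over U (b # bs)"
    then obtain x' r where x: "x = x' \<oplus> ract M b r" "x' \<in> span_over U bs" "r \<in> R" by auto
    have c: "x' \<in> carrier M" "ract M b r \<in> carrier M" using x IH'(1) b ract_closed by auto
    { fix y assume "y \<in> span_over U (b # bs)"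
      then obtain y' s where y: "y = y' \<oplus> ract M b s" "y' \<in> span_over U bs" "s \<in> R" by auto
      have c': "y' \<in> carrier M" "ract M b s \<in> carrier M" using y IH'(1) b ract_closed by auto
      have "x \<oplus> y = (x' \<oplus> y') \<oplus> ract M b (r + s)"
        using c c' x(3) y(3) b by (simp add: x(1) y(1) ract_add_right a_ac)
      then show "x \<oplus> y \<in> span_over U (b # bs)" using IH'(3)[OF x(2) y(2)] add_R[OF x(3) y(3)] by auto }
    fix s assume s: "s \<in> R"
    have "ract M x s = ract M x' s \<oplus> ract M b (r * s)"
      using c b x(3) s by (simp add: x(1) ract_add_left ract_mult)
    then show "ract M x s \<in> span_over U (b # bs)" using IH'(4)[OF x(2) s] mult_R[OF x(3) s] by auto
  qed
qed

lemma spn_submod: "set bs \<subseteq> carrier M \<Longrightarrow> submod (spn bs)"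
  by (rule span_over_submod[OF submod_zero])

lemma span_over_base: "\<lbrakk>U \<subseteq> carrier M; set bs \<subseteq> carrier M\<rbrakk> \<Longrightarrow> U \<subseteq> span_over U bs"
proof (induction bs)
  case (Cons b bs)
  show ?case
  proof
    fix u assume "u \<in> U"
    then have "u \<in> span_over U bs" "u = u \<oplus> ract M b 0" using Cons ract_zero_right by auto
    then show "u \<in> span_over U (b # bs)" using zero_R by auto
  qed
qed simp

lemma span_over_gens:
  assumes "submod U" "set bs \<subseteq> carrier M"
  shows "set bs \<subseteq> span_over U bs"
  using assms(2)
proof (induction bs)
  case (Cons b bs)
  have b: "b \<in> carrier M" using Cons by simp
  have sm: "submod (span_over U bs)" using span_over_submod assms(1) Cons by simp
  have "b = \<zero> \<oplus> ract M b 1" using b ract_one by simp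
  then have "b \<in> span_over U (b # bs)" using submodD(2)[OF sm] one_R by auto
  moreover have "span_over U bs \<subseteq> span_over U (b # bs)"
  proof
    fix u assume u: "u \<in> span_over U bs"
    then have "u = u \<oplus> ract M b 0" using ract_zero_right[OF b] submodD(1)[OF sm] by auto
    then show "u \<in> span_over U (b # bs)" using u zero_R by auto
  qed
  ultimately show ?case using Cons by auto
qed simp

lemma span_over_least:
  assumes "submod V" "U \<subseteq> V" "set bs \<subseteq> V"
  shows "span_over U bs \<subseteq> V"
  using assms(3)
proof (induction bs)
  case (Cons b bs)
  then show ?case using submodD(3,4)[OF assms(1)] by auto
qed (use assms in simp)

lemma span_over_mono: "U \<subseteq> V \<Longrightarrow> span_over U bs \<subseteq> span_over V bs"
  by (induction bs) auto

lemma span_over_append: "span_over U (bs @ cs) = span_over (span_over U cs) bs"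
  by (induction bs) simp_all

text \<open>
  A submodule \<open>V\<close> of a finitely generated extension of \<open>U\<close> is finitely generated over \<open>U \<inter> V\<close>, by
  induction on the number of generators: the coefficients at \<open>b\<close> of elements of \<open>V\<close> form a right ideal
  \<open>I\<close>, which is finitely generated, and after subtracting a combination of elements of \<open>V\<close> with leading
  coefficients generating \<open>I\<close> an element of \<open>V\<close> lies in the span of the remaining generators.
\<close>

lemma noetherian_exchange:
  assumes noeth: "\<And>I. right_ideal R I \<Longrightarrow> fg_right R I"
    and U: "submod U" and bs: "set bs \<subseteq> carrier M"
  shows "submod V \<Longrightarrow> V \<subseteq> span_over U bs \<Longrightarrow> \<exists>cs. set cs \<subseteq> V \<and> V \<subseteq> span_over (U \<inter> V) cs"
  using bs
proof (induction bs arbitrary: V)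
  case Nil
  then show ?case by (intro exI[of _ "[]"]) auto
next
  case (Cons b bs)
  let ?S = "span_over U bs"
  have b: "b \<in> carrier M" and S: "submod ?S" using Cons span_over_submod[OF U] by simp_all
  note V = submodD[OF Cons.prems(1)] and S' = submodD[OF S]
  define I where "I = {r \<in> R. \<exists>v\<in>V. v \<ominus> ract M b r \<in> ?S}"
  have VS: "\<exists>r\<in>R. v \<ominus> ract M b r \<in> ?S" if "v \<in> V" for v
  proof -
    have "v \<in> span_over U (b # bs)" using that Cons.prems(2) by blast
    then obtain x r where x: "v = x \<oplus> ract M b r" "x \<in> ?S" "r \<in> R" by auto
    have "v \<ominus> ract M b r = x" using x S'(1) ract_closed[OF b x(3)] by (auto simp: a_minus_def a_assoc r_neg)
    then show ?thesis using x by blast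
  qed
  have "right_ideal R I" unfolding right_ideal_def
  proof (intro conjI ballI)
    show "I \<subseteq> R" by (auto simp: I_def)
    have "\<zero> \<ominus> ract M b 0 \<in> ?S" using S'(2) by (simp add: ract_zero_right[OF b] a_minus_def neg_zero)
    then show "0 \<in> I" using V(2) zero_R by (auto simp: I_def)
    fix r assume "r \<in> I"
    then obtain v where v: "v \<in> V" "v \<ominus> ract M b r \<in> ?S" "r \<in> R" by (auto simp: I_def)
    have vc: "v \<in> carrier M" "ract M b r \<in> carrier M" using v V(1) ract_closed[OF b] by auto
    { fix s assume "s \<in> I"
      then obtain w where w: "w \<in> V" "w \<ominus> ract M b s \<in> ?S" "s \<in> R" by (auto simp: I_def)
      have wc: "w \<in> carrier M" "ract M b s \<in> carrier M" using w V(1) ract_closed[OF b] by auto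
      have "ract M b (r - s) = ract M b r \<ominus> ract M b s"
        using ract_add_right[OF b v(3) neg_R[OF w(3)]] ract_minus_right[OF b w(3)] by (simp add: a_minus_def)
      then have "(v \<ominus> w) \<ominus> ract M b (r - s) = (v \<ominus> ract M b r) \<ominus> (w \<ominus> ract M b s)"
        using vc wc by (simp add: a_minus_def minus_add a_ac)
      then have "(v \<ominus> w) \<ominus> ract M b (r - s) \<in> ?S"
        using submod_minus[OF S v(2) w(2)] by simp
      then show "r - s \<in> I"
        using submod_minus[OF Cons.prems(1) v(1) w(1)] diff_R[OF v(3) w(3)] unfolding I_def by blast }
    fix s assume s: "s \<in> R"
    have "ract M v s \<ominus> ract M b (r * s) = ract M (v \<ominus> ract M b r) s"
      using vc s v(3) b by (simp add: a_minus_def ract_add_left ract_neg ract_mult)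
    then have "ract M v s \<ominus> ract M b (r * s) \<in> ?S" using S'(4)[OF v(2) s] by simp
    then show "r * s \<in> I" using V(4)[OF v(1) s] mult_R[OF v(3) s] unfolding I_def by blast
  qed
  then have "fg_right R I" by (rule noeth)
  then obtain B where B: "finite B" "B \<subseteq> I" "I = {\<Sum>c\<in>B. c * q c | q. q \<in> B \<rightarrow> R}"
    unfolding fg_right_def by blast
  have "\<forall>c\<in>B. \<exists>w\<in>V. w \<ominus> ract M b c \<in> ?S" using B(2) by (auto simp: I_def)
  then obtain w where w: "\<And>c. c \<in> B \<Longrightarrow> w c \<in> V \<and> w c \<ominus> ract M b c \<in> ?S" by metis
  obtain cs where cs: "set cs = B" using B(1) finite_list by blast
  let ?ws = "map w cs"
  have ws: "set ?ws \<subseteq> V" using w cs by auto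
  then have wsc: "set ?ws \<subseteq> carrier M" using V(1) by blast
  have lift: "\<exists>x\<in>spn ?ws. x \<ominus> ract M b (\<Sum>c\<in>A. c * q c) \<in> ?S" if "finite A" "A \<subseteq> B" "q \<in> A \<rightarrow> R" for A q
    using that
  proof (induction A)
    case empty
    show ?case using submodD(2)[OF spn_submod[OF wsc]] S'(2) ract_zero_right[OF b]
      by (intro bexI[of _ \<zero>]) (simp_all add: a_minus_def neg_zero)
  next
    case (insert c A)
    then obtain x where x: "x \<in> spn ?ws" "x \<ominus> ract M b (\<Sum>c\<in>A. c * q c) \<in> ?S" by auto
    have cB: "c \<in> B" and qc: "q c \<in> R" and cR: "c \<in> R" using insert B(2) by (auto simp: I_def)
    have sR: "(\<Sum>c\<in>A. c * q c) \<in> R"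
    proof -
      have "(\<Sum>c\<in>A'. c * q c) \<in> R" if "A' \<subseteq> A" "finite A'" for A'
        using that(2,1)
        by (induction A') (use insert B(2) in \<open>auto simp: zero_R I_def intro!: add_R mult_R\<close>)
      then show ?thesis using insert by blast
    qed
    have xc: "x \<in> carrier M" using x(1) submodD(1)[OF spn_submod[OF wsc]] by blast
    have wc: "w c \<in> carrier M" "w c \<in> spn ?ws" using w[OF cB] V(1) span_over_gens[OF submod_zero wsc] cB cs by auto
    have bc: "ract M b (\<Sum>c\<in>A. c * q c) \<in> carrier M" "ract M b c \<in> carrier M" using ract_closed[OF b] sR cR by blast+
    have "(x \<oplus> ract M (w c) (q c)) \<ominus> ract M b (\<Sum>c\<in>insert c A. c * q c) =
      (x \<ominus> ract M b (\<Sum>c\<in>A. c * q c)) \<oplus> ract M (w c \<ominus> ract M b c) (q c)"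
    proof -
      have 1: "ract M b (\<Sum>c\<in>insert c A. c * q c) = ract M (ract M b c) (q c) \<oplus> ract M b (\<Sum>c\<in>A. c * q c)"
        using insert(1,2) ract_add_right[OF b mult_R[OF cR qc] sR] ract_mult[OF b cR qc] by simp
      have 2: "ract M (w c \<ominus> ract M b c) (q c) = ract M (w c) (q c) \<ominus> ract M (ract M b c) (q c)"
        using wc bc qc by (simp add: a_minus_def ract_add_left ract_neg)
      show ?thesis unfolding 1 2 using xc wc(1) bc qc ract_closed
        by (simp add: a_minus_def minus_add a_ac)
    qed
    moreover have "(x \<ominus> ract M b (\<Sum>c\<in>A. c * q c)) \<oplus> ract M (w c \<ominus> ract M b c) (q c) \<in> ?S"
      using S'(3)[OF x(2) S'(4)[OF conjunct2[OF w[OF cB]] qc]] .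
    moreover have "x \<oplus> ract M (w c) (q c) \<in> spn ?ws"
      using submodD(3,4)[OF spn_submod[OF wsc]] x(1) wc(2) qc by blast
    ultimately show ?case by (intro bexI[of _ "x \<oplus> ract M (w c) (q c)"]) simp_all
  qed
  have VI: "submod (V \<inter> ?S)" using submod_Int Cons.prems(1) S by blast
  obtain ds where ds: "set ds \<subseteq> V \<inter> ?S" "V \<inter> ?S \<subseteq> span_over (U \<inter> (V \<inter> ?S)) ds"
    using Cons.IH[OF VI] Cons.prems by auto
  have "V \<subseteq> span_over (U \<inter> V) (?ws @ ds)"
  proof
    fix v assume v: "v \<in> V"
    obtain r where r: "r \<in> R" "v \<ominus> ract M b r \<in> ?S" using VS[OF v] by blast
    then have "r \<in> I" using v by (auto simp: I_def)
    then obtain q where q: "q \<in> B \<rightarrow> R" "r = (\<Sum>c\<in>B. c * q c)" using B(3) by auto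
    obtain x where x: "x \<in> spn ?ws" "x \<ominus> ract M b r \<in> ?S" using lift[OF B(1) subset_refl q(1)] q(2) by auto
    have xV: "x \<in> V" using x(1) span_over_least[OF Cons.prems(1) _ ws, of "{\<zero>}"] V(2) by auto
    have car: "x \<in> carrier M" "v \<in> carrier M" "ract M b r \<in> carrier M" using xV v V(1) ract_closed[OF b r(1)] by auto
    have "v \<ominus> x = (v \<ominus> ract M b r) \<ominus> (x \<ominus> ract M b r)"
      using car by (simp add: a_minus_def minus_add a_ac r_neg r_neg1 r_neg2)
    then have vx: "v \<ominus> x \<in> V \<inter> ?S" using submod_minus[OF S r(2) x(2)] submod_minus[OF Cons.prems(1) v xV] by simp
    have dc: "set ds \<subseteq> carrier M" using ds(1) V(1) by blast
    have UV: "submod (U \<inter> V)" using submod_Int U Cons.prems(1) by blast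
    have sub: "submod (span_over (span_over (U \<inter> V) ds) ?ws)"
      by (intro span_over_submod UV dc wsc)
    have "v \<ominus> x \<in> span_over (U \<inter> V) ds" using vx ds(2) span_over_mono[of "U \<inter> (V \<inter> ?S)" "U \<inter> V" ds] by blast
    then have 1: "v \<ominus> x \<in> span_over (span_over (U \<inter> V) ds) ?ws"
      using span_over_base[OF submodD(1)[OF span_over_submod[OF UV dc]] wsc] by blast
    have 2: "x \<in> span_over (span_over (U \<inter> V) ds) ?ws"
      using x(1) span_over_mono[of "{\<zero>}" "span_over (U \<inter> V) ds" ?ws] submodD(2)[OF span_over_submod[OF UV dc]] by blast
    have "v = (v \<ominus> x) \<oplus> x" using car by (simp add: a_minus_def a_assoc l_neg)
    then show "v \<in> span_over (U \<inter> V) (?ws @ ds)"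
      using submodD(3)[OF sub 1 2] by (simp add: span_over_append)
  qed
  moreover have "set (?ws @ ds) \<subseteq> V" using ws ds(1) by auto
  ultimately show ?case by blast
qed

lemma noetherian_submod:
  assumes "\<And>I. right_ideal R I \<Longrightarrow> fg_right R I" "set bs \<subseteq> carrier M" "submod V" "V \<subseteq> spn bs"
  obtains cs where "set cs \<subseteq> V" "V = spn cs"
proof -
  obtain cs where cs: "set cs \<subseteq> V" "V \<subseteq> span_over ({\<zero>} \<inter> V) cs"
    using noetherian_exchange[OF assms(1) submod_zero assms(2-4)] by blast
  have "{\<zero>} \<inter> V = {\<zero>}" using submodD(2)[OF assms(3)] by auto
  then have "V \<subseteq> spn cs" using cs(2) by simp
  moreover have "spn cs \<subseteq> V"
    by (rule span_over_least[OF assms(3) _ cs(1)]) (simp add: submodD(2)[OF assms(3)])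
  ultimately show ?thesis by (intro that[OF cs(1)] subset_antisym)
qed

lemma finsum_in_spn:
  assumes "finite B" "B \<subseteq> carrier M" "r \<in> B \<rightarrow> R"
    and "submod V" "B \<subseteq> V"
  shows "(\<Oplus>b\<in>B. ract M b (r b)) \<in> V"
  using assms(1,2,3,5)
proof (induction B)
  case empty then show ?case using submodD(2)[OF assms(4)] by simp
next
  case (insert b B)
  then have "(\<Oplus>b\<in>insert b B. ract M b (r b)) = ract M b (r b) \<oplus> (\<Oplus>b\<in>B. ract M b (r b))"
    by (intro finsum_insert) (auto intro!: ract_closed)
  then show ?case using insert submodD(3,4)[OF assms(4)] by auto
qed

lemma spn_finsum:
  assumes "distinct bs" "set bs \<subseteq> carrier M" "x \<in> spn bs"
  shows "\<exists>r\<in>set bs \<rightarrow> R. x = (\<Oplus>b\<in>set bs. ract M b (r b))"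
  using assms
proof (induction bs arbitrary: x)
  case Nil then show ?case by simp
next
  case (Cons b bs)
  then obtain y s where y: "x = y \<oplus> ract M b s" "y \<in> spn bs" "s \<in> R" by auto
  obtain r where r: "r \<in> set bs \<rightarrow> R" "y = (\<Oplus>b\<in>set bs. ract M b (r b))" using Cons y by auto
  have b: "b \<in> carrier M" "b \<notin> set bs" using Cons by auto
  let ?r = "r(b := s)"
  have "(\<Oplus>c\<in>set bs. ract M c (?r c)) = (\<Oplus>c\<in>set bs. ract M c (r c))"
    using b Cons.prems r by (intro finsum_cong') (auto intro!: ract_closed)
  moreover have "(\<Oplus>c\<in>insert b (set bs). ract M c (?r c)) = ract M b (?r b) \<oplus> (\<Oplus>c\<in>set bs. ract M c (?r c))"
    using b Cons.prems r y by (intro finsum_insert) (auto intro!: ract_closed)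
  moreover have "y \<in> carrier M" "ract M b s \<in> carrier M"
    using y b submodD(1)[OF spn_submod, of bs] Cons.prems ract_closed by auto
  ultimately have "x = (\<Oplus>c\<in>insert b (set bs). ract M c (?r c))"
    using y r by (simp add: a_comm)
  moreover have "?r \<in> set (b # bs) \<rightarrow> R" using r y by auto
  ultimately show ?case by (intro bexI[of _ ?r]) simp_all
qed

lemma generated_by_finite_iff:
  assumes "V \<subseteq> carrier M"
  shows "(\<exists>B. finite B \<and> B \<subseteq> V \<and> (\<forall>x\<in>V. \<exists>r\<in>B \<rightarrow> R. x = (\<Oplus>b\<in>B. ract M b (r b)))) \<longleftrightarrow>
    (\<exists>bs. set bs \<subseteq> V \<and> V \<subseteq> spn bs)"
proof
  assume "\<exists>B. finite B \<and> B \<subseteq> V \<and> (\<forall>x\<in>V. \<exists>r\<in>B \<rightarrow> R. x = (\<Oplus>b\<in>B. ract M b (r b)))"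
  then obtain B where B: "finite B" "B \<subseteq> V" "\<forall>x\<in>V. \<exists>r\<in>B \<rightarrow> R. x = (\<Oplus>b\<in>B. ract M b (r b))" by blast
  obtain bs where bs: "set bs = B" using finite_list B(1) by blast
  have bc: "set bs \<subseteq> carrier M" "B \<subseteq> carrier M" using bs B(2) assms by blast+
  have "V \<subseteq> spn bs"
  proof
    fix x assume "x \<in> V"
    then obtain r where r: "r \<in> B \<rightarrow> R" "x = (\<Oplus>b\<in>B. ract M b (r b))" using B(3) by blast
    then show "x \<in> spn bs"
      using finsum_in_spn[OF B(1) bc(2) r(1) spn_submod[OF bc(1)]] span_over_gens[OF submod_zero bc(1)] bs by simp
  qed
  then show "\<exists>bs. set bs \<subseteq> V \<and> V \<subseteq> spn bs" using bs B(2) by blast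
next
  assume "\<exists>bs. set bs \<subseteq> V \<and> V \<subseteq> spn bs"
  then obtain bs where bs: "set bs \<subseteq> V" "V \<subseteq> spn bs" by blast
  let ?cs = "remdups bs"
  have c: "set ?cs \<subseteq> carrier M" using bs(1) assms by auto
  have "spn bs \<subseteq> spn ?cs"
    by (rule span_over_least[OF spn_submod[OF c]])
      (use submodD(2)[OF spn_submod[OF c]] span_over_gens[OF submod_zero c] in auto)
  then have "\<forall>x\<in>V. \<exists>r\<in>set ?cs \<rightarrow> R. x = (\<Oplus>b\<in>set ?cs. ract M b (r b))"
    using spn_finsum[OF _ c] bs(2) by auto
  then show "\<exists>B. finite B \<and> B \<subseteq> V \<and> (\<forall>x\<in>V. \<exists>r\<in>B \<rightarrow> R. x = (\<Oplus>b\<in>B. ract M b (r b)))"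
    using bs(1) by (intro exI[of _ "set ?cs"]) auto
qed

text \<open>
  Being contained in a finitely generated submodule. The set itself need not be a submodule, so the
  notion passes to subsets, finite unions, sums and images without further argument; over a noetherian
  ring it means finite generation when \<open>V\<close> is a submodule.
\<close>

definition fin_span :: "'m set \<Rightarrow> bool" where
  "fin_span V \<longleftrightarrow> (\<exists>bs. set bs \<subseteq> carrier M \<and> V \<subseteq> spn bs)"

lemma fin_span_subset: "fin_span V \<Longrightarrow> W \<subseteq> V \<Longrightarrow> fin_span W"
  unfolding fin_span_def by blast

lemma spn_append_subset:
  assumes "set bs \<subseteq> carrier M" "set cs \<subseteq> carrier M"
  shows "spn bs \<subseteq> spn (bs @ cs)" "spn cs \<subseteq> spn (bs @ cs)"
  using assms span_over_least[OF spn_submod[of "bs @ cs"], of "{\<zero>}"] submodD(2)[OF spn_submod[of "bs @ cs"]]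
    span_over_gens[OF submod_zero, of "bs @ cs"] by auto

lemma fin_span_Un:
  assumes "fin_span V" "fin_span W"
  shows "fin_span (V \<union> W)"
proof -
  obtain bs cs where b: "set bs \<subseteq> carrier M" "V \<subseteq> spn bs" and c: "set cs \<subseteq> carrier M" "W \<subseteq> spn cs"
    using assms unfolding fin_span_def by blast
  then show ?thesis unfolding fin_span_def
    using spn_append_subset[OF b(1) c(1)] by (intro exI[of _ "bs @ cs"]) auto
qed

lemma fin_span_closure:
  assumes "fin_span V"
  obtains S where "submod S" "V \<subseteq> S" "fin_span S"
  using assms spn_submod unfolding fin_span_def by blast

lemma fin_span_add:
  assumes "fin_span V" "fin_span W"
  shows "fin_span {v \<oplus> w | v w. v \<in> V \<and> w \<in> W}"
proof -
  obtain S where S: "submod S" "V \<union> W \<subseteq> S" "fin_span S" by (rule fin_span_closure[OF fin_span_Un[OF assms]])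
  show ?thesis by (rule fin_span_subset[OF S(3)]) (use S(2) submodD(3)[OF S(1)] in auto)
qed

lemma fin_span_UN:
  assumes "finite A" "\<And>a. a \<in> A \<Longrightarrow> fin_span (V a)"
  shows "fin_span (\<Union>a\<in>A. V a)"
  using assms
proof (induction A)
  case empty
  then show ?case unfolding fin_span_def by (intro exI[of _ "[]"]) auto
next
  case (insert a A) then show ?case using fin_span_Un by simp
qed

lemma fin_span_iff_generators:
  assumes noeth: "\<And>I. right_ideal R I \<Longrightarrow> fg_right R I" and V: "submod V"
  shows "fin_span V \<longleftrightarrow> (\<exists>bs. set bs \<subseteq> V \<and> V \<subseteq> spn bs)"
proof
  assume "fin_span V"
  then obtain bs where bs: "set bs \<subseteq> carrier M" "V \<subseteq> spn bs" unfolding fin_span_def by blast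
  obtain cs where "set cs \<subseteq> V" "V = spn cs" by (rule noetherian_submod[OF noeth bs(1) V bs(2)])
  then show "\<exists>bs. set bs \<subseteq> V \<and> V \<subseteq> spn bs" by blast
next
  assume "\<exists>bs. set bs \<subseteq> V \<and> V \<subseteq> spn bs"
  then show "fin_span V" unfolding fin_span_def using submodD(1)[OF V] by blast
qed

end

locale unital_module_hom = M: unital_module R M + N: unital_module R N
  for R :: "'s::{ring,monoid_mult} set" and M :: "('m, 's) rmodule" and N :: "('n, 's) rmodule" +
  fixes f :: "'m \<Rightarrow> 'n"
  assumes f_in: "x \<in> carrier M \<Longrightarrow> f x \<in> carrier N"
    and f_add: "\<lbrakk>x \<in> carrier M; y \<in> carrier M\<rbrakk> \<Longrightarrow> f (x \<oplus>\<^bsub>M\<^esub> y) = f x \<oplus>\<^bsub>N\<^esub> f y"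
    and f_ract: "\<lbrakk>x \<in> carrier M; r \<in> R\<rbrakk> \<Longrightarrow> f (ract M x r) = ract N (f x) r"
begin

lemma f_zero: "f \<zero>\<^bsub>M\<^esub> = \<zero>\<^bsub>N\<^esub>"
  using f_add[of "\<zero>\<^bsub>M\<^esub>" "\<zero>\<^bsub>M\<^esub>"] f_in[of "\<zero>\<^bsub>M\<^esub>"] by simp

lemma f_minus: "\<lbrakk>x \<in> carrier M; y \<in> carrier M\<rbrakk> \<Longrightarrow> f (x \<ominus>\<^bsub>M\<^esub> y) = f x \<ominus>\<^bsub>N\<^esub> f y"
  using f_add[of x "\<ominus>\<^bsub>M\<^esub> y"] f_ract[of y "-1"] M.neg_R[OF M.one_R] f_in
  by (simp add: a_minus_def M.neg_eq_ract N.neg_eq_ract M.ract_closed)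

lemma image_submod: "M.submod V \<Longrightarrow> N.submod (f ` V)"
  unfolding N.submod_def
proof (intro conjI ballI)
  assume V: "M.submod V"
  note V' = M.submodD[OF V]
  show "f ` V \<subseteq> carrier N" using V'(1) f_in by auto
  show "\<zero>\<^bsub>N\<^esub> \<in> f ` V" using V'(2) f_zero by (metis imageI)
  fix x assume "x \<in> f ` V"
  then obtain a where a: "a \<in> V" "x = f a" by blast
  { fix y assume "y \<in> f ` V"
    then obtain b where b: "b \<in> V" "y = f b" by blast
    have "x \<oplus>\<^bsub>N\<^esub> y = f (a \<oplus>\<^bsub>M\<^esub> b)" using f_add[of a b] a b subsetD[OF V'(1)] by simp
    then show "x \<oplus>\<^bsub>N\<^esub> y \<in> f ` V" using V'(3)[OF a(1) b(1)] by blast }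
  fix r assume r: "r \<in> R"
  have "ract N x r = f (ract M a r)" using f_ract[of a r] a r subsetD[OF V'(1)] by simp
  then show "ract N x r \<in> f ` V" using V'(4)[OF a(1) r] by blast
qed

lemma kernel_submod: "M.submod {x \<in> carrier M. f x = \<zero>\<^bsub>N\<^esub>}"
  unfolding M.submod_def
  by (auto simp: f_zero f_add f_ract M.ract_closed N.ract_zero_left)

lemma image_span_over: "set bs \<subseteq> carrier M \<Longrightarrow> U \<subseteq> carrier M \<Longrightarrow> f ` M.span_over U bs \<subseteq> N.span_over (f ` U) (map f bs)"
proof (induction bs)
  case (Cons b bs)
  show ?case
  proof
    fix y assume "y \<in> f ` M.span_over U (b # bs)"
    then obtain x r where x: "y = f (x \<oplus>\<^bsub>M\<^esub> ract M b r)" "x \<in> M.span_over U bs" "r \<in> R" by auto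
    have "M.span_over U bs \<subseteq> carrier M"
      by (rule M.span_over_least[OF M.submod_carrier]) (use Cons.prems in auto)
    then have xc: "x \<in> carrier M" and b: "b \<in> carrier M" using x Cons.prems by auto
    then have "y = f x \<oplus>\<^bsub>N\<^esub> ract N (f b) r" using x(1,3) f_add[OF xc M.ract_closed[OF b x(3)]] f_ract[OF b x(3)] by simp
    moreover have "f x \<in> N.span_over (f ` U) (map f bs)" using Cons x(2) by auto
    ultimately show "y \<in> N.span_over (f ` U) (map f (b # bs))" using x(3) by auto
  qed
qed simp

lemma span_over_image: "set bs \<subseteq> carrier M \<Longrightarrow> U \<subseteq> carrier M \<Longrightarrow> N.span_over (f ` U) (map f bs) \<subseteq> f ` M.span_over U bs"
proof (induction bs)
  case (Cons b bs)
  show ?case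
  proof
    fix y assume "y \<in> N.span_over (f ` U) (map f (b # bs))"
    obtain x r where x: "y = f x \<oplus>\<^bsub>N\<^esub> ract N (f b) r" "x \<in> M.span_over U bs" "r \<in> R"
    proof -
      obtain x' r where x': "y = x' \<oplus>\<^bsub>N\<^esub> ract N (f b) r" "x' \<in> N.span_over (f ` U) (map f bs)" "r \<in> R"
        using \<open>y \<in> N.span_over (f ` U) (map f (b # bs))\<close> by auto
      have "x' \<in> f ` M.span_over U bs" using Cons x'(2) by auto
      then show thesis using that x' by blast
    qed
    have "M.span_over U bs \<subseteq> carrier M"
      by (rule M.span_over_least[OF M.submod_carrier]) (use Cons.prems in auto)
    then have xc: "x \<in> carrier M" and b: "b \<in> carrier M" using x Cons.prems by auto
    then have "y = f (x \<oplus>\<^bsub>M\<^esub> ract M b r)" using x(1,3) f_add[OF xc M.ract_closed[OF b x(3)]] f_ract[OF b x(3)] by simp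
    then show "y \<in> f ` M.span_over U (b # bs)" using x(2,3) by auto
  qed
qed simp

lemma fin_span_image: "M.fin_span V \<Longrightarrow> N.fin_span (f ` V)"
proof -
  assume "M.fin_span V"
  then obtain bs where bs: "set bs \<subseteq> carrier M" "V \<subseteq> M.spn bs" unfolding M.fin_span_def by blast
  have "f ` V \<subseteq> N.spn (map f bs)" using image_span_over[OF bs(1), of "{\<zero>\<^bsub>M\<^esub>}"] bs(2) f_zero by auto
  moreover have "set (map f bs) \<subseteq> carrier N" using bs(1) f_in by auto
  ultimately show ?thesis unfolding N.fin_span_def by blast
qed

text \<open>
  Over a noetherian ring the image has finitely many generators of its own; they are lifted to \<open>V\<close>,
  and together with elements spanning the kernel the lifts span \<open>V\<close>.
\<close>

lemma fin_span_extension: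
  assumes noeth: "\<And>I. right_ideal R I \<Longrightarrow> fg_right R I" and V: "M.submod V"
    and im: "N.fin_span (f ` V)" and ker: "M.fin_span {x \<in> V. f x = \<zero>\<^bsub>N\<^esub>}"
  shows "M.fin_span V"
proof -
  note V' = M.submodD[OF V]
  obtain cs where cs: "set cs \<subseteq> f ` V" "f ` V \<subseteq> N.spn cs"
    using im N.fin_span_iff_generators[OF noeth image_submod[OF V]] by blast
  obtain ds where ds: "set ds \<subseteq> V" "cs = map f ds"
  proof -
    have "\<exists>ds. set ds \<subseteq> V \<and> cs = map f ds" using cs(1)
    proof (induction cs)
      case (Cons c cs)
      then obtain d ds where "d \<in> V" "c = f d" "set ds \<subseteq> V" "cs = map f ds" by auto
      then show ?case by (intro exI[of _ "d # ds"]) simp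
    qed simp
    then show ?thesis using that by blast
  qed
  have dc: "set ds \<subseteq> carrier M" using ds(1) V'(1) by blast
  obtain es where es: "set es \<subseteq> carrier M" "{x \<in> V. f x = \<zero>\<^bsub>N\<^esub>} \<subseteq> M.spn es" using ker unfolding M.fin_span_def by blast
  have "V \<subseteq> M.spn (ds @ es)"
  proof
    fix v assume v: "v \<in> V"
    have "f v \<in> f ` M.spn ds" using v cs(2) ds(2) span_over_image[OF dc, of "{\<zero>\<^bsub>M\<^esub>}"] f_zero by auto
    then obtain w where w: "w \<in> M.spn ds" "f v = f w" by blast
    have wV: "w \<in> V" using w(1) M.span_over_least[OF V _ ds(1), of "{\<zero>\<^bsub>M\<^esub>}"] V'(2) by auto
    have car: "v \<in> carrier M" "w \<in> carrier M" using v wV V'(1) by auto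
    have "f (v \<ominus>\<^bsub>M\<^esub> w) = \<zero>\<^bsub>N\<^esub>" using f_minus[OF car] w(2) f_in[OF car(2)] by (simp add: a_minus_def N.r_neg)
    then have "v \<ominus>\<^bsub>M\<^esub> w \<in> M.spn es" using M.submod_minus[OF V v wV] es(2) by blast
    then have "(v \<ominus>\<^bsub>M\<^esub> w) \<oplus>\<^bsub>M\<^esub> w \<in> M.spn (ds @ es)"
      using M.spn_append_subset[OF dc es(1)] w(1) M.submodD(3)[OF M.spn_submod[of "ds @ es"]] dc es(1) by auto
    then show "v \<in> M.spn (ds @ es)" using car by (simp add: a_minus_def M.a_assoc M.l_neg)
  qed
  then show ?thesis unfolding M.fin_span_def using dc es(1) by (intro exI[of _ "ds @ es"]) auto
qed

end

section \<open>Full subcategories\<close>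

lemma full_subcategory_simps [simp]:
  "Obj (full_subcategory C P) = Obj C \<inter> P" "Arr (full_subcategory C P) = Arr C"
  "cmp (full_subcategory C P) = cmp C" "idn (full_subcategory C P) = idn C"
  "plus_arr (full_subcategory C P) = plus_arr C" "zero_arr (full_subcategory C P) = zero_arr C"
  by (simp_all add: full_subcategory_def)

text \<open>
  Closure under \<open>joint\<close>, that is, under objects with a jointly injective pair of arrows into the
  subcategory, covers kernels (take the inclusion twice) and products at once.
\<close>

lemma element_category_full_subcategory:
  assumes "element_category C grp app tor"
    and joint: "\<And>Z A B p q. \<lbrakk>Z \<in> Obj C; A \<in> Obj C; A \<in> P; B \<in> Obj C; B \<in> P; p \<in> Arr C Z A; q \<in> Arr C Z B;
        \<And>i z. \<lbrakk>z \<in> carrier (grp Z i); app p i z = \<zero>\<^bsub>grp A i\<^esub>; app q i z = \<zero>\<^bsub>grp B i\<^esub>\<rbrakk> \<Longrightarrow> z = \<zero>\<^bsub>grp Z i\<^esub>\<rbrakk> \<Longrightarrow> Z \<in> P"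
    and quot: "\<And>M Q p. \<lbrakk>M \<in> Obj C; M \<in> P; Q \<in> Obj C; p \<in> Arr C M Q; \<And>i. app p i ` carrier (grp M i) = carrier (grp Q i)\<rbrakk> \<Longrightarrow> Q \<in> P"
    and zero: "\<And>Z. \<lbrakk>Z \<in> Obj C; \<And>i. carrier (grp Z i) = {\<zero>\<^bsub>grp Z i\<^esub>}\<rbrakk> \<Longrightarrow> Z \<in> P"
  shows "element_category (full_subcategory C P) grp app tor"
proof -
  interpret C: element_category C grp app tor by (rule assms(1))
  show ?thesis
  proof (rule element_category.intro, unfold full_subcategory_simps Int_iff, goal_cases)
    case 14
    then show ?case using C.zero_obj zero by auto
  next
    case (15 A B)
    then have o: "A \<in> Obj C" "B \<in> Obj C" by simp_all
    obtain Z p q where Z: "Z \<in> Obj C" "p \<in> Arr C Z A" "q \<in> Arr C Z B"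
      "(\<forall>i. \<forall>x\<in>carrier (grp A i). \<forall>y\<in>carrier (grp B i).
        \<exists>!z. z \<in> carrier (grp Z i) \<and> app p i z = x \<and> app q i z = y) \<and>
      (\<forall>X\<in>Obj C. \<forall>f\<in>Arr C X A. \<forall>g\<in>Arr C X B. \<exists>h\<in>Arr C X Z. cmp C X Z A p h = f \<and> cmp C X Z B q h = g)"
      using C.product[OF o] by (elim bexE)
    have "z = \<zero>\<^bsub>grp Z i\<^esub>" if z: "z \<in> carrier (grp Z i)" "app p i z = \<zero>\<^bsub>grp A i\<^esub>" "app q i z = \<zero>\<^bsub>grp B i\<^esub>" for i z
    proof -
      have "\<exists>!z. z \<in> carrier (grp Z i) \<and> app p i z = \<zero>\<^bsub>grp A i\<^esub> \<and> app q i z = \<zero>\<^bsub>grp B i\<^esub>"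
        using Z(4) C.nul_in[OF o(1), of i] C.nul_in[OF o(2), of i] by simp
      then show ?thesis
        using z C.nul_in[OF Z(1), of i] C.app_nul[OF Z(1) o(1) Z(2), of i] C.app_nul[OF Z(1) o(2) Z(3), of i] by metis
    qed
    then have "Z \<in> P" using 15 Z(1-3) by (intro joint[of Z A B p q]) simp_all
    then show ?case using Z by (intro bexI[of _ Z] bexI[of _ p] bexI[of _ q]) simp_all
  next
    case (16 M N f)
    then have o: "M \<in> Obj C" "N \<in> Obj C" "f \<in> Arr C M N" by simp_all
    obtain K k where K: "K \<in> Obj C" "k \<in> Arr C K M" "is_kernel C M N f K k"
      "\<And>i. inj_on (app k i) (C.E K i)" "\<And>i. app k i ` C.E K i = {x \<in> C.E M i. app f i x = C.nul N i}"
      by (rule C.concrete_kernel[OF o]) (rule that)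
    have "z = C.nul K i" if "z \<in> C.E K i" "app k i z = C.nul M i" for i z
      using C.inj_on_iff_kernel[OF K(1) o(1) K(2), of i] K(4)[of i] that by simp
    then have "K \<in> P" using 16 K(1,2) by (intro joint[of K M M k k]) simp_all
    then show ?case using K by (intro bexI[of _ K] bexI[of _ k]) simp_all
  next
    case (17 M N f)
    then have o: "M \<in> Obj C" "N \<in> Obj C" "f \<in> Arr C M N" by simp_all
    obtain Q p where Q: "Q \<in> Obj C" "p \<in> Arr C N Q" "is_cokernel C M N f Q p"
      "\<And>i. app p i ` C.E N i = C.E Q i" "\<And>i. {x \<in> C.E N i. app p i x = C.nul Q i} = app f i ` C.E M i"
      by (rule C.concrete_cokernel[OF o]) (rule that)
    have "Q \<in> P" using 17 Q(1,2,4) by (intro quot[of N Q p]) simp_all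
    then show ?case using Q by (intro bexI[of _ Q] bexI[of _ p]) simp_all
  next
    case (18 X K M f j) then show ?case by (intro C.lift) simp_all
  next
    case (19 M Q X f p) then show ?case by (intro C.descend) simp_all
  next
    case (23 M N f x i) show ?case by (rule C.tor_extension[OF _ _ 23(3-6)]) (use 23(1,2) in simp_all)
  next
    case (4 M N f g) show ?case by (rule C.arr_eqI[OF _ _ 4(3-5)]) (use 4(1,2) in simp_all)
  qed (auto simp: C.grp C.app_in C.app_add C.idn_arr C.app_idn C.cmp_arr C.app_cmp C.plus_arr C.app_plus
      C.zero_arr C.app_zero C.neg_arr C.tor_zero C.tor_add C.tor_image)
qed

section \<open>Transport of structure\<close>

text \<open>
  The structure that turns \<open>r\<close> into a homomorphism onto its image, for \<open>r\<close> compatible with the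
  operations. It serves both for quotients and for moving a structure into another universe.
\<close>

definition push_group :: "('x \<Rightarrow> 'm) \<Rightarrow> ('x, 'e) ring_scheme \<Rightarrow> 'm ring" where
  "push_group r G = \<lparr>carrier = r ` carrier G, monoid.mult = undefined, one = undefined, zero = r \<zero>\<^bsub>G\<^esub>,
     add = (\<lambda>u v. r (inv_into (carrier G) r u \<oplus>\<^bsub>G\<^esub> inv_into (carrier G) r v))\<rparr>"

lemma abelian_group_image:
  assumes "abelian_group G" and sur: "carrier H = r ` carrier G"
    and add: "\<And>x y. \<lbrakk>x \<in> carrier G; y \<in> carrier G\<rbrakk> \<Longrightarrow> r (x \<oplus>\<^bsub>G\<^esub> y) = r x \<oplus>\<^bsub>H\<^esub> r y"
    and zero: "r \<zero>\<^bsub>G\<^esub> = \<zero>\<^bsub>H\<^esub>"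
  shows "abelian_group H"
proof -
  interpret G: abelian_group G by (rule assms(1))
  have a: "r x \<oplus>\<^bsub>H\<^esub> r y = r (x \<oplus>\<^bsub>G\<^esub> y)" if "x \<in> carrier G" "y \<in> carrier G" for x y
    using add[OF that] by simp
  show ?thesis
  proof (rule abelian_groupI; unfold sur; (elim imageE)?; hypsubst_thin?)
    show "\<zero>\<^bsub>H\<^esub> \<in> r ` carrier G" using zero by (metis G.zero_closed imageI)
    fix x y z assume "x \<in> carrier G" "y \<in> carrier G" "z \<in> carrier G"
    then show "r x \<oplus>\<^bsub>H\<^esub> r y \<oplus>\<^bsub>H\<^esub> r z = r x \<oplus>\<^bsub>H\<^esub> (r y \<oplus>\<^bsub>H\<^esub> r z)" by (simp add: a G.a_assoc)
  next
    fix x y assume "x \<in> carrier G" "y \<in> carrier G"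
    then show "r x \<oplus>\<^bsub>H\<^esub> r y \<in> r ` carrier G" "r x \<oplus>\<^bsub>H\<^esub> r y = r y \<oplus>\<^bsub>H\<^esub> r x" by (simp_all add: a G.a_comm)
  next
    fix x assume x: "x \<in> carrier G"
    then show "\<zero>\<^bsub>H\<^esub> \<oplus>\<^bsub>H\<^esub> r x = r x" using a[of "\<zero>\<^bsub>G\<^esub>" x] by (simp add: zero)
    show "\<exists>y\<in>r ` carrier G. y \<oplus>\<^bsub>H\<^esub> r x = \<zero>\<^bsub>H\<^esub>"
      using a[of "\<ominus>\<^bsub>G\<^esub> x" x] x by (intro bexI[of _ "r (\<ominus>\<^bsub>G\<^esub> x)"]) (simp_all add: G.l_neg zero)
  qed
qed

locale additive_congruence = abelian_group G for G :: "('x, 'e) ring_scheme" (structure) +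
  fixes r :: "'x \<Rightarrow> 'm"
  assumes add_cong: "\<lbrakk>x \<in> carrier G; x' \<in> carrier G; y \<in> carrier G; y' \<in> carrier G; r x = r x'; r y = r y'\<rbrakk>
    \<Longrightarrow> r (x \<oplus> y) = r (x' \<oplus> y')"
begin

lemma push_carrier [simp]: "carrier (push_group r G) = r ` carrier G"
  by (simp add: push_group_def)

lemma push_zero [simp]: "\<zero>\<^bsub>push_group r G\<^esub> = r \<zero>"
  by (simp add: push_group_def)

lemma inv_r: "x \<in> carrier G \<Longrightarrow> inv_into (carrier G) r (r x) \<in> carrier G" "x \<in> carrier G \<Longrightarrow> r (inv_into (carrier G) r (r x)) = r x"
  by (simp_all add: inv_into_into f_inv_into_f)

lemma push_add: "\<lbrakk>x \<in> carrier G; y \<in> carrier G\<rbrakk> \<Longrightarrow> r x \<oplus>\<^bsub>push_group r G\<^esub> r y = r (x \<oplus> y)"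
  using add_cong[OF inv_r(1) _ inv_r(1)] inv_r by (simp add: push_group_def)

end

definition prod_group :: "('x, 'e) ring_scheme \<Rightarrow> ('y, 'f) ring_scheme \<Rightarrow> ('x \<times> 'y) ring" where
  "prod_group A B = \<lparr>carrier = carrier A \<times> carrier B, monoid.mult = undefined, one = undefined, zero = (\<zero>\<^bsub>A\<^esub>, \<zero>\<^bsub>B\<^esub>),
     add = (\<lambda>(x, y) (x', y'). (x \<oplus>\<^bsub>A\<^esub> x', y \<oplus>\<^bsub>B\<^esub> y'))\<rparr>"

lemma prod_group_simps [simp]:
  "carrier (prod_group A B) = carrier A \<times> carrier B" "\<zero>\<^bsub>prod_group A B\<^esub> = (\<zero>\<^bsub>A\<^esub>, \<zero>\<^bsub>B\<^esub>)"
  "(x, y) \<oplus>\<^bsub>prod_group A B\<^esub> (x', y') = (x \<oplus>\<^bsub>A\<^esub> x', y \<oplus>\<^bsub>B\<^esub> y')"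
  by (simp_all add: prod_group_def)

lemma abelian_group_prod:
  assumes "abelian_group A" "abelian_group B"
  shows "abelian_group (prod_group A B)"
proof -
  interpret A: abelian_group A by (rule assms)
  interpret B: abelian_group B by (rule assms)
  show ?thesis
  proof (rule abelian_groupI)
    fix x assume "x \<in> carrier (prod_group A B)"
    then show "\<exists>y\<in>carrier (prod_group A B). y \<oplus>\<^bsub>prod_group A B\<^esub> x = \<zero>\<^bsub>prod_group A B\<^esub>"
      by (cases x) (auto intro!: bexI[of _ "\<ominus>\<^bsub>A\<^esub> fst x"] bexI[of _ "\<ominus>\<^bsub>B\<^esub> snd x"] simp: A.l_neg B.l_neg)
  qed (auto simp: A.a_ac B.a_ac)
qed

lemma abelian_group_sub:
  assumes "abelian_group G" "V \<subseteq> carrier G" "\<zero>\<^bsub>G\<^esub> \<in> V" "\<And>x y. \<lbrakk>x \<in> V; y \<in> V\<rbrakk> \<Longrightarrow> x \<oplus>\<^bsub>G\<^esub> y \<in> V"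
    "\<And>x. x \<in> V \<Longrightarrow> \<ominus>\<^bsub>G\<^esub> x \<in> V"
  shows "abelian_group (G\<lparr>carrier := V\<rparr>)"
proof -
  interpret G: abelian_group G by (rule assms(1))
  note V = subsetD[OF assms(2)]
  show ?thesis
  proof (rule abelian_groupI)
    fix x assume "x \<in> carrier (G\<lparr>carrier := V\<rparr>)"
    then show "\<exists>y\<in>carrier (G\<lparr>carrier := V\<rparr>). y \<oplus>\<^bsub>G\<lparr>carrier := V\<rparr>\<^esub> x = \<zero>\<^bsub>G\<lparr>carrier := V\<rparr>\<^esub>"
      using assms(5) V by (auto intro!: bexI[of _ "\<ominus>\<^bsub>G\<^esub> x"] simp: G.l_neg)
  qed (use assms V in \<open>simp_all add: G.a_ac\<close>)
qed

text \<open>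
  Products of modules have to be formed inside the universe \<open>'m\<close>, by means of an injection from
  \<open>'m \<times> 'm\<close>. If \<open>'m\<close> is finite there is none, but then all modules are zero (\<open>inj_on_pairing\<close>).
\<close>

definition pairing :: "'m \<times> 'm \<Rightarrow> 'm" where
  "pairing = (SOME p. infinite (UNIV :: 'm set) \<longrightarrow> inj p)"

lemma inj_pairing:
  assumes "infinite (UNIV :: 'm set)"
  shows "inj (pairing :: 'm \<times> 'm \<Rightarrow> 'm)"
proof -
  have "(card_of ((UNIV :: 'm set) \<times> (UNIV :: 'm set)), card_of (UNIV :: 'm set)) \<in> ordLeq"
    using card_of_Times_same_infinite[OF assms] ordIso_iff_ordLeq by blast
  then have "\<exists>p :: 'm \<times> 'm \<Rightarrow> 'm. inj p"
    unfolding card_of_ordLeq[symmetric] by auto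
  then have "\<exists>p :: 'm \<times> 'm \<Rightarrow> 'm. infinite (UNIV :: 'm set) \<longrightarrow> inj p" by blast
  from someI_ex[OF this] show ?thesis using assms by (simp add: pairing_def)
qed

section \<open>Torsion over a noetherian algebra\<close>

locale noetherian_algebra = k_algebra scale
  for scale :: "'k::field_char_0 \<Rightarrow> 's::{ring,monoid_mult} \<Rightarrow> 's" +
  fixes R :: "'s set"
  assumes one_R: "1 \<in> R" and diff_R: "\<lbrakk>r \<in> R; s \<in> R\<rbrakk> \<Longrightarrow> r - s \<in> R" and mult_R: "\<lbrakk>r \<in> R; s \<in> R\<rbrakk> \<Longrightarrow> r * s \<in> R"
    and scale_R: "r \<in> R \<Longrightarrow> scale c r \<in> R"
    and noeth_R: "right_ideal R I \<Longrightarrow> fg_right R I"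
begin

text \<open>
  The scalars inside the algebra. A \<open>k\<close>-subspace is a submodule over this subring, which is noetherian,
  so that finite dimensionality is an instance of \<open>fin_span\<close>.
\<close>

definition scalars :: "'s set" where
  "scalars = range (\<lambda>c. scale c 1)"

lemma scalars_R: "scalars \<subseteq> R"
  using scale_R[OF one_R] by (auto simp: scalars_def)

lemma scalar_central: "a \<in> scalars \<Longrightarrow> a * s = s * a"
  by (auto simp: scalars_def scale_mult_left scale_mult_right)

lemma unital_R: "right_module R M \<Longrightarrow> unital_module R M"
  by (intro unital_module.intro unital_module_axioms.intro one_R diff_R mult_R)

lemma unital_scalars:
  assumes "right_module R M"
  shows "unital_module scalars M"
proof -
  interpret right_module R M by (rule assms)
  have sub: "a \<in> R" if "a \<in> scalars" for a using scalars_R that by blast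
  show ?thesis
  proof
    fix x a b assume x: "x \<in> carrier M" and ab: "a \<in> scalars" "b \<in> scalars"
    show "ract M x a \<in> carrier M" using x ab sub ract_closed by blast
    show "ract M x (a + b) = ract M x a \<oplus>\<^bsub>M\<^esub> ract M x b" using x ab sub ract_add_right by blast
    show "ract M x (a * b) = ract M (ract M x a) b" using x ab sub ract_mult by blast
  next
    fix x y a assume "x \<in> carrier M" "y \<in> carrier M" "a \<in> scalars"
    then show "ract M (x \<oplus>\<^bsub>M\<^esub> y) a = ract M x a \<oplus>\<^bsub>M\<^esub> ract M y a" using sub ract_add_left by blast
  next
    fix x assume "x \<in> carrier M" then show "ract M x 1 = x" by (rule ract_one)
  next
    show "1 \<in> scalars" unfolding scalars_def by (rule range_eqI[of _ _ 1]) simp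
    fix a b assume "a \<in> scalars" "b \<in> scalars"
    then obtain c d where cd: "a = scale c 1" "b = scale d 1" by (auto simp: scalars_def)
    show "a - b \<in> scalars" unfolding scalars_def cd by (rule range_eqI[of _ _ "c - d"]) (simp add: scale_left_diff_distrib)
    show "a * b \<in> scalars" unfolding scalars_def cd by (rule range_eqI[of _ _ "c * d"]) (simp add: scale_mult_left)
  qed
qed

text \<open>
  A nonzero ideal contains a nonzero scalar, hence \<open>1\<close>.
\<close>

lemma noeth_scalars:
  assumes "right_ideal scalars I"
  shows "fg_right scalars I"
proof (cases "I \<subseteq> {0}")
  case True
  then have "I = {0}" using assms by (auto simp: right_ideal_def)
  then show ?thesis unfolding fg_right_def by (intro exI[of _ "{}"]) auto
next
  case False
  then obtain a where a: "a \<in> I" "a \<noteq> 0" by blast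
  then obtain c where c: "a = scale c 1" using assms by (auto simp: right_ideal_def scalars_def)
  have "c \<noteq> 0" using a c by auto
  then have "a * scale (inverse c) 1 = 1" by (simp add: c scale_mult_left)
  then have 1: "1 \<in> I" using a(1) assms unfolding right_ideal_def scalars_def by (metis rangeI)
  have I: "I = scalars"
  proof
    show "I \<subseteq> scalars" using assms by (simp add: right_ideal_def)
    have "1 * s \<in> I" if "s \<in> scalars" for s using 1 assms that unfolding right_ideal_def by blast
    then show "scalars \<subseteq> I" by auto
  qed
  have "scalars = {\<Sum>b\<in>{1}. b * r b | r. r \<in> {1} \<rightarrow> scalars}"
    by (auto intro!: exI[of _ "\<lambda>_. _"])
  then show ?thesis unfolding fg_right_def I using 1 I by (intro exI[of _ "{1}"]) auto
qed

definition finite_dim :: "('m, 's) rmodule \<Rightarrow> 'm set \<Rightarrow> bool" where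
  "finite_dim M V = unital_module.fin_span scalars M V"

lemma finite_dim_in_iff:
  assumes M: "right_module R M" and V: "unital_module.submod scalars M V"
  shows "finite_dim_in scale M V \<longleftrightarrow> finite_dim M V"
proof -
  interpret M: unital_module scalars M by (rule unital_scalars[OF M])
  have VM: "V \<subseteq> carrier M" using M.submodD(1)[OF V] .
  have "finite_dim_in scale M V \<longleftrightarrow>
    (\<exists>B. finite B \<and> B \<subseteq> V \<and> (\<forall>x\<in>V. \<exists>r\<in>B \<rightarrow> scalars. x = (\<Oplus>\<^bsub>M\<^esub>b\<in>B. ract M b (r b))))"
    unfolding finite_dim_in_def
  proof (intro ex_cong1 conj_cong refl ball_cong iffI)
    fix B v assume B: "finite B" "B \<subseteq> V"
    { assume "\<exists>c. v = (\<Oplus>\<^bsub>M\<^esub>b\<in>B. ract M b (scale (c b) 1))"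
      then obtain c where "v = (\<Oplus>\<^bsub>M\<^esub>b\<in>B. ract M b (scale (c b) 1))" by blast
      then show "\<exists>r\<in>B \<rightarrow> scalars. v = (\<Oplus>\<^bsub>M\<^esub>b\<in>B. ract M b (r b))"
        by (intro bexI[of _ "\<lambda>b. scale (c b) 1"]) (auto simp: scalars_def) }
    assume "\<exists>r\<in>B \<rightarrow> scalars. v = (\<Oplus>\<^bsub>M\<^esub>b\<in>B. ract M b (r b))"
    then obtain r where r: "r \<in> B \<rightarrow> scalars" "v = (\<Oplus>\<^bsub>M\<^esub>b\<in>B. ract M b (r b))" by blast
    have "\<forall>b\<in>B. \<exists>c. r b = scale c 1" using r(1) by (auto simp: scalars_def)
    then obtain c where c: "\<And>b. b \<in> B \<Longrightarrow> r b = scale (c b) 1" by metis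
    have "(\<Oplus>\<^bsub>M\<^esub>b\<in>B. ract M b (r b)) = (\<Oplus>\<^bsub>M\<^esub>b\<in>B. ract M b (scale (c b) 1))"
    proof (rule M.finsum_cong')
      show "(\<lambda>b. ract M b (scale (c b) 1)) \<in> B \<rightarrow> carrier M"
      proof
        fix b assume "b \<in> B"
        then have "b \<in> carrier M" using B(2) VM by blast
        then show "ract M b (scale (c b) 1) \<in> carrier M" by (rule M.ract_closed) (unfold scalars_def, rule rangeI)
      qed
    qed (simp_all add: c)
    then show "\<exists>c. v = (\<Oplus>\<^bsub>M\<^esub>b\<in>B. ract M b (scale (c b) 1))" using r(2) by auto
  qed
  also have "\<dots> \<longleftrightarrow> (\<exists>bs. set bs \<subseteq> V \<and> V \<subseteq> M.spn bs)" by (rule M.generated_by_finite_iff[OF VM])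
  also have "\<dots> \<longleftrightarrow> finite_dim M V"
    unfolding finite_dim_def by (rule M.fin_span_iff_generators[OF noeth_scalars V, symmetric])
  finally show ?thesis .
qed

lemma fg_module_iff:
  assumes M: "right_module R M"
  shows "fg_module R M \<longleftrightarrow> unital_module.fin_span R M (carrier M)"
proof -
  interpret M: unital_module R M by (rule unital_R[OF M])
  show ?thesis unfolding fg_module_def M.generated_by_finite_iff[OF subset_refl] M.fin_span_def ..
qed

abbreviation orbit :: "('m, 's) rmodule \<Rightarrow> 'm \<Rightarrow> 'm set" where
  "orbit M y \<equiv> {ract M y r | r. r \<in> R}"

lemma submod_scalars: "right_module R M \<Longrightarrow> unital_module.submod R M V \<Longrightarrow> unital_module.submod scalars M V"
  using scalars_R by (auto simp: unital_module.submod_def[OF unital_R] unital_module.submod_def[OF unital_scalars])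

lemma orbit_submod:
  assumes "right_module R M" "y \<in> carrier M"
  shows "unital_module.submod R M (orbit M y)"
proof -
  interpret M: unital_module R M by (rule unital_R[OF assms(1)])
  have "\<zero>\<^bsub>M\<^esub> = ract M y 0" using M.ract_zero_right assms(2) by simp
  then have "\<zero>\<^bsub>M\<^esub> \<in> orbit M y" using M.zero_R by blast
  moreover have "a \<oplus>\<^bsub>M\<^esub> b \<in> orbit M y" if "a \<in> orbit M y" "b \<in> orbit M y" for a b
    using that M.ract_add_right[OF assms(2), symmetric] M.add_R by auto
  moreover have "ract M a s \<in> orbit M y" if "a \<in> orbit M y" "s \<in> R" for a s
    using that M.ract_mult[OF assms(2), symmetric] mult_R by auto
  ultimately show ?thesis unfolding M.submod_def using M.ract_closed[OF assms(2)] by auto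
qed

lemma torsion_element_iff:
  assumes "right_module R M" "y \<in> carrier M"
  shows "torsion_element scale R M y \<longleftrightarrow> finite_dim M (orbit M y)"
  unfolding torsion_element_def
  by (rule finite_dim_in_iff[OF assms(1) submod_scalars[OF assms(1) orbit_submod[OF assms]]])

text \<open>
  The multiples of \<open>x\<close> by the infinitely many scalars are distinct.
\<close>

lemma infinite_carrier:
  assumes "right_module R M" "x \<in> carrier M" "x \<noteq> \<zero>\<^bsub>M\<^esub>"
  shows "infinite (carrier M)"
proof -
  interpret M: unital_module scalars M by (rule unital_scalars[OF assms(1)])
  have sc: "scale c 1 \<in> scalars" for c unfolding scalars_def by (rule rangeI)
  have "inj (\<lambda>c. ract M x (scale c 1))"
  proof (rule injI, rule ccontr)
    fix c d assume e: "ract M x (scale c 1) = ract M x (scale d 1)" and "c \<noteq> d"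
    let ?a = "scale c 1 - scale d 1" and ?b = "scale (inverse (c - d)) 1"
    have "?a * ?b = 1"
      using \<open>c \<noteq> d\<close> by (simp add: scale_mult_left flip: scale_left_diff_distrib)
    moreover have "ract M x ?a = \<zero>\<^bsub>M\<^esub>"
      using M.ract_add_right[OF assms(2) sc M.neg_R[OF sc], of c d] M.ract_minus_right[OF assms(2) sc, of d] e
        M.ract_closed[OF assms(2) sc] by (simp add: M.r_neg)
    moreover have "ract M x (?a * ?b) = ract M (ract M x ?a) ?b"
      by (rule M.ract_mult[OF assms(2) M.diff_R[OF sc sc] sc])
    ultimately have "x = \<zero>\<^bsub>M\<^esub>" using M.ract_one[OF assms(2)] M.ract_zero_left[OF sc] by simp
    then show False using assms(3) by simp
  qed
  then have "infinite (range (\<lambda>c. ract M x (scale c 1)))"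
    using infinite_UNIV_char_0 finite_imageD by blast
  moreover have "range (\<lambda>c. ract M x (scale c 1)) \<subseteq> carrier M" using M.ract_closed[OF assms(2) sc] by blast
  ultimately show ?thesis using finite_subset by blast
qed

lemma inj_on_pairing:
  assumes "right_module R M" "right_module R N"
  shows "inj_on pairing (carrier M \<times> carrier N)"
proof (cases "infinite (UNIV :: 'a set)")
  case True then show ?thesis using inj_pairing inj_on_subset by blast
next
  case False
  then have fin: "finite A" for A :: "'a set" using finite_subset subset_UNIV by blast
  have "x = \<zero>\<^bsub>M\<^esub>" if "x \<in> carrier M" for x using infinite_carrier[OF assms(1) that] fin by blast
  moreover have "x = \<zero>\<^bsub>N\<^esub>" if "x \<in> carrier N" for x using infinite_carrier[OF assms(2) that] fin by blast
  ultimately show ?thesis by (auto simp: inj_on_def)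
qed

end

section \<open>Quotients, products and torsion of modules\<close>

text \<open>
  A chosen element of the coset of \<open>x\<close> modulo \<open>U\<close>, so that quotients stay in the universe of the module.
\<close>

definition coset_rep :: "('m, 'e) ring_scheme \<Rightarrow> 'm set \<Rightarrow> 'm \<Rightarrow> 'm" where
  "coset_rep G U x = (SOME y. \<exists>u\<in>U. y = x \<oplus>\<^bsub>G\<^esub> u)"

lemma (in abelian_group) coset_rep_eq_iff:
  assumes U: "U \<subseteq> carrier G" "\<zero> \<in> U" "\<And>x y. \<lbrakk>x \<in> U; y \<in> U\<rbrakk> \<Longrightarrow> x \<oplus> y \<in> U" "\<And>x. x \<in> U \<Longrightarrow> \<ominus> x \<in> U"
    and x: "x \<in> carrier G" "x' \<in> carrier G"
  shows "coset_rep G U x = coset_rep G U x' \<longleftrightarrow> x \<ominus> x' \<in> U"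
proof
  have rep: "\<exists>u\<in>U. coset_rep G U y = y \<oplus> u" if "y \<in> carrier G" for y
    unfolding coset_rep_def by (rule someI[of "\<lambda>z. \<exists>u\<in>U. z = y \<oplus> u" y]) (use that U(2) in \<open>auto intro!: bexI[of _ \<zero>]\<close>)
  assume e: "coset_rep G U x = coset_rep G U x'"
  obtain u u' where u: "u \<in> U" "u' \<in> U" "x \<oplus> u = x' \<oplus> u'" using rep[OF x(1)] rep[OF x(2)] e by auto
  have c: "u \<in> carrier G" "u' \<in> carrier G" using u U(1) by auto
  have "x = (x \<oplus> u) \<oplus> \<ominus> u" using x c by (simp add: a_assoc r_neg)
  also have "\<dots> = x' \<oplus> (u' \<oplus> \<ominus> u)" using x c u(3) by (simp add: a_assoc)
  finally have "x = (u' \<oplus> \<ominus> u) \<oplus> x'" using x c by (simp add: a_comm)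
  then have "x \<ominus> x' = ((u' \<oplus> \<ominus> u) \<oplus> x') \<oplus> \<ominus> x'" by (simp add: a_minus_def)
  also have "\<dots> = u' \<oplus> \<ominus> u" using x c by (simp add: a_assoc r_neg)
  finally have "x \<ominus> x' = u' \<oplus> \<ominus> u" .
  then show "x \<ominus> x' \<in> U" using U(3,4) u by simp
next
  assume d: "x \<ominus> x' \<in> U"
  have *: "(\<exists>u\<in>U. y = a \<oplus> u) \<Longrightarrow> (\<exists>u\<in>U. y = b \<oplus> u)" if "a \<ominus> b \<in> U" "a \<in> carrier G" "b \<in> carrier G" for a b y
  proof -
    assume "\<exists>u\<in>U. y = a \<oplus> u"
    then obtain u where u: "u \<in> U" "y = a \<oplus> u" by blast
    have uG: "u \<in> carrier G" using u(1) U(1) by blast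
    then have "b \<oplus> ((a \<ominus> b) \<oplus> u) = (b \<oplus> \<ominus> b) \<oplus> (a \<oplus> u)" using that by (simp add: a_minus_def a_ac)
    then have "y = b \<oplus> ((a \<ominus> b) \<oplus> u)" using that uG u(2) by (simp add: r_neg)
    then show "\<exists>u\<in>U. y = b \<oplus> u" using U(3)[OF that(1) u(1)] by blast
  qed
  have "x' \<ominus> x = \<ominus> (x \<ominus> x')" using x by (simp add: a_minus_def minus_add a_comm)
  then have d': "x' \<ominus> x \<in> U" using U(4)[OF d] by simp
  have "(\<lambda>y. \<exists>u\<in>U. y = x \<oplus> u) = (\<lambda>y. \<exists>u\<in>U. y = x' \<oplus> u)"
    by (rule ext) (use *[OF d x] *[OF d' x(2,1)] in blast)
  then show "coset_rep G U x = coset_rep G U x'" by (simp add: coset_rep_def)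
qed

lemma right_module_image:
  assumes "right_module R M" and sur: "carrier N = r ` carrier M"
    and add: "\<And>x y. \<lbrakk>x \<in> carrier M; y \<in> carrier M\<rbrakk> \<Longrightarrow> r (x \<oplus>\<^bsub>M\<^esub> y) = r x \<oplus>\<^bsub>N\<^esub> r y"
    and zero: "r \<zero>\<^bsub>M\<^esub> = \<zero>\<^bsub>N\<^esub>"
    and ract: "\<And>x s. \<lbrakk>x \<in> carrier M; s \<in> R\<rbrakk> \<Longrightarrow> r (ract M x s) = ract N (r x) s"
    and R: "1 \<in> R" "\<And>s t. \<lbrakk>s \<in> R; t \<in> R\<rbrakk> \<Longrightarrow> s + t \<in> R" "\<And>s t. \<lbrakk>s \<in> R; t \<in> R\<rbrakk> \<Longrightarrow> s * t \<in> R"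
  shows "right_module R N"
proof -
  interpret M: right_module R M by (rule assms(1))
  have "abelian_group N" by (rule abelian_group_image[OF M.abelian_group_axioms sur add zero])
  note a = add[symmetric] and b = ract[symmetric]
  show ?thesis
  proof (intro right_module.intro right_module_axioms.intro \<open>abelian_group N\<close>; unfold sur; (elim imageE)?; hypsubst_thin?)
    fix x s assume "x \<in> carrier M" "s \<in> R"
    then show "ract N (r x) s \<in> r ` carrier M" by (simp add: b M.ract_closed)
  next
    fix x y s assume "x \<in> carrier M" "y \<in> carrier M" "s \<in> R"
    then show "ract N (r x \<oplus>\<^bsub>N\<^esub> r y) s = ract N (r x) s \<oplus>\<^bsub>N\<^esub> ract N (r y) s"
      by (simp add: a b M.ract_closed M.ract_add_left)
  next
    fix x s t assume "x \<in> carrier M" "s \<in> R" "t \<in> R"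
    then show "ract N (r x) (s + t) = ract N (r x) s \<oplus>\<^bsub>N\<^esub> ract N (r x) t" "ract N (r x) (s * t) = ract N (ract N (r x) s) t"
      by (simp_all add: a b M.ract_closed M.ract_add_right M.ract_mult R)
  next
    fix x assume "x \<in> carrier M"
    then show "ract N (r x) 1 = r x" by (simp add: b R M.ract_one)
  qed
qed

definition push_module :: "('x \<Rightarrow> 'm) \<Rightarrow> ('x, 's) rmodule \<Rightarrow> ('m, 's) rmodule" where
  "push_module r M = \<lparr>carrier = carrier (push_group r M), monoid.mult = undefined, one = undefined,
     zero = \<zero>\<^bsub>push_group r M\<^esub>, add = add (push_group r M),
     ract = (\<lambda>u s. r (ract M (inv_into (carrier M) r u) s))\<rparr>"

definition prod_module :: "('x, 's) rmodule \<Rightarrow> ('y, 's) rmodule \<Rightarrow> ('x \<times> 'y, 's) rmodule" where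
  "prod_module A B = \<lparr>carrier = carrier (prod_group A B), monoid.mult = undefined, one = undefined,
     zero = \<zero>\<^bsub>prod_group A B\<^esub>, add = add (prod_group A B), ract = (\<lambda>(x, y) s. (ract A x s, ract B y s))\<rparr>"

lemma prod_module_simps [simp]:
  "carrier (prod_module A B) = carrier A \<times> carrier B" "\<zero>\<^bsub>prod_module A B\<^esub> = (\<zero>\<^bsub>A\<^esub>, \<zero>\<^bsub>B\<^esub>)"
  "(x, y) \<oplus>\<^bsub>prod_module A B\<^esub> (x', y') = (x \<oplus>\<^bsub>A\<^esub> x', y \<oplus>\<^bsub>B\<^esub> y')"
  "ract (prod_module A B) (x, y) s = (ract A x s, ract B y s)"
  by (simp_all add: prod_module_def)

lemma abelian_group_cong:
  assumes "abelian_group G" "carrier H = carrier G" "\<zero>\<^bsub>H\<^esub> = \<zero>\<^bsub>G\<^esub>" "add H = add G"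
  shows "abelian_group H"
  by (rule abelian_group_image[OF assms(1), of _ "\<lambda>x. x"]) (simp_all add: assms)

lemma right_module_prod:
  assumes "right_module R A" "right_module R B"
  shows "right_module R (prod_module A B)"
proof -
  interpret A: right_module R A by (rule assms)
  interpret B: right_module R B by (rule assms)
  have "abelian_group (prod_module A B)"
    by (rule abelian_group_cong[OF abelian_group_prod[OF A.abelian_group_axioms B.abelian_group_axioms]])
      (simp_all add: prod_module_def)
  then show ?thesis
    by (intro right_module.intro right_module_axioms.intro)
      (auto simp: A.ract_closed B.ract_closed A.ract_add_left B.ract_add_left A.ract_add_right B.ract_add_right
        A.ract_mult B.ract_mult A.ract_one B.ract_one)
qed

locale module_congruence = unital_module R M for R and M :: "('x, 's::{ring,monoid_mult}) rmodule" (structure) +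
  fixes r :: "'x \<Rightarrow> 'm"
  assumes add_cong: "\<lbrakk>x \<in> carrier M; x' \<in> carrier M; y \<in> carrier M; y' \<in> carrier M; r x = r x'; r y = r y'\<rbrakk>
    \<Longrightarrow> r (x \<oplus> y) = r (x' \<oplus> y')"
    and ract_cong: "\<lbrakk>x \<in> carrier M; x' \<in> carrier M; s \<in> R; r x = r x'\<rbrakk> \<Longrightarrow> r (ract M x s) = r (ract M x' s)"
begin

sublocale ac: additive_congruence M r
  by unfold_locales (rule add_cong)

lemma push_simps [simp]:
  "carrier (push_module r M) = r ` carrier M" "\<zero>\<^bsub>push_module r M\<^esub> = r \<zero>"
  by (simp_all add: push_module_def)

lemma push_add: "\<lbrakk>x \<in> carrier M; y \<in> carrier M\<rbrakk> \<Longrightarrow> r x \<oplus>\<^bsub>push_module r M\<^esub> r y = r (x \<oplus> y)"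
  using ac.push_add by (simp add: push_module_def)

lemma push_ract: "\<lbrakk>x \<in> carrier M; s \<in> R\<rbrakk> \<Longrightarrow> ract (push_module r M) (r x) s = r (ract M x s)"
  using ract_cong[OF ac.inv_r(1)] ac.inv_r by (simp add: push_module_def)

lemma push_right_module: "right_module R (push_module r M)"
  by (rule right_module_image[OF right_module_axioms, of _ r])
    (simp_all add: push_add push_ract one_R mult_R add_R)

end

lemma (in unital_module) right_module_sub:
  assumes "submod V"
  shows "right_module R (M\<lparr>carrier := V\<rparr>)"
proof -
  note V = submodD[OF assms]
  have "abelian_group (M\<lparr>carrier := V\<rparr>)"
    by (rule abelian_group_sub[OF abelian_group_axioms V(1,2,3) submod_neg[OF assms]])
  then show ?thesis
    using V(4) subsetD[OF V(1)]
    by (intro right_module.intro right_module_axioms.intro)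
      (simp_all add: ract_add_left ract_add_right ract_mult ract_one)
qed

lemma Obj_Mod [simp]: "M \<in> Obj (Mod R) \<longleftrightarrow> right_module R M"
  by (simp add: Mod_def)

lemma Arr_Mod: "f \<in> Arr (Mod R) M N \<longleftrightarrow> f \<in> carrier M \<rightarrow>\<^sub>E carrier N \<and>
    (\<forall>x\<in>carrier M. \<forall>y\<in>carrier M. f (x \<oplus>\<^bsub>M\<^esub> y) = f x \<oplus>\<^bsub>N\<^esub> f y) \<and>
    (\<forall>x\<in>carrier M. \<forall>r\<in>R. f (ract M x r) = ract N (f x) r)"
  by (simp add: Mod_def)

lemma Mod_simps [simp]:
  "cmp (Mod R) M N P g f = compose (carrier M) g f" "idn (Mod R) M = (\<lambda>x\<in>carrier M. x)"
  "plus_arr (Mod R) M N f g = (\<lambda>x\<in>carrier M. f x \<oplus>\<^bsub>N\<^esub> g x)" "zero_arr (Mod R) M N = (\<lambda>x\<in>carrier M. \<zero>\<^bsub>N\<^esub>)"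
  by (simp_all add: Mod_def)

lemma Arr_ModD:
  assumes "f \<in> Arr (Mod R) M N"
  shows "x \<in> carrier M \<Longrightarrow> f x \<in> carrier N" "\<lbrakk>x \<in> carrier M; y \<in> carrier M\<rbrakk> \<Longrightarrow> f (x \<oplus>\<^bsub>M\<^esub> y) = f x \<oplus>\<^bsub>N\<^esub> f y"
    "\<lbrakk>x \<in> carrier M; r \<in> R\<rbrakk> \<Longrightarrow> f (ract M x r) = ract N (f x) r" "f \<in> extensional (carrier M)"
  using assms by (auto simp: Arr_Mod PiE_def)

lemma Arr_ModI:
  assumes "\<And>x. x \<in> carrier M \<Longrightarrow> f x \<in> carrier N" "\<And>x y. \<lbrakk>x \<in> carrier M; y \<in> carrier M\<rbrakk> \<Longrightarrow> f (x \<oplus>\<^bsub>M\<^esub> y) = f x \<oplus>\<^bsub>N\<^esub> f y"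
    "\<And>x r. \<lbrakk>x \<in> carrier M; r \<in> R\<rbrakk> \<Longrightarrow> f (ract M x r) = ract N (f x) r" "right_module R M"
  shows "restrict f (carrier M) \<in> Arr (Mod R) M N"
proof -
  interpret M: right_module R M by (rule assms(4))
  show ?thesis using assms M.ract_closed by (simp add: Arr_Mod)
qed

context noetherian_algebra begin

lemma hom_Mod:
  assumes "right_module R M" "right_module R N" "\<And>x. x \<in> carrier M \<Longrightarrow> f x \<in> carrier N"
    "\<And>x y. \<lbrakk>x \<in> carrier M; y \<in> carrier M\<rbrakk> \<Longrightarrow> f (x \<oplus>\<^bsub>M\<^esub> y) = f x \<oplus>\<^bsub>N\<^esub> f y"
    "\<And>x r. \<lbrakk>x \<in> carrier M; r \<in> R\<rbrakk> \<Longrightarrow> f (ract M x r) = ract N (f x) r"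
  shows "unital_module_hom R M N f" "unital_module_hom scalars M N f"
  using assms scalars_R
  by (auto intro!: unital_module_hom.intro unital_module_hom_axioms.intro unital_R unital_scalars)

lemma hom_of_Arr:
  assumes "right_module R M" "right_module R N" "f \<in> Arr (Mod R) M N"
  shows "unital_module_hom R M N f"
  by (rule hom_Mod(1)[OF assms(1,2) Arr_ModD(1-3)[OF assms(3)]])

lemma hom_scalars: "unital_module_hom R M N f \<Longrightarrow> unital_module_hom scalars M N f"
proof -
  assume "unital_module_hom R M N f"
  then interpret unital_module_hom R M N f .
  show ?thesis by (rule hom_Mod(2)[OF M.right_module_axioms N.right_module_axioms f_in f_add f_ract])
qed

lemma finite_dim_image:
  assumes "unital_module_hom R M N f" "finite_dim M V"
  shows "finite_dim N (f ` V)"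
proof -
  interpret unital_module_hom scalars M N f by (rule hom_scalars[OF assms(1)])
  show ?thesis using assms(2) fin_span_image unfolding finite_dim_def by blast
qed

lemma finite_dim_subset: "right_module R M \<Longrightarrow> finite_dim M V \<Longrightarrow> W \<subseteq> V \<Longrightarrow> finite_dim M W"
  unfolding finite_dim_def using unital_module.fin_span_subset[OF unital_scalars] by blast

lemma finite_dim_UN:
  assumes "right_module R M" "finite A" "\<And>a. a \<in> A \<Longrightarrow> finite_dim M (V a)"
  shows "finite_dim M (\<Union>a\<in>A. V a)"
  using unital_module.fin_span_UN[OF unital_scalars[OF assms(1)] assms(2)] assms(3) unfolding finite_dim_def by blast

lemma finite_dim_closure:
  assumes "right_module R M" "finite_dim M V"
  obtains S where "unital_module.submod scalars M S" "V \<subseteq> S" "finite_dim M S"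
proof -
  interpret unital_module scalars M by (rule unital_scalars[OF assms(1)])
  show ?thesis using fin_span_closure[of V] assms(2) that unfolding finite_dim_def by blast
qed

text \<open>
  Each \<open>c R\<close> is finite dimensional, so their finite sum is.
\<close>

lemma finite_dim_spn:
  assumes M: "right_module R M" and cs: "set cs \<subseteq> carrier M" "\<And>c. c \<in> set cs \<Longrightarrow> finite_dim M (orbit M c)"
  shows "finite_dim M (unital_module.spn R M cs)"
proof -
  interpret M: unital_module R M by (rule unital_R[OF M])
  interpret K: unital_module scalars M by (rule unital_scalars[OF M])
  obtain S where S: "K.submod S" "(\<Union>c\<in>set cs. orbit M c) \<subseteq> S" "finite_dim M S"
    by (rule finite_dim_closure[OF M finite_dim_UN[OF M finite_set cs(2)]])
  have "M.spn cs \<subseteq> S" using S(2)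
  proof (induction cs)
    case Nil then show ?case using K.submodD(2)[OF S(1)] by simp
  next
    case (Cons c cs)
    have "ract M c r \<in> S" if "r \<in> R" for r using Cons.prems that by auto
    then show ?case using Cons K.submodD(3)[OF S(1)] by auto
  qed
  then show ?thesis using finite_dim_subset[OF M S(3)] by blast
qed

text \<open>
  The part \<open>K\<close> of \<open>V\<close> killed by \<open>f\<close> is finitely generated because \<open>R\<close> is noetherian, and each of its
  generators spans a finite dimensional submodule. So \<open>K\<close> is finite dimensional, like \<open>f V\<close>.
\<close>

lemma finite_dim_extension:
  assumes f: "unital_module_hom R M N f" and V: "unital_module.submod R M V" "unital_module.fin_span R M V"
    and im: "finite_dim N (f ` V)" and ker: "\<And>y. y \<in> V \<Longrightarrow> f y = \<zero>\<^bsub>N\<^esub> \<Longrightarrow> finite_dim M (orbit M y)"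
  shows "finite_dim M V"
proof -
  interpret f: unital_module_hom R M N f by (rule f)
  interpret g: unital_module_hom scalars M N f by (rule hom_scalars[OF f])
  note M = f.M.right_module_axioms
  have VK: "f.M.submod {x \<in> V. f x = \<zero>\<^bsub>N\<^esub>}"
  proof -
    have "{x \<in> V. f x = \<zero>\<^bsub>N\<^esub>} = V \<inter> {x \<in> carrier M. f x = \<zero>\<^bsub>N\<^esub>}" using f.M.submodD(1)[OF V(1)] by auto
    then show ?thesis using f.M.submod_Int[OF V(1) f.kernel_submod] by simp
  qed
  obtain bs where bs: "set bs \<subseteq> carrier M" "V \<subseteq> f.M.spn bs" using V(2) unfolding f.M.fin_span_def by blast
  have "{x \<in> V. f x = \<zero>\<^bsub>N\<^esub>} \<subseteq> f.M.spn bs" using bs(2) by blast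
  from f.M.noetherian_submod[OF noeth_R bs(1) VK this]
  obtain cs where cs: "set cs \<subseteq> {x \<in> V. f x = \<zero>\<^bsub>N\<^esub>}" "{x \<in> V. f x = \<zero>\<^bsub>N\<^esub>} = f.M.spn cs" by blast
  have "finite_dim M (f.M.spn cs)"
    by (rule finite_dim_spn[OF M]) (use cs(1) f.M.submodD(1)[OF V(1)] ker in auto)
  then have "g.M.fin_span {x \<in> V. f x = \<zero>\<^bsub>N\<^esub>}" using cs(2) by (simp add: finite_dim_def)
  then show ?thesis
    unfolding finite_dim_def
    using g.fin_span_extension[OF noeth_scalars submod_scalars[OF M V(1)]] im[unfolded finite_dim_def] by blast
qed

lemma torsion_element_zero: "right_module R M \<Longrightarrow> torsion_element scale R M \<zero>\<^bsub>M\<^esub>"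
proof -
  assume M: "right_module R M"
  interpret M: unital_module R M by (rule unital_R[OF M])
  have "orbit M \<zero>\<^bsub>M\<^esub> \<subseteq> {\<zero>\<^bsub>M\<^esub>}" using M.ract_zero_left by auto
  moreover have "finite_dim M {\<zero>\<^bsub>M\<^esub>}"
    unfolding finite_dim_def unital_module.fin_span_def[OF unital_scalars[OF M]]
    by (intro exI[of _ "[]"]) (simp add: unital_module.span_over.simps[OF unital_scalars[OF M]])
  ultimately show ?thesis using torsion_element_iff[OF M M.zero_closed] finite_dim_subset[OF M] by blast
qed

lemma finite_dim_add:
  assumes "right_module R M" "finite_dim M V" "finite_dim M W"
  shows "finite_dim M {v \<oplus>\<^bsub>M\<^esub> w | v w. v \<in> V \<and> w \<in> W}"
  using assms unital_module.fin_span_add[OF unital_scalars[OF assms(1)]] unfolding finite_dim_def by blast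

lemma torsion_element_add:
  assumes M: "right_module R M" and x: "x \<in> carrier M" "y \<in> carrier M"
    and t: "torsion_element scale R M x" "torsion_element scale R M y"
  shows "torsion_element scale R M (x \<oplus>\<^bsub>M\<^esub> y)"
proof -
  interpret M: unital_module R M by (rule unital_R[OF M])
  have sub: "orbit M (x \<oplus>\<^bsub>M\<^esub> y) \<subseteq> {v \<oplus>\<^bsub>M\<^esub> w | v w. v \<in> orbit M x \<and> w \<in> orbit M y}"
    using M.ract_add_left[OF x] by auto
  have t': "finite_dim M (orbit M x)" "finite_dim M (orbit M y)"
    using t torsion_element_iff[OF M x(1)] torsion_element_iff[OF M x(2)] by blast+
  have "finite_dim M (orbit M (x \<oplus>\<^bsub>M\<^esub> y))"
    by (rule finite_dim_subset[OF M finite_dim_add[OF M t'] sub])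
  then show ?thesis using torsion_element_iff[OF M M.a_closed[OF x]] by blast
qed

lemma hom_orbit:
  assumes f: "unital_module_hom R M N f" and x: "x \<in> carrier M"
  shows "f ` orbit M x = orbit N (f x)"
proof -
  interpret f: unital_module_hom R M N f by (rule f)
  show ?thesis using f.f_ract[OF x] by (auto simp: image_iff) metis
qed

lemma torsion_element_image:
  assumes f: "unital_module_hom R M N f" and x: "x \<in> carrier M" "torsion_element scale R M x"
  shows "torsion_element scale R N (f x)"
proof -
  interpret f: unital_module_hom R M N f by (rule f)
  show ?thesis using finite_dim_image[OF f, of "orbit M x"] x
    torsion_element_iff[OF f.M.right_module_axioms x(1)] torsion_element_iff[OF f.N.right_module_axioms f.f_in[OF x(1)]]
    hom_orbit[OF f x(1)] by simp
qed

lemma orbit_fin_span: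
  assumes M: "right_module R M" "x \<in> carrier M"
  shows "unital_module.fin_span R M (orbit M x)"
proof -
  interpret M: unital_module R M by (rule unital_R[OF M(1)])
  have "ract M x r = \<zero>\<^bsub>M\<^esub> \<oplus>\<^bsub>M\<^esub> ract M x r" if "r \<in> R" for r using M.ract_closed[OF M(2) that] by simp
  then have "orbit M x \<subseteq> M.spn [x]" by auto
  then show ?thesis unfolding M.fin_span_def using M(2) by (intro exI[of _ "[x]"]) auto
qed

text \<open>
  Here the kernel is assumed to be torsion but not finite dimensional; this suffices because its
  intersection with \<open>x R\<close> is finitely generated.
\<close>

lemma torsion_element_extension:
  assumes f: "unital_module_hom R M N f" and x: "x \<in> carrier M" "torsion_element scale R N (f x)"
    and ker: "\<And>y. y \<in> carrier M \<Longrightarrow> f y = \<zero>\<^bsub>N\<^esub> \<Longrightarrow> torsion_element scale R M y"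
  shows "torsion_element scale R M x"
proof -
  interpret f: unital_module_hom R M N f by (rule f)
  note M = f.M.right_module_axioms and N = f.N.right_module_axioms
  have sub: "orbit M x \<subseteq> carrier M" using f.M.ract_closed[OF x(1)] by auto
  have "finite_dim M (orbit M x)"
  proof (rule finite_dim_extension[OF f orbit_submod[OF M x(1)] orbit_fin_span[OF M x(1)]])
    show "finite_dim N (f ` orbit M x)"
      using x(2) torsion_element_iff[OF N f.f_in[OF x(1)]] hom_orbit[OF f x(1)] by simp
    fix y assume y: "y \<in> orbit M x" "f y = \<zero>\<^bsub>N\<^esub>"
    then have "y \<in> carrier M" using sub by blast
    then show "finite_dim M (orbit M y)" using ker y(2) torsion_element_iff[OF M] by blast
  qed
  then show ?thesis using torsion_element_iff[OF M x(1)] by blast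
qed

end

section \<open>Modules as a category with elements\<close>

context noetherian_algebra begin

lemma module_congruence_coset_rep:
  assumes N: "unital_module R N" and U: "unital_module.submod R N U"
  shows "module_congruence R N (coset_rep N U)"
    and "x \<in> carrier N \<Longrightarrow> coset_rep N U x = coset_rep N U \<zero>\<^bsub>N\<^esub> \<longleftrightarrow> x \<in> U"
proof -
  interpret N: unital_module R N by (rule N)
  note U' = N.submodD[OF U]
  note eq = N.coset_rep_eq_iff[OF U'(1,2,3) N.submod_neg[OF U]]
  show "module_congruence R N (coset_rep N U)"
  proof (intro module_congruence.intro N module_congruence_axioms.intro)
    fix x x' y y' assume c: "x \<in> carrier N" "x' \<in> carrier N" "y \<in> carrier N" "y' \<in> carrier N"
      and e: "coset_rep N U x = coset_rep N U x'" "coset_rep N U y = coset_rep N U y'"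
    have "(x \<oplus>\<^bsub>N\<^esub> y) \<ominus>\<^bsub>N\<^esub> (x' \<oplus>\<^bsub>N\<^esub> y') = (x \<ominus>\<^bsub>N\<^esub> x') \<oplus>\<^bsub>N\<^esub> (y \<ominus>\<^bsub>N\<^esub> y')"
      using c by (simp add: a_minus_def N.minus_add N.a_ac)
    then show "coset_rep N U (x \<oplus>\<^bsub>N\<^esub> y) = coset_rep N U (x' \<oplus>\<^bsub>N\<^esub> y')"
      using U'(3) e c by (simp add: eq)
  next
    fix x x' s assume c: "x \<in> carrier N" "x' \<in> carrier N" "s \<in> R" and e: "coset_rep N U x = coset_rep N U x'"
    have "ract N x s \<ominus>\<^bsub>N\<^esub> ract N x' s = ract N (x \<ominus>\<^bsub>N\<^esub> x') s"
      using c by (simp add: a_minus_def N.ract_add_left N.ract_neg)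
    then show "coset_rep N U (ract N x s) = coset_rep N U (ract N x' s)"
      using U'(4) e c by (simp add: eq N.ract_closed)
  qed
  show "x \<in> carrier N \<Longrightarrow> coset_rep N U x = coset_rep N U \<zero>\<^bsub>N\<^esub> \<longleftrightarrow> x \<in> U"
    by (simp add: eq a_minus_def N.neg_zero)
qed

lemma Mod_kernel:
  assumes M: "right_module R M" and N: "right_module R N" and f: "f \<in> Arr (Mod R) M N"
  shows "\<exists>K\<in>Obj (Mod R). \<exists>j\<in>Arr (Mod R) K M. inj_on j (carrier K) \<and> j ` carrier K = {x \<in> carrier M. f x = \<zero>\<^bsub>N\<^esub>}"
proof -
  interpret f: unital_module_hom R M N f by (rule hom_of_Arr[OF M N f])
  let ?V = "{x \<in> carrier M. f x = \<zero>\<^bsub>N\<^esub>}"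
  let ?K = "M\<lparr>carrier := ?V\<rparr>"
  have K: "right_module R ?K" by (rule f.M.right_module_sub[OF f.kernel_submod])
  have "restrict (\<lambda>x. x) (carrier ?K) \<in> Arr (Mod R) ?K M"
    by (rule Arr_ModI[OF _ _ _ K]) simp_all
  moreover have "inj_on (restrict (\<lambda>x. x) (carrier ?K)) (carrier ?K)" by (simp add: inj_on_def)
  moreover have "restrict (\<lambda>x. x) (carrier ?K) ` carrier ?K = ?V" by simp
  moreover have "?K \<in> Obj (Mod R)" using K by simp
  ultimately show ?thesis by (intro bexI[of _ ?K] bexI[of _ "restrict (\<lambda>x. x) (carrier ?K)"] conjI)
qed

lemma Mod_cokernel:
  assumes M: "right_module R M" and N: "right_module R N" and f: "f \<in> Arr (Mod R) M N"
  shows "\<exists>Q\<in>Obj (Mod R). \<exists>p\<in>Arr (Mod R) N Q. p ` carrier N = carrier Q \<and>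
    {x \<in> carrier N. p x = \<zero>\<^bsub>Q\<^esub>} = f ` carrier M"
proof -
  interpret f: unital_module_hom R M N f by (rule hom_of_Arr[OF M N f])
  let ?U = "f ` carrier M"
  have U: "f.N.submod ?U" by (rule f.image_submod[OF f.M.submod_carrier])
  interpret r: module_congruence R N "coset_rep N ?U"
    by (rule module_congruence_coset_rep(1)[OF f.N.unital_module_axioms U])
  let ?Q = "push_module (coset_rep N ?U) N" and ?p = "restrict (coset_rep N ?U) (carrier N)"
  have Q: "?Q \<in> Obj (Mod R)" using r.push_right_module by simp
  have "?p \<in> Arr (Mod R) N ?Q"
    by (rule Arr_ModI[OF _ _ _ N]) (simp_all add: r.push_add r.push_ract)
  moreover have "?p ` carrier N = carrier ?Q" by simp
  moreover have "{x \<in> carrier N. ?p x = \<zero>\<^bsub>?Q\<^esub>} = ?U"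
    using module_congruence_coset_rep(2)[OF f.N.unital_module_axioms U] f.N.submodD(1)[OF U] by auto
  ultimately show ?thesis by (intro bexI[OF _ Q] bexI[of _ ?p] conjI)
qed

lemma Mod_product:
  fixes A B :: "('m, 's) rmodule"
  assumes A: "right_module R A" and B: "right_module R B"
  shows "\<exists>P\<in>Obj (Mod R). \<exists>p\<in>Arr (Mod R) P A. \<exists>q\<in>Arr (Mod R) P B.
      (\<forall>x\<in>carrier A. \<forall>y\<in>carrier B. \<exists>!z. z \<in> carrier P \<and> p z = x \<and> q z = y) \<and>
      (\<forall>X\<in>Obj (Mod R). \<forall>f\<in>Arr (Mod R) X A. \<forall>g\<in>Arr (Mod R) X B.
        \<exists>h\<in>Arr (Mod R) X P. cmp (Mod R) X P A p h = f \<and> cmp (Mod R) X P B q h = g)"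
proof -
  let ?AB = "prod_module A B" and ?r = "pairing :: 'm \<times> 'm \<Rightarrow> 'm"
  have inj: "inj_on ?r (carrier A \<times> carrier B)" by (rule inj_on_pairing[OF A B])
  interpret AB: unital_module R ?AB by (rule unital_R[OF right_module_prod[OF A B]])
  interpret r: module_congruence R ?AB ?r
  proof unfold_locales
    fix x x' y y' assume "x \<in> carrier ?AB" "x' \<in> carrier ?AB" "y \<in> carrier ?AB" "y' \<in> carrier ?AB" "?r x = ?r x'" "?r y = ?r y'"
    then show "?r (x \<oplus>\<^bsub>?AB\<^esub> y) = ?r (x' \<oplus>\<^bsub>?AB\<^esub> y')" using inj_onD[OF inj, of x x'] inj_onD[OF inj, of y y'] by simp
  next
    fix x x' s assume "x \<in> carrier ?AB" "x' \<in> carrier ?AB" "?r x = ?r x'"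
    then show "?r (ract ?AB x s) = ?r (ract ?AB x' s)" using inj_onD[OF inj, of x x'] by simp
  qed
  let ?P = "push_module ?r ?AB" and ?i = "inv_into (carrier A \<times> carrier B) ?r"
  have P: "right_module R ?P" by (rule r.push_right_module)
  have i: "?i (?r (x, y)) = (x, y)" if "x \<in> carrier A" "y \<in> carrier B" for x y
    using inv_into_f_f[OF inj] that by simp
  interpret A: right_module R A by (rule A)
  interpret B: right_module R B by (rule B)
  let ?p = "restrict (\<lambda>z. fst (?i z)) (carrier ?P)" and ?q = "restrict (\<lambda>z. snd (?i z)) (carrier ?P)"
  have pq: "?p \<in> Arr (Mod R) ?P A" "?q \<in> Arr (Mod R) ?P B"
    by (rule Arr_ModI[OF _ _ _ P]; auto simp: i r.push_add r.push_ract A.ract_closed B.ract_closed)+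
  have v: "?p (?r (x, y)) = x" "?q (?r (x, y)) = y" if "x \<in> carrier A" "y \<in> carrier B" for x y
    using that by (simp_all add: i)
  have ex1: "\<exists>!z. z \<in> carrier ?P \<and> ?p z = x \<and> ?q z = y" if xy: "x \<in> carrier A" "y \<in> carrier B" for x y
  proof (rule ex1I[of _ "?r (x, y)"])
    show "?r (x, y) \<in> carrier ?P \<and> ?p (?r (x, y)) = x \<and> ?q (?r (x, y)) = y" using xy by (simp add: i)
    fix z assume "z \<in> carrier ?P \<and> ?p z = x \<and> ?q z = y"
    then show "z = ?r (x, y)" by (auto simp: i)
  qed
  have uni: "\<exists>h\<in>Arr (Mod R) X ?P. cmp (Mod R) X ?P A ?p h = f \<and> cmp (Mod R) X ?P B ?q h = g"
    if X: "X \<in> Obj (Mod R)" and f: "f \<in> Arr (Mod R) X A" and g: "g \<in> Arr (Mod R) X B" for X f g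
  proof -
    note f' = Arr_ModD[OF f] and g' = Arr_ModD[OF g]
    interpret X: right_module R X using X by simp
    let ?h = "restrict (\<lambda>x. ?r (f x, g x)) (carrier X)"
    have "?h \<in> Arr (Mod R) X ?P"
      by (rule Arr_ModI) (simp_all add: f' g' r.push_add r.push_ract X.right_module_axioms)
    moreover have "compose (carrier X) ?p ?h = f"
    proof (rule extensionalityI[OF compose_extensional f'(4)])
      fix x assume "x \<in> carrier X"
      then show "compose (carrier X) ?p ?h x = f x" using v(1)[OF f'(1) g'(1)] by (simp add: compose_eq)
    qed
    moreover have "compose (carrier X) ?q ?h = g"
    proof (rule extensionalityI[OF compose_extensional g'(4)])
      fix x assume "x \<in> carrier X"
      then show "compose (carrier X) ?q ?h x = g x" using v(2)[OF f'(1) g'(1)] by (simp add: compose_eq)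
    qed
    ultimately show ?thesis unfolding Mod_simps by (intro bexI[of _ ?h] conjI)
  qed
  have P': "?P \<in> Obj (Mod R)" using P by simp
  show ?thesis
    by (intro bexI[OF _ P'] bexI[OF _ pq(1)] bexI[OF _ pq(2)] conjI ballI) (rule ex1 uni; assumption)+
qed

lemma Mod_lift:
  assumes o: "right_module R X" "right_module R K" "right_module R M" and f: "f \<in> Arr (Mod R) X M" and j: "j \<in> Arr (Mod R) K M"
    and inj: "inj_on j (carrier K)" and im: "f ` carrier X \<subseteq> j ` carrier K"
  shows "\<exists>h\<in>Arr (Mod R) X K. cmp (Mod R) X K M j h = f"
proof -
  note f' = Arr_ModD[OF f] and j' = Arr_ModD[OF j]
  interpret X: right_module R X by (rule o)
  interpret K: right_module R K by (rule o)
  let ?g = "\<lambda>x. inv_into (carrier K) j (f x)"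
  have g: "?g x \<in> carrier K" "j (?g x) = f x" if "x \<in> carrier X" for x
    using im that by (auto intro!: inv_into_into f_inv_into_f)
  have h: "restrict ?g (carrier X) \<in> Arr (Mod R) X K"
  proof (rule Arr_ModI[OF g(1) _ _ o(1)])
    fix x y assume xy: "x \<in> carrier X" "y \<in> carrier X"
    show "?g (x \<oplus>\<^bsub>X\<^esub> y) = ?g x \<oplus>\<^bsub>K\<^esub> ?g y"
      by (rule inj_onD[OF inj]) (use xy g[of "x \<oplus>\<^bsub>X\<^esub> y"] in \<open>simp_all add: g f' j'\<close>)
  next
    fix x r assume x: "x \<in> carrier X" "r \<in> R"
    show "?g (ract X x r) = ract K (?g x) r"
      by (rule inj_onD[OF inj]) (use x g[of "ract X x r"] in \<open>simp_all add: g f' j' X.ract_closed K.ract_closed\<close>)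
  qed
  have "compose (carrier X) j (restrict ?g (carrier X)) = f"
    by (rule extensionalityI[OF compose_extensional f'(4)]) (simp add: compose_eq g)
  then show ?thesis using h unfolding Mod_simps by (intro bexI[of _ "restrict ?g (carrier X)"])
qed

lemma Mod_descend:
  assumes o: "right_module R M" "right_module R Q" "right_module R X" and f: "f \<in> Arr (Mod R) M X" and p: "p \<in> Arr (Mod R) M Q"
    and sur: "p ` carrier M = carrier Q" and ker: "\<And>x. \<lbrakk>x \<in> carrier M; p x = \<zero>\<^bsub>Q\<^esub>\<rbrakk> \<Longrightarrow> f x = \<zero>\<^bsub>X\<^esub>"
  shows "\<exists>h\<in>Arr (Mod R) Q X. cmp (Mod R) M Q X h p = f"
proof -
  note f' = Arr_ModD[OF f] and p' = Arr_ModD[OF p]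
  interpret f: unital_module_hom R M X f by (rule hom_of_Arr[OF o(1,3) f])
  interpret p: unital_module_hom R M Q p by (rule hom_of_Arr[OF o(1,2) p])
  have eq: "f x = f y" if "x \<in> carrier M" "y \<in> carrier M" "p x = p y" for x y
  proof -
    have "p (x \<ominus>\<^bsub>M\<^esub> y) = \<zero>\<^bsub>Q\<^esub>"
      using p.f_minus[OF that(1,2)] that(3) p'(1)[OF that(2)] by (simp add: a_minus_def p.N.r_neg)
    then have "f x \<ominus>\<^bsub>X\<^esub> f y = \<zero>\<^bsub>X\<^esub>" using ker[of "x \<ominus>\<^bsub>M\<^esub> y"] that by (simp add: f.f_minus)
    then show ?thesis using f.N.minus_equality[of "f x" "\<ominus>\<^bsub>X\<^esub> f y"] f'(1) that f.N.minus_minus by (simp add: a_minus_def)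
  qed
  let ?g = "\<lambda>z. f (inv_into (carrier M) p z)"
  have g: "?g (p x) = f x" if "x \<in> carrier M" for x
    using that by (intro eq) (simp_all add: inv_into_into f_inv_into_f)
  have h: "restrict ?g (carrier Q) \<in> Arr (Mod R) Q X"
  proof (rule Arr_ModI[OF _ _ _ o(2)]; unfold sur[symmetric]; (elim imageE)?; hypsubst_thin?)
    fix x assume "x \<in> carrier M" then show "?g (p x) \<in> carrier X" by (simp add: g f')
  next
    fix x y assume "x \<in> carrier M" "y \<in> carrier M"
    then show "?g (p x \<oplus>\<^bsub>Q\<^esub> p y) = ?g (p x) \<oplus>\<^bsub>X\<^esub> ?g (p y)" using g[of "x \<oplus>\<^bsub>M\<^esub> y"] by (simp add: g f' p')
  next
    fix x r assume "x \<in> carrier M" "r \<in> R"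
    then show "?g (ract Q (p x) r) = ract X (?g (p x)) r" using g[of "ract M x r"] by (simp add: g f' p' f.M.ract_closed)
  qed
  have "compose (carrier M) (restrict ?g (carrier Q)) p = f"
    by (rule extensionalityI[OF compose_extensional f'(4)]) (simp add: compose_eq g p')
  then show ?thesis using h unfolding Mod_simps by (intro bexI[of _ "restrict ?g (carrier Q)"])
qed

definition zero_module :: "('m, 's) rmodule" where
  "zero_module = \<lparr>carrier = {undefined}, monoid.mult = undefined, one = undefined, zero = undefined, add = (\<lambda>_ _. undefined), ract = (\<lambda>_ _. undefined)\<rparr>"

lemma right_module_zero: "right_module R (zero_module :: ('m, 's) rmodule)"
proof -
  have "abelian_group (zero_module :: ('m, 's) rmodule)"
    by (rule abelian_groupI) (simp_all add: zero_module_def)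
  then show ?thesis
    by (intro right_module.intro right_module_axioms.intro) (simp_all add: zero_module_def)
qed

theorem element_category_Mod:
  "element_category (Mod R :: (('m, 's) rmodule, 'm \<Rightarrow> 'm) cat) (\<lambda>M (_::unit). M) (\<lambda>f _. f)
    (\<lambda>M _. torsion_element scale R M)"
proof (rule element_category.intro, unfold Obj_Mod, goal_cases)
  case (1 M i)
  then show ?case by (rule right_module.axioms(1))
next
  case (2 M N f x i) show ?case by (rule Arr_ModD(1)[OF 2(3,4)])
next
  case (3 M N f x i y) show ?case by (rule Arr_ModD(2)[OF 3(3-5)])
next
  case (4 M N f g)
  show ?case by (rule extensionalityI[OF Arr_ModD(4)[OF 4(3)] Arr_ModD(4)[OF 4(4)] 4(5)])
next
  case (5 M)
  show ?case unfolding Mod_simps by (rule Arr_ModI[OF _ _ _ 5]) simp_all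
next
  case (6 M x i) then show ?case by simp
next
  case (7 M N P f g)
  have "restrict (\<lambda>x. g (f x)) (carrier M) \<in> Arr (Mod R) M P"
    by (rule Arr_ModI[OF _ _ _ 7(1)]) (simp_all add: Arr_ModD[OF 7(4)] Arr_ModD[OF 7(5)])
  then show ?case by (simp add: compose_def)
next
  case (8 M N P f g x i) then show ?case by (simp add: compose_eq)
next
  case (9 M N f g)
  interpret N: right_module R N by (rule 9(2))
  note f = Arr_ModD[OF 9(3)] and g = Arr_ModD[OF 9(4)]
  show ?case unfolding Mod_simps
  proof (rule Arr_ModI[OF _ _ _ 9(1)])
    fix x y assume "x \<in> carrier M" "y \<in> carrier M"
    then show "f (x \<oplus>\<^bsub>M\<^esub> y) \<oplus>\<^bsub>N\<^esub> g (x \<oplus>\<^bsub>M\<^esub> y) = f x \<oplus>\<^bsub>N\<^esub> g x \<oplus>\<^bsub>N\<^esub> (f y \<oplus>\<^bsub>N\<^esub> g y)"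
      by (simp add: f g N.a_ac)
  qed (simp_all add: f g N.ract_add_left)
next
  case (10 M N f g x i) then show ?case by simp
next
  case (11 M N)
  interpret N: unital_module R N by (rule unital_R[OF 11(2)])
  show ?case unfolding Mod_simps by (rule Arr_ModI[OF _ _ _ 11(1)]) (simp_all add: N.ract_zero_left)
next
  case (12 M N x i) then show ?case by simp
next
  case (13 M N f)
  interpret N: unital_module R N by (rule unital_R[OF 13(2)])
  note f = Arr_ModD[OF 13(3)]
  have "restrict (\<lambda>x. \<ominus>\<^bsub>N\<^esub> f x) (carrier M) \<in> Arr (Mod R) M N"
    by (rule Arr_ModI[OF _ _ _ 13(1)]) (simp_all add: f N.ract_neg N.minus_add)
  then show ?case by (intro bexI[of _ "restrict (\<lambda>x. \<ominus>\<^bsub>N\<^esub> f x) (carrier M)"]) simp_all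
next
  case 14
  show ?case using right_module_zero by (intro bexI[of _ zero_module]) (simp_all add: zero_module_def)
next
  case (15 A B) show ?case using Mod_product[OF 15] by simp
next
  case (16 M N f) show ?case using Mod_kernel[OF 16] by simp
next
  case (17 M N f) show ?case using Mod_cokernel[OF 17] by simp
next
  case (18 X K M f j) show ?case by (rule Mod_lift[OF 18])
next
  case (19 M Q X f p) show ?case by (rule Mod_descend[OF 19(1-6)]) (rule 19(7))
next
  case (20 M i) then show ?case by (rule torsion_element_zero)
next
  case (21 M x i y) then show ?case by (rule torsion_element_add)
next
  case (22 M N f x i) show ?case by (rule torsion_element_image[OF hom_of_Arr[OF 22(1-3)] 22(4,5)])
next
  case (23 M N f x i)
  show ?case by (rule torsion_element_extension[OF hom_of_Arr[OF 23(1-3)] 23(4,5)]) (rule 23(6))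
qed

end

section \<open>Graded modules\<close>

lemma Obj_GrMod [simp]: "M \<in> Obj (GrMod S) \<longleftrightarrow> graded_right_module S M"
  by (simp add: GrMod_def)

lemma Arr_GrModD:
  assumes "f \<in> Arr (GrMod S) M N"
  shows "x \<in> gcar M i \<Longrightarrow> f i x \<in> gcar N i"
    "\<lbrakk>x \<in> gcar M i; y \<in> gcar M i\<rbrakk> \<Longrightarrow> f i (x \<oplus>\<^bsub>gcomp M i\<^esub> y) = f i x \<oplus>\<^bsub>gcomp N i\<^esub> f i y"
    "\<lbrakk>x \<in> gcar M i; s \<in> S j\<rbrakk> \<Longrightarrow> f (i + j) (gact M i j x s) = gact N i j (f i x) s"
    "f i \<in> extensional (gcar M i)"
  using assms by (auto simp: GrMod_def PiE_def)

lemma Arr_GrModI: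
  assumes "\<And>i x. x \<in> gcar M i \<Longrightarrow> f i x \<in> gcar N i"
    "\<And>i x y. \<lbrakk>x \<in> gcar M i; y \<in> gcar M i\<rbrakk> \<Longrightarrow> f i (x \<oplus>\<^bsub>gcomp M i\<^esub> y) = f i x \<oplus>\<^bsub>gcomp N i\<^esub> f i y"
    "\<And>i j x s. \<lbrakk>x \<in> gcar M i; s \<in> S j\<rbrakk> \<Longrightarrow> f (i + j) (gact M i j x s) = gact N i j (f i x) s"
    "graded_right_module S M"
  shows "(\<lambda>i. restrict (f i) (gcar M i)) \<in> Arr (GrMod S) M N"
proof -
  interpret M: graded_right_module S M by (rule assms(4))
  have "x \<oplus>\<^bsub>gcomp M i\<^esub> y \<in> gcar M i" if "x \<in> gcar M i" "y \<in> gcar M i" for x y i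
    using abelian_monoid.a_closed[OF abelian_group.axioms(1)[OF M.gcomp_group]] that by blast
  then show ?thesis using assms M.gact_closed by (simp add: GrMod_def)
qed

lemma GrMod_simps [simp]:
  "cmp (GrMod S) M N P g f = (\<lambda>i. compose (gcar M i) (g i) (f i))" "idn (GrMod S) M = (\<lambda>i. \<lambda>x\<in>gcar M i. x)"
  "plus_arr (GrMod S) M N f g = (\<lambda>i. \<lambda>x\<in>gcar M i. f i x \<oplus>\<^bsub>gcomp N i\<^esub> g i x)"
  "zero_arr (GrMod S) M N = (\<lambda>i. \<lambda>x\<in>gcar M i. \<zero>\<^bsub>gcomp N i\<^esub>)"
  by (simp_all add: GrMod_def)

lemma degree_part_simps [simp]:
  "carrier (degree_part M i) = gcar M i" "add (degree_part M i) = add (gcomp M i)"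
  "\<zero>\<^bsub>degree_part M i\<^esub> = \<zero>\<^bsub>gcomp M i\<^esub>" "ract (degree_part M i) = gact M i 0"
  by (simp_all add: degree_part_def)

lemma graded_right_module_image:
  assumes M: "graded_right_module S M" and sur: "\<And>i. gcar N i = r i ` gcar M i"
    and add: "\<And>i x y. \<lbrakk>x \<in> gcar M i; y \<in> gcar M i\<rbrakk> \<Longrightarrow> r i (x \<oplus>\<^bsub>gcomp M i\<^esub> y) = r i x \<oplus>\<^bsub>gcomp N i\<^esub> r i y"
    and zero: "\<And>i. r i \<zero>\<^bsub>gcomp M i\<^esub> = \<zero>\<^bsub>gcomp N i\<^esub>"
    and act: "\<And>i j x s. \<lbrakk>x \<in> gcar M i; s \<in> S j\<rbrakk> \<Longrightarrow> r (i + j) (gact M i j x s) = gact N i j (r i x) s"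
    and S: "1 \<in> S 0" "\<And>s t j. \<lbrakk>s \<in> S j; t \<in> S j\<rbrakk> \<Longrightarrow> s + t \<in> S j" "\<And>s t j l. \<lbrakk>s \<in> S j; t \<in> S l\<rbrakk> \<Longrightarrow> s * t \<in> S (j + l)"
  shows "graded_right_module S N"
proof -
  interpret M: graded_right_module S M by (rule M)
  have cl: "x \<oplus>\<^bsub>gcomp M i\<^esub> y \<in> gcar M i" if "x \<in> gcar M i" "y \<in> gcar M i" for x y i
    using abelian_monoid.a_closed[OF abelian_group.axioms(1)[OF M.gcomp_group]] that by blast
  note a = add[symmetric] and b = act[symmetric]
  show ?thesis
  proof (intro graded_right_module.intro; (unfold sur)?; (elim imageE)?; hypsubst_thin?)
    fix i show "abelian_group (gcomp N i)" by (rule abelian_group_image[OF M.gcomp_group sur add zero])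
  next
    fix i j x s assume "x \<in> gcar M i" "s \<in> S j"
    then show "gact N i j (r i x) s \<in> r (i + j) ` gcar M (i + j)" by (simp add: b M.gact_closed)
  next
    fix i j x y s assume "x \<in> gcar M i" "y \<in> gcar M i" "s \<in> S j"
    then show "gact N i j (r i x \<oplus>\<^bsub>gcomp N i\<^esub> r i y) s = gact N i j (r i x) s \<oplus>\<^bsub>gcomp N (i + j)\<^esub> gact N i j (r i y) s"
      by (simp add: a b cl M.gact_closed M.gact_add_left)
  next
    fix i j x s t assume "x \<in> gcar M i" "s \<in> S j" "t \<in> S j"
    then show "gact N i j (r i x) (s + t) = gact N i j (r i x) s \<oplus>\<^bsub>gcomp N (i + j)\<^esub> gact N i j (r i x) t"
      by (simp add: a b M.gact_closed M.gact_add_right S)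
  next
    fix i j l x s t assume x: "x \<in> gcar M i" "s \<in> S j" "t \<in> S l"
    have "gact N i (j + l) (r i x) (s * t) = r (i + (j + l)) (gact M i (j + l) x (s * t))"
      using x S by (simp add: b)
    also have "\<dots> = r ((i + j) + l) (gact M (i + j) l (gact M i j x s) t)" using x by (simp add: M.gact_mult add.assoc)
    also have "\<dots> = gact N (i + j) l (gact N i j (r i x) s) t" using act[OF M.gact_closed[OF x(1,2)] x(3)] act[OF x(1,2)] by simp
    finally show "gact N i (j + l) (r i x) (s * t) = gact N (i + j) l (gact N i j (r i x) s) t" .
  next
    fix i x assume "x \<in> gcar M i"
    then show "gact N i 0 (r i x) 1 = r i x" using b[of x i 1 0] S(1) by (simp add: M.gact_one)
  qed
qed

definition push_graded :: "(int \<Rightarrow> 'x \<Rightarrow> 'm) \<Rightarrow> ('x, 's) grmodule \<Rightarrow> ('m, 's) grmodule" where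
  "push_graded r M = \<lparr>gcomp = (\<lambda>i. push_group (r i) (gcomp M i)),
     gact = (\<lambda>i j u s. r (i + j) (gact M i j (inv_into (gcar M i) (r i) u) s))\<rparr>"

definition prod_graded :: "('x, 's) grmodule \<Rightarrow> ('y, 's) grmodule \<Rightarrow> ('x \<times> 'y, 's) grmodule" where
  "prod_graded A B = \<lparr>gcomp = (\<lambda>i. prod_group (gcomp A i) (gcomp B i)),
     gact = (\<lambda>i j (x, y) s. (gact A i j x s, gact B i j y s))\<rparr>"

lemma prod_graded_simps [simp]:
  "gcomp (prod_graded A B) i = prod_group (gcomp A i) (gcomp B i)"
  "gact (prod_graded A B) i j (x, y) s = (gact A i j x s, gact B i j y s)"
  by (simp_all add: prod_graded_def)

lemma graded_right_module_prod:
  assumes "graded_right_module S A" "graded_right_module S B"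
  shows "graded_right_module S (prod_graded A B)"
proof -
  interpret A: graded_right_module S A by (rule assms)
  interpret B: graded_right_module S B by (rule assms)
  show ?thesis
    by (rule graded_right_module.intro)
      (auto simp: abelian_group_prod A.gcomp_group B.gcomp_group A.gact_closed B.gact_closed A.gact_add_left B.gact_add_left
        A.gact_add_right B.gact_add_right A.gact_mult B.gact_mult A.gact_one B.gact_one)
qed

definition sub_graded :: "('m, 's) grmodule \<Rightarrow> (int \<Rightarrow> 'm set) \<Rightarrow> ('m, 's) grmodule" where
  "sub_graded M V = \<lparr>gcomp = (\<lambda>i. (gcomp M i)\<lparr>carrier := V i\<rparr>), gact = gact M\<rparr>"

lemma sub_graded_simps [simp]:
  "gcar (sub_graded M V) i = V i" "add (gcomp (sub_graded M V) i) = add (gcomp M i)"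
  "\<zero>\<^bsub>gcomp (sub_graded M V) i\<^esub> = \<zero>\<^bsub>gcomp M i\<^esub>" "gact (sub_graded M V) = gact M"
  by (simp_all add: sub_graded_def)

locale noetherian_graded_algebra = densely_graded_algebra scale S
  for scale :: "'k::field_char_0 \<Rightarrow> 's::{ring,monoid_mult} \<Rightarrow> 's" and S +
  assumes noeth_S0: "noetherian_subring (S 0)"
    and fg_left_S: "fg_left (S 0) (S i)"
    and fg_right_S: "fg_right (S 0) (S i)"
begin

abbreviation "graded \<equiv> graded_right_module S"
abbreviation "GHom \<equiv> Arr (GrMod S)"
abbreviation "Hom0 \<equiv> Arr (Mod (S 0))"
abbreviation "torsion0 \<equiv> torsion_element scale (S 0)"
abbreviation "ltorsion \<equiv> locally_torsion_element scale S"

lemma add_S: "\<lbrakk>s \<in> S j; t \<in> S j\<rbrakk> \<Longrightarrow> s + t \<in> S j"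
  using subspace_add[OF subspace_S] .

lemma zero_S: "0 \<in> S j" by (rule subspace_0[OF subspace_S])

lemma gact_zero_left:
  assumes M: "graded M" and s: "s \<in> S j"
  shows "gact M i j \<zero>\<^bsub>gcomp M i\<^esub> s = \<zero>\<^bsub>gcomp M (i + j)\<^esub>"
proof -
  interpret M: graded_right_module S M by (rule M)
  interpret A: abelian_group "gcomp M i" by (rule M.gcomp_group)
  interpret B: abelian_group "gcomp M (i + j)" by (rule M.gcomp_group)
  show ?thesis
    using M.gact_add_left[OF A.zero_closed A.zero_closed s] M.gact_closed[OF A.zero_closed s]
      B.add.r_cancel_one'[of "gact M i j \<zero>\<^bsub>gcomp M i\<^esub> s" "gact M i j \<zero>\<^bsub>gcomp M i\<^esub> s"] by simp
qed

lemma gact_zero_right: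
  assumes M: "graded M" and x: "x \<in> gcar M i"
  shows "gact M i j x 0 = \<zero>\<^bsub>gcomp M (i + j)\<^esub>"
proof -
  interpret M: graded_right_module S M by (rule M)
  interpret B: abelian_group "gcomp M (i + j)" by (rule M.gcomp_group)
  show ?thesis
    using M.gact_add_right[OF x zero_S zero_S, of j] M.gact_closed[OF x zero_S, of j]
      B.add.r_cancel_one'[of "gact M i j x 0" "gact M i j x 0"] by simp
qed

sublocale S0: noetherian_algebra scale "S 0"
proof
  show "1 \<in> S 0" by (rule one_S)
  show "r - s \<in> S 0" if "r \<in> S 0" "s \<in> S 0" for r s using subspace_diff[OF subspace_S] that .
  show "r * s \<in> S 0" if "r \<in> S 0" "s \<in> S 0" for r s using mult_S[OF that] by simp
  show "scale c r \<in> S 0" if "r \<in> S 0" for c r using subspace_scale[OF subspace_S] that .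
  show "fg_right (S 0) I" if "right_ideal (S 0) I" for I using noeth_S0 that by (simp add: noetherian_subring_def)
qed

abbreviation "fdim M n \<equiv> S0.finite_dim (degree_part M n)"

lemmas graded_image = graded_right_module_image[OF _ _ _ _ _ one_S add_S mult_S]

lemma right_module_degree_part:
  assumes "graded M"
  shows "right_module (S 0) (degree_part M i)"
proof -
  interpret M: graded_right_module S M by (rule assms)
  have "abelian_group (degree_part M i)"
    by (rule abelian_group_cong[OF M.gcomp_group]) simp_all
  moreover have "gact M i 0 x s \<in> gcar M i" if "x \<in> gcar M i" "s \<in> S 0" for x s
    using M.gact_closed[OF that] by simp
  moreover have "gact M i 0 (x \<oplus>\<^bsub>gcomp M i\<^esub> y) s = gact M i 0 x s \<oplus>\<^bsub>gcomp M i\<^esub> gact M i 0 y s"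
    if "x \<in> gcar M i" "y \<in> gcar M i" "s \<in> S 0" for x y s
    using M.gact_add_left[OF that] by simp
  moreover have "gact M i 0 x (s + t) = gact M i 0 x s \<oplus>\<^bsub>gcomp M i\<^esub> gact M i 0 x t"
    if "x \<in> gcar M i" "s \<in> S 0" "t \<in> S 0" for x s t
    using M.gact_add_right[OF that] by simp
  moreover have "gact M i 0 x (s * t) = gact M i 0 (gact M i 0 x s) t"
    if "x \<in> gcar M i" "s \<in> S 0" "t \<in> S 0" for x s t
    using M.gact_mult[OF that] by simp
  ultimately show ?thesis
    by (intro right_module.intro right_module_axioms.intro) (simp_all add: M.gact_one)
qed

lemmas unital_degree_part = S0.unital_R[OF right_module_degree_part]

lemma degree_part_arr:
  assumes M: "graded M" and f: "f \<in> GHom M N"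
  shows "f i \<in> Hom0 (degree_part M i) (degree_part N i)"
proof -
  note f' = Arr_GrModD[OF f]
  have "restrict (f i) (carrier (degree_part M i)) \<in> Hom0 (degree_part M i) (degree_part N i)"
    by (rule Arr_ModI[OF _ _ _ right_module_degree_part[OF M]])
      (use f'(1)[of _ i] f'(2)[of _ i] f'(3)[of _ i _ 0] in simp_all)
  then show ?thesis using f'(4)[of i] by (simp add: extensional_restrict)
qed

lemma Arr_GrMod_partsI:
  assumes "\<And>i. f i \<in> Hom0 (degree_part M i) (degree_part N i)"
    and "\<And>i j x s. \<lbrakk>x \<in> gcar M i; s \<in> S j\<rbrakk> \<Longrightarrow> f (i + j) (gact M i j x s) = gact N i j (f i x) s"
  shows "f \<in> GHom M N"
  using assms(1)[unfolded Arr_Mod] assms(2) by (simp add: GrMod_def)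

lemma hom_degree_part:
  assumes "graded M" "graded N" "f \<in> GHom M N"
  shows "unital_module_hom (S 0) (degree_part M i) (degree_part N i) (f i)"
  by (rule S0.hom_of_Arr[OF right_module_degree_part[OF assms(1)] right_module_degree_part[OF assms(2)]
    degree_part_arr[OF assms(1,3)]])

text \<open>
  The component \<open>(xS)\<^sub>n\<close> of the graded submodule generated by \<open>x\<close> of degree \<open>i\<close>.
\<close>

definition xS :: "('m, 's) grmodule \<Rightarrow> int \<Rightarrow> 'm \<Rightarrow> int \<Rightarrow> 'm set" where
  "xS M i x n = {gact M i (n - i) x s | s. s \<in> S (n - i)}"

lemma xS_submod:
  assumes M: "graded M" and x: "x \<in> gcar M i"
  shows "unital_module.submod (S 0) (degree_part M n) (xS M i x n)"
proof -
  interpret M: graded_right_module S M by (rule M)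
  interpret D: unital_module "S 0" "degree_part M n" by (rule unital_degree_part[OF M])
  have cl: "gact M i (n - i) x s \<in> gcar M n" if "s \<in> S (n - i)" for s using M.gact_closed[OF x that] by simp
  have add: "gact M i (n - i) x (s + t) = gact M i (n - i) x s \<oplus>\<^bsub>gcomp M n\<^esub> gact M i (n - i) x t"
    if "s \<in> S (n - i)" "t \<in> S (n - i)" for s t using M.gact_add_right[OF x that] by simp
  have mult: "gact M i (n - i) x (s * t) = gact M n 0 (gact M i (n - i) x s) t" if "s \<in> S (n - i)" "t \<in> S 0" for s t
    using M.gact_mult[OF x that] by simp
  have "gact M i (n - i) x 0 = \<zero>\<^bsub>gcomp M n\<^esub>"
    using gact_zero_right[OF M x, of "n - i"] by simp
  then have "\<zero>\<^bsub>gcomp M n\<^esub> \<in> xS M i x n" unfolding xS_def using zero_S by force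
  moreover have "gact M n 0 y t \<in> xS M i x n" if "y \<in> xS M i x n" "t \<in> S 0" for y t
    using that mult[symmetric] mult_S[of _ "n - i" t 0] by (auto simp: xS_def)
  moreover have "y \<oplus>\<^bsub>gcomp M n\<^esub> z \<in> xS M i x n" if "y \<in> xS M i x n" "z \<in> xS M i x n" for y z
    using that add[symmetric] add_S by (auto simp: xS_def)
  ultimately show ?thesis unfolding D.submod_def using cl by (auto simp: xS_def)
qed

lemma gact_sum_in_submod:
  assumes M: "graded M" and x: "x \<in> gcar M i" and W: "unital_module.submod (S 0) (degree_part M (i + j)) W"
    and B: "finite B" "B \<subseteq> S j" and r: "r \<in> B \<rightarrow> S 0" and xB: "\<And>b. b \<in> B \<Longrightarrow> gact M i j x b \<in> W"
  shows "gact M i j x (\<Sum>b\<in>B. b * r b) \<in> W"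
proof -
  interpret M: graded_right_module S M by (rule M)
  interpret D: unital_module "S 0" "degree_part M (i + j)" by (rule unital_degree_part[OF M])
  have "gact M i j x 0 = \<zero>\<^bsub>gcomp M (i + j)\<^esub>"
    by (rule gact_zero_right[OF M x])
  moreover have "gact M i j x (\<Sum>b\<in>A. b * r b) \<in> W \<and> (\<Sum>b\<in>A. b * r b) \<in> S j" if "A \<subseteq> B" "finite A" for A
    using that(2,1)
  proof (induction A)
    case empty
    then show ?case using calculation D.submodD(2)[OF W] zero_S by simp
  next
    case (insert b A)
    have b: "b \<in> S j" "r b \<in> S 0" using insert B r by auto
    have br: "b * r b \<in> S j" using mult_S[OF b] by simp
    have "gact M i j x (b * r b) = gact M (i + j) 0 (gact M i j x b) (r b)" using M.gact_mult[OF x b] by simp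
    then have "gact M i j x (b * r b) \<in> W" using D.submodD(4)[OF W xB[of b] b(2)] insert by simp
    then show ?case using insert br D.submodD(3)[OF W] add_S M.gact_add_right[OF x br] by simp
  qed
  ultimately show ?thesis using B(1) by blast
qed

text \<open>
  \<open>x S\<^bsub>n-i\<^esub>\<close> is generated by the products of \<open>x\<close> with right generators of \<open>S\<^bsub>n-i\<^esub>\<close>.
\<close>

lemma xS_fin_span:
  assumes M: "graded M" and x: "x \<in> gcar M i"
  shows "unital_module.fin_span (S 0) (degree_part M n) (xS M i x n)"
proof -
  interpret M: graded_right_module S M by (rule M)
  interpret D: unital_module "S 0" "degree_part M n" by (rule unital_degree_part[OF M])
  obtain B where B: "finite B" "B \<subseteq> S (n - i)" "S (n - i) = {\<Sum>b\<in>B. b * r b | r. r \<in> B \<rightarrow> S 0}"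
    using fg_right_S[of "n - i"] unfolding fg_right_def by blast
  obtain bs where bs: "set bs = B" using finite_list[OF B(1)] by blast
  let ?cs = "map (gact M i (n - i) x) bs"
  have cs: "set ?cs \<subseteq> carrier (degree_part M n)" using M.gact_closed[OF x, of _ "n - i"] B(2) bs by auto
  have "xS M i x n \<subseteq> D.spn ?cs"
  proof
    fix y assume "y \<in> xS M i x n"
    then obtain s where s: "s \<in> S (n - i)" "y = gact M i (n - i) x s" by (auto simp: xS_def)
    obtain r where r: "r \<in> B \<rightarrow> S 0" "s = (\<Sum>b\<in>B. b * r b)" using s(1) B(3) by auto
    have "gact M i (n - i) x (\<Sum>b\<in>B. b * r b) \<in> D.spn ?cs"
      by (rule gact_sum_in_submod[OF M x _ B(1,2) r(1)])
        (use D.spn_submod[OF cs] D.span_over_gens[OF D.submod_zero cs] bs in auto)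
    then show "y \<in> D.spn ?cs" using s r by simp
  qed
  then show ?thesis unfolding D.fin_span_def using cs by blast
qed

lemma locally_torsion_iff:
  assumes M: "graded M" and x: "x \<in> gcar M i"
  shows "ltorsion M i x \<longleftrightarrow> (\<forall>n. fdim M n (xS M i x n))"
  unfolding locally_torsion_element_def xS_def[symmetric]
  using S0.finite_dim_in_iff[OF right_module_degree_part[OF M] S0.submod_scalars[OF right_module_degree_part[OF M] xS_submod[OF M x]]]
  by simp

lemma xS_orbit: "xS M n y n = S0.orbit (degree_part M n) y"
  by (simp add: xS_def)

lemma xS_hom:
  assumes "f \<in> GHom M N" "x \<in> gcar M i"
  shows "f n ` xS M i x n = xS N i (f i x) n"
proof -
  have "f n (gact M i (n - i) x s) = gact N i (n - i) (f i x) s" if "s \<in> S (n - i)" for s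
    using Arr_GrModD(3)[OF assms that] by simp
  then show ?thesis unfolding xS_def by (auto simp: image_iff) metis
qed

lemma locally_torsion_zero:
  assumes M: "graded M"
  shows "ltorsion M i \<zero>\<^bsub>gcomp M i\<^esub>"
proof -
  interpret M: graded_right_module S M by (rule M)
  have z: "\<zero>\<^bsub>gcomp M n\<^esub> \<in> gcar M n" for n
    by (rule abelian_group.axioms(1)[OF M.gcomp_group, THEN abelian_monoid.zero_closed])
  have "fdim M n (xS M i \<zero>\<^bsub>gcomp M i\<^esub> n)" for n
  proof -
    interpret D: unital_module "S 0" "degree_part M n" by (rule unital_degree_part[OF M])
    have "gact M i (n - i) \<zero>\<^bsub>gcomp M i\<^esub> s = \<zero>\<^bsub>gcomp M n\<^esub>" if "s \<in> S (n - i)" for s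
      using gact_zero_left[OF M that, of i] by simp
    then have "xS M i \<zero>\<^bsub>gcomp M i\<^esub> n \<subseteq> S0.orbit (degree_part M n) \<zero>\<^bsub>gcomp M n\<^esub>"
      using D.ract_zero_left[OF one_S] one_S by (auto simp: xS_def intro!: exI[of _ 1])
    moreover have "fdim M n (S0.orbit (degree_part M n) \<zero>\<^bsub>gcomp M n\<^esub>)"
      using S0.torsion_element_zero[OF right_module_degree_part[OF M], of n]
        S0.torsion_element_iff[OF right_module_degree_part[OF M], of "\<zero>\<^bsub>gcomp M n\<^esub>" n] z by simp
    ultimately show ?thesis using S0.finite_dim_subset[OF right_module_degree_part[OF M]] by blast
  qed
  then show ?thesis using locally_torsion_iff[OF M z] by blast
qed

lemma locally_torsion_add:
  assumes M: "graded M" and x: "x \<in> gcar M i" "y \<in> gcar M i"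
    and t: "ltorsion M i x" "ltorsion M i y"
  shows "ltorsion M i (x \<oplus>\<^bsub>gcomp M i\<^esub> y)"
proof -
  interpret M: graded_right_module S M by (rule M)
  interpret G: abelian_group "gcomp M i" by (rule M.gcomp_group)
  have "fdim M n (xS M i (x \<oplus>\<^bsub>gcomp M i\<^esub> y) n)" for n
  proof -
    note D = right_module_degree_part[OF M, of n]
    have f: "fdim M n (xS M i x n)" "fdim M n (xS M i y n)"
      using t locally_torsion_iff[OF M x(1)] locally_torsion_iff[OF M x(2)] by blast+
    have a: "gact M i (n - i) (x \<oplus>\<^bsub>gcomp M i\<^esub> y) s = gact M i (n - i) x s \<oplus>\<^bsub>gcomp M n\<^esub> gact M i (n - i) y s"
      if "s \<in> S (n - i)" for s using M.gact_add_left[OF x that] by simp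
    have "xS M i (x \<oplus>\<^bsub>gcomp M i\<^esub> y) n \<subseteq> {v \<oplus>\<^bsub>degree_part M n\<^esub> w | v w. v \<in> xS M i x n \<and> w \<in> xS M i y n}"
      unfolding xS_def using a by auto
    then show ?thesis by (rule S0.finite_dim_subset[OF D S0.finite_dim_add[OF D f]])
  qed
  then show ?thesis using locally_torsion_iff[OF M G.a_closed[OF x]] by blast
qed

lemma locally_torsion_image:
  assumes o: "graded M" "graded N" and f: "f \<in> GHom M N"
    and x: "x \<in> gcar M i" "ltorsion M i x"
  shows "ltorsion N i (f i x)"
proof -
  have "fdim N n (xS N i (f i x) n)" for n
    using S0.finite_dim_image[OF hom_degree_part[OF o f, of n], of "xS M i x n"] x(2) locally_torsion_iff[OF o(1) x(1)] xS_hom[OF f x(1), of n] by simp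
  then show ?thesis using locally_torsion_iff[OF o(2) Arr_GrModD(1)[OF f x(1)]] by blast
qed

text \<open>
  Apply \<open>finite_dim_extension\<close> to the finitely generated \<open>S\<^sub>0\<close>-modules \<open>(xS)\<^sub>n\<close>: a homogeneous element of
  \<open>xS\<close> killed by \<open>f\<close> is locally torsion, so it generates a finite dimensional \<open>S\<^sub>0\<close>-module in its degree.
\<close>

lemma locally_torsion_extension:
  assumes o: "graded M" "graded N" and f: "f \<in> GHom M N"
    and x: "x \<in> gcar M i" "ltorsion N i (f i x)"
    and ker: "\<And>j y. \<lbrakk>y \<in> gcar M j; f j y = \<zero>\<^bsub>gcomp N j\<^esub>\<rbrakk> \<Longrightarrow> ltorsion M j y"
  shows "ltorsion M i x"
proof -
  have "fdim M n (xS M i x n)" for n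
  proof (rule S0.finite_dim_extension[OF hom_degree_part[OF o f] xS_submod[OF o(1) x(1)] xS_fin_span[OF o(1) x(1)]])
    show "fdim N n (f n ` xS M i x n)"
      unfolding xS_hom[OF f x(1)] using x(2) locally_torsion_iff[OF o(2) Arr_GrModD(1)[OF f x(1)]] by blast
    interpret D: unital_module "S 0" "degree_part M n" by (rule unital_degree_part[OF o(1)])
    fix y assume y: "y \<in> xS M i x n" "f n y = \<zero>\<^bsub>degree_part N n\<^esub>"
    have yn: "y \<in> gcar M n" using D.submodD(1)[OF xS_submod[OF o(1) x(1)]] y(1) by auto
    then have "ltorsion M n y" using ker y(2) by simp
    then show "fdim M n (S0.orbit (degree_part M n) y)"
      using locally_torsion_iff[OF o(1) yn] xS_orbit by metis
  qed
  then show ?thesis using locally_torsion_iff[OF o(1) x(1)] by blast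
qed

end

section \<open>Graded modules as a category with elements\<close>

locale graded_congruence = graded_right_module S M for S and M :: "('x, 's::{ring,monoid_mult}) grmodule" +
  fixes r :: "int \<Rightarrow> 'x \<Rightarrow> 'm"
  assumes add_cong: "\<lbrakk>x \<in> gcar M i; x' \<in> gcar M i; y \<in> gcar M i; y' \<in> gcar M i; r i x = r i x'; r i y = r i y'\<rbrakk>
    \<Longrightarrow> r i (x \<oplus>\<^bsub>gcomp M i\<^esub> y) = r i (x' \<oplus>\<^bsub>gcomp M i\<^esub> y')"
    and act_cong: "\<lbrakk>x \<in> gcar M i; x' \<in> gcar M i; s \<in> S j; r i x = r i x'\<rbrakk> \<Longrightarrow> r (i + j) (gact M i j x s) = r (i + j) (gact M i j x' s)"
begin

lemma ac: "additive_congruence (gcomp M i) (r i)"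
  by (intro additive_congruence.intro gcomp_group additive_congruence_axioms.intro add_cong)

lemma push_simps [simp]:
  "gcar (push_graded r M) i = r i ` gcar M i" "\<zero>\<^bsub>gcomp (push_graded r M) i\<^esub> = r i \<zero>\<^bsub>gcomp M i\<^esub>"
  using additive_congruence.push_carrier[OF ac] additive_congruence.push_zero[OF ac] by (simp_all add: push_graded_def)

lemma push_add: "\<lbrakk>x \<in> gcar M i; y \<in> gcar M i\<rbrakk> \<Longrightarrow> r i x \<oplus>\<^bsub>gcomp (push_graded r M) i\<^esub> r i y = r i (x \<oplus>\<^bsub>gcomp M i\<^esub> y)"
  using additive_congruence.push_add[OF ac] by (simp add: push_graded_def)

lemma push_act: "\<lbrakk>x \<in> gcar M i; s \<in> S j\<rbrakk> \<Longrightarrow> gact (push_graded r M) i j (r i x) s = r (i + j) (gact M i j x s)"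
  using act_cong[OF additive_congruence.inv_r(1)[OF ac]] additive_congruence.inv_r(2)[OF ac] by (simp add: push_graded_def)

end

context noetherian_graded_algebra begin

lemma graded_congruence_inj:
  assumes M: "graded M" and inj: "\<And>i. inj_on (r i) (gcar M i)"
  shows "graded_congruence S M r"
proof (intro graded_congruence.intro M graded_congruence_axioms.intro)
  fix i x x' y y' assume "x \<in> gcar M i" "x' \<in> gcar M i" "y \<in> gcar M i" "y' \<in> gcar M i" "r i x = r i x'" "r i y = r i y'"
  then show "r i (x \<oplus>\<^bsub>gcomp M i\<^esub> y) = r i (x' \<oplus>\<^bsub>gcomp M i\<^esub> y')" using inj_onD[OF inj] by metis
next
  fix i j x x' s assume "x \<in> gcar M i" "x' \<in> gcar M i" "r i x = r i x'"
  then show "r (i + j) (gact M i j x s) = r (i + j) (gact M i j x' s)" using inj_onD[OF inj] by metis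
qed

lemma push_graded_right_module:
  assumes "graded_congruence S M r"
  shows "graded (push_graded r M)"
proof -
  interpret r: graded_congruence S M r by (rule assms)
  show ?thesis
    by (rule graded_image[OF r.graded_right_module_axioms, of _ r]) (simp_all add: r.push_add r.push_act)
qed

lemma graded_sub:
  assumes M: "graded M" and V: "\<And>i. unital_module.submod (S 0) (degree_part M i) (V i)"
    and act: "\<And>i j x s. \<lbrakk>x \<in> V i; s \<in> S j\<rbrakk> \<Longrightarrow> gact M i j x s \<in> V (i + j)"
  shows "graded (sub_graded M V)"
proof -
  interpret M: graded_right_module S M by (rule M)
  have VM: "V i \<subseteq> gcar M i" for i
    using unital_module.submodD(1)[OF unital_degree_part[OF M, of i] V] by simp
  note car = subsetD[OF VM]
  have "abelian_group (gcomp (sub_graded M V) i)" for i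
  proof -
    interpret D: unital_module "S 0" "degree_part M i" by (rule unital_degree_part[OF M])
    show ?thesis
      by (rule abelian_group_cong[OF abelian_group_sub[OF D.abelian_group_axioms D.submodD(1,2,3)[OF V] D.submod_neg[OF V]]])
        simp_all
  qed
  then show ?thesis
    using act car
    by (intro graded_right_module.intro) (simp_all add: M.gact_add_left M.gact_add_right M.gact_mult M.gact_one)
qed

lemma GrMod_kernel:
  assumes M: "graded M" and N: "graded N" and f: "f \<in> GHom M N"
  shows "\<exists>K\<in>Obj (GrMod S). \<exists>j\<in>GHom K M. \<forall>i. inj_on (j i) (gcar K i) \<and>
    j i ` gcar K i = {x \<in> gcar M i. f i x = \<zero>\<^bsub>gcomp N i\<^esub>}"
proof -
  interpret M: graded_right_module S M by (rule M)
  note f' = Arr_GrModD[OF f]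
  let ?V = "\<lambda>i. {x \<in> gcar M i. f i x = \<zero>\<^bsub>gcomp N i\<^esub>}"
  let ?K = "sub_graded M ?V"
  have V: "unital_module.submod (S 0) (degree_part M i) (?V i)" for i
    using unital_module_hom.kernel_submod[OF hom_degree_part[OF M N f, of i]] by simp
  have "f (i + j) (gact M i j x s) = \<zero>\<^bsub>gcomp N (i + j)\<^esub>" if "x \<in> ?V i" "s \<in> S j" for i j x s
    using f'(3)[of x i s j] gact_zero_left[OF N that(2), of i] that(1,2) by simp
  then have K: "graded ?K" by (intro graded_sub[OF M V]) (simp add: M.gact_closed)
  let ?j = "\<lambda>i. restrict (\<lambda>x. x) (gcar ?K i)"
  have "?j \<in> GHom ?K M" by (rule Arr_GrModI[OF _ _ _ K]) simp_all
  moreover have "inj_on (?j i) (gcar ?K i) \<and> ?j i ` gcar ?K i = ?V i" for i by (simp add: inj_on_def)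
  moreover have "?K \<in> Obj (GrMod S)" using K by simp
  ultimately show ?thesis by (intro bexI[of _ ?K] bexI[of _ ?j] allI)
qed

lemma GrMod_cokernel:
  assumes M: "graded M" and N: "graded N" and f: "f \<in> GHom M N"
  shows "\<exists>Q\<in>Obj (GrMod S). \<exists>p\<in>GHom N Q. \<forall>i. p i ` gcar N i = gcar Q i \<and>
    {x \<in> gcar N i. p i x = \<zero>\<^bsub>gcomp Q i\<^esub>} = f i ` gcar M i"
proof -
  interpret M: graded_right_module S M by (rule M)
  interpret N: graded_right_module S N by (rule N)
  note f' = Arr_GrModD[OF f]
  let ?U = "\<lambda>i. f i ` gcar M i" and ?r = "\<lambda>i. coset_rep (degree_part N i) (f i ` gcar M i)"
  have U: "unital_module.submod (S 0) (degree_part N i) (?U i)" for i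
    using unital_module_hom.image_submod[OF hom_degree_part[OF M N f, of i]
      unital_module.submod_carrier[OF unital_degree_part[OF M, of i]]] by simp
  note coset = S0.module_congruence_coset_rep[OF unital_degree_part[OF N] U]
  have gc: "graded_congruence S N ?r"
  proof (intro graded_congruence.intro N graded_congruence_axioms.intro)
    fix i x x' y y' assume "x \<in> gcar N i" "x' \<in> gcar N i" "y \<in> gcar N i" "y' \<in> gcar N i" "?r i x = ?r i x'" "?r i y = ?r i y'"
    then show "?r i (x \<oplus>\<^bsub>gcomp N i\<^esub> y) = ?r i (x' \<oplus>\<^bsub>gcomp N i\<^esub> y')"
      using module_congruence.add_cong[OF coset(1)[of i], of x x' y y'] by simp
  next
    fix i j x x' s assume c: "x \<in> gcar N i" "x' \<in> gcar N i" "s \<in> S j" and e: "?r i x = ?r i x'"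
    interpret D: unital_module "S 0" "degree_part N i" by (rule unital_degree_part[OF N])
    interpret E: unital_module "S 0" "degree_part N (i + j)" by (rule unital_degree_part[OF N])
    have "x \<ominus>\<^bsub>degree_part N i\<^esub> x' \<in> ?U i"
      using D.coset_rep_eq_iff[OF D.submodD(1,2,3)[OF U] D.submod_neg[OF U], of x x'] c e by simp
    then obtain m where m: "m \<in> gcar M i" "x \<ominus>\<^bsub>degree_part N i\<^esub> x' = f i m" by blast
    have fm: "f i m \<in> gcar N i" using f'(1) m(1) .
    have "x = f i m \<oplus>\<^bsub>degree_part N i\<^esub> x'" unfolding m(2)[symmetric] a_minus_def
      by (subst D.a_assoc) (use c D.l_neg[of x'] D.a_inv_closed[of x'] D.r_zero[of x] in simp_all)
    then have "gact N i j x s = f (i + j) (gact M i j m s) \<oplus>\<^bsub>degree_part N (i + j)\<^esub> gact N i j x' s"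
      using N.gact_add_left[OF fm c(2,3)] f'(3)[OF m(1) c(3)] by simp
    moreover have "gact N i j x' s \<in> carrier (degree_part N (i + j))" "f (i + j) (gact M i j m s) \<in> carrier (degree_part N (i + j))"
      using N.gact_closed[OF c(2,3)] f'(1)[OF M.gact_closed[OF m(1) c(3)]] by simp_all
    ultimately have "gact N i j x s \<ominus>\<^bsub>degree_part N (i + j)\<^esub> gact N i j x' s = f (i + j) (gact M i j m s)"
      by (simp only: a_minus_def E.a_assoc E.r_neg E.r_zero E.a_inv_closed)
    then show "?r (i + j) (gact N i j x s) = ?r (i + j) (gact N i j x' s)"
      using E.coset_rep_eq_iff[OF E.submodD(1,2,3)[OF U] E.submod_neg[OF U]] M.gact_closed[OF m(1) c(3)]
        N.gact_closed[OF c(1,3)] N.gact_closed[OF c(2,3)] by simp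
  qed
  interpret r: graded_congruence S N ?r by (rule gc)
  let ?Q = "push_graded ?r N" and ?p = "\<lambda>i. restrict (?r i) (gcar N i)"
  have Q: "?Q \<in> Obj (GrMod S)" using push_graded_right_module[OF gc] by simp
  have p: "?p \<in> GHom N ?Q"
    by (rule Arr_GrModI[OF _ _ _ N]) (simp_all add: r.push_add r.push_act)
  have "?p i ` gcar N i = gcar ?Q i \<and> {x \<in> gcar N i. ?p i x = \<zero>\<^bsub>gcomp ?Q i\<^esub>} = ?U i" for i
    using coset(2)[of _ i] f'(1) by auto
  then show ?thesis using p by (intro bexI[OF _ Q] bexI[of _ ?p] allI)
qed

lemma GrMod_product:
  fixes A B :: "('m, 's) grmodule"
  assumes A: "graded A" and B: "graded B"
  shows "\<exists>P\<in>Obj (GrMod S). \<exists>p\<in>GHom P A. \<exists>q\<in>GHom P B.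
      (\<forall>i. \<forall>x\<in>gcar A i. \<forall>y\<in>gcar B i. \<exists>!z. z \<in> gcar P i \<and> p i z = x \<and> q i z = y) \<and>
      (\<forall>X\<in>Obj (GrMod S). \<forall>f\<in>GHom X A. \<forall>g\<in>GHom X B.
        \<exists>h\<in>GHom X P. cmp (GrMod S) X P A p h = f \<and> cmp (GrMod S) X P B q h = g)"
proof -
  let ?AB = "prod_graded A B" and ?r = "\<lambda>i::int. pairing :: 'm \<times> 'm \<Rightarrow> 'm"
  interpret A: graded_right_module S A by (rule A)
  interpret B: graded_right_module S B by (rule B)
  have inj: "inj_on (?r i) (gcar A i \<times> gcar B i)" for i
    using S0.inj_on_pairing[OF right_module_degree_part[OF A, of i] right_module_degree_part[OF B, of i]] by simp
  have gc: "graded_congruence S ?AB ?r"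
    by (rule graded_congruence_inj[OF graded_right_module_prod[OF A B]]) (simp add: inj)
  interpret r: graded_congruence S ?AB ?r by (rule gc)
  let ?P = "push_graded ?r ?AB" and ?i = "\<lambda>i. inv_into (gcar A i \<times> gcar B i) (?r i)"
  have P: "graded ?P" by (rule push_graded_right_module[OF gc])
  have i: "?i i (?r i (x, y)) = (x, y)" if "x \<in> gcar A i" "y \<in> gcar B i" for x y i
    using inv_into_f_f[OF inj] that by simp
  have cA: "x \<oplus>\<^bsub>gcomp A i\<^esub> y \<in> gcar A i" if "x \<in> gcar A i" "y \<in> gcar A i" for x y i
    using abelian_monoid.a_closed[OF abelian_group.axioms(1)[OF A.gcomp_group]] that by blast
  have cB: "x \<oplus>\<^bsub>gcomp B i\<^esub> y \<in> gcar B i" if "x \<in> gcar B i" "y \<in> gcar B i" for x y i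
    using abelian_monoid.a_closed[OF abelian_group.axioms(1)[OF B.gcomp_group]] that by blast
  let ?p = "\<lambda>i. restrict (\<lambda>z. fst (?i i z)) (gcar ?P i)" and ?q = "\<lambda>i. restrict (\<lambda>z. snd (?i i z)) (gcar ?P i)"
  have pq: "?p \<in> GHom ?P A" "?q \<in> GHom ?P B"
    by (rule Arr_GrModI[OF _ _ _ P]; auto simp: i r.push_add r.push_act A.gact_closed B.gact_closed cA cB)+
  have v: "?p i (?r i (x, y)) = x" "?q i (?r i (x, y)) = y" if "x \<in> gcar A i" "y \<in> gcar B i" for x y i
    using that by (simp_all add: i)
  have ex1: "\<exists>!z. z \<in> gcar ?P i \<and> ?p i z = x \<and> ?q i z = y" if xy: "x \<in> gcar A i" "y \<in> gcar B i" for x y i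
  proof (rule ex1I[of _ "?r i (x, y)"])
    show "?r i (x, y) \<in> gcar ?P i \<and> ?p i (?r i (x, y)) = x \<and> ?q i (?r i (x, y)) = y" using xy by (simp add: i)
    fix z assume "z \<in> gcar ?P i \<and> ?p i z = x \<and> ?q i z = y"
    then show "z = ?r i (x, y)" by (auto simp: i)
  qed
  have uni: "\<exists>h\<in>GHom X ?P. cmp (GrMod S) X ?P A ?p h = f \<and> cmp (GrMod S) X ?P B ?q h = g"
    if X: "X \<in> Obj (GrMod S)" and f: "f \<in> GHom X A" and g: "g \<in> GHom X B" for X f g
  proof -
    note f' = Arr_GrModD[OF f] and g' = Arr_GrModD[OF g]
    have X': "graded X" using X by simp
    let ?h = "\<lambda>i. restrict (\<lambda>x. ?r i (f i x, g i x)) (gcar X i)"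
    have "?h \<in> GHom X ?P"
      by (rule Arr_GrModI[OF _ _ _ X']) (simp_all add: f' g' r.push_add r.push_act)
    moreover have "(\<lambda>i. compose (gcar X i) (?p i) (?h i)) = f"
    proof (rule ext, rule extensionalityI[OF compose_extensional f'(4)])
      fix i x assume "x \<in> gcar X i"
      then show "compose (gcar X i) (?p i) (?h i) x = f i x" using v(1)[OF f'(1) g'(1)] by (simp add: compose_eq)
    qed
    moreover have "(\<lambda>i. compose (gcar X i) (?q i) (?h i)) = g"
    proof (rule ext, rule extensionalityI[OF compose_extensional g'(4)])
      fix i x assume "x \<in> gcar X i"
      then show "compose (gcar X i) (?q i) (?h i) x = g i x" using v(2)[OF f'(1) g'(1)] by (simp add: compose_eq)
    qed
    ultimately show ?thesis unfolding GrMod_simps by (intro bexI[of _ ?h] conjI)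
  qed
  have P': "?P \<in> Obj (GrMod S)" using P by simp
  show ?thesis
    by (intro bexI[OF _ P'] bexI[OF _ pq(1)] bexI[OF _ pq(2)] conjI ballI allI) (rule ex1 uni; assumption)+
qed

lemma GrMod_lift:
  assumes o: "graded X" "graded K" "graded M"
    and f: "f \<in> GHom X M" and j: "j \<in> GHom K M"
    and inj: "\<And>i. inj_on (j i) (gcar K i)" and im: "\<And>i. f i ` gcar X i \<subseteq> j i ` gcar K i"
  shows "\<exists>h\<in>GHom X K. cmp (GrMod S) X K M j h = f"
proof -
  note part = right_module_degree_part and j' = Arr_GrModD[OF j]
  have "\<exists>h. h \<in> Hom0 (degree_part X i) (degree_part K i) \<and> compose (gcar X i) (j i) h = f i" for i
    using S0.Mod_lift[OF part[OF o(1)] part[OF o(2)] part[OF o(3)] degree_part_arr[OF o(1) f] degree_part_arr[OF o(2) j], of i]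
      inj im by auto
  then obtain h where h: "\<And>i. h i \<in> Hom0 (degree_part X i) (degree_part K i)"
    and jh: "\<And>i. compose (gcar X i) (j i) (h i) = f i" by metis
  have hK: "h i x \<in> gcar K i" "j i (h i x) = f i x" if "x \<in> gcar X i" for i x
    using Arr_ModD(1)[OF h] compose_eq[OF that, of "j i" "h i"] that by (simp_all add: jh)
  have "h \<in> GHom X K"
  proof (rule Arr_GrMod_partsI[OF h])
    fix i l x s assume x: "x \<in> gcar X i" "s \<in> S l"
    have c: "gact X i l x s \<in> gcar X (i + l)" by (rule graded_right_module.gact_closed[OF o(1) x])
    show "h (i + l) (gact X i l x s) = gact K i l (h i x) s"
      by (rule inj_onD[OF inj _ hK(1)[OF c] graded_right_module.gact_closed[OF o(2) hK(1)[OF x(1)] x(2)]])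
        (simp add: hK c x j'(3) Arr_GrModD(3)[OF f x])
  qed
  then show ?thesis using jh unfolding GrMod_simps by (intro bexI[of _ h]) simp_all
qed

lemma GrMod_descend:
  assumes o: "graded M" "graded Q" "graded X"
    and f: "f \<in> GHom M X" and p: "p \<in> GHom M Q"
    and sur: "\<And>i. p i ` gcar M i = gcar Q i" and ker: "\<And>i x. \<lbrakk>x \<in> gcar M i; p i x = \<zero>\<^bsub>gcomp Q i\<^esub>\<rbrakk> \<Longrightarrow> f i x = \<zero>\<^bsub>gcomp X i\<^esub>"
  shows "\<exists>h\<in>GHom Q X. cmp (GrMod S) M Q X h p = f"
proof -
  note part = right_module_degree_part and f' = Arr_GrModD[OF f] and p' = Arr_GrModD[OF p]
  have "\<exists>h. h \<in> Hom0 (degree_part Q i) (degree_part X i) \<and> compose (gcar M i) h (p i) = f i" for i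
    using S0.Mod_descend[OF part[OF o(1)] part[OF o(2)] part[OF o(3)] degree_part_arr[OF o(1) f] degree_part_arr[OF o(1) p], of i]
      sur ker by auto
  then obtain h where h: "\<And>i. h i \<in> Hom0 (degree_part Q i) (degree_part X i)"
    and hp: "\<And>i. compose (gcar M i) (h i) (p i) = f i" by metis
  have hp': "h i (p i x) = f i x" if "x \<in> gcar M i" for i x
    using compose_eq[OF that, of "h i" "p i"] by (simp add: hp)
  have "h \<in> GHom Q X"
  proof (rule Arr_GrMod_partsI[OF h])
    fix i l y s assume y: "y \<in> gcar Q i" "s \<in> S l"
    obtain x where x: "x \<in> gcar M i" "y = p i x" using y(1) sur by blast
    show "h (i + l) (gact Q i l y s) = gact X i l (h i y) s"
      using hp'[OF graded_right_module.gact_closed[OF o(1) x(1) y(2)]] p'(3)[OF x(1) y(2)] f'(3)[OF x(1) y(2)]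
      by (simp add: x hp')
  qed
  then show ?thesis using hp unfolding GrMod_simps by (intro bexI[of _ h]) simp_all
qed

theorem element_category_GrMod:
  "element_category (GrMod S :: (('m, 's) grmodule, int \<Rightarrow> 'm \<Rightarrow> 'm) cat) gcomp (\<lambda>f. f)
    (locally_torsion_element scale S)"
proof -
  note part = right_module_degree_part
  interpret D: element_category "Mod (S 0) :: (('m, 's) rmodule, 'm \<Rightarrow> 'm) cat" "\<lambda>M (_::unit). M" "\<lambda>f _. f"
    "\<lambda>M _. torsion0 M"
    by (rule S0.element_category_Mod)
  show ?thesis
proof (rule element_category.intro, unfold Obj_GrMod, goal_cases)
  case (1 M i)
  then show ?case by (rule graded_right_module.gcomp_group)
next
  case (2 M N f x i) show ?case by (rule Arr_GrModD(1)[OF 2(3,4)])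
next
  case (3 M N f x i y) show ?case by (rule Arr_GrModD(2)[OF 3(3-5)])
next
  case (4 M N f g)
  show ?case by (rule ext, rule extensionalityI[OF Arr_GrModD(4)[OF 4(3)] Arr_GrModD(4)[OF 4(4)] 4(5)])
next
  case (5 M)
  show ?case unfolding GrMod_simps by (rule Arr_GrModI[OF _ _ _ 5]) simp_all
next
  case (6 M x i) then show ?case by simp
next
  case (7 M N P f g)
  show ?case unfolding GrMod_simps
  proof (rule Arr_GrMod_partsI)
    show "compose (gcar M i) (g i) (f i) \<in> Hom0 (degree_part M i) (degree_part P i)" for i
      using D.cmp_arr[of "degree_part M i" "degree_part N i" "degree_part P i"] 7 by (simp add: part degree_part_arr)
  qed (simp add: compose_eq graded_right_module.gact_closed[OF 7(1)] Arr_GrModD[OF 7(4)] Arr_GrModD[OF 7(5)])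
next
  case (8 M N P f g x i) then show ?case by (simp add: compose_eq)
next
  case (9 M N f g)
  show ?case unfolding GrMod_simps
  proof (rule Arr_GrMod_partsI)
    show "(\<lambda>x\<in>gcar M i. f i x \<oplus>\<^bsub>gcomp N i\<^esub> g i x) \<in> Hom0 (degree_part M i) (degree_part N i)" for i
      using D.plus_arr[of "degree_part M i" "degree_part N i" "f i" "g i"] 9 by (simp add: part degree_part_arr)
  qed (simp add: graded_right_module.gact_closed[OF 9(1)] graded_right_module.gact_add_left[OF 9(2)]
      Arr_GrModD[OF 9(3)] Arr_GrModD[OF 9(4)])
next
  case (10 M N f g x i) then show ?case by simp
next
  case (11 M N)
  show ?case unfolding GrMod_simps
  proof (rule Arr_GrMod_partsI)
    show "(\<lambda>x\<in>gcar M i. \<zero>\<^bsub>gcomp N i\<^esub>) \<in> Hom0 (degree_part M i) (degree_part N i)" for i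
      using D.zero_arr[of "degree_part M i" "degree_part N i"] 11 by (simp add: part)
  qed (simp add: graded_right_module.gact_closed[OF 11(1)] gact_zero_left[OF 11(2)])
next
  case (12 M N x i) then show ?case by simp
next
  case (13 M N f)
  let ?g = "\<lambda>i. \<lambda>x\<in>gcar M i. gact N i 0 (f i x) (- 1)"
  have n: "gact N i 0 y (- 1) = \<ominus>\<^bsub>gcomp N i\<^esub> y" if "y \<in> gcar N i" for i y
  proof -
    interpret U: unital_module "S 0" "degree_part N i" by (rule S0.unital_R[OF part[OF 13(2)]])
    have "\<ominus>\<^bsub>degree_part N i\<^esub> y = \<ominus>\<^bsub>gcomp N i\<^esub> y" by (simp add: a_inv_def m_inv_def)
    then show ?thesis using U.neg_eq_ract[of y] that by simp
  qed
  have m1: "- 1 \<in> S 0" using subspace_neg[OF subspace_S one_S] .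
  have "?g \<in> GHom M N"
  proof (rule Arr_GrModI[OF _ _ _ 13(1)])
    fix i x assume x: "x \<in> gcar M i"
    then show "gact N i 0 (f i x) (- 1) \<in> gcar N i"
      using graded_right_module.gact_closed[OF 13(2) Arr_GrModD(1)[OF 13(3) x] m1] by simp
    fix j s assume s: "s \<in> S j"
    show "gact N (i + j) 0 (f (i + j) (gact M i j x s)) (- 1) = gact N i j (gact N i 0 (f i x) (- 1)) s"
      using graded_right_module.gact_mult[OF 13(2) Arr_GrModD(1)[OF 13(3) x] s m1]
        graded_right_module.gact_mult[OF 13(2) Arr_GrModD(1)[OF 13(3) x] m1 s] by (simp add: Arr_GrModD(3)[OF 13(3) x s])
  next
    fix i x y assume xy: "x \<in> gcar M i" "y \<in> gcar M i"
    show "gact N i 0 (f i (x \<oplus>\<^bsub>gcomp M i\<^esub> y)) (- 1) = gact N i 0 (f i x) (- 1) \<oplus>\<^bsub>gcomp N i\<^esub> gact N i 0 (f i y) (- 1)"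
      using graded_right_module.gact_add_left[OF 13(2) Arr_GrModD(1)[OF 13(3) xy(1)] Arr_GrModD(1)[OF 13(3) xy(2)] m1]
      by (simp add: Arr_GrModD(2)[OF 13(3) xy])
  qed
  moreover have "?g i x = \<ominus>\<^bsub>gcomp N i\<^esub> f i x" if "x \<in> gcar M i" for i x
    using n[OF Arr_GrModD(1)[OF 13(3) that]] that by simp
  ultimately show ?case by (intro bexI[of _ ?g]) simp_all
next
  case 14
  let ?Z = "\<lparr>gcomp = (\<lambda>_. \<lparr>carrier = {undefined}, monoid.mult = undefined, one = undefined, zero = undefined,
      add = (\<lambda>_ _. undefined)\<rparr>), gact = (\<lambda>_ _ _ _. undefined)\<rparr> :: ('m, 's) grmodule"
  have "abelian_group (gcomp ?Z i)" for i by (rule abelian_groupI) simp_all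
  then have "graded ?Z" by (intro graded_right_module.intro) simp_all
  then show ?case by (intro bexI[of _ ?Z]) simp_all
next
  case (15 A B) show ?case using GrMod_product[OF 15] by simp
next
  case (16 M N f) show ?case using GrMod_kernel[OF 16] by simp
next
  case (17 M N f) show ?case using GrMod_cokernel[OF 17] by simp
next
  case (18 X K M f j) show ?case by (rule GrMod_lift[OF 18])
next
  case (19 M Q X f p) show ?case by (rule GrMod_descend[OF 19(1-6)]) (rule 19(7))
next
  case (20 M i) then show ?case by (rule locally_torsion_zero)
next
  case (21 M x i y) then show ?case by (rule locally_torsion_add)
next
  case (22 M N f x i) show ?case by (rule locally_torsion_image[OF 22])
next
  case (23 M N f x i)
  show ?case by (rule locally_torsion_extension[OF 23(1-5)]) (rule 23(6))
qed
qed

end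

section \<open>Torsion and generation in degree zero\<close>

text \<open>
  The component \<open>W S\<^sub>i\<close> of the graded submodule generated by \<open>W \<subseteq> M\<^sub>0\<close>, that is, the finite sums of
  products \<open>w s\<close>.
\<close>

inductive_set gen :: "(int \<Rightarrow> 's set) \<Rightarrow> ('m, 's) grmodule \<Rightarrow> 'm set \<Rightarrow> int \<Rightarrow> 'm set"
  for S :: "int \<Rightarrow> 's set" and M :: "('m, 's) grmodule" and W :: "'m set" and i :: int where
  zero: "\<zero>\<^bsub>gcomp M i\<^esub> \<in> gen S M W i"
| add: "\<lbrakk>w \<in> W; s \<in> S i; y \<in> gen S M W i\<rbrakk> \<Longrightarrow> gact M 0 i w s \<oplus>\<^bsub>gcomp M i\<^esub> y \<in> gen S M W i"

context noetherian_graded_algebra begin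

lemma act_hom:
  assumes M: "graded M" and s: "s \<in> S l"
  shows "unital_module_hom S0.scalars (degree_part M j) (degree_part M (j + l)) (\<lambda>v. gact M j l v s)"
proof (intro unital_module_hom.intro unital_module_hom_axioms.intro S0.unital_scalars[OF right_module_degree_part[OF M]])
  interpret M: graded_right_module S M by (rule M)
  fix v assume v: "v \<in> carrier (degree_part M j)"
  then show "gact M j l v s \<in> carrier (degree_part M (j + l))" using M.gact_closed s by simp
  { fix w assume "w \<in> carrier (degree_part M j)"
    then show "gact M j l (v \<oplus>\<^bsub>degree_part M j\<^esub> w) s = gact M j l v s \<oplus>\<^bsub>degree_part M (j + l)\<^esub> gact M j l w s"
      using v M.gact_add_left s by simp }
  fix a assume a: "a \<in> S0.scalars"
  have aS: "a \<in> S 0" using S0.scalars_R a by blast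
  show "gact M j l (ract (degree_part M j) v a) s = ract (degree_part M (j + l)) (gact M j l v s) a"
    using M.gact_mult[of v j a 0 s l] M.gact_mult[of v j s l a 0] v aS s S0.scalar_central[OF a, of s] by simp
qed

lemma finite_dim_act:
  assumes M: "graded M" and s: "s \<in> S l" and V: "S0.finite_dim (degree_part M j) V"
  shows "S0.finite_dim (degree_part M (j + l)) ((\<lambda>v. gact M j l v s) ` V)"
  using unital_module_hom.fin_span_image[OF act_hom[OF M s]] V unfolding S0.finite_dim_def by blast

text \<open>
  If \<open>S\<^sub>n\<close> is the sum of finitely many \<open>S\<^sub>0 b\<close>, then \<open>w S\<^sub>n\<close> is the sum of the \<open>(w S\<^sub>0) b\<close>, which are images
  of the finite dimensional space \<open>w S\<^sub>0\<close> under linear maps.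
\<close>

lemma finite_dim_torsion_act:
  assumes M: "graded M" and w: "w \<in> gcar M 0" "torsion0 (degree_part M 0) w"
  shows "fdim M n (xS M 0 w n)"
proof -
  interpret M: graded_right_module S M by (rule M)
  note D0 = right_module_degree_part[OF M, of 0] and Dn = right_module_degree_part[OF M, of n]
  interpret Kn: unital_module S0.scalars "degree_part M n" by (rule S0.unital_scalars[OF Dn])
  obtain B where B: "finite B" "B \<subseteq> S n" "S n = {\<Sum>b\<in>B. r b * b | r. r \<in> B \<rightarrow> S 0}"
    using fg_left_S[of n] unfolding fg_left_def by blast
  have orb: "fdim M 0 (S0.orbit (degree_part M 0) w)"
    using w S0.torsion_element_iff[OF D0] by simp
  have "fdim M n (\<Union>b\<in>B. (\<lambda>v. gact M 0 n v b) ` S0.orbit (degree_part M 0) w)"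
    using finite_dim_act[OF M _ orb, of _ n] B(2) by (intro S0.finite_dim_UN[OF Dn B(1)]) auto
  then obtain T where T: "Kn.submod T" "(\<Union>b\<in>B. (\<lambda>v. gact M 0 n v b) ` S0.orbit (degree_part M 0) w) \<subseteq> T"
    "fdim M n T" by (rule S0.finite_dim_closure[OF Dn])
  have step: "gact M 0 n w (\<Sum>b\<in>A. r b * b) \<in> T \<and> (\<Sum>b\<in>A. r b * b) \<in> S n" if "finite A" "A \<subseteq> B" "r \<in> B \<rightarrow> S 0" for A r
    using that(1,2)
  proof (induction A)
    case empty
    then show ?case using Kn.submodD(2)[OF T(1)] zero_S gact_zero_right[OF M w(1), of n] by simp
  next
    case (insert b A)
    have b: "r b \<in> S 0" "b \<in> S n" using insert B(2) that(3) by auto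
    have rb: "r b * b \<in> S n" using mult_S[OF b] by simp
    have "gact M 0 n w (r b * b) = gact M 0 n (gact M 0 0 w (r b)) b" using M.gact_mult[OF w(1) b] by simp
    moreover have "gact M 0 0 w (r b) \<in> S0.orbit (degree_part M 0) w" using b by auto
    moreover have "b \<in> B" using insert by simp
    ultimately have "gact M 0 n w (r b * b) \<in> T" using T(2) by blast
    then show ?case using insert rb Kn.submodD(3)[OF T(1)] add_S M.gact_add_right[OF w(1) rb] by simp
  qed
  have "xS M 0 w n \<subseteq> T"
  proof
    fix y assume "y \<in> xS M 0 w n"
    then obtain s where s: "s \<in> S n" "y = gact M 0 n w s" by (auto simp: xS_def)
    obtain r where "r \<in> B \<rightarrow> S 0" "s = (\<Sum>b\<in>B. r b * b)" using s(1) B(3) by auto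
    then show "y \<in> T" using step[OF B(1) subset_refl] s(2) by simp
  qed
  then show ?thesis by (rule S0.finite_dim_subset[OF Dn T(3)])
qed

text \<open>
  Torsion is detected in degree zero. The finitely generated torsion module \<open>x S\<^bsub>-i\<^esub>\<close> is finite
  dimensional, say with spanning elements \<open>ws\<close>, and \<open>w S\<^sub>n\<close> is finite dimensional for each of them. By
  density \<open>S\<^bsub>n-i\<^esub>\<close> is spanned by the products \<open>S\<^bsub>-i\<^esub> S\<^sub>n\<close> and a finite set \<open>B\<close>; hence \<open>x S\<^bsub>n-i\<^esub>\<close> lies in the
  span \<open>T\<close> of the \<open>w S\<^sub>n\<close> and of \<open>x B\<close>.
\<close>

lemma locally_torsionI:
  assumes M: "graded M" and x: "x \<in> gcar M i"
    and t: "\<And>s. s \<in> S (- i) \<Longrightarrow> torsion0 (degree_part M 0) (gact M i (- i) x s)"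
  shows "ltorsion M i x"
proof -
  interpret M: graded_right_module S M by (rule M)
  note D0 = right_module_degree_part[OF M, of 0]
  interpret R0: unital_module "S 0" "degree_part M 0" by (rule S0.unital_R[OF D0])
  interpret K0: unital_module S0.scalars "degree_part M 0" by (rule S0.unital_scalars[OF D0])
  have xS0: "xS M i x 0 = {gact M i (- i) x s | s. s \<in> S (- i)}" by (simp add: xS_def)
  have car: "xS M i x 0 \<subseteq> gcar M 0" using R0.submodD(1)[OF xS_submod[OF M x]] by simp
  have tx: "torsion0 (degree_part M 0) w" if "w \<in> xS M i x 0" for w
    using that t unfolding xS0 by blast
  obtain cs where cs: "set cs \<subseteq> xS M i x 0" "xS M i x 0 \<subseteq> R0.spn cs"
    using xS_fin_span[OF M x] R0.fin_span_iff_generators[OF S0.noeth_R xS_submod[OF M x]] by blast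
  have "fdim M 0 (R0.spn cs)"
  proof (rule S0.finite_dim_spn[OF D0])
    show "set cs \<subseteq> carrier (degree_part M 0)" using cs(1) car by auto
    fix c assume "c \<in> set cs"
    then have "c \<in> xS M i x 0" "c \<in> carrier (degree_part M 0)" using cs(1) car by auto
    then show "fdim M 0 (S0.orbit (degree_part M 0) c)"
      using S0.torsion_element_iff[OF D0] tx by blast
  qed
  then have "K0.fin_span (xS M i x 0)" using S0.finite_dim_subset[OF D0 _ cs(2)] unfolding S0.finite_dim_def by blast
  then obtain ws where ws: "set ws \<subseteq> xS M i x 0" "xS M i x 0 \<subseteq> K0.spn ws"
    using K0.fin_span_iff_generators[OF S0.noeth_scalars S0.submod_scalars[OF D0 xS_submod[OF M x]]] by blast
  have wc: "set ws \<subseteq> carrier (degree_part M 0)" using ws(1) car by auto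
  have "fdim M n (xS M i x n)" for n
  proof -
    note Dn = right_module_degree_part[OF M, of n]
    interpret Rn: unital_module "S 0" "degree_part M n" by (rule S0.unital_R[OF Dn])
    interpret Kn: unital_module S0.scalars "degree_part M n" by (rule S0.unital_scalars[OF Dn])
    have "finite_codim (span {a * b | a b. a \<in> S (- i) \<and> b \<in> S n}) (S (n - i))"
      using dense_grading[of "- i" "n - i"] by simp
    then obtain B where B: "finite B" "B \<subseteq> S (n - i)" "S (n - i) \<subseteq> span (span {a * b | a b. a \<in> S (- i) \<and> b \<in> S n} \<union> B)"
      unfolding finite_codim_def by blast
    have "fdim M n (\<Union>w\<in>set ws. xS M 0 w n)"
    proof (rule S0.finite_dim_UN[OF Dn finite_set])
      fix w assume "w \<in> set ws"
      then have "w \<in> xS M i x 0" "w \<in> gcar M 0" using ws(1) car by auto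
      then show "fdim M n (xS M 0 w n)" using finite_dim_torsion_act[OF M] tx by blast
    qed
    moreover have "fdim M n (gact M i (n - i) x ` B)"
    proof -
      obtain bs where bs: "set bs = B" using finite_list[OF B(1)] by blast
      have c: "set (map (gact M i (n - i) x) bs) \<subseteq> carrier (degree_part M n)"
        using M.gact_closed[OF x, of _ "n - i"] B(2) bs by auto
      show ?thesis unfolding S0.finite_dim_def Kn.fin_span_def
        using c Kn.span_over_gens[OF Kn.submod_zero c] bs by (intro exI[of _ "map (gact M i (n - i) x) bs"]) auto
    qed
    ultimately have "Kn.fin_span ((\<Union>w\<in>set ws. xS M 0 w n) \<union> gact M i (n - i) x ` B)"
      unfolding S0.finite_dim_def by (rule Kn.fin_span_Un)
    then obtain T where T: "Kn.submod T" "(\<Union>w\<in>set ws. xS M 0 w n) \<union> gact M i (n - i) x ` B \<subseteq> T"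
      "fdim M n T" unfolding S0.finite_dim_def by (rule Kn.fin_span_closure)
    have yb: "gact M 0 n y b \<in> T" if y: "y \<in> xS M i x 0" and b: "b \<in> S n" for y b
    proof -
      interpret h: unital_module_hom S0.scalars "degree_part M 0" "degree_part M n" "\<lambda>v. gact M 0 n v b"
        using act_hom[OF M b, of 0] by simp
      have "gact M 0 n y b \<in> Kn.span_over ((\<lambda>v. gact M 0 n v b) ` {\<zero>\<^bsub>degree_part M 0\<^esub>}) (map (\<lambda>v. gact M 0 n v b) ws)"
      proof -
        have "{\<zero>\<^bsub>degree_part M 0\<^esub>} \<subseteq> carrier (degree_part M 0)" using R0.zero_closed by blast
        from subsetD[OF h.image_span_over[OF wc this] imageI[OF subsetD[OF ws(2) y]]] show ?thesis .
      qed
      moreover have "Kn.span_over ((\<lambda>v. gact M 0 n v b) ` {\<zero>\<^bsub>degree_part M 0\<^esub>}) (map (\<lambda>v. gact M 0 n v b) ws) \<subseteq> T"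
      proof (rule Kn.span_over_least[OF T(1)])
        show "(\<lambda>v. gact M 0 n v b) ` {\<zero>\<^bsub>degree_part M 0\<^esub>} \<subseteq> T" using h.f_zero Kn.submodD(2)[OF T(1)] by simp
        show "set (map (\<lambda>v. gact M 0 n v b) ws) \<subseteq> T" using T(2) b by (force simp: xS_def)
      qed
      ultimately show ?thesis by blast
    qed
    \<comment> \<open>The elements carrying \<open>x\<close> into \<open>T\<close> form a subspace, so it is enough to test products and \<open>B\<close>.\<close>
    let ?T = "{s \<in> S (n - i). gact M i (n - i) x s \<in> T}"
    have sub: "subspace ?T"
    proof (rule subspaceI)
      show "0 \<in> ?T" using zero_S gact_zero_right[OF M x, of "n - i"] Kn.submodD(2)[OF T(1)] by simp
      show "s + t \<in> ?T" if "s \<in> ?T" "t \<in> ?T" for s t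
        using that add_S M.gact_add_right[OF x, of s "n - i" t] Kn.submodD(3)[OF T(1)] by simp
      show "scale c s \<in> ?T" if s: "s \<in> ?T" for c s
      proof -
        have e: "scale c s = s * scale c 1" by (simp add: scale_mult_right)
        have sc: "scale c 1 \<in> S0.scalars" "scale c 1 \<in> S 0" using subspace_scale[OF subspace_S one_S] unfolding S0.scalars_def by blast+
        have "gact M i (n - i) x (scale c s) = gact M n 0 (gact M i (n - i) x s) (scale c 1)"
          using M.gact_mult[OF x _ sc(2), of s "n - i"] s by (simp add: e)
        then show ?thesis using s subspace_scale[OF subspace_S, of s "n - i" c] Kn.submodD(4)[OF T(1) _ sc(1), of "gact M i (n - i) x s"] by simp
      qed
    qed
    have "{a * b | a b. a \<in> S (- i) \<and> b \<in> S n} \<subseteq> ?T"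
    proof clarify
      fix a b assume ab: "a \<in> S (- i)" "b \<in> S n"
      have "a * b \<in> S (n - i)" using mult_S[OF ab] by simp
      moreover have "gact M i (- i + n) x (a * b) = gact M 0 n (gact M i (- i) x a) b" using M.gact_mult[OF x ab] by simp
      moreover have "gact M i (- i) x a \<in> xS M i x 0" using ab xS0 by blast
      ultimately show "a * b \<in> S (n - i) \<and> gact M i (n - i) x (a * b) \<in> T" using yb ab(2) by simp
    qed
    then have "span {a * b | a b. a \<in> S (- i) \<and> b \<in> S n} \<subseteq> ?T" by (rule span_minimal[OF _ sub])
    moreover have "B \<subseteq> ?T" using B(2) T(2) by blast
    ultimately have "span {a * b | a b. a \<in> S (- i) \<and> b \<in> S n} \<union> B \<subseteq> ?T" by (rule Un_least)
    from subset_trans[OF B(3) span_minimal[OF this sub]] have "S (n - i) \<subseteq> ?T" .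
    then have "xS M i x n \<subseteq> T" by (auto simp: xS_def)
    then show ?thesis by (rule S0.finite_dim_subset[OF Dn T(3)])
  qed
  then show ?thesis using locally_torsion_iff[OF M x] by blast
qed

lemma torsion_of_locally_torsion:
  assumes M: "graded M" and x: "x \<in> gcar M 0" "ltorsion M 0 x"
  shows "torsion0 (degree_part M 0) x"
proof -
  have "fdim M 0 (xS M 0 x 0)" using x(2) locally_torsion_iff[OF M x(1)] by blast
  then show ?thesis using x(1) S0.torsion_element_iff[OF right_module_degree_part[OF M], of x 0] by (simp add: xS_def)
qed

context
  fixes M :: "('m, 's) grmodule" and W :: "'m set"
  assumes M: "graded M" and W: "unital_module.submod (S 0) (degree_part M 0) W"
begin

interpretation M: graded_right_module S M by (rule M)

lemma W_car: "w \<in> W \<Longrightarrow> w \<in> gcar M 0"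
  using unital_module.submodD(1)[OF unital_degree_part[OF M] W] by auto

lemma gen_car: "y \<in> gen S M W i \<Longrightarrow> y \<in> gcar M i"
proof (induction rule: gen.induct)
  case zero
  then show ?case by (rule abelian_group.axioms(1)[OF M.gcomp_group, THEN abelian_monoid.zero_closed])
next
  case (add w s y)
  then show ?case
    using M.gact_closed[OF W_car, of w s i] abelian_monoid.a_closed[OF abelian_group.axioms(1)[OF M.gcomp_group]] by simp
qed

lemma gen_generator: "\<lbrakk>w \<in> W; s \<in> S i\<rbrakk> \<Longrightarrow> gact M 0 i w s \<in> gen S M W i"
proof -
  interpret A: abelian_group "gcomp M i" by (rule M.gcomp_group)
  assume a: "w \<in> W" "s \<in> S i"
  then show ?thesis using gen.add[where S = S and M = M and W = W and i = i, OF a gen.zero] M.gact_closed[OF W_car[OF a(1)] a(2)] by simp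
qed

lemma gen_add: "\<lbrakk>x \<in> gen S M W i; y \<in> gen S M W i\<rbrakk> \<Longrightarrow> x \<oplus>\<^bsub>gcomp M i\<^esub> y \<in> gen S M W i"
proof (induction x rule: gen.induct)
  case zero
  interpret A: abelian_group "gcomp M i" by (rule M.gcomp_group)
  show ?case using zero gen_car by simp
next
  case (add w s x)
  interpret A: abelian_group "gcomp M i" by (rule M.gcomp_group)
  have "gact M 0 i w s \<oplus>\<^bsub>gcomp M i\<^esub> x \<oplus>\<^bsub>gcomp M i\<^esub> y = gact M 0 i w s \<oplus>\<^bsub>gcomp M i\<^esub> (x \<oplus>\<^bsub>gcomp M i\<^esub> y)"
    using add gen_car M.gact_closed[OF W_car[OF add(1)] add(2)] by (simp add: A.a_assoc)
  then show ?case using gen.add[where S = S and M = M and W = W and i = i, OF add(1,2)] add by simp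
qed

lemma gen_act: "\<lbrakk>x \<in> gen S M W i; t \<in> S j\<rbrakk> \<Longrightarrow> gact M i j x t \<in> gen S M W (i + j)"
proof (induction rule: gen.induct)
  case zero
  then show ?case using gact_zero_left[OF M, of t j i] gen.zero by metis
next
  case (add w s x)
  have ws: "gact M 0 i w s \<in> gcar M i" using M.gact_closed[OF W_car[OF add(1)] add(2)] by simp
  have "gact M i j (gact M 0 i w s \<oplus>\<^bsub>gcomp M i\<^esub> x) t = gact M i j (gact M 0 i w s) t \<oplus>\<^bsub>gcomp M (i + j)\<^esub> gact M i j x t"
    using M.gact_add_left[OF ws gen_car[OF add(3)] add.prems] .
  moreover have "gact M i j (gact M 0 i w s) t = gact M 0 (i + j) w (s * t)"
    using M.gact_mult[OF W_car[OF add(1)] add(2) add.prems] by simp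
  ultimately show ?case using gen.add[where S = S and M = M and W = W and i = "i + j", OF add(1) mult_S[OF add(2) add.prems]] add by simp
qed

lemma gen_submod: "unital_module.submod (S 0) (degree_part M i) (gen S M W i)"
proof -
  interpret D: unital_module "S 0" "degree_part M i" by (rule unital_degree_part[OF M])
  show ?thesis unfolding D.submod_def using gen_car gen.zero gen_add gen_act[of _ i _ 0] by auto
qed

lemma gen_graded: "graded (sub_graded M (gen S M W))"
  by (rule graded_sub[OF M gen_submod gen_act])

text \<open>
  No new elements appear in degree zero because \<open>W\<close> is already an \<open>S\<^sub>0\<close>-module.
\<close>

lemma gen_degree_zero: "gen S M W 0 = W"
proof
  interpret D: unital_module "S 0" "degree_part M 0" by (rule unital_degree_part[OF M])
  show "gen S M W 0 \<subseteq> W"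
  proof
    fix x assume "x \<in> gen S M W 0"
    then show "x \<in> W"
      by (induction rule: gen.induct) (use D.submodD[OF W] in simp_all)
  qed
  show "W \<subseteq> gen S M W 0"
  proof
    fix w assume w: "w \<in> W"
    then show "w \<in> gen S M W 0" using gen_generator[OF w one_S] M.gact_one[OF W_car[OF w]] by simp
  qed
qed

text \<open>
  Every element is a sum of products \<open>w s\<close> with \<open>w\<close> of degree zero, and arrows commute with the action of \<open>s\<close>.
\<close>

lemma gen_arrow_eqI:
  assumes N: "graded N" and a: "a \<in> GHom (sub_graded M (gen S M W)) N"
    and b: "b \<in> GHom (sub_graded M (gen S M W)) N" and eq: "a 0 = b 0"
  shows "a = b"
proof (rule ext, rule extensionalityI[OF Arr_GrModD(4)[OF a] Arr_GrModD(4)[OF b]])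
  note a' = Arr_GrModD[OF a] and b' = Arr_GrModD[OF b]
  fix i x assume "x \<in> gcar (sub_graded M (gen S M W)) i"
  then have "x \<in> gen S M W i" by simp
  then show "a i x = b i x"
  proof (induction rule: gen.induct)
    case zero
    have z: "c i \<zero>\<^bsub>gcomp M i\<^esub> = \<zero>\<^bsub>gcomp N i\<^esub>" if c: "c \<in> GHom (sub_graded M (gen S M W)) N" for c
      using unital_module_hom.f_zero[OF hom_degree_part[OF gen_graded N c, of i]] by simp
    show ?case using z[OF a] z[OF b] by simp
  next
    case (add w s y)
    have w: "w \<in> gcar (sub_graded M (gen S M W)) 0" using add(1) gen_degree_zero by simp
    have ws: "gact M 0 i w s \<in> gcar (sub_graded M (gen S M W)) i" using gen_generator[OF add(1,2)] by simp
    have y: "y \<in> gcar (sub_graded M (gen S M W)) i" using add(3) by simp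
    have "a i (gact M 0 i w s) = b i (gact M 0 i w s)" using a'(3)[OF w add(2)] b'(3)[OF w add(2)] eq by simp
    then show ?case using a'(2)[OF ws y] b'(2)[OF ws y] add.IH by simp
  qed
qed

text \<open>
  The products of generators of \<open>W\<close> with right generators of \<open>S\<^sub>i\<close> generate: a coefficient
  \<open>r \<in> S\<^sub>0\<close> of a generator \<open>g\<close> is absorbed into \<open>S\<^sub>i\<close>.
\<close>

lemma gen_fin_span:
  assumes fs: "unital_module.fin_span (S 0) (degree_part M 0) W"
  shows "unital_module.fin_span (S 0) (degree_part M i) (gen S M W i)"
proof -
  interpret D0: unital_module "S 0" "degree_part M 0" by (rule unital_degree_part[OF M])
  interpret D: unital_module "S 0" "degree_part M i" by (rule unital_degree_part[OF M])
  obtain gs where gs: "set gs \<subseteq> carrier (degree_part M 0)" "W \<subseteq> D0.spn gs" using fs unfolding D0.fin_span_def by blast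
  have "D.fin_span (\<Union>g\<in>set gs. xS M 0 g i)"
    by (rule D.fin_span_UN[OF finite_set]) (use gs(1) xS_fin_span[OF M, of _ 0 i] in auto)
  then obtain T where T: "D.submod T" "(\<Union>g\<in>set gs. xS M 0 g i) \<subseteq> T" "D.fin_span T" by (rule D.fin_span_closure)
  have sp: "gact M 0 i w s \<in> T" if "w \<in> D0.spn gs" "s \<in> S i" for w s
    using that(1) gs(1) T(2)
  proof (induction gs arbitrary: w)
    case Nil
    then show ?case using gact_zero_left[OF M that(2), of 0] D.submodD(2)[OF T(1)] by simp
  next
    case (Cons g gs)
    obtain y r where y: "w = y \<oplus>\<^bsub>gcomp M 0\<^esub> gact M 0 0 g r" "y \<in> D0.spn gs" "r \<in> S 0" using Cons.prems(1) by auto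
    have g: "g \<in> gcar M 0" and gsc: "set gs \<subseteq> carrier (degree_part M 0)" using Cons.prems(2) by simp_all
    have yc: "y \<in> gcar M 0" using D0.submodD(1)[OF D0.spn_submod[OF gsc]] y(2) by auto
    have grc: "gact M 0 0 g r \<in> gcar M 0" using M.gact_closed[OF g y(3)] by simp
    have "gact M 0 i (gact M 0 0 g r) s = gact M 0 i g (r * s)" using M.gact_mult[OF g y(3) that(2)] by simp
    moreover have "r * s \<in> S i" using mult_S[OF y(3) that(2)] by simp
    ultimately have "gact M 0 i (gact M 0 0 g r) s \<in> xS M 0 g i" by (auto simp: xS_def)
    then have "gact M 0 i (gact M 0 0 g r) s \<in> T" using Cons.prems(3) by auto
    moreover have "gact M 0 i y s \<in> T" using Cons.IH[OF y(2) gsc] Cons.prems(3) by auto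
    ultimately show ?case using M.gact_add_left[OF yc grc that(2)] D.submodD(3)[OF T(1)] by (simp add: y(1))
  qed
  have "gen S M W i \<subseteq> T"
  proof
    fix x assume "x \<in> gen S M W i"
    then show "x \<in> T"
      by (induction rule: gen.induct) (use D.submodD(2,3)[OF T(1)] sp gs(2) in auto)
  qed
  then show ?thesis by (rule D.fin_span_subset[OF T(3)])
qed

text \<open>
  With \<open>S\<^sub>i\<close> finitely generated on the left, \<open>W S\<^sub>i\<close> is the sum of finitely many sets \<open>W b\<close>. In contrast
  to \<open>gen\<close> the number of summands is fixed, which bounds the cardinality by a power of that of \<open>W\<close>.
\<close>

fun left_combinations :: "int \<Rightarrow> 's list \<Rightarrow> 'm set" where
  "left_combinations i [] = {\<zero>\<^bsub>gcomp M i\<^esub>}"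
| "left_combinations i (b # bs) = (\<lambda>(w, y). gact M 0 i w b \<oplus>\<^bsub>gcomp M i\<^esub> y) ` (W \<times> left_combinations i bs)"

lemma left_combinations_add:
  "\<lbrakk>set bs \<subseteq> S i; x \<in> left_combinations i bs; y \<in> left_combinations i bs\<rbrakk>
    \<Longrightarrow> x \<in> gcar M i \<and> x \<oplus>\<^bsub>gcomp M i\<^esub> y \<in> left_combinations i bs"
proof (induction bs arbitrary: x y)
  case Nil
  interpret A: abelian_group "gcomp M i" by (rule M.gcomp_group)
  show ?case using Nil by simp
next
  case (Cons b bs)
  interpret A: abelian_group "gcomp M i" by (rule M.gcomp_group)
  interpret D: unital_module "S 0" "degree_part M 0" by (rule unital_degree_part[OF M])
  have b: "b \<in> S i" using Cons by simp
  obtain w x' where x: "w \<in> W" "x' \<in> left_combinations i bs" "x = gact M 0 i w b \<oplus>\<^bsub>gcomp M i\<^esub> x'" using Cons.prems(2) by auto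
  obtain v y' where y: "v \<in> W" "y' \<in> left_combinations i bs" "y = gact M 0 i v b \<oplus>\<^bsub>gcomp M i\<^esub> y'" using Cons.prems(3) by auto
  have IH: "x' \<in> gcar M i" "y' \<in> gcar M i" "x' \<oplus>\<^bsub>gcomp M i\<^esub> y' \<in> left_combinations i bs"
    using Cons.IH[OF _ x(2) y(2)] Cons.IH[OF _ y(2) y(2)] Cons.prems(1) by simp_all
  have wb: "gact M 0 i w b \<in> gcar M i" "gact M 0 i v b \<in> gcar M i"
    using M.gact_closed[OF W_car[OF x(1)] b] M.gact_closed[OF W_car[OF y(1)] b] by simp_all
  have wv: "w \<oplus>\<^bsub>gcomp M 0\<^esub> v \<in> W" using D.submodD(3)[OF W x(1) y(1)] by simp
  have "x \<oplus>\<^bsub>gcomp M i\<^esub> y = gact M 0 i (w \<oplus>\<^bsub>gcomp M 0\<^esub> v) b \<oplus>\<^bsub>gcomp M i\<^esub> (x' \<oplus>\<^bsub>gcomp M i\<^esub> y')"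
    using M.gact_add_left[OF W_car[OF x(1)] W_car[OF y(1)] b] wb IH by (simp add: x(3) y(3) A.a_ac)
  then have "x \<oplus>\<^bsub>gcomp M i\<^esub> y \<in> left_combinations i (b # bs)" using wv IH(3) by force
  then show ?case using wb IH by (simp add: x(3))
qed

lemma gen_subset_left_combinations:
  obtains bs where "set bs \<subseteq> S i" "gen S M W i \<subseteq> left_combinations i bs"
proof -
  interpret A: abelian_group "gcomp M i" by (rule M.gcomp_group)
  interpret D: unital_module "S 0" "degree_part M 0" by (rule unital_degree_part[OF M])
  obtain B where B: "finite B" "B \<subseteq> S i" "S i = {\<Sum>b\<in>B. r b * b | r. r \<in> B \<rightarrow> S 0}"
    using fg_left_S[of i] unfolding fg_left_def by blast
  obtain bs where bs: "set bs = B" "distinct bs" using finite_distinct_list[OF B(1)] by blast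
  have z: "\<zero>\<^bsub>gcomp M i\<^esub> \<in> left_combinations i cs" if "set cs \<subseteq> S i" for cs using that
  proof (induction cs)
    case (Cons c cs)
    have "gact M 0 i \<zero>\<^bsub>gcomp M 0\<^esub> c \<oplus>\<^bsub>gcomp M i\<^esub> \<zero>\<^bsub>gcomp M i\<^esub> = \<zero>\<^bsub>gcomp M i\<^esub>"
      using gact_zero_left[OF M, of c i 0] Cons by simp
    then show ?case using Cons D.submodD(2)[OF W] by force
  qed simp
  have step: "gact M 0 i w (\<Sum>b\<in>set cs. r b * b) \<in> left_combinations i cs \<and> (\<Sum>b\<in>set cs. r b * b) \<in> S i"
    if "distinct cs" "set cs \<subseteq> B" "w \<in> W" "r \<in> B \<rightarrow> S 0" for cs w r
    using that(1,2)
  proof (induction cs)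
    case Nil
    then show ?case using gact_zero_right[OF M W_car[OF that(3)], of i] zero_S by simp
  next
    case (Cons c cs)
    have c: "r c \<in> S 0" "c \<in> S i" using Cons that(4) B(2) by auto
    have rc: "r c * c \<in> S i" using mult_S[OF c] by simp
    have IH: "gact M 0 i w (\<Sum>b\<in>set cs. r b * b) \<in> left_combinations i cs" "(\<Sum>b\<in>set cs. r b * b) \<in> S i" using Cons by simp_all
    have "gact M 0 i w (r c * c) = gact M 0 i (gact M 0 0 w (r c)) c" using M.gact_mult[OF W_car[OF that(3)] c] by simp
    moreover have "gact M 0 0 w (r c) \<in> W" using D.submodD(4)[OF W that(3) c(1)] by simp
    moreover have "gact M 0 i w (\<Sum>b\<in>set (c # cs). r b * b) = gact M 0 i w (r c * c) \<oplus>\<^bsub>gcomp M i\<^esub> gact M 0 i w (\<Sum>b\<in>set cs. r b * b)"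
      using Cons M.gact_add_right[OF W_car[OF that(3)] rc IH(2)] by simp
    ultimately show ?case using IH add_S[OF rc IH(2)] Cons by force
  qed
  have "gen S M W i \<subseteq> left_combinations i bs"
  proof
    fix x assume "x \<in> gen S M W i"
    then show "x \<in> left_combinations i bs"
    proof (induction rule: gen.induct)
      case zero then show ?case using z bs B(2) by simp
    next
      case (add w s y)
      obtain r where "r \<in> B \<rightarrow> S 0" "s = (\<Sum>b\<in>B. r b * b)" using add(2) B(3) by auto
      then have "gact M 0 i w s \<in> left_combinations i bs" using step[OF bs(2) _ add(1)] bs(1) by simp
      then show ?case using left_combinations_add[of bs i] add.IH bs(1) B(2) by simp
    qed
  qed
  then show ?thesis using that bs(1) B(2) by blast
qed

text \<open>
  \<open>W S\<^sub>i\<close> is the image of a finite power of \<open>W\<close>, and an infinite type absorbs finite powers.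
\<close>

lemma gen_card:
  assumes inf: "infinite (UNIV :: 'n set)" and W_card: "\<exists>h :: 'm \<Rightarrow> 'n. inj_on h W"
  shows "\<exists>h :: 'm \<Rightarrow> 'n. inj_on h (gen S M W i)"
proof -
  obtain bs where bs: "gen S M W i \<subseteq> left_combinations i bs" by (rule gen_subset_left_combinations)
  have "\<exists>h :: 'm \<Rightarrow> 'n. inj_on h (left_combinations i bs)"
  proof (induction bs)
    case Nil then show ?case by simp
  next
    case (Cons b bs)
    obtain h g :: "'m \<Rightarrow> 'n" where h: "inj_on h W" and g: "inj_on g (left_combinations i bs)" using Cons W_card by blast
    let ?X = "W \<times> left_combinations i bs" and ?F = "\<lambda>(w, y). gact M 0 i w b \<oplus>\<^bsub>gcomp M i\<^esub> y"
    have 1: "inj_on (pairing \<circ> map_prod h g) ?X"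
      by (rule comp_inj_on[OF map_prod_inj_on[OF h g] inj_on_subset[OF inj_pairing[OF inf] subset_UNIV]])
    have 2: "inj_on (inv_into ?X ?F) (?F ` ?X)" by (rule inj_on_inv_into) (rule subset_refl)
    have "inv_into ?X ?F ` (?F ` ?X) \<subseteq> ?X"
    proof
      fix z assume "z \<in> inv_into ?X ?F ` (?F ` ?X)"
      then obtain u where "u \<in> ?F ` ?X" "z = inv_into ?X ?F u" by blast
      then show "z \<in> ?X" using inv_into_into[of u ?F ?X] by simp
    qed
    then have "inj_on ((pairing \<circ> map_prod h g) \<circ> inv_into ?X ?F) (left_combinations i (b # bs))"
      unfolding left_combinations.simps by (intro comp_inj_on[OF 2] inj_on_subset[OF 1])
    then show ?case by blast
  qed
  then show ?thesis using bs inj_on_subset by blast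
qed

end

end

section \<open>Coinduced graded modules and finite generation\<close>

context noetherian_graded_algebra begin

text \<open>
  The coinduced graded module of an \<open>S\<^sub>0\<close>-module \<open>N\<close>: its component of degree \<open>i\<close> consists of the additive
  maps \<open>S\<^bsub>-i\<^esub> \<rightarrow> N\<close>, with \<open>S\<close> acting by \<open>(\<phi> s)(t) = \<phi>(s t)\<close>. It serves as an ambient module in which
  \<open>N\<close>, embedded in degree zero by \<open>n \<mapsto> (t \<mapsto> n t)\<close>, generates a graded submodule.
\<close>

definition hom_graded :: "('m, 's) rmodule \<Rightarrow> ('s \<Rightarrow> 'm, 's) grmodule" where
  "hom_graded N = \<lparr>gcomp = (\<lambda>i. \<lparr>carrier = {\<phi> \<in> extensional (S (- i)). (\<forall>t\<in>S (- i). \<phi> t \<in> carrier N) \<and>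
        (\<forall>t\<in>S (- i). \<forall>u\<in>S (- i). \<phi> (t + u) = \<phi> t \<oplus>\<^bsub>N\<^esub> \<phi> u)},
      monoid.mult = undefined, one = undefined, zero = (\<lambda>t\<in>S (- i). \<zero>\<^bsub>N\<^esub>), add = (\<lambda>\<phi> \<psi>. \<lambda>t\<in>S (- i). \<phi> t \<oplus>\<^bsub>N\<^esub> \<psi> t)\<rparr>),
    gact = (\<lambda>i j \<phi> s. \<lambda>t\<in>S (- (i + j)). \<phi> (s * t))\<rparr>"

lemma hom_graded_simps:
  "\<phi> \<in> gcar (hom_graded N) i \<longleftrightarrow> \<phi> \<in> extensional (S (- i)) \<and> (\<forall>t\<in>S (- i). \<phi> t \<in> carrier N) \<and>
        (\<forall>t\<in>S (- i). \<forall>u\<in>S (- i). \<phi> (t + u) = \<phi> t \<oplus>\<^bsub>N\<^esub> \<phi> u)"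
  "\<zero>\<^bsub>gcomp (hom_graded N) i\<^esub> = (\<lambda>t\<in>S (- i). \<zero>\<^bsub>N\<^esub>)"
  "\<phi> \<oplus>\<^bsub>gcomp (hom_graded N) i\<^esub> \<psi> = (\<lambda>t\<in>S (- i). \<phi> t \<oplus>\<^bsub>N\<^esub> \<psi> t)"
  "gact (hom_graded N) i j \<phi> s = (\<lambda>t\<in>S (- (i + j)). \<phi> (s * t))"
  by (simp_all add: hom_graded_def)

lemma hom_graded_right_module:
  assumes N: "right_module (S 0) N"
  shows "graded (hom_graded N)"
proof -
  interpret N: right_module "S 0" N by (rule N)
  let ?H = "hom_graded N"
  have st: "s * t \<in> S (- i)" if "s \<in> S j" "t \<in> S (- (i + j))" for s t i j
    using mult_S[OF that] by simp
  show ?thesis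
  proof (rule graded_right_module.intro)
    fix i
    show "abelian_group (gcomp ?H i)"
    proof (rule abelian_groupI)
      fix \<phi> \<psi> assume "\<phi> \<in> gcar ?H i" "\<psi> \<in> gcar ?H i"
      then show "\<phi> \<oplus>\<^bsub>gcomp ?H i\<^esub> \<psi> \<in> gcar ?H i"
        unfolding hom_graded_simps using add_S[of _ "- i"] by (auto simp: N.a_ac)
    next
      show "\<zero>\<^bsub>gcomp ?H i\<^esub> \<in> gcar ?H i" unfolding hom_graded_simps using add_S[of _ "- i"] by auto
    next
      fix \<phi> \<psi> \<chi> assume "\<phi> \<in> gcar ?H i" "\<psi> \<in> gcar ?H i" "\<chi> \<in> gcar ?H i"
      then show "\<phi> \<oplus>\<^bsub>gcomp ?H i\<^esub> \<psi> \<oplus>\<^bsub>gcomp ?H i\<^esub> \<chi> = \<phi> \<oplus>\<^bsub>gcomp ?H i\<^esub> (\<psi> \<oplus>\<^bsub>gcomp ?H i\<^esub> \<chi>)"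
        unfolding hom_graded_simps by (auto simp: N.a_assoc restrict_def fun_eq_iff)
    next
      fix \<phi> \<psi> assume "\<phi> \<in> gcar ?H i" "\<psi> \<in> gcar ?H i"
      then show "\<phi> \<oplus>\<^bsub>gcomp ?H i\<^esub> \<psi> = \<psi> \<oplus>\<^bsub>gcomp ?H i\<^esub> \<phi>"
        unfolding hom_graded_simps by (auto simp: N.a_comm restrict_def fun_eq_iff)
    next
      fix \<phi> assume \<phi>: "\<phi> \<in> gcar ?H i"
      then show "\<zero>\<^bsub>gcomp ?H i\<^esub> \<oplus>\<^bsub>gcomp ?H i\<^esub> \<phi> = \<phi>"
        unfolding hom_graded_simps by (auto simp: restrict_def fun_eq_iff extensional_def)
      have "(\<lambda>t\<in>S (- i). \<ominus>\<^bsub>N\<^esub> \<phi> t) \<in> gcar ?H i"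
        using \<phi> unfolding hom_graded_simps using add_S[of _ "- i"] by (auto simp: N.minus_add)
      moreover have "(\<lambda>t\<in>S (- i). \<ominus>\<^bsub>N\<^esub> \<phi> t) \<oplus>\<^bsub>gcomp ?H i\<^esub> \<phi> = \<zero>\<^bsub>gcomp ?H i\<^esub>"
        using \<phi> unfolding hom_graded_simps by (auto simp: restrict_def fun_eq_iff N.l_neg)
      ultimately show "\<exists>\<psi>\<in>gcar ?H i. \<psi> \<oplus>\<^bsub>gcomp ?H i\<^esub> \<phi> = \<zero>\<^bsub>gcomp ?H i\<^esub>" by blast
    qed
  next
    fix \<phi> i s j assume \<phi>: "\<phi> \<in> gcar ?H i" and s: "s \<in> S j"
    show "gact ?H i j \<phi> s \<in> gcar ?H (i + j)"
      unfolding hom_graded_simps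
    proof (intro conjI ballI)
      fix t u assume t: "t \<in> S (- (i + j))" and u: "u \<in> S (- (i + j))"
      have "t + u \<in> S (- (i + j))" by (rule add_S[OF t u])
      then show "(\<lambda>t\<in>S (- (i + j)). \<phi> (s * t)) (t + u) = (\<lambda>t\<in>S (- (i + j)). \<phi> (s * t)) t \<oplus>\<^bsub>N\<^esub> (\<lambda>t\<in>S (- (i + j)). \<phi> (s * t)) u"
        using \<phi> st[OF s t] st[OF s u] t u unfolding hom_graded_simps by (simp add: distrib_left)
    qed (use \<phi> st[OF s] in \<open>auto simp: hom_graded_simps\<close>)
    fix \<psi> assume \<psi>: "\<psi> \<in> gcar ?H i"
    show "gact ?H i j (\<phi> \<oplus>\<^bsub>gcomp ?H i\<^esub> \<psi>) s = gact ?H i j \<phi> s \<oplus>\<^bsub>gcomp ?H (i + j)\<^esub> gact ?H i j \<psi> s"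
      unfolding hom_graded_simps by (rule restrict_ext) (simp add: st[OF s])
  next
    fix \<phi> i s j s' assume \<phi>: "\<phi> \<in> gcar ?H i" and s: "s \<in> S j" "s' \<in> S j"
    show "gact ?H i j \<phi> (s + s') = gact ?H i j \<phi> s \<oplus>\<^bsub>gcomp ?H (i + j)\<^esub> gact ?H i j \<phi> s'"
      unfolding hom_graded_simps
    proof (rule restrict_ext)
      fix t assume t: "t \<in> S (- (i + j))"
      then show "\<phi> ((s + s') * t) = (\<lambda>t\<in>S (- (i + j)). \<phi> (s * t)) t \<oplus>\<^bsub>N\<^esub> (\<lambda>t\<in>S (- (i + j)). \<phi> (s' * t)) t"
        using \<phi> st[OF s(1) t] st[OF s(2) t] unfolding hom_graded_simps by (simp add: distrib_right)
    qed
  next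
    fix \<phi> i s j t l assume \<phi>: "\<phi> \<in> gcar ?H i" and s: "s \<in> S j" and t: "t \<in> S l"
    show "gact ?H i (j + l) \<phi> (s * t) = gact ?H (i + j) l (gact ?H i j \<phi> s) t"
      unfolding hom_graded_simps add.assoc[of i j l]
    proof (rule restrict_ext)
      fix u assume "u \<in> S (- (i + (j + l)))"
      then have "t * u \<in> S (- (i + j))" using st[OF t, of u "i + j"] by (simp add: add.assoc)
      then show "\<phi> (s * t * u) = (\<lambda>t\<in>S (- (i + j)). \<phi> (s * t)) (t * u)" by (simp add: mult.assoc)
    qed
  next
    fix \<phi> i assume "\<phi> \<in> gcar ?H i"
    then show "gact ?H i 0 \<phi> 1 = \<phi>" unfolding hom_graded_simps by (simp add: extensional_restrict)
  qed
qed

lemma unit_hom: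
  assumes N: "right_module (S 0) N"
  shows "unital_module_hom (S 0) N (degree_part (hom_graded N) 0) (\<lambda>n. \<lambda>t\<in>S 0. ract N n t)"
proof -
  interpret N: right_module "S 0" N by (rule N)
  show ?thesis
  proof (rule S0.hom_Mod(1)[OF N right_module_degree_part[OF hom_graded_right_module[OF N]]])
    fix n assume n: "n \<in> carrier N"
    show "(\<lambda>t\<in>S 0. ract N n t) \<in> carrier (degree_part (hom_graded N) 0)"
      using n add_S[of _ 0] N.ract_closed N.ract_add_right by (auto simp: hom_graded_simps)
    fix s assume s: "s \<in> S 0"
    show "(\<lambda>t\<in>S 0. ract N (ract N n s) t) = ract (degree_part (hom_graded N) 0) (\<lambda>t\<in>S 0. ract N n t) s"
      using n s S0.mult_R N.ract_mult by (auto simp: hom_graded_simps restrict_def fun_eq_iff)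
  next
    fix m n assume "m \<in> carrier N" "n \<in> carrier N"
    then show "(\<lambda>t\<in>S 0. ract N (m \<oplus>\<^bsub>N\<^esub> n) t) =
        (\<lambda>t\<in>S 0. ract N m t) \<oplus>\<^bsub>degree_part (hom_graded N) 0\<^esub> (\<lambda>t\<in>S 0. ract N n t)"
      using N.ract_add_left by (auto simp: hom_graded_simps restrict_def fun_eq_iff)
  qed
qed

lemma span_over_cong:
  assumes A: "unital_module R A" and B: "unital_module R B" and "add A = add B" "ract A = ract B"
  shows "unital_module.span_over R A U bs = unital_module.span_over R B U bs"
  by (induction bs) (simp_all add: unital_module.span_over.simps[OF A] unital_module.span_over.simps[OF B] assms)

text \<open>
  The graded submodule generated by \<open>N\<close> in the coinduced module has \<open>N\<close> itself as component of degree
  zero, since evaluation at \<open>1\<close> recovers \<open>n\<close> from \<open>t \<mapsto> n t\<close>. Its elements are functions, so it is carried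
  into the universe \<open>'m\<close> of \<open>N\<close> along injections \<open>h i\<close>, which exist by \<open>gen_card\<close>.
\<close>

lemma essentially_surjective:
  fixes N :: "('m, 's) rmodule"
  assumes N: "right_module (S 0) N"
  obtains M :: "('m, 's) grmodule" and e where "graded M" "e \<in> Hom0 N (degree_part M 0)"
    "bij_betw e (carrier N) (carrier (degree_part M 0))"
    "fg_module (S 0) N \<longrightarrow> (\<forall>i. fg_module (S 0) (degree_part M i))"
proof -
  let ?H = "hom_graded N" and ?u = "\<lambda>n. \<lambda>t\<in>S 0. ract N n t"
  interpret N: unital_module "S 0" N by (rule S0.unital_R[OF N])
  note H = hom_graded_right_module[OF N]
  interpret u: unital_module_hom "S 0" N "degree_part ?H 0" ?u by (rule unit_hom[OF N])
  define W where "W = ?u ` carrier N"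
  have W: "unital_module.submod (S 0) (degree_part ?H 0) W"
    unfolding W_def by (rule u.image_submod[OF N.submod_carrier])
  have u1: "?u n 1 = n" if "n \<in> carrier N" for n using that one_S N.ract_one by simp
  have inju: "inj_on ?u (carrier N)" using u1 by (metis (no_types, lifting) inj_onI)
  \<comment> \<open>If \<open>N\<close> is zero, the universe may be finite, but then the generated module is zero as well.\<close>
  have "\<exists>h :: ('s \<Rightarrow> 'm) \<Rightarrow> 'm. inj_on h (gen S ?H W i)" for i
  proof (cases "\<exists>x\<in>carrier N. x \<noteq> \<zero>\<^bsub>N\<^esub>")
    case True
    then have "infinite (UNIV :: 'm set)" using S0.infinite_carrier[OF N] finite_subset[OF subset_UNIV] by blast
    moreover have "inj_on (\<lambda>\<phi>. \<phi> 1) W" unfolding W_def inj_on_def using u1 by auto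
    ultimately show ?thesis using gen_card[OF H W] by blast
  next
    case False
    then have W0: "w = \<zero>\<^bsub>gcomp ?H 0\<^esub>" if "w \<in> W" for w using that u.f_zero unfolding W_def by auto
    have "\<phi> = \<zero>\<^bsub>gcomp ?H i\<^esub>" if "\<phi> \<in> gen S ?H W i" for \<phi>
      using that
    proof (induction rule: gen.induct)
      case (add w s y)
      interpret A: abelian_group "gcomp ?H i" by (rule graded_right_module.gcomp_group[OF H])
      show ?case using add W0[OF add(1)] gact_zero_left[OF H add(2), of 0] by simp
    qed simp
    then have "inj_on (\<lambda>_. undefined) (gen S ?H W i)" by (auto simp: inj_on_def)
    then show ?thesis by blast
  qed
  then obtain h :: "int \<Rightarrow> ('s \<Rightarrow> 'm) \<Rightarrow> 'm" where h: "\<And>i. inj_on (h i) (gen S ?H W i)" by metis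
  let ?Z = "sub_graded ?H (gen S ?H W)"
  note Z = gen_graded[OF H W]
  have gc: "graded_congruence S ?Z h" by (rule graded_congruence_inj[OF Z]) (simp add: h)
  interpret r: graded_congruence S ?Z h by (rule gc)
  let ?M = "push_graded h ?Z"
  have M: "graded ?M" by (rule push_graded_right_module[OF gc])
  have hh: "unital_module_hom (S 0) (degree_part ?Z i) (degree_part ?M i) (h i)" for i
  proof (rule S0.hom_Mod(1)[OF right_module_degree_part[OF Z] right_module_degree_part[OF M]])
    fix x assume x: "x \<in> carrier (degree_part ?Z i)"
    then show "h i x \<in> carrier (degree_part ?M i)" using r.push_simps(1)[of i] by simp
    { fix y assume "y \<in> carrier (degree_part ?Z i)"
      then show "h i (x \<oplus>\<^bsub>degree_part ?Z i\<^esub> y) = h i x \<oplus>\<^bsub>degree_part ?M i\<^esub> h i y"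
        using x r.push_add[of x i y] by simp }
    fix s assume s: "s \<in> S 0"
    show "h i (ract (degree_part ?Z i) x s) = ract (degree_part ?M i) (h i x) s"
      using x s r.push_act[of x i s 0] by simp
  qed
  have g0: "gen S ?H W 0 = W" by (rule gen_degree_zero[OF H W])
  let ?e = "restrict (\<lambda>n. h 0 (?u n)) (carrier N)"
  have uZ: "?u n \<in> carrier (degree_part ?Z 0)" if "n \<in> carrier N" for n using that g0 by (simp add: W_def)
  have e: "?e \<in> Hom0 N (degree_part ?M 0)"
  proof (rule Arr_ModI[OF _ _ _ N])
    fix x assume x: "x \<in> carrier N"
    show "h 0 (?u x) \<in> carrier (degree_part ?M 0)" by (rule unital_module_hom.f_in[OF hh uZ[OF x]])
    { fix y assume y: "y \<in> carrier N"
      have "?u (x \<oplus>\<^bsub>N\<^esub> y) = ?u x \<oplus>\<^bsub>degree_part ?Z 0\<^esub> ?u y" using u.f_add[OF x y] by simp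
      then show "h 0 (?u (x \<oplus>\<^bsub>N\<^esub> y)) = h 0 (?u x) \<oplus>\<^bsub>degree_part ?M 0\<^esub> h 0 (?u y)"
        using unital_module_hom.f_add[OF hh uZ[OF x] uZ[OF y]] by simp }
    fix s assume s: "s \<in> S 0"
    have "?u (ract N x s) = ract (degree_part ?Z 0) (?u x) s" using u.f_ract[OF x s] by simp
    then show "h 0 (?u (ract N x s)) = ract (degree_part ?M 0) (h 0 (?u x)) s"
      using unital_module_hom.f_ract[OF hh uZ[OF x] s] by simp
  qed
  have bij: "bij_betw ?e (carrier N) (carrier (degree_part ?M 0))"
    unfolding bij_betw_def
  proof
    have "inj_on (h 0 \<circ> ?u) (carrier N)"
      using comp_inj_on[OF inju] h[of 0] g0 by (simp add: W_def)
    then show "inj_on ?e (carrier N)" by (simp add: inj_on_def)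
    have "?e ` carrier N = h 0 ` W" unfolding W_def image_image by (rule image_cong) simp_all
    then show "?e ` carrier N = carrier (degree_part ?M 0)" using g0 r.push_simps(1)[of 0] by simp
  qed
  have fg: "fg_module (S 0) (degree_part ?M i)" if "fg_module (S 0) N" for i
  proof -
    have "N.fin_span (carrier N)" using that S0.fg_module_iff[OF N] by blast
    then have "unital_module.fin_span (S 0) (degree_part ?H 0) W"
      unfolding W_def by (rule u.fin_span_image)
    then have fH: "unital_module.fin_span (S 0) (degree_part ?H i) (gen S ?H W i)" by (rule gen_fin_span[OF H W])
    note uH = unital_degree_part[OF H, of i] and uZ = unital_degree_part[OF Z, of i]
    obtain bs where bs: "set bs \<subseteq> gen S ?H W i" "gen S ?H W i \<subseteq> unital_module.span_over (S 0) (degree_part ?H i) {\<zero>\<^bsub>degree_part ?H i\<^esub>} bs"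
      using fH unital_module.fin_span_iff_generators[OF uH S0.noeth_R gen_submod[OF H W]] by blast
    have "unital_module.fin_span (S 0) (degree_part ?Z i) (carrier (degree_part ?Z i))"
      unfolding unital_module.fin_span_def[OF uZ] using bs span_over_cong[OF uZ uH, of "{\<zero>\<^bsub>degree_part ?H i\<^esub>}" bs]
      by (intro exI[of _ bs]) simp
    from unital_module_hom.fin_span_image[OF hh this]
    have "unital_module.fin_span (S 0) (degree_part ?M i) (carrier (degree_part ?M i))" using r.push_simps(1)[of i] by simp
    then show ?thesis using S0.fg_module_iff[OF right_module_degree_part[OF M]] by blast
  qed
  show thesis by (rule that[OF M e bij]) (use fg in blast)
qed

text \<open>
  The kernel of \<open>p\<close> embeds into \<open>B\<close> by \<open>q\<close>, and the image of \<open>p\<close> lies in \<open>A\<close>; both are noetherian.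
\<close>

lemma fg_joint:
  assumes p: "unital_module_hom (S 0) Z A p" and q: "unital_module_hom (S 0) Z B q"
    and inj: "\<And>z. \<lbrakk>z \<in> carrier Z; p z = \<zero>\<^bsub>A\<^esub>; q z = \<zero>\<^bsub>B\<^esub>\<rbrakk> \<Longrightarrow> z = \<zero>\<^bsub>Z\<^esub>"
    and fg: "fg_module (S 0) A" "fg_module (S 0) B"
  shows "fg_module (S 0) Z"
proof -
  interpret p: unital_module_hom "S 0" Z A p by (rule p)
  interpret q: unital_module_hom "S 0" Z B q by (rule q)
  have A: "p.N.fin_span (carrier A)" using fg(1) S0.fg_module_iff[OF p.N.right_module_axioms] by blast
  have B: "q.N.fin_span (carrier B)" using fg(2) S0.fg_module_iff[OF q.N.right_module_axioms] by blast
  have 0: "p.M.fin_span {\<zero>\<^bsub>Z\<^esub>}" unfolding p.M.fin_span_def by (intro exI[of _ "[]"]) simp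
  let ?K = "{z \<in> carrier Z. p z = \<zero>\<^bsub>A\<^esub>}"
  have "p.M.fin_span ?K"
  proof (rule q.fin_span_extension[OF S0.noeth_R p.kernel_submod])
    show "q.N.fin_span (q ` ?K)" by (rule q.N.fin_span_subset[OF B]) (use q.f_in in auto)
    show "p.M.fin_span {x \<in> ?K. q x = \<zero>\<^bsub>B\<^esub>}" by (rule p.M.fin_span_subset[OF 0]) (use inj in auto)
  qed
  then have "p.M.fin_span (carrier Z)"
  proof (intro p.fin_span_extension[OF S0.noeth_R p.M.submod_carrier])
    show "p.N.fin_span (p ` carrier Z)" by (rule p.N.fin_span_subset[OF A]) (use p.f_in in auto)
  qed
  then show ?thesis using S0.fg_module_iff[OF p.M.right_module_axioms] by blast
qed

lemma fg_image:
  assumes p: "unital_module_hom (S 0) M Q p" and sur: "p ` carrier M = carrier Q" and fg: "fg_module (S 0) M"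
  shows "fg_module (S 0) Q"
proof -
  interpret p: unital_module_hom "S 0" M Q p by (rule p)
  have "p.M.fin_span (carrier M)" using fg S0.fg_module_iff[OF p.M.right_module_axioms] by blast
  then have "p.N.fin_span (carrier Q)" using p.fin_span_image sur by metis
  then show ?thesis using S0.fg_module_iff[OF p.N.right_module_axioms] by blast
qed

lemma fg_zero:
  assumes M: "right_module (S 0) M" and "carrier M = {\<zero>\<^bsub>M\<^esub>}"
  shows "fg_module (S 0) M"
proof -
  interpret M: unital_module "S 0" M by (rule S0.unital_R[OF M])
  have "M.fin_span (carrier M)" unfolding M.fin_span_def assms(2) by (intro exI[of _ "[]"]) simp
  then show ?thesis using S0.fg_module_iff[OF M] by blast
qed

end

section \<open>The equivalence\<close>

context noetherian_graded_algebra begin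

text \<open>
  The arrows \<open>s\<close> and \<open>f\<close> define an arrow \<open>k\<close> from \<open>X\<close> to the degree-zero part of the product \<open>B\<close> of \<open>M\<close>
  and \<open>P\<close>; the module \<open>Z\<close> is generated by its image, which is therefore the whole of \<open>Z\<^sub>0\<close>.
\<close>

lemma generated_by_pair:
  fixes X :: "('m, 's) rmodule" and M P :: "('m, 's) grmodule"
  assumes M: "graded M" and P: "graded P" and X: "right_module (S 0) X"
    and s: "s \<in> Hom0 X (degree_part M 0)" and f: "f \<in> Hom0 X (degree_part P 0)"
  obtains Z :: "('m, 's) grmodule" and p q e where "graded Z" "p \<in> GHom Z M" "q \<in> GHom Z P"
    "e \<in> Hom0 X (degree_part Z 0)" "e ` carrier X = gcar Z 0"
    "\<And>x. x \<in> carrier X \<Longrightarrow> p 0 (e x) = s x" "\<And>x. x \<in> carrier X \<Longrightarrow> q 0 (e x) = f x"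
    "\<And>i z. \<lbrakk>z \<in> gcar Z i; p i z = \<zero>\<^bsub>gcomp M i\<^esub>; q i z = \<zero>\<^bsub>gcomp P i\<^esub>\<rbrakk> \<Longrightarrow> z = \<zero>\<^bsub>gcomp Z i\<^esub>"
    "\<And>A :: ('m, 's) grmodule. \<And>a b. \<lbrakk>graded A; a \<in> GHom Z A; b \<in> GHom Z A; a 0 = b 0\<rbrakk> \<Longrightarrow> a = b"
proof -
  obtain B :: "('m, 's) grmodule" and p q where B': "B \<in> Obj (GrMod S)" and p: "p \<in> GHom B M" and q: "q \<in> GHom B P"
    and *: "(\<forall>i. \<forall>x\<in>gcar M i. \<forall>y\<in>gcar P i. \<exists>!z. z \<in> gcar B i \<and> p i z = x \<and> q i z = y) \<and>
      (\<forall>X\<in>Obj (GrMod S). \<forall>f\<in>GHom X M. \<forall>g\<in>GHom X P.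
        \<exists>h\<in>GHom X B. cmp (GrMod S) X B M p h = f \<and> cmp (GrMod S) X B P q h = g)"
    using GrMod_product[OF M P] by (elim bexE)
  have B: "graded B" using B' by simp
  interpret B: graded_right_module S B by (rule B)
  note p' = Arr_GrModD[OF p] and q' = Arr_GrModD[OF q] and s' = Arr_ModD[OF s] and f' = Arr_ModD[OF f]
  have ex1: "\<exists>!z. z \<in> gcar B i \<and> p i z = x \<and> q i z = y" if "x \<in> gcar M i" "y \<in> gcar P i" for i x y
    using * that by blast
  have un: "z = z'" if z: "z \<in> gcar B i" "z' \<in> gcar B i" "p i z = p i z'" "q i z = q i z'" for i z z'
    using ex1[OF p'(1)[OF z(1)] q'(1)[OF z(1)]] z by metis
  have "\<exists>z. z \<in> gcar B 0 \<and> p 0 z = s x \<and> q 0 z = f x" if "x \<in> carrier X" for x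
    using ex1[of "s x" 0 "f x"] s'(1)[OF that] f'(1)[OF that] by auto
  then obtain k where k: "\<And>x. x \<in> carrier X \<Longrightarrow> k x \<in> gcar B 0" "\<And>x. x \<in> carrier X \<Longrightarrow> p 0 (k x) = s x"
    "\<And>x. x \<in> carrier X \<Longrightarrow> q 0 (k x) = f x" by metis
  interpret X: right_module "S 0" X by (rule X)
  interpret B0: abelian_group "gcomp B 0" by (rule B.gcomp_group)
  have k_add: "k (x \<oplus>\<^bsub>X\<^esub> y) = k x \<oplus>\<^bsub>gcomp B 0\<^esub> k y" if "x \<in> carrier X" "y \<in> carrier X" for x y
    by (rule un[of _ 0]) (use that in \<open>simp_all add: k p' q' s' f'\<close>)
  have k_act: "k (ract X x r) = gact B 0 0 (k x) r" if "x \<in> carrier X" "r \<in> S 0" for x r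
    by (rule un[of _ 0])
      (use that p'(3)[OF k(1)[OF that(1)] that(2)] q'(3)[OF k(1)[OF that(1)] that(2)] B.gact_closed[OF k(1)[OF that(1)] that(2)]
        X.ract_closed in \<open>simp_all add: k s' f'\<close>)
  interpret k: unital_module_hom "S 0" X "degree_part B 0" k
    by (rule S0.hom_Mod(1)[OF X right_module_degree_part[OF B]]) (simp_all add: k k_add k_act)
  define W where "W = k ` carrier X"
  have W: "unital_module.submod (S 0) (degree_part B 0) W"
    unfolding W_def by (rule k.image_submod[OF k.M.submod_carrier])
  let ?Z = "sub_graded B (gen S B W)"
  note Z = gen_graded[OF B W] and g0 = gen_degree_zero[OF B W] and gc = gen_car[OF B W]
  let ?p = "\<lambda>i. restrict (p i) (gcar ?Z i)" and ?q = "\<lambda>i. restrict (q i) (gcar ?Z i)" and ?e = "restrict k (carrier X)"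
  have P1: "?p \<in> GHom ?Z M"
    by (rule Arr_GrModI[OF _ _ _ Z]) (use gc in \<open>simp_all add: p'\<close>)
  have Q1: "?q \<in> GHom ?Z P"
    by (rule Arr_GrModI[OF _ _ _ Z]) (use gc in \<open>simp_all add: q'\<close>)
  have kW: "k x \<in> gen S B W 0" if "x \<in> carrier X" for x using that unfolding g0 unfolding W_def by blast
  have E1: "?e \<in> Hom0 X (degree_part ?Z 0)"
    by (rule Arr_ModI[OF _ _ _ X]) (simp_all add: kW k_add k_act)
  show thesis
  proof (rule that[OF Z P1 Q1 E1])
    show "?e ` carrier X = gcar ?Z 0" using g0 by (simp add: W_def)
    show "?p 0 (?e x) = s x" "?q 0 (?e x) = f x" if "x \<in> carrier X" for x using that kW[OF that] k by simp_all
    fix i z assume z: "z \<in> gcar ?Z i" "?p i z = \<zero>\<^bsub>gcomp M i\<^esub>" "?q i z = \<zero>\<^bsub>gcomp P i\<^esub>"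
    have zB: "z \<in> gcar B i" using z(1) gc by simp
    interpret Bi: abelian_group "gcomp B i" by (rule B.gcomp_group)
    have "p i \<zero>\<^bsub>gcomp B i\<^esub> = \<zero>\<^bsub>gcomp M i\<^esub>" "q i \<zero>\<^bsub>gcomp B i\<^esub> = \<zero>\<^bsub>gcomp P i\<^esub>"
      using unital_module_hom.f_zero[OF hom_degree_part[OF B M p, of i]] unital_module_hom.f_zero[OF hom_degree_part[OF B P q, of i]] by simp_all
    then have "z = \<zero>\<^bsub>gcomp B i\<^esub>" using z zB by (intro un[of z i]) simp_all
    then show "z = \<zero>\<^bsub>gcomp ?Z i\<^esub>" by simp
  next
    fix A :: "('m, 's) grmodule" and a b
    assume "graded A" "a \<in> GHom ?Z A" "b \<in> GHom ?Z A" "a 0 = b 0"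
    then show "a = b" by (rule gen_arrow_eqI[OF B W])
  qed
qed

text \<open>
  Both equivalences of the theorem are instances, for the full subcategories of all modules and of the
  finitely generated ones.
  
  That the functor detects inverted arrows reduces to elements. If \<open>r\<close> is monic modulo torsion in degree
  zero and kills \<open>x\<close> of degree \<open>i\<close>, then it kills \<open>x S\<^bsub>-i\<^esub>\<close>, which is therefore torsion, and so is \<open>x\<close>;
  the epimorphic side is similar. In the other direction, an arrow out of \<open>M\<^sub>0\<close> that vanishes on the
  image of \<open>r\<close> factors through the degree-zero part of the cokernel of \<open>r\<close>.
\<close>

lemma degree_zero_equivalence:
  fixes PC :: "('m, 's) grmodule set" and PD :: "('m, 's) rmodule set"
  defines "C \<equiv> full_subcategory (GrMod S) PC" and "D \<equiv> full_subcategory (Mod (S 0)) PD"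
  assumes C: "element_category C gcomp (\<lambda>f. f) (locally_torsion_element scale S)"
    and D: "element_category D (\<lambda>M (_::unit). M) (\<lambda>f _. f) (\<lambda>M _. torsion0 M)"
    and joint: "\<And>Z A B p q. \<lbrakk>graded Z; A \<in> Obj C; B \<in> Obj C; p \<in> GHom Z A; q \<in> GHom Z B;
        \<And>i z. \<lbrakk>z \<in> gcar Z i; p i z = \<zero>\<^bsub>gcomp A i\<^esub>; q i z = \<zero>\<^bsub>gcomp B i\<^esub>\<rbrakk> \<Longrightarrow> z = \<zero>\<^bsub>gcomp Z i\<^esub>\<rbrakk> \<Longrightarrow> Z \<in> PC"
    and degree: "\<And>M. M \<in> Obj C \<Longrightarrow> degree_part M 0 \<in> PD"
    and ess: "\<And>N. N \<in> Obj D \<Longrightarrow> \<exists>M\<in>Obj C. \<exists>e\<in>Hom0 N (degree_part M 0).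
        bij_betw e (carrier N) (carrier (degree_part M 0))"
  shows "induces_abelian_equivalence C (element_category.torsion_objects C gcomp (locally_torsion_element scale S))
    D (element_category.torsion_objects D (\<lambda>M (_::unit). M) (\<lambda>M _. torsion0 M)) (degree_zero TYPE('m))"
proof (rule element_equivalence.induces_equivalence, rule element_equivalence.intro[OF C D])
  interpret C: element_category C gcomp "\<lambda>f. f" "locally_torsion_element scale S" by (rule C)
  interpret D: element_category D "\<lambda>M (_::unit). M" "\<lambda>f _. f" "\<lambda>M _. torsion0 M" by (rule D)
  let ?F = "degree_zero TYPE('m) :: (('m, 's) grmodule, int \<Rightarrow> 'm \<Rightarrow> 'm, ('m, 's) rmodule, 'm \<Rightarrow> 'm) cat_map"
  have ObjC: "M \<in> Obj C \<longleftrightarrow> graded M \<and> M \<in> PC" for M by (simp add: C_def)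
  have ObjD: "N \<in> Obj D \<longleftrightarrow> right_module (S 0) N \<and> N \<in> PD" for N by (simp add: D_def)
  have arrs: "Arr C = Arr (GrMod S)" "Arr D = Arr (Mod (S 0))" "cmp C = cmp (GrMod S)" "cmp D = cmp (Mod (S 0))"
    by (simp_all add: C_def D_def)
  have F: "omap ?F M = degree_part M 0" "amap ?F M N f = f 0" for M N f by (simp_all add: degree_zero_def)
  have gr: "graded M" if "M \<in> Obj C" for M using that ObjC by blast
  have Fo: "degree_part M 0 \<in> Obj D" if "M \<in> Obj C" for M
    using right_module_degree_part[OF gr[OF that], of 0] degree[OF that] ObjD by blast
  have Fa: "f 0 \<in> Arr D (degree_part M 0) (degree_part N 0)" if "M \<in> Obj C" "f \<in> Arr C M N" for M N f
    using degree_part_arr[OF gr[OF that(1)], of f N 0] that(2) unfolding arrs by blast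
  have additive: "is_additive_functor C D ?F"
    unfolding is_additive_functor_def is_functor_def F
  proof (intro conjI ballI)
    show "degree_part A 0 \<in> Obj D" if "A \<in> Obj C" for A by (rule Fo[OF that])
    show "f 0 \<in> Arr D (degree_part A 0) (degree_part B 0)" if "A \<in> Obj C" "B \<in> Obj C" "f \<in> Arr C A B" for A B f
      by (rule Fa[OF that(1,3)])
  qed (simp_all add: C_def D_def)
  have mono: "C.tor_mono L M r \<longleftrightarrow> D.tor_mono (degree_part L 0) (degree_part M 0) (r 0)"
    if o: "L \<in> Obj C" "M \<in> Obj C" "r \<in> Arr C L M" for L M r
  proof
    assume c: "C.tor_mono L M r"
    show "D.tor_mono (degree_part L 0) (degree_part M 0) (r 0)"
      unfolding D.tor_mono_def
    proof (intro allI ballI impI)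
      fix x assume "x \<in> carrier (degree_part L 0)" "r 0 x = \<zero>\<^bsub>degree_part M 0\<^esub>"
      then have "x \<in> gcar L 0" "r 0 x = \<zero>\<^bsub>gcomp M 0\<^esub>" by simp_all
      then show "torsion0 (degree_part L 0) x"
        using torsion_of_locally_torsion[OF gr[OF o(1)]] C.tor_monoD[OF c] by blast
    qed
  next
    assume d: "D.tor_mono (degree_part L 0) (degree_part M 0) (r 0)"
    show "C.tor_mono L M r"
      unfolding C.tor_mono_def
    proof (intro allI ballI impI)
      fix i x assume x: "x \<in> gcar L i" "r i x = \<zero>\<^bsub>gcomp M i\<^esub>"
      show "ltorsion L i x"
      proof (rule locally_torsionI[OF gr[OF o(1)] x(1)])
        fix s assume s: "s \<in> S (- i)"
        have "gact L i (- i) x s \<in> gcar L 0"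
          using graded_right_module.gact_closed[OF gr[OF o(1)] x(1) s] by simp
        moreover have "r 0 (gact L i (- i) x s) = \<zero>\<^bsub>gcomp M 0\<^esub>"
          using Arr_GrModD(3)[OF o(3)[unfolded arrs] x(1) s] x(2) gact_zero_left[OF gr[OF o(2)] s, of i] by simp
        ultimately show "torsion0 (degree_part L 0) (gact L i (- i) x s)"
          using d unfolding D.tor_mono_def by simp
      qed
    qed
  qed
  have epi: "C.tor_epi L M r \<longleftrightarrow> D.tor_epi (degree_part L 0) (degree_part M 0) (r 0)"
    if o: "L \<in> Obj C" "M \<in> Obj C" "r \<in> Arr C L M" for L M r
  proof
    assume c: "C.tor_epi L M r"
    obtain Q' p where Q': "Q' \<in> Obj C" "p \<in> Arr C M Q'" "is_cokernel C L M r Q' p"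
      "\<And>i. p i ` gcar M i = gcar Q' i" "\<And>i. {x \<in> gcar M i. p i x = \<zero>\<^bsub>gcomp Q' i\<^esub>} = r i ` gcar L i"
      by (rule C.concrete_cokernel[OF o]) (rule that)
    have pr: "p i (r i x) = \<zero>\<^bsub>gcomp Q' i\<^esub>" if "x \<in> gcar L i" for i x using Q'(5)[of i] that by blast
    show "D.tor_epi (degree_part L 0) (degree_part M 0) (r 0)"
    proof (rule D.tor_epiI[OF Fo[OF o(1)] Fo[OF o(2)] Fa[OF o(1,3)]])
      fix Q \<rho> y assume Q: "Q \<in> Obj D" "\<rho> \<in> Arr D (degree_part M 0) Q"
        and z: "\<And>(j::unit) x. x \<in> carrier (degree_part L 0) \<Longrightarrow> \<rho> (r 0 x) = \<zero>\<^bsub>Q\<^esub>" and y: "y \<in> carrier (degree_part M 0)"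
      have sur: "p 0 ` carrier (degree_part M 0) = carrier (degree_part Q' 0)" using Q'(4)[of 0] by simp
      have ker: "\<rho> x = \<zero>\<^bsub>Q\<^esub>" if "x \<in> carrier (degree_part M 0)" "p 0 x = \<zero>\<^bsub>degree_part Q' 0\<^esub>" for x
      proof -
        have "x \<in> r 0 ` gcar L 0" unfolding Q'(5)[of 0, symmetric] using that by simp
        then show ?thesis using z by auto
      qed
      obtain h where h: "h \<in> Arr D (degree_part Q' 0) Q" "cmp D (degree_part M 0) (degree_part Q' 0) Q h (p 0) = \<rho>"
        using D.descend[OF Fo[OF o(2)] Fo[OF Q'(1)] Q Fa[OF o(2) Q'(2)] sur ker] by blast
      have py: "p 0 y \<in> carrier (degree_part Q' 0)" using sur y by blast
      have y': "y \<in> gcar M 0" using y by simp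
      have "ltorsion Q' 0 (p 0 y)"
        by (rule C.tor_epiD[OF c o Q'(1,2) pr y'])
      then have "torsion0 (degree_part Q' 0) (p 0 y)"
        using torsion_of_locally_torsion[OF gr[OF Q'(1)]] py by simp
      then have "torsion0 Q (h (p 0 y))"
        by (rule D.tor_image[OF Fo[OF Q'(1)] Q(1) h(1) py])
      then show "torsion0 Q (\<rho> y)"
        using D.app_cmp[OF Fo[OF o(2)] Fo[OF Q'(1)] Q(1) Fa[OF o(2) Q'(2)] h(1) y] h(2) by simp
    qed
  next
    assume d: "D.tor_epi (degree_part L 0) (degree_part M 0) (r 0)"
    show "C.tor_epi L M r"
    proof (rule C.tor_epiI[OF o])
      fix Q \<rho> i y assume Q: "Q \<in> Obj C" "\<rho> \<in> Arr C M Q"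
        and z: "\<And>j x. x \<in> gcar L j \<Longrightarrow> \<rho> j (r j x) = \<zero>\<^bsub>gcomp Q j\<^esub>" and y: "y \<in> gcar M i"
      show "ltorsion Q i (\<rho> i y)"
      proof (rule locally_torsionI[OF gr[OF Q(1)] C.app_in[OF o(2) Q(1) Q(2) y]])
        fix s assume s: "s \<in> S (- i)"
        have z0: "\<rho> 0 (r 0 x) = \<zero>\<^bsub>degree_part Q 0\<^esub>" if "x \<in> carrier (degree_part L 0)" for x using z that by simp
        have ys: "gact M i (- i) y s \<in> carrier (degree_part M 0)"
          using graded_right_module.gact_closed[OF gr[OF o(2)] y s] by simp
        have "torsion0 (degree_part Q 0) (\<rho> 0 (gact M i (- i) y s))"
          by (rule D.tor_epiD[OF d Fo[OF o(1)] Fo[OF o(2)] Fa[OF o(1,3)] Fo[OF Q(1)] Fa[OF o(2) Q(2)] z0 ys])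
        then show "torsion0 (degree_part Q 0) (gact Q i (- i) (\<rho> i y) s)"
          using Arr_GrModD(3)[OF Q(2)[unfolded arrs] y s] by simp
      qed
    qed
  qed
  show "element_equivalence_axioms C gcomp (locally_torsion_element scale S) D (\<lambda>M (_::unit). M) (\<lambda>f _. f)
    (\<lambda>M _. torsion0 M) ?F"
  proof (rule element_equivalence_axioms.intro, unfold F)
    show "is_additive_functor C D ?F" by (rule additive)
  next
    fix L M r assume o: "L \<in> Obj C" "M \<in> Obj C" "r \<in> Arr C L M"
    show "r \<in> serre_weq C C.torsion_objects L M \<longleftrightarrow> r 0 \<in> serre_weq D D.torsion_objects (degree_part L 0) (degree_part M 0)"
      unfolding C.serre_weq_iff[OF o(1,2)] D.serre_weq_iff[OF Fo[OF o(1)] Fo[OF o(2)]]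
      using mono[OF o] epi[OF o] o(3) Fa[OF o(1,3)] by blast
  next
    fix M P X s f assume o: "M \<in> Obj C" "P \<in> Obj C" "X \<in> Obj D"
      and s: "s \<in> Arr D X (degree_part M 0)" and f: "f \<in> Arr D X (degree_part P 0)"
    have X: "right_module (S 0) X" using o(3) ObjD by blast
    obtain Z :: "('m, 's) grmodule" and p q e where Z: "graded Z" "p \<in> GHom Z M" "q \<in> GHom Z P"
      and e: "e \<in> Hom0 X (degree_part Z 0)" "e ` carrier X = gcar Z 0"
      and pe: "\<And>x. x \<in> carrier X \<Longrightarrow> p 0 (e x) = s x" and qe: "\<And>x. x \<in> carrier X \<Longrightarrow> q 0 (e x) = f x"
      and inj: "\<And>i z. \<lbrakk>z \<in> gcar Z i; p i z = \<zero>\<^bsub>gcomp M i\<^esub>; q i z = \<zero>\<^bsub>gcomp P i\<^esub>\<rbrakk> \<Longrightarrow> z = \<zero>\<^bsub>gcomp Z i\<^esub>"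
      and det: "\<And>A :: ('m, 's) grmodule. \<And>a b. \<lbrakk>graded A; a \<in> GHom Z A; b \<in> GHom Z A; a 0 = b 0\<rbrakk> \<Longrightarrow> a = b"
      by (rule generated_by_pair[OF gr[OF o(1)] gr[OF o(2)] X s[unfolded arrs] f[unfolded arrs]]) (rule that)
    have ZC: "Z \<in> Obj C" using Z(1) joint[OF Z(1) o(1,2) Z(2,3) inj] ObjC by blast
    note Z' = Z(2,3)[folded arrs] and e' = e(1)[folded arrs]
    have "cmp D X (degree_part Z 0) (degree_part M 0) (p 0) e = s"
      by (rule D.arr_eqI[OF o(3) Fo[OF o(1)] D.cmp_arr[OF o(3) Fo[OF ZC] Fo[OF o(1)] e' Fa[OF ZC Z'(1)]] s])
        (simp add: D.app_cmp[OF o(3) Fo[OF ZC] Fo[OF o(1)] e' Fa[OF ZC Z'(1)]] pe)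
    moreover have "cmp D X (degree_part Z 0) (degree_part P 0) (q 0) e = f"
      by (rule D.arr_eqI[OF o(3) Fo[OF o(2)] D.cmp_arr[OF o(3) Fo[OF ZC] Fo[OF o(2)] e' Fa[OF ZC Z'(2)]] f])
        (simp add: D.app_cmp[OF o(3) Fo[OF ZC] Fo[OF o(2)] e' Fa[OF ZC Z'(2)]] qe)
    moreover have "\<forall>A\<in>Obj C. \<forall>a\<in>Arr C Z A. \<forall>b\<in>Arr C Z A. a 0 = b 0 \<longrightarrow> a = b"
      unfolding arrs by (intro ballI impI) (rule det[OF gr])
    ultimately show "\<exists>Z\<in>Obj C. \<exists>p\<in>Arr C Z M. \<exists>q\<in>Arr C Z P. \<exists>e\<in>Arr D X (degree_part Z 0).
        (\<forall>i::unit. e ` carrier X = carrier (degree_part Z 0)) \<and>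
        cmp D X (degree_part Z 0) (degree_part M 0) (p 0) e = s \<and> cmp D X (degree_part Z 0) (degree_part P 0) (q 0) e = f \<and>
        (\<forall>A\<in>Obj C. \<forall>a\<in>Arr C Z A. \<forall>b\<in>Arr C Z A. a 0 = b 0 \<longrightarrow> a = b)"
      using e(2) by (intro bexI[OF _ ZC] bexI[OF _ Z'(1)] bexI[OF _ Z'(2)] bexI[OF _ e'] conjI allI) simp_all
  next
    fix N assume N: "N \<in> Obj D"
    then show "\<exists>M\<in>Obj C. \<exists>e\<in>Arr D N (degree_part M 0). \<forall>i::unit. bij_betw e (carrier N) (carrier (degree_part M 0))"
      using ess[OF N] unfolding arrs by blast
  qed
qed

end

lemma full_subcategory_UNIV: "full_subcategory C UNIV = C"
  by (simp add: full_subcategory_def)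

context noetherian_graded_algebra begin

lemma locally_fg_joint:
  assumes o: "graded Z" "graded A" "graded B"
    and fg: "\<forall>i. fg_module (S 0) (degree_part A i)" "\<forall>i. fg_module (S 0) (degree_part B i)"
    and pq: "p \<in> GHom Z A" "q \<in> GHom Z B"
    and inj: "\<And>i z. \<lbrakk>z \<in> gcar Z i; p i z = \<zero>\<^bsub>gcomp A i\<^esub>; q i z = \<zero>\<^bsub>gcomp B i\<^esub>\<rbrakk> \<Longrightarrow> z = \<zero>\<^bsub>gcomp Z i\<^esub>"
  shows "\<forall>i. fg_module (S 0) (degree_part Z i)"
proof
  show "fg_module (S 0) (degree_part Z i)" for i
    by (rule fg_joint[OF hom_degree_part[OF o(1,2) pq(1)] hom_degree_part[OF o(1,3) pq(2)] _ spec[OF fg(1)] spec[OF fg(2)]])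
      (use inj in simp)
qed

lemma element_category_lgrmod:
  "element_category (lgrmod S :: (('m, 's) grmodule, int \<Rightarrow> 'm \<Rightarrow> 'm) cat) gcomp (\<lambda>f. f) (locally_torsion_element scale S)"
  unfolding lgrmod_def
proof (rule element_category_full_subcategory[OF element_category_GrMod]; unfold Obj_GrMod mem_Collect_eq)
  fix Z A B :: "('m, 's) grmodule" and p q
  assume "graded Z" "graded A" "\<forall>i. fg_module (S 0) (degree_part A i)"
    "graded B" "\<forall>i. fg_module (S 0) (degree_part B i)" "p \<in> GHom Z A" "q \<in> GHom Z B"
    "\<And>i z. \<lbrakk>z \<in> gcar Z i; p i z = \<zero>\<^bsub>gcomp A i\<^esub>; q i z = \<zero>\<^bsub>gcomp B i\<^esub>\<rbrakk> \<Longrightarrow> z = \<zero>\<^bsub>gcomp Z i\<^esub>"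
  then show "\<forall>i. fg_module (S 0) (degree_part Z i)" by (intro locally_fg_joint[of Z A B p q])
next
  fix M Q :: "('m, 's) grmodule" and p
  assume o: "graded M" "graded Q" and p: "p \<in> GHom M Q"
    and fg: "\<forall>i. fg_module (S 0) (degree_part M i)" and sur: "\<And>i. p i ` gcar M i = gcar Q i"
  show "\<forall>i. fg_module (S 0) (degree_part Q i)"
    by (rule allI, rule fg_image[OF hom_degree_part[OF o p] _ spec[OF fg]]) (simp add: sur)
next
  fix Z :: "('m, 's) grmodule"
  assume o: "graded Z" and z: "\<And>i. gcar Z i = {\<zero>\<^bsub>gcomp Z i\<^esub>}"
  show "\<forall>i. fg_module (S 0) (degree_part Z i)"
    by (rule allI, rule fg_zero[OF right_module_degree_part[OF o]]) (simp add: z)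
qed

lemma element_category_mod_fg:
  "element_category (mod_fg (S 0) :: (('m, 's) rmodule, 'm \<Rightarrow> 'm) cat) (\<lambda>M (_::unit). M) (\<lambda>f _. f)
    (\<lambda>M _. torsion0 M)"
  unfolding mod_fg_def
proof (rule element_category_full_subcategory[OF S0.element_category_Mod]; unfold Obj_Mod mem_Collect_eq)
  fix Z A B :: "('m, 's) rmodule" and p q
  assume o: "right_module (S 0) Z" "right_module (S 0) A" "right_module (S 0) B"
    and fg: "fg_module (S 0) A" "fg_module (S 0) B"
    and pq: "p \<in> Hom0 Z A" "q \<in> Hom0 Z B"
    and inj: "\<And>(i::unit) z. \<lbrakk>z \<in> carrier Z; p z = \<zero>\<^bsub>A\<^esub>; q z = \<zero>\<^bsub>B\<^esub>\<rbrakk> \<Longrightarrow> z = \<zero>\<^bsub>Z\<^esub>"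
  show "fg_module (S 0) Z"
    by (rule fg_joint[OF S0.hom_of_Arr[OF o(1,2) pq(1)] S0.hom_of_Arr[OF o(1,3) pq(2)] inj fg])
next
  fix M Q :: "('m, 's) rmodule" and p
  assume o: "right_module (S 0) M" "right_module (S 0) Q" and p: "p \<in> Hom0 M Q"
    and fg: "fg_module (S 0) M" and sur: "\<And>(i::unit). p ` carrier M = carrier Q"
  show "fg_module (S 0) Q" by (rule fg_image[OF S0.hom_of_Arr[OF o p] sur fg])
next
  fix Z :: "('m, 's) rmodule"
  assume o: "right_module (S 0) Z" and z: "\<And>(i::unit). carrier Z = {\<zero>\<^bsub>Z\<^esub>}"
  show "fg_module (S 0) Z" by (rule fg_zero[OF o z])
qed

theorem equivalence_QGr:
  "induces_abelian_equivalence (GrMod S) (LTors scale S) (Mod (S 0)) (Tors scale (S 0)) (degree_zero TYPE('m))"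
proof -
  interpret C: element_category "GrMod S :: (('m, 's) grmodule, int \<Rightarrow> 'm \<Rightarrow> 'm) cat" gcomp "\<lambda>f. f" "locally_torsion_element scale S"
    by (rule element_category_GrMod)
  interpret D: element_category "Mod (S 0) :: (('m, 's) rmodule, 'm \<Rightarrow> 'm) cat" "\<lambda>M (_::unit). M" "\<lambda>f _. f" "\<lambda>M _. torsion0 M"
    by (rule S0.element_category_Mod)
  have T: "LTors scale S = C.torsion_objects" "Tors scale (S 0) = D.torsion_objects"
    by (simp_all add: LTors_def Tors_def C.torsion_objects_def D.torsion_objects_def)
  show ?thesis
    unfolding T
  proof (rule degree_zero_equivalence[where PC = UNIV and PD = UNIV, unfolded full_subcategory_UNIV,
        OF element_category_GrMod S0.element_category_Mod UNIV_I UNIV_I])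
    fix N :: "('m, 's) rmodule" assume "N \<in> Obj (Mod (S 0))"
    then have N: "right_module (S 0) N" by simp
    obtain M :: "('m, 's) grmodule" and e where "graded M" "e \<in> Hom0 N (degree_part M 0)"
      "bij_betw e (carrier N) (carrier (degree_part M 0))"
      by (rule essentially_surjective[OF N]) (rule that)
    then show "\<exists>M\<in>Obj (GrMod S). \<exists>e\<in>Hom0 N (degree_part M 0). bij_betw e (carrier N) (carrier (degree_part M 0))"
      unfolding Bex_def Obj_GrMod by blast
  qed
qed

theorem equivalence_qlgr:
  "induces_abelian_equivalence (lgrmod S) (lltors scale S) (mod_fg (S 0)) (tors_fg scale (S 0)) (degree_zero TYPE('m))"
proof -
  interpret C: element_category "lgrmod S :: (('m, 's) grmodule, int \<Rightarrow> 'm \<Rightarrow> 'm) cat" gcomp "\<lambda>f. f" "locally_torsion_element scale S"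
    by (rule element_category_lgrmod)
  interpret D: element_category "mod_fg (S 0) :: (('m, 's) rmodule, 'm \<Rightarrow> 'm) cat" "\<lambda>M (_::unit). M" "\<lambda>f _. f" "\<lambda>M _. torsion0 M"
    by (rule element_category_mod_fg)
  have T: "lltors scale S = C.torsion_objects" "tors_fg scale (S 0) = D.torsion_objects"
    unfolding C.torsion_objects_def D.torsion_objects_def lltors_def tors_fg_def LTors_def Tors_def
    by (auto simp: lgrmod_def mod_fg_def)
  show ?thesis
    unfolding T unfolding lgrmod_def mod_fg_def
  proof (rule degree_zero_equivalence[OF element_category_lgrmod[unfolded lgrmod_def] element_category_mod_fg[unfolded mod_fg_def]];
      unfold full_subcategory_simps Int_iff mem_Collect_eq Obj_GrMod Obj_Mod)
    fix Z A B :: "('m, 's) grmodule" and p q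
    assume "graded Z" "graded A \<and> (\<forall>i. fg_module (S 0) (degree_part A i))"
        "graded B \<and> (\<forall>i. fg_module (S 0) (degree_part B i))"
      "p \<in> GHom Z A" "q \<in> GHom Z B"
      "\<And>i z. \<lbrakk>z \<in> gcar Z i; p i z = \<zero>\<^bsub>gcomp A i\<^esub>; q i z = \<zero>\<^bsub>gcomp B i\<^esub>\<rbrakk> \<Longrightarrow> z = \<zero>\<^bsub>gcomp Z i\<^esub>"
    then show "\<forall>i. fg_module (S 0) (degree_part Z i)" by (intro locally_fg_joint[of Z A B p q]) simp_all
  next
    fix M :: "('m, 's) grmodule" assume "graded M \<and> (\<forall>i. fg_module (S 0) (degree_part M i))"
    then show "fg_module (S 0) (degree_part M 0)" by blast
  next
    fix N :: "('m, 's) rmodule" assume N: "right_module (S 0) N \<and> fg_module (S 0) N"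
    obtain M :: "('m, 's) grmodule" and e where M: "graded M" "e \<in> Hom0 N (degree_part M 0)"
      "bij_betw e (carrier N) (carrier (degree_part M 0))" and fg: "fg_module (S 0) N \<longrightarrow> (\<forall>i. fg_module (S 0) (degree_part M i))"
      by (rule essentially_surjective[OF conjunct1[OF N]]) (rule that)
    have "M \<in> Obj (full_subcategory (GrMod S) {M. \<forall>i. fg_module (S 0) (degree_part M i)})"
      using M(1) fg N by simp
    then show "\<exists>M\<in>Obj (GrMod S) \<inter> {M. \<forall>i. fg_module (S 0) (degree_part M i)}. \<exists>e\<in>Hom0 N (degree_part M 0).
        bij_betw e (carrier N) (carrier (degree_part M 0))"
      using M(2,3) unfolding Bex_def full_subcategory_simps by blast
  qed
qed

end

theorem theorem4p8:
  fixes scale :: "'k::{alg_closed_field, field_char_0} \<Rightarrow> 's::{ring, monoid_mult} \<Rightarrow> 's"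
    and S :: "int \<Rightarrow> 's set"
  assumes "densely_graded_algebra scale S"
    and "noetherian_subring (S 0)"
    and "\<And>i. fg_left (S 0) (S i)"
    and "\<And>i. fg_right (S 0) (S i)"
  shows "induces_abelian_equivalence (GrMod S) (LTors scale S)
           (Mod (S 0)) (Tors scale (S 0)) (degree_zero TYPE('m)) \<and>
         induces_abelian_equivalence (lgrmod S) (lltors scale S)
           (mod_fg (S 0)) (tors_fg scale (S 0)) (degree_zero TYPE('m))"
proof -
  interpret noetherian_graded_algebra scale S
    by (intro noetherian_graded_algebra.intro noetherian_graded_algebra_axioms.intro assms)
  show ?thesis using equivalence_QGr equivalence_qlgr by (rule conjI)
qed

end
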